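(* Consider the single-cell multigroup multicast massive MIMO system described in the context, with $N>K_{tot}$. Suppose the base station uses the unicast transmission $\sum_{j=1}^{G}\sum_{t=1}^{K_j}\mathbf{v}_{jt}s_j$ with the zero-forcing precoding vectors $$\mathbf{v}_{jk}=\sqrt{p_{jk}^{dl}\,\gamma_{jk}\,(N-K_{tot})}\;\hat{\mathbf{G}}\bigl(\hat{\mathbf{G}}^H\hat{\mathbf{G}}\bigr)^{-1}\mathbf{e}_{\nu_{jk},K_{tot}},\qquad \nu_{jk}=\sum_{t=1}^{j-1}K_t+k,\qquad j\in\mathcal{G},\ k\in\mathcal{K}_j,$$ where $p^{dl}_{jk}\ge 0$ are the downlink powers, $P=\sum_{j=1}^{G}\sum_{k=1}^{K_j}p_{jk}^{dl}$, and $\mathbf{e}_{m,K_{tot}}$ is the $m$-th standard basis vector of $\mathbb{C}^{K_{tot}}$. Then for every group $i\in\mathcal{G}$ and every user $k\in\mathcal{K}_i$, an achievable spectral efficiency for user $k$ of group $i$ is $$\mathrm{SE}_{ik}^{un}=\Bigl(1-\frac{\tau_p}{T}\Bigr)\log_2\bigl(1+\mathrm{SINR}_{ik}^{un}\bigr),\qquad \mathrm{SINR}_{ik}^{un}=\frac{(N-K_{tot})\,\gamma_{ik}\,p_{ik}^{dl}}{1+(\beta_{ik}-\gamma_{ik})P}.$$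
   Context: System. A base station (BS) with $N$ antennas serves $G$ multicast groups, $\mathcal{G}=\{1,\dots,G\}$; group $j$ contains the $K_j$ single-antenna users $\mathcal{K}_j=\{1,\dots,K_j\}$, each user belongs to exactly one group, and $K_{tot}=\sum_{j=1}^G K_j$. The channel is block fading: it is constant during each coherence interval of $T$ symbols and independent across intervals. The channel of user $k$ in group $j$ is $\mathbf{g}_{jk}\sim\mathcal{CN}(\mathbf{0},\beta_{jk}\mathbf{I}_N)$, independent across users, with known constants $\beta_{jk}>0$. Channel estimation. In each interval, $\tau_p$ symbols ($K_{tot}\le\tau_p\le T$) are used for uplink pilots, one orthogonal pilot per user, with pilot powers $p^u_{jk}>0$. The BS computes the MMSE estimates $$\hat{\mathbf{g}}_{jk}=\frac{\sqrt{\tau_p p_{jk}^u}\,\beta_{jk}}{1+\tau_p p_{jk}^u\beta_{jk}}\bigl(\sqrt{\tau_p p_{jk}^u}\,\mathbf{g}_{jk}+\mathbf{n}_{jk}\bigr),$$ with $\mathbf{n}_{jk}\sim\mathcal{CN}(\mathbf{0},\mathbf{I}_N)$ independent across users and independent of the channels. Thus $\hat{\mathbf{g}}_{jk}\sim\mathcal{CN}(\mathbf{0},\gamma_{jk}\mathbf{I}_N)$ with $$\gamma_{jk}=\frac{\tau_p p_{jk}^u\beta_{jk}^2}{1+\tau_p p_{jk}^u\beta_{jk}},$$ and $\tilde{\mathbf{g}}_{jk}=\hat{\mathbf{g}}_{jk}-\mathbf{g}_{jk}\sim\mathcal{CN}(\mathbf{0},(\beta_{jk}-\gamma_{jk})\mathbf{I}_N)$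 is independent of $\hat{\mathbf{g}}_{jk}$. Put $\hat{\mathbf{G}}_j=[\hat{\mathbf{g}}_{j1},\dots,\hat{\mathbf{g}}_{jK_j}]$ and $\hat{\mathbf{G}}=[\hat{\mathbf{G}}_1,\dots,\hat{\mathbf{G}}_G]$, an $N\times K_{tot}$ matrix. Downlink. In the remaining $T-\tau_p$ symbols of each interval the received signal of user $k$ in group $j$ is $y_{jk}=\mathbf{g}_{jk}^H\sum_{i=1}^{G}\sum_{t=1}^{K_i}\mathbf{v}_{it}s_i+n$, where $s_i\sim\mathcal{CN}(0,1)$ is the data symbol of group $i$ (common to all users of the group), independent across $i$, and $n\sim\mathcal{CN}(0,1)$ is noise; data symbols and noise are i.i.d. over time, and independent of each other, of the channels and of the channel estimates. Achievable spectral efficiency. A number $R$ (in bits per symbol of the coherence interval, i.e. counting all $T$ symbols) is an achievable spectral efficiency for user $k$ of group $i$ if it is a lower bound on the ergodic capacity of the channel from $s_i$ (with $\mathbb{E}|s_i|^2=1$) to $y_{ik}$, with coding over arbitrarily many independent coherence intervals, only the $T-\tau_p$ downlink symbols per interval carrying data, the other groups' signals acting as random interference, and the user knowing the channel statistics but not the realizations of the channels or of the precoders. *)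

theory Defs
  imports "HOL-Probability.Probability" "Jordan_Normal_Form.Schur_Decomposition"
begin

text \<open>
  A channel is given by its outputs \<open>Y b t x \<omega>\<close>: what the receiver observes at the data symbol
  \<open>t < L\<close> of the coherence interval \<open>b\<close> if \<open>x\<close> is sent there and the outcome of all random
  quantities (fading, estimation noise, interference, receiver noise) is \<open>\<omega>\<close>.

  A code over \<open>n\<close> intervals with \<open>m\<close> messages consists of deterministic codewords \<open>c \<mu>\<close> and a
  decoder \<open>d\<close>. The normalisation \<open>E|s|^2 = 1\<close> of the input is imposed on every single codeword.
  The decoder sees the \<open>n L\<close> received symbols only; it may depend on the law of the channel, but
  not on the realisation of the fading. Asking for the probability of correct decoding to be at
  least \<open>1 - \<epsilon>\<close> (for every message) excludes non-measurable error events of measure \<open>0\<close>.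
\<close>

definition reliable_code ::
  "'w measure \<Rightarrow> (nat \<Rightarrow> nat \<Rightarrow> complex \<Rightarrow> 'w \<Rightarrow> complex) \<Rightarrow> nat \<Rightarrow> nat \<Rightarrow> nat \<Rightarrow>
    (nat \<Rightarrow> nat \<Rightarrow> nat \<Rightarrow> complex) \<Rightarrow> ((nat \<times> nat \<Rightarrow> complex) \<Rightarrow> nat) \<Rightarrow> real \<Rightarrow> bool" where
  "reliable_code P Y L n m c d \<epsilon> \<longleftrightarrow>
     (\<forall>\<mu><m. (\<Sum>b<n. \<Sum>t<L. (cmod (c \<mu> b t))\<^sup>2) = real (n * L)) \<and>
     d \<in> measurable (\<Pi>\<^sub>M bt \<in> {..<n} \<times> {..<L}. borel) (count_space UNIV) \<and>
     (\<forall>\<mu><m. measure P {\<omega> \<in> space P.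
        d (\<lambda>(b, t) \<in> {..<n} \<times> {..<L}. Y b t (c \<mu> b t) \<omega>) = \<mu>} \<ge> 1 - \<epsilon>)"

text \<open>Rates are in bits per symbol, counting all \<open>T\<close> symbols of a coherence interval.\<close>

definition achievable_rate ::
  "'w measure \<Rightarrow> (nat \<Rightarrow> nat \<Rightarrow> complex \<Rightarrow> 'w \<Rightarrow> complex) \<Rightarrow> nat \<Rightarrow> nat \<Rightarrow> real \<Rightarrow> bool" where
  "achievable_rate P Y T L R \<longleftrightarrow>
     (\<forall>\<epsilon>>0. \<forall>\<^sub>F n in sequentially. \<exists>m c d.
        m \<ge> 1 \<and> log 2 (real m) \<ge> real n * real T * R \<and> reliable_code P Y L n m c d \<epsilon>)"

definition ergodic_capacity ::
  "'w measure \<Rightarrow> (nat \<Rightarrow> nat \<Rightarrow> complex \<Rightarrow> 'w \<Rightarrow> complex) \<Rightarrow> nat \<Rightarrow> nat \<Rightarrow> ereal" where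
  "ergodic_capacity P Y T L = (SUP R \<in> {R. achievable_rate P Y T L R}. ereal R)"

definition achievable_spectral_efficiency ::
  "'w measure \<Rightarrow> (nat \<Rightarrow> nat \<Rightarrow> complex \<Rightarrow> 'w \<Rightarrow> complex) \<Rightarrow> nat \<Rightarrow> nat \<Rightarrow> real \<Rightarrow> bool" where
  "achievable_spectral_efficiency P Y T L R \<longleftrightarrow> ereal R \<le> ergodic_capacity P Y T L"

definition circular_gaussian :: "'w measure \<Rightarrow> real \<Rightarrow> ('w \<Rightarrow> complex) \<Rightarrow> bool" where
  "circular_gaussian P v X \<longleftrightarrow>
     distributed P lborel X (\<lambda>z. ennreal (exp (- (cmod z)\<^sup>2 / v) / (pi * v)))"

text \<open>
  A vector with law \<open>CN(0, v I)\<close> is represented by its components, which are independent with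
  law \<open>CN(0, v)\<close>. Groups and users are numbered from \<open>1\<close>; intervals, symbols and antennas
  from \<open>0\<close>. The indices are: interval, group, user, antenna for \<open>Channel\<close> and \<open>Pilot_Noise\<close>;
  interval, symbol, group for \<open>Data\<close>; interval, symbol for \<open>Receiver_Noise\<close>.
\<close>

datatype source =
    Channel nat nat nat nat
  | Pilot_Noise nat nat nat nat
  | Data nat nat nat
  | Receiver_Noise nat nat

definition sources :: "nat \<Rightarrow> nat \<Rightarrow> (nat \<Rightarrow> nat) \<Rightarrow> nat \<Rightarrow> source set" where
  "sources N G K L =
     {Channel b j k a | b j k a. j \<in> {1..G} \<and> k \<in> {1..K j} \<and> a < N} \<union>
     {Pilot_Noise b j k a | b j k a. j \<in> {1..G} \<and> k \<in> {1..K j} \<and> a < N} \<union>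
     {Data b t j | b t j. t < L \<and> j \<in> {1..G}} \<union>
     {Receiver_Noise b t | b t. t < L}"

fun source_variance :: "(nat \<Rightarrow> nat \<Rightarrow> real) \<Rightarrow> source \<Rightarrow> real" where
  "source_variance \<beta> (Channel b j k a) = \<beta> j k"
| "source_variance \<beta> (Pilot_Noise b j k a) = 1"
| "source_variance \<beta> (Data b t j) = 1"
| "source_variance \<beta> (Receiver_Noise b t) = 1"

fun source_variable ::
  "(nat \<Rightarrow> nat \<Rightarrow> nat \<Rightarrow> nat \<Rightarrow> 'w \<Rightarrow> complex) \<Rightarrow>
   (nat \<Rightarrow> nat \<Rightarrow> nat \<Rightarrow> nat \<Rightarrow> 'w \<Rightarrow> complex) \<Rightarrow>
   (nat \<Rightarrow> nat \<Rightarrow> nat \<Rightarrow> 'w \<Rightarrow> complex) \<Rightarrow>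
   (nat \<Rightarrow> nat \<Rightarrow> 'w \<Rightarrow> complex) \<Rightarrow> source \<Rightarrow> 'w \<Rightarrow> complex" where
  "source_variable g w s z (Channel b j k a) = g b j k a"
| "source_variable g w s z (Pilot_Noise b j k a) = w b j k a"
| "source_variable g w s z (Data b t j) = s b t j"
| "source_variable g w s z (Receiver_Noise b t) = z b t"

definition K_tot :: "nat \<Rightarrow> (nat \<Rightarrow> nat) \<Rightarrow> nat" where
  "K_tot G K = (\<Sum>j = 1..G. K j)"

definition mmse_gamma :: "nat \<Rightarrow> real \<Rightarrow> real \<Rightarrow> real" where
  "mmse_gamma \<tau> p \<beta> = real \<tau> * p * \<beta>\<^sup>2 / (1 + real \<tau> * p * \<beta>)"

definition mmse_estimate :: "nat \<Rightarrow> real \<Rightarrow> real \<Rightarrow> complex vec \<Rightarrow> complex vec \<Rightarrow> complex vec" where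
  "mmse_estimate \<tau> p \<beta> x y =
     complex_of_real (sqrt (real \<tau> * p) * \<beta> / (1 + real \<tau> * p * \<beta>)) \<cdot>\<^sub>v
       (complex_of_real (sqrt (real \<tau> * p)) \<cdot>\<^sub>v x + y)"

text \<open>Columns in the order \<open>(1,1), \<dots>, (1,K 1), (2,1), \<dots>, (G,K G)\<close>.\<close>

definition estimate_matrix ::
  "nat \<Rightarrow> nat \<Rightarrow> (nat \<Rightarrow> nat) \<Rightarrow> (nat \<Rightarrow> nat \<Rightarrow> complex vec) \<Rightarrow> complex mat" where
  "estimate_matrix N G K h =
     mat_of_cols N (concat (map (\<lambda>j. map (h j) [1..<K j + 1]) [1..<G + 1]))"

definition user_position :: "(nat \<Rightarrow> nat) \<Rightarrow> nat \<Rightarrow> nat \<Rightarrow> nat" where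
  "user_position K j k = (\<Sum>t = 1..<j. K t) + k"

text \<open>
  \<^const>\<open>unit_vec\<close> counts from \<open>0\<close>, hence the \<open>- 1\<close>. \<^const>\<open>mat_inverse\<close> returns \<^const>\<open>None\<close> for
  singular matrices; for the Gram matrix below and \<open>N \<ge> K_tot\<close> this is an event of
  probability \<open>0\<close>, on which the precoder is an arbitrary constant.
\<close>

definition zf_precoder ::
  "nat \<Rightarrow> nat \<Rightarrow> (nat \<Rightarrow> nat) \<Rightarrow> (nat \<Rightarrow> nat \<Rightarrow> real) \<Rightarrow> (nat \<Rightarrow> nat \<Rightarrow> real) \<Rightarrow>
    (nat \<Rightarrow> nat \<Rightarrow> complex vec) \<Rightarrow> nat \<Rightarrow> nat \<Rightarrow> complex vec" where
  "zf_precoder N G K p \<gamma> h j k =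
     (let H = estimate_matrix N G K h in
      complex_of_real (sqrt (p j k * \<gamma> j k * (real N - real (K_tot G K)))) \<cdot>\<^sub>v
        ((H * the (mat_inverse (mat_adjoint H * H))) *\<^sub>v
           unit_vec (K_tot G K) (user_position K j k - 1)))"

definition transmit_signal ::
  "nat \<Rightarrow> nat \<Rightarrow> (nat \<Rightarrow> nat) \<Rightarrow> (nat \<Rightarrow> nat \<Rightarrow> complex vec) \<Rightarrow> (nat \<Rightarrow> complex) \<Rightarrow> complex vec" where
  "transmit_signal N G K v s = vec N (\<lambda>a. \<Sum>j = 1..G. \<Sum>t = 1..K j. v j t $ a * s j)"

text \<open>Note that \<open>x \<bullet>c y\<close> conjugates its second argument.\<close>

definition received_signal :: "complex vec \<Rightarrow> complex vec \<Rightarrow> complex \<Rightarrow> complex" where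
  "received_signal g x n = x \<bullet>c g + n"

text \<open>
  The channel from the data symbols of group \<open>i\<close> to user \<open>k\<close> of that group, in the format of
  \<^const>\<open>ergodic_capacity\<close>: the symbol of group \<open>i\<close> is the input \<open>x\<close>, those of the other groups
  are random.
\<close>

definition zf_user_channel ::
  "nat \<Rightarrow> nat \<Rightarrow> (nat \<Rightarrow> nat) \<Rightarrow> nat \<Rightarrow>
    (nat \<Rightarrow> nat \<Rightarrow> real) \<Rightarrow> (nat \<Rightarrow> nat \<Rightarrow> real) \<Rightarrow> (nat \<Rightarrow> nat \<Rightarrow> real) \<Rightarrow>
    (nat \<Rightarrow> nat \<Rightarrow> nat \<Rightarrow> nat \<Rightarrow> 'w \<Rightarrow> complex) \<Rightarrow>
    (nat \<Rightarrow> nat \<Rightarrow> nat \<Rightarrow> nat \<Rightarrow> 'w \<Rightarrow> complex) \<Rightarrow>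
    (nat \<Rightarrow> nat \<Rightarrow> nat \<Rightarrow> 'w \<Rightarrow> complex) \<Rightarrow>
    (nat \<Rightarrow> nat \<Rightarrow> 'w \<Rightarrow> complex) \<Rightarrow>
    nat \<Rightarrow> nat \<Rightarrow> nat \<Rightarrow> nat \<Rightarrow> complex \<Rightarrow> 'w \<Rightarrow> complex" where
  "zf_user_channel N G K \<tau> \<beta> pu pdl g w s z i k b t x \<omega> =
     (let gv = (\<lambda>j l. vec N (\<lambda>a. g b j l a \<omega>));
          wv = (\<lambda>j l. vec N (\<lambda>a. w b j l a \<omega>));
          h = (\<lambda>j l. mmse_estimate \<tau> (pu j l) (\<beta> j l) (gv j l) (wv j l));
          \<gamma> = (\<lambda>j l. mmse_gamma \<tau> (pu j l) (\<beta> j l));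
          v = zf_precoder N G K pdl \<gamma> h
      in received_signal (gv i k)
           (transmit_signal N G K v (\<lambda>j. if j = i then x else s b t j \<omega>))
           (z b t \<omega>))"

definition total_power :: "nat \<Rightarrow> (nat \<Rightarrow> nat) \<Rightarrow> (nat \<Rightarrow> nat \<Rightarrow> real) \<Rightarrow> real" where
  "total_power G K pdl = (\<Sum>j = 1..G. \<Sum>k = 1..K j. pdl j k)"

definition SINR_un ::
  "nat \<Rightarrow> nat \<Rightarrow> (nat \<Rightarrow> nat) \<Rightarrow> nat \<Rightarrow>
    (nat \<Rightarrow> nat \<Rightarrow> real) \<Rightarrow> (nat \<Rightarrow> nat \<Rightarrow> real) \<Rightarrow> (nat \<Rightarrow> nat \<Rightarrow> real) \<Rightarrow> nat \<Rightarrow> nat \<Rightarrow> real" where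
  "SINR_un N G K \<tau> \<beta> pu pdl i k =
     (let \<gamma> = mmse_gamma \<tau> (pu i k) (\<beta> i k) in
      (real N - real (K_tot G K)) * \<gamma> * pdl i k / (1 + (\<beta> i k - \<gamma>) * total_power G K pdl))"

definition SE_un ::
  "nat \<Rightarrow> nat \<Rightarrow> (nat \<Rightarrow> nat) \<Rightarrow> nat \<Rightarrow> nat \<Rightarrow>
    (nat \<Rightarrow> nat \<Rightarrow> real) \<Rightarrow> (nat \<Rightarrow> nat \<Rightarrow> real) \<Rightarrow> (nat \<Rightarrow> nat \<Rightarrow> real) \<Rightarrow> nat \<Rightarrow> nat \<Rightarrow> real" where
  "SE_un N G K T \<tau> \<beta> pu pdl i k =
     (1 - real \<tau> / real T) * log 2 (1 + SINR_un N G K \<tau> \<beta> pu pdl i k)"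

end

theory Submission
  imports Defs
begin

text \<open>A user that knows only the statistics sees a block channel
  \<open>y = h x + u\<close> with deterministic mean gain \<open>a = E h\<close>. Codewords are Gaussian and normalised to a
  sphere; the decoder accepts the codewords whose squared correlation with the received vector
  exceeds a threshold. A Chernoff bound for the mass of a spherical cap makes a wrong acceptance
  exponentially unlikely, while laws of large numbers for four block statistics make the right
  codeword accepted with high probability, although \<open>h\<close> and \<open>u\<close> are dependent. Expurgation then yields every rate
  below the logarithm of \<open>H / (H - a\<^sup>2)\<close>, where \<open>H\<close> is the mean received power.

  For zero forcing, the estimates cancel the interference up to the product of the estimation
  error, which is independent of the estimates, with the precoder. Its power needs only
  \<open>E 1/D = 1/(\<gamma> (N - K))\<close> for the squared distance \<open>D\<close> of one Gaussian column from the span of the others,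
  which is computed from \<open>1/D = \<integral> exp (-s D) ds\<close>. Distinct columns of the zero-forcing matrix are
  uncorrelated because flipping the sign of a channel column preserves its law.\<close>

section \<open>Complex Gaussian integrals\<close>

text \<open>The receiver knows no realisation, \<open>h\<close> is constant over an interval, and
  \<open>h\<close> and the disturbance are neither Gaussian nor independent, so there is no
  convenient density to decode with. A test on the angle between received vector and codeword avoids
  this: it ignores scale, so a wrong codeword may be taken as a Gaussian vector independent of the
  received one, whatever the law of the latter, and for the right one averages suffice. Its squared
  cosine is near \<open>a\<^sup>2 / H\<close>; a cap of squared cosine \<open>c\<close> has mass
  about \<open>(1 - c) ^ n\<close> in complex dimension \<open>n\<close>, whence
  \<open>H / (H - a\<^sup>2)\<close>. The averages are controlled by first moments only: with just
  one antenna more than users, the squared norm of a zero-forcing vector has infinite variance. All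
  vectors of a group carry the same symbol, so independence of the data does not remove their cross
  terms; hence the sign flip. The leakage of the user's own group is a fluctuation of the gain about
  its mean, that of the other groups is interference. Both end up in \<open>H - a\<^sup>2\<close>,
  and so the power of all groups appears in the denominator.\<close>

definition cgauss :: "real \<Rightarrow> complex measure" where
  "cgauss v = density lborel (\<lambda>z. ennreal (exp (- (cmod z)\<^sup>2 / v) / (pi * v)))"

lemma sets_cgauss [simp, measurable_cong]: "sets (cgauss v) = sets borel"
  and space_cgauss [simp]: "space (cgauss v) = UNIV"
  by (simp_all add: cgauss_def)

lemma borel_measurable_cnj [measurable]: "cnj \<in> borel_measurable borel"
  by (intro borel_measurable_continuous_onI continuous_intros)

lemma nn_integral_exp_quadratic:
  fixes A c :: real
  assumes A: "A > 0"
  shows "(\<integral>\<^sup>+x. ennreal (exp (- A * x\<^sup>2 + 2 * c * x)) \<partial>lborel) = ennreal (sqrt (pi / A) * exp (c\<^sup>2 / A))"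
proof -
  let ?\<sigma> = "1 / sqrt (2 * A)"
  have s2: "?\<sigma>\<^sup>2 = 1 / (2 * A)"
    using A by (simp add: power_divide)
  have sq: "sqrt (pi / A) / sqrt (2 * pi * (1 / (2 * A))) = 1"
    using A by simp
  have eq: "exp (- A * x\<^sup>2 + 2 * c * x) = (sqrt (pi / A) * exp (c\<^sup>2 / A)) * normal_density (c / A) ?\<sigma> x" for x
  proof -
    have "- A * x\<^sup>2 + 2 * c * x = c\<^sup>2 / A - (x - c / A)\<^sup>2 / (2 * (1 / (2 * A)))"
      using A by (simp add: field_simps power2_eq_square)
    then show ?thesis
      unfolding normal_density_def s2 using A
      by (simp add: exp_diff exp_minus exp_add[symmetric] field_simps)
  qed
  have "(\<integral>\<^sup>+x. ennreal (exp (- A * x\<^sup>2 + 2 * c * x)) \<partial>lborel)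
      = (\<integral>\<^sup>+x. ennreal (sqrt (pi / A) * exp (c\<^sup>2 / A)) * ennreal (normal_density (c / A) ?\<sigma> x) \<partial>lborel)"
    unfolding eq using A by (subst ennreal_mult) auto
  also have "\<dots> = ennreal (sqrt (pi / A) * exp (c\<^sup>2 / A)) * ennreal 1"
    using A by (subst nn_integral_cmult) (auto simp: nn_integral_eq_integral)
  finally show ?thesis by simp
qed

lemma nn_integral_exp_quadratic_complex:
  fixes A :: real and b :: complex
  assumes A: "A > 0"
  shows "(\<integral>\<^sup>+z. ennreal (exp (- A * (cmod z)\<^sup>2 + 2 * Re (cnj b * z))) \<partial>lborel)
    = ennreal (pi / A * exp ((cmod b)\<^sup>2 / A))"
proof -
  let ?f = "\<lambda>e x. ennreal (exp (- A * x\<^sup>2 + 2 * (inner b e) * x))"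
  have "(\<integral>\<^sup>+z. ennreal (exp (- A * (cmod z)\<^sup>2 + 2 * Re (cnj b * z))) \<partial>lborel)
      = (\<integral>\<^sup>+z. (\<Prod>e\<in>Basis. ?f e (inner z e)) \<partial>lborel)"
    by (intro nn_integral_cong)
       (simp add: Basis_complex_def cmod_power2 ennreal_mult[symmetric] exp_add[symmetric] algebra_simps inner_complex_def)
  also have "\<dots> = (\<Prod>e\<in>Basis. \<integral>\<^sup>+x. ?f e x \<partial>lborel)"
    by (rule nn_integral_lborel_prod) auto
  also have "\<dots> = ennreal ((sqrt (pi / A) * sqrt (pi / A)) * (exp ((Re b)\<^sup>2 / A) * exp ((Im b)\<^sup>2 / A)))"
    unfolding nn_integral_exp_quadratic[OF A] using A
    by (simp add: Basis_complex_def ennreal_mult[symmetric] inner_complex_def mult_ac del: real_sqrt_mult_self)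
  also have "\<dots> = ennreal (pi / A * exp ((cmod b)\<^sup>2 / A))"
    using A by (simp add: exp_add[symmetric] cmod_power2 add_divide_distrib)
  finally show ?thesis .
qed

text \<open>Against the density of CN(0, v) the exponent stays quadratic, with
  \<open>A + 1 / v\<close> in place of \<open>A\<close>, so \<open>A\<close> may be negative down to
  \<open>- 1 / v\<close>. With \<open>b = 0\<close> this is a Laplace transform of the squared
  modulus, with \<open>A = 0\<close> the moment generating function that linearises squares
  below.\<close>

lemma nn_integral_cgauss_exp:
  fixes A v :: real and b :: complex
  assumes v: "v > 0" and A: "1 + A * v > 0"
  shows "(\<integral>\<^sup>+z. ennreal (exp (- A * (cmod z)\<^sup>2 + 2 * Re (cnj b * z))) \<partial>cgauss v)
    = ennreal (1 / (1 + A * v) * exp (v * (cmod b)\<^sup>2 / (1 + A * v)))"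
proof -
  have A': "A + 1 / v > 0" using v A by (simp add: field_simps)
  have eq: "exp (- (cmod z)\<^sup>2 / v) / (pi * v) * exp (- A * (cmod z)\<^sup>2 + 2 * Re (cnj b * z))
     = 1 / (pi * v) * exp (- (A + 1 / v) * (cmod z)\<^sup>2 + 2 * Re (cnj b * z))" for z
    by (simp add: exp_add[symmetric] algebra_simps)
  have "(\<integral>\<^sup>+z. ennreal (exp (- A * (cmod z)\<^sup>2 + 2 * Re (cnj b * z))) \<partial>cgauss v)
     = (\<integral>\<^sup>+z. ennreal (1 / (pi * v)) * ennreal (exp (- (A + 1 / v) * (cmod z)\<^sup>2 + 2 * Re (cnj b * z))) \<partial>lborel)"
    unfolding cgauss_def
    apply (subst nn_integral_density)
      apply measurable
    apply (intro nn_integral_cong)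
    apply (subst ennreal_mult[symmetric])
    using v apply simp
     apply simp
    apply (subst ennreal_mult[symmetric])
    using v apply simp
     apply simp
    apply (subst eq)
    apply simp
    done
  also have "\<dots> = ennreal (1 / (pi * v)) * ennreal (pi / (A + 1 / v) * exp ((cmod b)\<^sup>2 / (A + 1 / v)))"
    unfolding nn_integral_exp_quadratic_complex[OF A', symmetric]
    by (rule nn_integral_cmult) measurable
  also have "\<dots> = ennreal (1 / (1 + A * v) * exp (v * (cmod b)\<^sup>2 / (1 + A * v)))"
  proof -
    have e: "A + 1 / v = (1 + A * v) / v" using v by (simp add: field_simps)
    show ?thesis unfolding e using v A
      by (subst ennreal_mult[symmetric]) (auto simp: field_simps)
  qed
  finally show ?thesis .
qed

lemma prob_space_cgauss: "v > 0 \<Longrightarrow> prob_space (cgauss v)"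
  using nn_integral_cgauss_exp[of v 0 0]
  by (intro prob_spaceI) simp

text \<open>Hubbard-Stratonovich linearisation: the exponential of \<theta> times a squared modulus
  is a Gaussian expectation of exponentials of linear forms. After swapping the integrals the one
  over \<open>x\<close> splits into coordinates; orthonormality of \<open>q\<close> then makes the
  remaining integral over \<xi> split as well. This avoids rotating the Gaussian measure and
  completing \<open>q\<close> to a basis.\<close>

lemma nn_integral_gauss_quadratic_form:
  fixes q :: "'l \<Rightarrow> 'i \<Rightarrow> complex"
  assumes v: "v > 0" and A: "1 + A * v > 0" and lam: "0 \<le> \<theta>" "\<theta> * v < 1 + A * v"
    and fin: "finite I" "finite J"
    and orth: "\<And>l l'. l \<in> J \<Longrightarrow> l' \<in> J \<Longrightarrow> (\<Sum>a\<in>I. cnj (q l a) * q l' a) = (if l = l' then 1 else 0)"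
  shows "(\<integral>\<^sup>+x. ennreal (exp (- A * (\<Sum>a\<in>I. (cmod (x a))\<^sup>2)
             + \<theta> * (\<Sum>l\<in>J. (cmod (\<Sum>a\<in>I. cnj (q l a) * x a))\<^sup>2))) \<partial>(\<Pi>\<^sub>M a\<in>I. cgauss v))
    = ennreal ((1 / (1 + A * v)) ^ card I * (1 / (1 - \<theta> * v / (1 + A * v))) ^ card J)"
proof -
  interpret X: product_sigma_finite "\<lambda>_::'i. cgauss v"
    by (rule product_sigma_finite.intro) (simp add: prob_space_cgauss[OF v] prob_space_imp_sigma_finite)
  interpret Xi: product_sigma_finite "\<lambda>_::'l. cgauss 1"
    by (rule product_sigma_finite.intro) (simp add: prob_space_cgauss prob_space_imp_sigma_finite)
  interpret FX: finite_product_sigma_finite "\<lambda>_::'i. cgauss v" I by standard (rule fin)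
  interpret FXi: finite_product_sigma_finite "\<lambda>_::'l. cgauss 1" J by standard (rule fin)
  interpret XX: pair_sigma_finite "\<Pi>\<^sub>M a\<in>I. cgauss v" "\<Pi>\<^sub>M l\<in>J. cgauss 1" ..
  define ip where "ip l x = (\<Sum>a\<in>I. cnj (q l a) * x a)" for l and x :: "'i \<Rightarrow> complex"
  define B where "B \<xi> a = (\<Sum>l\<in>J. \<xi> l * q l a)" for \<xi> :: "'l \<Rightarrow> complex" and a
  \<comment> \<open>The coefficient left on the squares of \<open>B \<xi>\<close> once
    \<open>x\<close> is integrated out; below 1, so that the outer Gaussian integral
    converges.\<close>
  define \<kappa> where "\<kappa> = \<theta> * v / (1 + A * v)"
  have k1: "\<kappa> < 1" using lam A by (simp add: \<kappa>_def field_simps)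
  have [measurable]: "ip l \<in> borel_measurable (\<Pi>\<^sub>M a\<in>I. cgauss v)" for l
    unfolding ip_def by measurable
  have gauss1: "(\<integral>\<^sup>+z. ennreal (exp (2 * Re (cnj b * z))) \<partial>cgauss 1) = ennreal (exp ((cmod b)\<^sup>2))" for b
    using nn_integral_cgauss_exp[of 1 0 b] by simp
  have HS: "ennreal (exp (\<theta> * (\<Sum>l\<in>J. (cmod (ip l x))\<^sup>2)))
     = (\<integral>\<^sup>+\<xi>. (\<Prod>l\<in>J. ennreal (exp (2 * Re (cnj (sqrt \<theta> * ip l x) * \<xi> l)))) \<partial>(\<Pi>\<^sub>M l\<in>J. cgauss 1))" for x
  proof -
    have "(\<integral>\<^sup>+\<xi>. (\<Prod>l\<in>J. ennreal (exp (2 * Re (cnj (sqrt \<theta> * ip l x) * \<xi> l)))) \<partial>(\<Pi>\<^sub>M l\<in>J. cgauss 1))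
       = (\<Prod>l\<in>J. \<integral>\<^sup>+z. ennreal (exp (2 * Re (cnj (sqrt \<theta> * ip l x) * z))) \<partial>cgauss 1)"
      by (rule Xi.product_nn_integral_prod[OF fin(2)]) measurable
    also have "\<dots> = (\<Prod>l\<in>J. ennreal (exp ((cmod (sqrt \<theta> * ip l x))\<^sup>2)))"
      by (intro prod.cong refl gauss1)
    also have "\<dots> = ennreal (exp (\<theta> * (\<Sum>l\<in>J. (cmod (ip l x))\<^sup>2)))"
      using lam(1) by (simp add: prod_ennreal exp_sum[OF fin(2)] norm_mult power_mult_distrib sum_distrib_left)
    finally show ?thesis by simp
  qed
  have sumB: "(\<Sum>l\<in>J. Re (cnj (ip l x) * \<xi> l)) = (\<Sum>a\<in>I. Re (cnj (B \<xi> a) * x a))" for x \<xi>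
  proof -
    have "(\<Sum>l\<in>J. cnj (ip l x) * \<xi> l) = cnj (\<Sum>a\<in>I. cnj (B \<xi> a) * x a)"
      unfolding ip_def B_def cnj_sum complex_cnj_mult sum_distrib_right complex_cnj_cnj
      by (subst sum.swap) (simp add: mult_ac)
    then have "Re (\<Sum>l\<in>J. cnj (ip l x) * \<xi> l) = Re (\<Sum>a\<in>I. cnj (B \<xi> a) * x a)" by simp
    then show ?thesis by (simp only: Re_sum)
  qed
  \<comment> \<open>The one place where orthonormality enters: passing from \<xi> to
    \<open>B \<xi>\<close> is an isometry.\<close>
  have normB: "(\<Sum>a\<in>I. (cmod (B \<xi> a))\<^sup>2) = (\<Sum>l\<in>J. (cmod (\<xi> l))\<^sup>2)" for \<xi>
  proof -
    have "complex_of_real (\<Sum>a\<in>I. (cmod (B \<xi> a))\<^sup>2) = (\<Sum>a\<in>I. cnj (B \<xi> a) * B \<xi> a)"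
      by (simp add: complex_norm_square mult.commute del: of_real_power)
    also have "\<dots> = (\<Sum>a\<in>I. \<Sum>l\<in>J. \<Sum>l'\<in>J. cnj (\<xi> l) * \<xi> l' * (cnj (q l a) * q l' a))"
      unfolding B_def cnj_sum sum_product by (simp add: mult_ac)
    also have "\<dots> = (\<Sum>l\<in>J. \<Sum>l'\<in>J. cnj (\<xi> l) * \<xi> l' * (\<Sum>a\<in>I. cnj (q l a) * q l' a))"
      unfolding sum_distrib_left by (subst sum.swap, rule sum.cong[OF refl], rule sum.swap)
    also have "\<dots> = (\<Sum>l\<in>J. \<Sum>l'\<in>J. if l = l' then cnj (\<xi> l) * \<xi> l' else 0)"
      by (intro sum.cong refl) (simp add: orth)
    also have "\<dots> = complex_of_real (\<Sum>l\<in>J. (cmod (\<xi> l))\<^sup>2)"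
      using fin by (simp add: complex_norm_square mult.commute del: of_real_power)
    finally show ?thesis by (simp only: of_real_eq_iff)
  qed
  have e1: "ennreal (exp (- A * (\<Sum>a\<in>I. (cmod (x a))\<^sup>2))) *
        (\<Prod>l\<in>J. ennreal (exp (2 * Re (cnj (sqrt \<theta> * ip l x) * \<xi> l))))
     = (\<Prod>a\<in>I. ennreal (exp (- A * (cmod (x a))\<^sup>2 + 2 * Re (cnj (sqrt \<theta> * B \<xi> a) * x a))))" for x \<xi>
  proof -
    have "- A * (\<Sum>a\<in>I. (cmod (x a))\<^sup>2) + (\<Sum>l\<in>J. 2 * Re (cnj (sqrt \<theta> * ip l x) * \<xi> l))
        = - A * (\<Sum>a\<in>I. (cmod (x a))\<^sup>2) + 2 * sqrt \<theta> * (\<Sum>l\<in>J. Re (cnj (ip l x) * \<xi> l))"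
      by (simp add: sum_distrib_left algebra_simps)
    also have "\<dots> = (\<Sum>a\<in>I. - A * (cmod (x a))\<^sup>2 + 2 * Re (cnj (sqrt \<theta> * B \<xi> a) * x a))"
      unfolding sumB by (simp add: sum_distrib_left algebra_simps sum.distrib sum_negf sum_subtractf)
    finally show ?thesis
      by (simp add: prod_ennreal ennreal_mult[symmetric] exp_sum[OF fin(1), symmetric] exp_sum[OF fin(2), symmetric] exp_add[symmetric])
  qed
  have "(\<integral>\<^sup>+x. ennreal (exp (- A * (\<Sum>a\<in>I. (cmod (x a))\<^sup>2)
             + \<theta> * (\<Sum>l\<in>J. (cmod (ip l x))\<^sup>2))) \<partial>(\<Pi>\<^sub>M a\<in>I. cgauss v))
    = (\<integral>\<^sup>+x. ennreal (exp (- A * (\<Sum>a\<in>I. (cmod (x a))\<^sup>2))) *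
         (\<integral>\<^sup>+\<xi>. (\<Prod>l\<in>J. ennreal (exp (2 * Re (cnj (sqrt \<theta> * ip l x) * \<xi> l)))) \<partial>(\<Pi>\<^sub>M l\<in>J. cgauss 1)) \<partial>(\<Pi>\<^sub>M a\<in>I. cgauss v))"
    unfolding HS[symmetric] exp_add by (subst ennreal_mult) simp_all
  also have "\<dots> = (\<integral>\<^sup>+x. (\<integral>\<^sup>+\<xi>. (\<Prod>a\<in>I. ennreal (exp (- A * (cmod (x a))\<^sup>2 + 2 * Re (cnj (sqrt \<theta> * B \<xi> a) * x a)))) \<partial>(\<Pi>\<^sub>M l\<in>J. cgauss 1)) \<partial>(\<Pi>\<^sub>M a\<in>I. cgauss v))"
    unfolding e1[symmetric] by (intro nn_integral_cong nn_integral_cmult[symmetric]) measurable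
  also have "\<dots> = (\<integral>\<^sup>+\<xi>. (\<integral>\<^sup>+x. (\<Prod>a\<in>I. ennreal (exp (- A * (cmod (x a))\<^sup>2 + 2 * Re (cnj (sqrt \<theta> * B \<xi> a) * x a)))) \<partial>(\<Pi>\<^sub>M a\<in>I. cgauss v)) \<partial>(\<Pi>\<^sub>M l\<in>J. cgauss 1))"
  proof (rule XX.Fubini'[symmetric])
    let ?P = "(\<Pi>\<^sub>M a\<in>I. cgauss v) \<Otimes>\<^sub>M (\<Pi>\<^sub>M l\<in>J. cgauss 1)"
    have m1: "(\<lambda>z. fst z a) \<in> borel_measurable ?P" if "a \<in> I" for a
    proof -
      have "(\<lambda>z. fst z a) \<in> measurable ?P (cgauss v)" using that by measurable
      then show ?thesis by (subst (asm) measurable_cong_sets[OF refl sets_cgauss])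
    qed
    have m2: "(\<lambda>z. snd z l) \<in> borel_measurable ?P" if "l \<in> J" for l
    proof -
      have "(\<lambda>z. snd z l) \<in> measurable ?P (cgauss 1)" using that by measurable
      then show ?thesis by (subst (asm) measurable_cong_sets[OF refl sets_cgauss])
    qed
    show "(\<lambda>(x, \<xi>). \<Prod>a\<in>I. ennreal (exp (- A * (cmod (x a))\<^sup>2 + 2 * Re (cnj (sqrt \<theta> * B \<xi> a) * x a)))) \<in> borel_measurable ?P"
      unfolding B_def split_beta'
      using m1[measurable] m2[measurable] by measurable
  qed
  also have "\<dots> = (\<integral>\<^sup>+\<xi>. (\<Prod>a\<in>I. ennreal (1 / (1 + A * v) * exp (\<kappa> * (cmod (B \<xi> a))\<^sup>2))) \<partial>(\<Pi>\<^sub>M l\<in>J. cgauss 1))"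
  proof (intro nn_integral_cong)
    fix \<xi> :: "'l \<Rightarrow> complex"
    have "(\<integral>\<^sup>+x. (\<Prod>a\<in>I. ennreal (exp (- A * (cmod (x a))\<^sup>2 + 2 * Re (cnj (sqrt \<theta> * B \<xi> a) * x a)))) \<partial>(\<Pi>\<^sub>M a\<in>I. cgauss v))
       = (\<Prod>a\<in>I. \<integral>\<^sup>+z. ennreal (exp (- A * (cmod z)\<^sup>2 + 2 * Re (cnj (sqrt \<theta> * B \<xi> a) * z))) \<partial>cgauss v)"
      by (rule X.product_nn_integral_prod[OF fin(1)]) measurable
    also have "\<dots> = (\<Prod>a\<in>I. ennreal (1 / (1 + A * v) * exp (\<kappa> * (cmod (B \<xi> a))\<^sup>2)))"
      unfolding nn_integral_cgauss_exp[OF v A] \<kappa>_def using lam(1)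
      by (simp add: norm_mult power_mult_distrib mult_ac)
    finally show "(\<integral>\<^sup>+x. (\<Prod>a\<in>I. ennreal (exp (- A * (cmod (x a))\<^sup>2 + 2 * Re (cnj (sqrt \<theta> * B \<xi> a) * x a)))) \<partial>(\<Pi>\<^sub>M a\<in>I. cgauss v)) = \<dots>" .
  qed
  also have "\<dots> = (\<integral>\<^sup>+\<xi>. ennreal ((1 / (1 + A * v)) ^ card I) * (\<Prod>l\<in>J. ennreal (exp (\<kappa> * (cmod (\<xi> l))\<^sup>2))) \<partial>(\<Pi>\<^sub>M l\<in>J. cgauss 1))"
  proof (intro nn_integral_cong)
    fix \<xi> :: "'l \<Rightarrow> complex"
    have "(\<Prod>a\<in>I. ennreal (1 / (1 + A * v) * exp (\<kappa> * (cmod (B \<xi> a))\<^sup>2)))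
       = ennreal ((1 / (1 + A * v)) ^ card I * exp (\<kappa> * (\<Sum>a\<in>I. (cmod (B \<xi> a))\<^sup>2)))"
      using A fin by (subst prod_ennreal) (auto simp: prod.distrib prod_dividef sum_distrib_left exp_sum power_one_over)
    also have "\<dots> = ennreal ((1 / (1 + A * v)) ^ card I) * (\<Prod>l\<in>J. ennreal (exp (\<kappa> * (cmod (\<xi> l))\<^sup>2)))"
      unfolding normB sum_distrib_left exp_sum[OF fin(2)] using A
      by (subst prod_ennreal) (auto intro!: ennreal_mult prod_nonneg zero_le_power)
    finally show "(\<Prod>a\<in>I. ennreal (1 / (1 + A * v) * exp (\<kappa> * (cmod (B \<xi> a))\<^sup>2))) = \<dots>" .
  qed
  also have "\<dots> = ennreal ((1 / (1 + A * v)) ^ card I) * (\<Prod>l\<in>J. \<integral>\<^sup>+z. ennreal (exp (\<kappa> * (cmod z)\<^sup>2)) \<partial>cgauss 1)"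
    apply (subst nn_integral_cmult)
     apply measurable
    apply (subst Xi.product_nn_integral_prod[OF fin(2)])
     apply measurable
    done
  also have "\<dots> = ennreal ((1 / (1 + A * v)) ^ card I) * (\<Prod>l\<in>J. ennreal (1 / (1 - \<kappa>)))"
    using nn_integral_cgauss_exp[of 1 "-\<kappa>" 0] k1 by simp
  also have "\<dots> = ennreal ((1 / (1 + A * v)) ^ card I * (1 / (1 - \<kappa>)) ^ card J)"
    using k1 A by (simp add: ennreal_power ennreal_mult)
  finally show ?thesis unfolding \<kappa>_def ip_def .
qed

text \<open>Chernoff bound: with \<open>q\<close> the direction of \<open>y\<close>, the event makes
  \<theta> times (squared projection on \<open>q\<close> minus \<open>t\<^sup>2\<close> times
  squared norm) nonnegative. The bound is the same for all \<open>y\<close>. Only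
  \<open>1 / (1 + \<theta> * t\<^sup>2)\<close> is raised to the dimension; the last factor stems
  from the single direction \<open>q\<close> and does not grow.\<close>

lemma emeasure_gauss_cap_le:
  fixes y :: "'i \<Rightarrow> complex"
  assumes fin: "finite I" and theta: "0 \<le> \<theta>" "\<theta> * (1 - t\<^sup>2) < 1"
  shows "emeasure (\<Pi>\<^sub>M a\<in>I. cgauss 1) {x \<in> space (\<Pi>\<^sub>M a\<in>I. cgauss 1).
      t\<^sup>2 * (\<Sum>a\<in>I. (cmod (y a))\<^sup>2) * (\<Sum>a\<in>I. (cmod (x a))\<^sup>2) < (cmod (\<Sum>a\<in>I. cnj (y a) * x a))\<^sup>2}
    \<le> ennreal ((1 / (1 + \<theta> * t\<^sup>2)) ^ card I * ((1 + \<theta> * t\<^sup>2) / (1 - \<theta> * (1 - t\<^sup>2))))"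
    (is "emeasure ?M {x \<in> _. ?E x} \<le> ?b")
proof (cases "(\<Sum>a\<in>I. (cmod (y a))\<^sup>2) = 0")
  case True
  \<comment> \<open>There is no direction to project on, but the strict inequality makes the event
    empty.\<close>
  then have "\<forall>a\<in>I. y a = 0" using fin by (simp add: sum_nonneg_eq_0_iff)
  then have "{x \<in> space ?M. ?E x} = {}" by (simp add: True)
  then show ?thesis by (simp only: emeasure_empty zero_le)
next
  case False
  define S where "S = (\<Sum>a\<in>I. (cmod (y a))\<^sup>2)"
  have S: "S > 0" using False by (simp add: S_def order_less_le sum_nonneg)
  \<comment> \<open>The type \<open>unit\<close> serves as index set of an orthonormal family with
    one member.\<close>
  define q where "q = (\<lambda>(u::unit) a. y a / sqrt S)"
  have q1: "(\<Sum>a\<in>I. cnj (q l a) * q l' a) = (if l = l' then 1 else 0)" for l l'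
  proof -
    have "(\<Sum>a\<in>I. cnj (q l a) * q l' a) = (\<Sum>a\<in>I. complex_of_real ((cmod (y a))\<^sup>2 / S))"
      using S by (intro sum.cong) (auto simp: q_def complex_norm_square mult.commute simp flip: of_real_mult simp del: of_real_power)
    also have "\<dots> = complex_of_real (\<Sum>a\<in>I. (cmod (y a))\<^sup>2 / S)" by (rule of_real_sum[symmetric])
    also have "(\<Sum>a\<in>I. (cmod (y a))\<^sup>2 / S) = 1"
      using S by (simp add: S_def sum_divide_distrib[symmetric])
    finally show ?thesis by simp
  qed
  have ipq: "(cmod (\<Sum>a\<in>I. cnj (q () a) * x a))\<^sup>2 = (cmod (\<Sum>a\<in>I. cnj (y a) * x a))\<^sup>2 / S" for x
    using S by (simp add: q_def sum_divide_distrib[symmetric] norm_divide power_divide)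
  have pos: "1 + \<theta> * t\<^sup>2 * 1 > 0" using theta by (simp add: add_pos_nonneg)
  have lt: "\<theta> * 1 < 1 + \<theta> * t\<^sup>2 * 1" using theta by (simp add: algebra_simps)
  have "emeasure ?M {x \<in> space ?M. ?E x} = (\<integral>\<^sup>+x. indicator {x \<in> space ?M. ?E x} x \<partial>?M)"
    by (rule nn_integral_indicator[symmetric]) measurable
  also have "\<dots> \<le> (\<integral>\<^sup>+x. ennreal (exp (- (\<theta> * t\<^sup>2) * (\<Sum>a\<in>I. (cmod (x a))\<^sup>2)
             + \<theta> * (\<Sum>l\<in>{()}. (cmod (\<Sum>a\<in>I. cnj (q l a) * x a))\<^sup>2))) \<partial>?M)"
  proof (rule nn_integral_mono)
    fix x assume "x \<in> space ?M"
    have "0 \<le> - (\<theta> * t\<^sup>2) * (\<Sum>a\<in>I. (cmod (x a))\<^sup>2) + \<theta> * (\<Sum>l\<in>{()}. (cmod (\<Sum>a\<in>I. cnj (q l a) * x a))\<^sup>2)"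
      if "?E x"
    proof -
      have "t\<^sup>2 * (\<Sum>a\<in>I. (cmod (x a))\<^sup>2) \<le> (cmod (\<Sum>a\<in>I. cnj (y a) * x a))\<^sup>2 / S"
        using that S unfolding S_def[symmetric] by (simp add: field_simps)
      from mult_left_mono[OF this theta(1)] show ?thesis by (simp add: ipq)
    qed
    then show "indicator {x \<in> space ?M. ?E x} x \<le> ennreal (exp (- (\<theta> * t\<^sup>2) * (\<Sum>a\<in>I. (cmod (x a))\<^sup>2)
             + \<theta> * (\<Sum>l\<in>{()}. (cmod (\<Sum>a\<in>I. cnj (q l a) * x a))\<^sup>2)))"
      by (auto simp: indicator_def simp flip: ennreal_1 intro!: ennreal_leI simp del: ennreal_1)
  qed
  also have "\<dots> = ennreal ((1 / (1 + \<theta> * t\<^sup>2 * 1)) ^ card I * (1 / (1 - \<theta> * 1 / (1 + \<theta> * t\<^sup>2 * 1))) ^ card {()})"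
    by (rule nn_integral_gauss_quadratic_form) (use pos lt theta fin q1 in auto)
  also have "1 / (1 - \<theta> * 1 / (1 + \<theta> * t\<^sup>2 * 1)) = (1 + \<theta> * t\<^sup>2) / (1 - \<theta> * (1 - t\<^sup>2))"
  proof -
    have "1 - \<theta> * 1 / (1 + \<theta> * t\<^sup>2 * 1) = (1 - \<theta> * (1 - t\<^sup>2)) / (1 + \<theta> * t\<^sup>2)"
      using pos by (simp add: field_simps)
    then show ?thesis by simp
  qed
  finally show ?thesis by simp
qed

text \<open>For \<open>D \<le> 0\<close> both sides are infinite, since \<open>ennreal D\<close> is
  0 and its inverse \<infinity>. Hence the inverse of a squared distance can be integrated before
  the distance is known to be positive.\<close>

lemma nn_integral_exp_decay:
  "(\<integral>\<^sup>+s. ennreal (exp (- s * D)) * indicator {0..} s \<partial>lborel) = inverse (ennreal D)"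
proof (cases "D > 0")
  case True
  have "(\<integral>\<^sup>+s. ennreal (exp (- s * D)) * indicator {0..} s \<partial>lborel) = ennreal (0 - (- exp (- 0 * D) / D))"
  proof (rule nn_integral_FTC_atLeast)
    show "DERIV (\<lambda>s. - exp (- s * D) / D) x :> exp (- x * D)" for x
      using True by (auto intro!: derivative_eq_intros)
    have "filterlim (\<lambda>s. s * D) at_top at_top"
      by (rule filterlim_at_top_mult_tendsto_pos[OF tendsto_const True filterlim_ident])
    then have "filterlim (\<lambda>s. - s * D) at_bot at_top" by (simp add: filterlim_uminus_at_bot)
    then have "((\<lambda>s. - exp (- s * D) / D) \<longlongrightarrow> - 0 / D) at_top"
      using True by (intro tendsto_intros filterlim_compose[OF exp_at_bot]) auto
    then show "((\<lambda>s. - exp (- s * D) / D) \<longlongrightarrow> 0) at_top" by simp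
  qed auto
  then show ?thesis using True by (simp add: inverse_ennreal divide_inverse)
next
  case False
  have "(\<integral>\<^sup>+s. indicator {0..} s \<partial>(lborel::real measure)) \<le> (\<integral>\<^sup>+s. ennreal (exp (- s * D)) * indicator {0..} s \<partial>lborel)"
  proof (rule nn_integral_mono)
    fix s :: real
    show "indicator {0..} s \<le> ennreal (exp (- s * D)) * indicator {0..} s"
      using False ennreal_leI[of 1 "exp (- (s * D))"] by (auto simp: indicator_def mult_nonneg_nonpos)
  qed
  moreover have "emeasure lborel {0::real..} = \<infinity>"
  proof -
    have "ennreal (real n) \<le> emeasure lborel {0::real..}" for n :: nat
    proof -
      have "emeasure lborel {0..real n} \<le> emeasure lborel {0::real..}" by (rule emeasure_mono) auto
      then show ?thesis by simp
    qed
    then show ?thesis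
      by (metis ennreal_of_nat_eq_real_of_nat ennreal_SUP_of_nat_eq_top SUP_least top.extremum_unique infinity_ennreal_def)
  qed
  ultimately show ?thesis using False by (simp add: ennreal_neg top.extremum_unique)
qed

lemma nn_integral_inverse_power:
  fixes v :: real and m :: nat
  assumes v: "v > 0" and m: "m \<ge> 2"
  shows "(\<integral>\<^sup>+s. ennreal ((1 / (1 + s * v)) ^ m) * indicator {0..} s \<partial>lborel) = ennreal (1 / (v * (real m - 1)))"
proof -
  obtain k where k: "m = Suc (Suc k)" using m by (metis add_2_eq_Suc le_Suc_ex)
  \<comment> \<open>An antiderivative; its exponent \<open>m - 1\<close> is positive because
    \<open>m \<ge> 2\<close>, which makes it vanish at infinity.\<close>
  let ?F = "\<lambda>s. - ((1 / (1 + s * v)) ^ Suc k) / (v * (real k + 1))"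
  have "(\<integral>\<^sup>+s. ennreal ((1 / (1 + s * v)) ^ m) * indicator {0..} s \<partial>lborel) = ennreal (0 - ?F 0)"
  proof (rule nn_integral_FTC_atLeast)
    fix x :: real assume x: "0 \<le> x"
    have p: "1 + x * v > 0" using x v by (simp add: add_pos_nonneg)
    have "DERIV (\<lambda>s. 1 / (1 + s * v)) x :> - v / (1 + x * v)\<^sup>2"
      using p by (auto intro!: derivative_eq_intros simp: power2_eq_square)
    from DERIV_power[OF this, of "Suc k"]
    have d: "DERIV (\<lambda>s. (1 / (1 + s * v)) ^ Suc k) x :> real (Suc k) * (- v / (1 + x * v)\<^sup>2 * (1 / (1 + x * v)) ^ k)"
      by (simp add: mult_ac)
    have "DERIV ?F x :> - (real (Suc k) * (- v / (1 + x * v)\<^sup>2 * (1 / (1 + x * v)) ^ k)) / (v * (real k + 1))"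
      by (intro DERIV_cdivide DERIV_minus d)
    also have "- (real (Suc k) * (- v / (1 + x * v)\<^sup>2 * (1 / (1 + x * v)) ^ k)) / (v * (real k + 1)) = (1 / (1 + x * v)) ^ m"
    proof -
      have "(real k + 1) * v \<noteq> 0" using v by simp
      then have "- (real (Suc k) * (- v / (1 + x * v)\<^sup>2 * (1 / (1 + x * v)) ^ k)) / (v * (real k + 1))
          = (1 / (1 + x * v)) ^ k / (1 + x * v)\<^sup>2"
        using p by (simp add: divide_simps add.commute)
      then show ?thesis by (simp add: k power2_eq_square)
    qed
    finally show "DERIV ?F x :> (1 / (1 + x * v)) ^ m" .
    show "0 \<le> (1 / (1 + x * v)) ^ m" using p by simp
  next
    have "filterlim (\<lambda>s. 1 + s * v) at_top at_top"
      using v by (intro filterlim_tendsto_add_at_top[OF tendsto_const] filterlim_at_top_mult_tendsto_pos[OF tendsto_const _ filterlim_ident])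
    then have "((\<lambda>s. 1 / (1 + s * v)) \<longlongrightarrow> 0) at_top"
      by (intro tendsto_divide_0[OF tendsto_const] filterlim_at_top_imp_at_infinity)
    then have "(?F \<longlongrightarrow> - (0 ^ Suc k) / (v * (real k + 1))) at_top"
      by (intro tendsto_intros) (use v in auto)
    then show "(?F \<longlongrightarrow> 0) at_top" by simp
  qed auto
  then show ?thesis by (simp add: k add.commute)
qed

text \<open>Write the inverse as an integral of exponentials and swap. With both coefficients of the
  quadratic form equal to \<open>s\<close>, the directions \<open>q l\<close> cancel, and what
  remains is the Laplace transform of a Gamma variable of shape \<open>card I - card J\<close>. Its
  inverse has a finite mean once this shape is at least 2.\<close>

lemma nn_integral_inverse_gauss_residual:
  fixes q :: "'l \<Rightarrow> 'i \<Rightarrow> complex"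
  assumes v: "v > 0" and fin: "finite I" "finite J" and card: "card J + 2 \<le> card I"
    and orth: "\<And>l l'. l \<in> J \<Longrightarrow> l' \<in> J \<Longrightarrow> (\<Sum>a\<in>I. cnj (q l a) * q l' a) = (if l = l' then 1 else 0)"
  shows "(\<integral>\<^sup>+x. inverse (ennreal ((\<Sum>a\<in>I. (cmod (x a))\<^sup>2) - (\<Sum>l\<in>J. (cmod (\<Sum>a\<in>I. cnj (q l a) * x a))\<^sup>2)))
      \<partial>(\<Pi>\<^sub>M a\<in>I. cgauss v)) = ennreal (1 / (v * (real (card I) - real (card J) - 1)))"
proof -
  interpret X: product_sigma_finite "\<lambda>_::'i. cgauss v"
    by (rule product_sigma_finite.intro) (simp add: prob_space_cgauss[OF v] prob_space_imp_sigma_finite)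
  interpret FX: finite_product_sigma_finite "\<lambda>_::'i. cgauss v" I by standard (rule fin)
  interpret XX: pair_sigma_finite "\<Pi>\<^sub>M a\<in>I. cgauss v" "lborel :: real measure" ..
  let ?D = "\<lambda>x. (\<Sum>a\<in>I. (cmod (x a))\<^sup>2) - (\<Sum>l\<in>J. (cmod (\<Sum>a\<in>I. cnj (q l a) * x a))\<^sup>2)"
  define m where "m = card I - card J"
  have m: "m \<ge> 2" "card I = card J + m" using card by (auto simp: m_def)
  have "(\<integral>\<^sup>+x. inverse (ennreal (?D x)) \<partial>(\<Pi>\<^sub>M a\<in>I. cgauss v))
     = (\<integral>\<^sup>+x. \<integral>\<^sup>+s. ennreal (exp (- s * ?D x)) * indicator {0..} s \<partial>lborel \<partial>(\<Pi>\<^sub>M a\<in>I. cgauss v))"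
    unfolding nn_integral_exp_decay ..
  also have "\<dots> = (\<integral>\<^sup>+s. \<integral>\<^sup>+x. ennreal (exp (- s * ?D x)) * indicator {0..} s \<partial>(\<Pi>\<^sub>M a\<in>I. cgauss v) \<partial>lborel)"
    by (rule XX.Fubini'[symmetric]) measurable
  also have "\<dots> = (\<integral>\<^sup>+s. ennreal ((1 / (1 + s * v)) ^ m) * indicator {0..} s \<partial>lborel)"
  proof (rule nn_integral_cong)
    fix s :: real
    show "(\<integral>\<^sup>+x. ennreal (exp (- s * ?D x)) * indicator {0..} s \<partial>(\<Pi>\<^sub>M a\<in>I. cgauss v))
        = ennreal ((1 / (1 + s * v)) ^ m) * indicator {0..} s"
    proof (cases "s \<ge> 0")
      case True
      have p: "1 + s * v > 0" using True v by (simp add: add_pos_nonneg)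
      have "(\<integral>\<^sup>+x. ennreal (exp (- s * ?D x)) \<partial>(\<Pi>\<^sub>M a\<in>I. cgauss v))
         = (\<integral>\<^sup>+x. ennreal (exp (- s * (\<Sum>a\<in>I. (cmod (x a))\<^sup>2)
             + s * (\<Sum>l\<in>J. (cmod (\<Sum>a\<in>I. cnj (q l a) * x a))\<^sup>2))) \<partial>(\<Pi>\<^sub>M a\<in>I. cgauss v))"
        by (simp add: algebra_simps)
      also have "\<dots> = ennreal ((1 / (1 + s * v)) ^ card I * (1 / (1 - s * v / (1 + s * v))) ^ card J)"
        by (rule nn_integral_gauss_quadratic_form) (use v p True fin orth in auto)
      also have "1 / (1 - s * v / (1 + s * v)) = 1 + s * v" using p by (simp add: field_simps)
      also have "(1 / (1 + s * v)) ^ card I * (1 + s * v) ^ card J = (1 / (1 + s * v)) ^ m"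
        unfolding m(2) power_add using p by (simp add: power_one_over)
      finally show ?thesis using True by simp
    qed simp
  qed
  also have "\<dots> = ennreal (1 / (v * (real m - 1)))"
    by (rule nn_integral_inverse_power[OF v m(1)])
  also have "real m = real (card I) - real (card J)" by (simp add: m(2))
  finally show ?thesis .
qed

section \<open>A weak law of large numbers\<close>

text \<open>Truncation at a level \<open>A\<close>, Chebyshev for the truncated part, Markov for the
  rest. Integrability alone is assumed because the law is applied to squared gains, whose variance
  can be infinite.\<close>

lemma (in prob_space) weak_law_pairwise_indep:
  fixes Z :: "nat \<Rightarrow> 'a \<Rightarrow> real"
  assumes int: "integrable M (Z 0)"
    and ident: "\<And>b. distr M borel (Z b) = distr M borel (Z 0)"
    and ind: "\<And>b b'. b \<noteq> b' \<Longrightarrow> indep_var borel (Z b) borel (Z b')"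
    and e: "\<epsilon> > 0"
  shows "(\<lambda>n. prob {\<omega> \<in> space M. \<epsilon> * real n < \<bar>(\<Sum>b<n. Z b \<omega>) - real n * expectation (Z 0)\<bar>}) \<longlonglongrightarrow> 0"
proof -
  have rv[measurable]: "Z b \<in> borel_measurable M" for b
    using indep_var_rv1[OF ind[of b "Suc b"]] by simp
  have transfer: "expectation (\<lambda>\<omega>. \<phi> (Z b \<omega>)) = expectation (\<lambda>\<omega>. \<phi> (Z 0 \<omega>))"
    "integrable M (\<lambda>\<omega>. \<phi> (Z b \<omega>)) \<longleftrightarrow> integrable M (\<lambda>\<omega>. \<phi> (Z 0 \<omega>))"
    if [measurable]: "\<phi> \<in> borel_measurable borel" for b and \<phi> :: "real \<Rightarrow> real"
    using integral_distr[OF rv[of b] that] integral_distr[OF rv[of 0] that]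
      integrable_distr_eq[OF rv[of b] that] integrable_distr_eq[OF rv[of 0] that] ident[of b] by simp_all
  define f where "f A z = (if \<bar>z\<bar> \<le> A then z else 0)" for A z :: real
  have f_meas[measurable]: "f A \<in> borel_measurable borel" for A
    unfolding f_def by measurable
  have f_le: "A \<ge> 0 \<Longrightarrow> \<bar>f A z\<bar> \<le> A" for A z by (simp add: f_def)
  have tail: "(\<lambda>k::nat. expectation (\<lambda>\<omega>. \<bar>Z 0 \<omega> - f (real k) (Z 0 \<omega>)\<bar>)) \<longlonglongrightarrow> expectation (\<lambda>\<omega>. 0)"
  proof (rule integral_dominated_convergence[where w="\<lambda>\<omega>. \<bar>Z 0 \<omega>\<bar>"])
    show "AE \<omega> in M. (\<lambda>k. \<bar>Z 0 \<omega> - f (real k) (Z 0 \<omega>)\<bar>) \<longlonglongrightarrow> 0"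
    proof (rule AE_I2)
      fix \<omega>
      have "\<forall>\<^sub>F k in sequentially. \<bar>Z 0 \<omega>\<bar> \<le> real k"
        using filterlim_real_sequentially by (simp add: filterlim_at_top)
      then have "\<forall>\<^sub>F k in sequentially. \<bar>Z 0 \<omega> - f (real k) (Z 0 \<omega>)\<bar> = 0"
        by eventually_elim (simp add: f_def)
      then show "(\<lambda>k. \<bar>Z 0 \<omega> - f (real k) (Z 0 \<omega>)\<bar>) \<longlonglongrightarrow> 0" by (rule tendsto_eventually)
    qed
    show "AE \<omega> in M. norm \<bar>Z 0 \<omega> - f (real k) (Z 0 \<omega>)\<bar> \<le> \<bar>Z 0 \<omega>\<bar>" for k
      by (rule AE_I2) (simp add: f_def)
  qed (use int in auto)
  show ?thesis
  proof (rule LIMSEQ_I)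
    fix \<eta> :: real assume \<eta>: "\<eta> > 0"
    \<comment> \<open>\<open>\<epsilon> / 3\<close> bounds the shift of the mean caused by
      truncation; \<open>\<epsilon> * \<eta> / 9\<close> makes the Markov bound
      \<open>3 * \<delta> / \<epsilon>\<close> at most \<open>\<eta> / 3\<close>.\<close>
    define \<delta> where "\<delta> = min (\<epsilon> / 3) (\<epsilon> * \<eta> / 9)"
    have d: "\<delta> > 0" using e \<eta> by (simp add: \<delta>_def)
    from tail have "(\<lambda>k::nat. expectation (\<lambda>\<omega>. \<bar>Z 0 \<omega> - f (real k) (Z 0 \<omega>)\<bar>)) \<longlonglongrightarrow> 0" by simp
    from order_tendstoD(2)[OF this d] obtain k :: nat
      where k: "expectation (\<lambda>\<omega>. \<bar>Z 0 \<omega> - f (real k) (Z 0 \<omega>)\<bar>) < \<delta>"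
      by (auto simp: eventually_sequentially)
    define A where "A = real k"
    have A: "A \<ge> 0" by (simp add: A_def)
    define T where "T b \<omega> = f A (Z b \<omega>)" for b \<omega>
    have [measurable]: "T b \<in> borel_measurable M" for b unfolding T_def by measurable
    have T_le: "\<bar>T b \<omega>\<bar> \<le> A" for b \<omega> by (simp add: T_def f_le A)
    have intT: "integrable M (T b)" for b
      by (rule integrable_const_bound[of _ A]) (auto simp: T_le)
    define \<mu> where "\<mu> = expectation (T 0)"
    have ET: "expectation (T b) = \<mu>" for b
      using transfer(1)[of "f A" b] by (simp add: T_def[abs_def] \<mu>_def)
    have \<mu>_le: "\<bar>\<mu>\<bar> \<le> A"
    proof -
      have "\<bar>\<mu>\<bar> \<le> expectation (\<lambda>\<omega>. \<bar>T 0 \<omega>\<bar>)" unfolding \<mu>_def by (rule integral_abs_bound)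
      also have "\<dots> \<le> A"
        by (rule integral_le_const) (use intT[of 0] T_le in auto)
      finally show ?thesis .
    qed
    define U where "U b \<omega> = T b \<omega> - \<mu>" for b \<omega>
    have U_le: "\<bar>U b \<omega>\<bar> \<le> 2 * A" for b \<omega>
      using T_le[of b \<omega>] \<mu>_le by (simp add: U_def)
    have [measurable]: "U b \<in> borel_measurable M" for b unfolding U_def by measurable
    have intU: "integrable M (U b)" for b unfolding U_def using intT by simp
    have EU: "expectation (U b) = 0" for b
      unfolding U_def using intT[of b] ET[of b] by (simp add: prob_space)
    have UU: "integrable M (\<lambda>\<omega>. U b \<omega> * U b' \<omega>)" for b b'
    proof (rule integrable_const_bound[of _ "(2 * A) * (2 * A)"])
      have "norm (U b \<omega> * U b' \<omega>) \<le> (2 * A) * (2 * A)" for \<omega>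
        unfolding real_norm_def abs_mult by (intro mult_mono U_le) (use A in auto)
      then show "AE \<omega> in M. norm (U b \<omega> * U b' \<omega>) \<le> (2 * A) * (2 * A)" by simp
    qed measurable
    have EUU: "expectation (\<lambda>\<omega>. U b \<omega> * U b' \<omega>) \<le> (if b = b' then 4 * A\<^sup>2 else 0)" for b b'
    proof (cases "b = b'")
      case True
      have "U b \<omega> * U b \<omega> \<le> 4 * A\<^sup>2" for \<omega>
        using mult_mono[OF U_le[of b \<omega>] U_le[of b \<omega>]] A by (simp add: power2_eq_square flip: abs_mult)
      then have "expectation (\<lambda>\<omega>. U b \<omega> * U b \<omega>) \<le> 4 * A\<^sup>2"
        by (intro integral_le_const UU) auto
      then show ?thesis using True by simp
    next
      case False
      have "indep_var borel ((\<lambda>z. f A z - \<mu>) \<circ> Z b) borel ((\<lambda>z. f A z - \<mu>) \<circ> Z b')"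
        by (rule indep_var_compose[OF ind[OF False]]) measurable
      then have "indep_var borel (U b) borel (U b')"
        by (simp add: comp_def U_def[abs_def] T_def)
      from indep_var_lebesgue_integral[OF this intU intU] show ?thesis
        using False EU by simp
    qed
    have var: "expectation (\<lambda>\<omega>. (\<Sum>b<n. U b \<omega>)\<^sup>2) \<le> real n * (4 * A\<^sup>2)" for n
    proof -
      have "expectation (\<lambda>\<omega>. (\<Sum>b<n. U b \<omega>)\<^sup>2) = (\<Sum>b<n. \<Sum>b'<n. expectation (\<lambda>\<omega>. U b \<omega> * U b' \<omega>))"
        unfolding power2_eq_square sum_product
        by (simp add: Bochner_Integration.integral_sum Bochner_Integration.integrable_sum UU)
      also have "\<dots> \<le> (\<Sum>b<n. \<Sum>b'<n. if b = b' then 4 * A\<^sup>2 else 0)"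
        by (intro sum_mono EUU)
      also have "\<dots> = real n * (4 * A\<^sup>2)" by simp
      finally show ?thesis .
    qed
    define R where "R b \<omega> = \<bar>Z b \<omega> - T b \<omega>\<bar>" for b \<omega>
    have R_eq: "R b = (\<lambda>\<omega>. (\<lambda>z. \<bar>z - f A z\<bar>) (Z b \<omega>))" for b
      by (simp add: R_def[abs_def] T_def)
    have intR: "integrable M (R b)" for b
    proof -
      have "integrable M (\<lambda>\<omega>. \<bar>Z 0 \<omega> - f A (Z 0 \<omega>)\<bar>)"
        using int intT[of 0] by (simp add: T_def[abs_def])
      then show ?thesis unfolding R_eq by (subst transfer(2)) auto
    qed
    have ER: "expectation (R b) < \<delta>" for b
      unfolding R_eq by (subst transfer(1)) (use k in \<open>auto simp: A_def\<close>)
    have \<mu>diff: "\<bar>\<mu> - expectation (Z 0)\<bar> \<le> \<epsilon> / 3"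
    proof -
      have "\<mu> - expectation (Z 0) = expectation (\<lambda>\<omega>. T 0 \<omega> - Z 0 \<omega>)"
        using int intT[of 0] by (simp add: \<mu>_def)
      also have "\<bar>\<dots>\<bar> \<le> expectation (\<lambda>\<omega>. \<bar>T 0 \<omega> - Z 0 \<omega>\<bar>)" by (rule integral_abs_bound)
      also have "\<dots> = expectation (R 0)" by (simp add: R_def[abs_def] abs_minus_commute)
      finally show ?thesis using ER[of 0] by (simp add: \<delta>_def)
    qed
    \<comment> \<open>The Chebyshev bound: variance at most \<open>4 * A\<^sup>2\<close> per
      summand, deviation \<open>\<epsilon> * real n / 3\<close>.\<close>
    obtain n0 :: nat where n0: "n0 > 0" "36 * A\<^sup>2 / (\<epsilon>\<^sup>2 * real n0) < \<eta> / 3"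
    proof -
      obtain n0 :: nat where "real n0 > 36 * A\<^sup>2 / (\<epsilon>\<^sup>2 * (\<eta> / 3))" using reals_Archimedean2 by blast
      then have "36 * A\<^sup>2 / (\<epsilon>\<^sup>2 * (\<eta> / 3)) < real (Suc n0)" by simp
      then have "36 * A\<^sup>2 < real (Suc n0) * (\<epsilon>\<^sup>2 * (\<eta> / 3))"
        using e \<eta> by (subst (asm) pos_divide_less_eq) auto
      then have "36 * A\<^sup>2 / (\<epsilon>\<^sup>2 * real (Suc n0)) < \<eta> / 3"
        using e by (subst pos_divide_less_eq) (auto simp: mult_ac simp del: of_nat_Suc)
      then show ?thesis using that[of "Suc n0"] by simp
    qed
    show "\<exists>n0. \<forall>n\<ge>n0. norm (prob {\<omega> \<in> space M. \<epsilon> * real n < \<bar>(\<Sum>b<n. Z b \<omega>) - real n * expectation (Z 0)\<bar>} - 0) < \<eta>"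
    proof (intro exI allI impI)
      fix n assume n: "n \<ge> n0"
      have npos: "real n > 0" using n n0(1) by simp
      let ?E = "{\<omega> \<in> space M. \<epsilon> * real n < \<bar>(\<Sum>b<n. Z b \<omega>) - real n * expectation (Z 0)\<bar>}"
      let ?E1 = "{\<omega> \<in> space M. \<bar>(\<Sum>b<n. U b \<omega>) - expectation (\<lambda>\<omega>. \<Sum>b<n. U b \<omega>)\<bar> \<ge> \<epsilon> * real n / 3}"
      let ?E2 = "{\<omega> \<in> space M. (\<Sum>b<n. R b \<omega>) \<ge> \<epsilon> * real n / 3}"
      have EsU: "expectation (\<lambda>\<omega>. \<Sum>b<n. U b \<omega>) = 0"
        using EU intU by (simp add: Bochner_Integration.integral_sum)
      \<comment> \<open>The deviation consists of the fluctuation of the truncated sum, the cut-off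
        tails and the shift of the mean, each granted a third of \<open>\<epsilon> * real n\<close>.
        The third never exceeds its share, so one of the first two must.\<close>
      have "?E \<subseteq> ?E1 \<union> ?E2"
      proof
        fix \<omega> assume w: "\<omega> \<in> ?E"
        have eq: "(\<Sum>b<n. Z b \<omega>) - real n * expectation (Z 0)
           = (\<Sum>b<n. U b \<omega>) + (\<Sum>b<n. Z b \<omega> - T b \<omega>) + real n * (\<mu> - expectation (Z 0))"
          by (simp add: U_def sum_subtractf algebra_simps)
        have "\<bar>\<Sum>b<n. Z b \<omega> - T b \<omega>\<bar> \<le> (\<Sum>b<n. R b \<omega>)" unfolding R_def by (rule sum_abs)
        moreover have "\<bar>real n * (\<mu> - expectation (Z 0))\<bar> \<le> real n * (\<epsilon> / 3)"
          using mult_left_mono[OF \<mu>diff, of "real n"] by (simp add: abs_mult)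
        ultimately have "\<epsilon> * real n < \<bar>\<Sum>b<n. U b \<omega>\<bar> + (\<Sum>b<n. R b \<omega>) + \<epsilon> * real n / 3"
          using w abs_triangle_ineq[of "(\<Sum>b<n. U b \<omega>) + (\<Sum>b<n. Z b \<omega> - T b \<omega>)" "real n * (\<mu> - expectation (Z 0))"]
            abs_triangle_ineq[of "\<Sum>b<n. U b \<omega>" "\<Sum>b<n. Z b \<omega> - T b \<omega>"]
          unfolding mem_Collect_eq eq by (simp add: mult.commute)
        then show "\<omega> \<in> ?E1 \<union> ?E2" using w EsU by auto
      qed
      then have "prob ?E \<le> prob (?E1 \<union> ?E2)" by (intro finite_measure_mono) (auto simp: R_def)
      also have "\<dots> \<le> prob ?E1 + prob ?E2" by (intro measure_Un_le) (auto simp: R_def)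
      also have "prob ?E1 \<le> \<eta> / 3"
      proof -
        have "prob ?E1 \<le> variance (\<lambda>\<omega>. \<Sum>b<n. U b \<omega>) / (\<epsilon> * real n / 3)\<^sup>2"
        proof (rule Chebyshev_inequality)
          show "integrable M (\<lambda>\<omega>. (\<Sum>b<n. U b \<omega>)\<^sup>2)"
            unfolding power2_eq_square sum_product by (intro Bochner_Integration.integrable_sum UU)
        qed (use e npos in auto)
        also have "\<dots> \<le> real n * (4 * A\<^sup>2) / (\<epsilon> * real n / 3)\<^sup>2"
          using var[of n] EsU by (intro divide_right_mono) auto
        also have "\<dots> = 36 * A\<^sup>2 / (\<epsilon>\<^sup>2 * real n)"
          using npos e by (simp add: power2_eq_square field_simps)
        also have "\<dots> \<le> 36 * A\<^sup>2 / (\<epsilon>\<^sup>2 * real n0)"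
          using n n0(1) e by (intro divide_left_mono) (auto intro!: mult_pos_pos)
        finally show ?thesis using n0(2) by simp
      qed
      also have "prob ?E2 \<le> \<eta> / 3"
      proof -
        have intSR: "integrable M (\<lambda>\<omega>. \<Sum>b<n. R b \<omega>)"
          by (intro Bochner_Integration.integrable_sum intR)
        have "prob ?E2 \<le> expectation (\<lambda>\<omega>. \<Sum>b<n. R b \<omega>) / (\<epsilon> * real n / 3)"
          by (rule integral_Markov_inequality_measure[where A="{}", OF intSR])
             (use e npos in \<open>auto simp: R_def intro!: sum_nonneg\<close>)
        also have "expectation (\<lambda>\<omega>. \<Sum>b<n. R b \<omega>) = (\<Sum>b<n. expectation (R b))"
          using intR by (simp add: Bochner_Integration.integral_sum)
        also have "\<dots> \<le> (\<Sum>b<n. \<delta>)" by (intro sum_mono less_imp_le ER)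
        also have "(\<Sum>b<n. \<delta>) / (\<epsilon> * real n / 3) = 3 * \<delta> / \<epsilon>" using npos by simp
        also have "\<dots> \<le> \<eta> / 3"
        proof -
          have "\<delta> \<le> \<epsilon> * \<eta> / 9" by (simp add: \<delta>_def)
          then show ?thesis using e by (simp add: field_simps)
        qed
        finally show ?thesis using npos e by (simp add: divide_right_mono)
      qed
      finally show "norm (prob ?E - 0) < \<eta>" using \<eta> by simp
    qed
  qed
qed

section \<open>Second moments and independence\<close>

text \<open>Symmetry of the law, which yields its mean here and the sign flip of a whole column
  later.\<close>

lemma distr_cgauss_uminus: "distr (cgauss v) borel uminus = cgauss v"
proof -
  have "distr lborel borel (\<lambda>x::complex. 0 + (-1) *\<^sub>R x) = lborel"
    using lborel_affine[of "-1" "0::complex", symmetric] by (simp add: density_1)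
  then have u: "distr lborel borel (uminus :: complex \<Rightarrow> complex) = lborel" by simp
  let ?f = "\<lambda>z. ennreal (exp (- (cmod z)\<^sup>2 / v) / (pi * v))"
  have "distr (density (distr lborel borel uminus) ?f) lborel uminus = density lborel (?f \<circ> uminus)"
    by (rule distr_density_distr) auto
  then have "distr (density lborel ?f) lborel uminus = density lborel ?f"
    unfolding u by (simp add: comp_def)
  moreover have "distr (density lborel ?f) borel uminus = distr (density lborel ?f) lborel uminus"
    by (rule distr_cong) simp_all
  ultimately show ?thesis unfolding cgauss_def by simp
qed

text \<open>The density factors into two real normal densities of variance \<open>v / 2\<close>, one
  for each component.\<close>

lemma nn_integral_cgauss_component:
  assumes v: "v > 0" and e: "e \<in> Basis"
  shows "(\<integral>\<^sup>+z. ennreal ((inner z e)\<^sup>2) \<partial>cgauss v) = ennreal (v / 2)"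
proof -
  let ?\<sigma> = "sqrt (v / 2)"
  let ?n = "normal_density 0 ?\<sigma>"
  let ?f = "\<lambda>b x. ennreal (?n x * (if b = e then x\<^sup>2 else 1))"
  have dens: "exp (- (cmod z)\<^sup>2 / v) / (pi * v) = ?n (Re z) * ?n (Im z)" for z
  proof -
    have nd: "?n x = exp (- (x\<^sup>2 / v)) / sqrt (pi * v)" for x
      using v by (simp add: normal_density_def)
    have sq: "sqrt (pi * v) * sqrt (pi * v) = pi * v" using v by simp
    have "- (cmod z)\<^sup>2 / v = - ((Re z)\<^sup>2 / v) + - ((Im z)\<^sup>2 / v)"
      by (simp add: cmod_power2 add_divide_distrib diff_divide_distrib)
    then show ?thesis unfolding nd times_divide_times_eq sq by (simp only: exp_add)
  qed
  have s: "?\<sigma> > 0" using v by simp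
  have m2: "(\<integral>\<^sup>+x. ennreal (?n x * x\<^sup>2) \<partial>lborel) = ennreal (v / 2)"
    using normal_moment_even[OF s, of 0 1] v
    by (subst nn_integral_eq_integral)
       (auto simp: has_bochner_integral_iff power_divide numeral_eq_Suc)
  have m0: "(\<integral>\<^sup>+x. ennreal (?n x) \<partial>lborel) = 1"
    using s by (subst nn_integral_eq_integral) auto
  have "(\<integral>\<^sup>+z. ennreal ((inner z e)\<^sup>2) \<partial>cgauss v)
     = (\<integral>\<^sup>+z. ennreal (?n (Re z) * ?n (Im z)) * ennreal ((inner z e)\<^sup>2) \<partial>lborel)"
    unfolding cgauss_def dens by (rule nn_integral_density) measurable
  also have "\<dots> = (\<integral>\<^sup>+z. (\<Prod>b\<in>Basis. ?f b (inner z b)) \<partial>lborel)"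
    using e by (intro nn_integral_cong)
      (auto simp: Basis_complex_def ennreal_mult[symmetric] inner_complex_def mult_ac)
  also have "\<dots> = (\<Prod>b\<in>Basis. \<integral>\<^sup>+x. ?f b x \<partial>lborel)"
    by (rule nn_integral_lborel_prod) auto
  also have "\<dots> = (\<Prod>b\<in>Basis. if b = e then ennreal (v / 2) else 1)"
    by (intro prod.cong refl) (simp add: m2 m0)
  also have "\<dots> = ennreal (v / 2)"
    using e by (simp add: prod.delta)
  finally show ?thesis .
qed

lemma cgauss_second_moment:
  assumes v: "v > 0"
  shows "integrable (cgauss v) (\<lambda>z. (cmod z)\<^sup>2)" "(\<integral>z. (cmod z)\<^sup>2 \<partial>cgauss v) = v"
proof -
  have "(\<integral>\<^sup>+z. ennreal ((cmod z)\<^sup>2) \<partial>cgauss v)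
     = (\<integral>\<^sup>+z. ennreal ((inner z 1)\<^sup>2) + ennreal ((inner z \<i>)\<^sup>2) \<partial>cgauss v)"
    by (intro nn_integral_cong) (simp add: cmod_power2 inner_complex_def)
  also have "\<dots> = ennreal v"
    using v nn_integral_cgauss_component[OF v, of 1] nn_integral_cgauss_component[OF v, of \<i>]
    by (subst nn_integral_add) (simp_all add: Basis_complex_def flip: ennreal_plus)
  finally have n: "(\<integral>\<^sup>+z. ennreal ((cmod z)\<^sup>2) \<partial>cgauss v) = ennreal v" .
  show i: "integrable (cgauss v) (\<lambda>z. (cmod z)\<^sup>2)"
    by (rule integrableI_nn_integral_finite[OF _ _ n]) auto
  show "(\<integral>z. (cmod z)\<^sup>2 \<partial>cgauss v) = v"
    using n v nn_integral_eq_integral[OF i] by simp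
qed

lemma norm_le_one_plus_square: "norm z \<le> norm (1 + (cmod z)\<^sup>2)"
proof -
  have "2 * cmod z \<le> 1 + (cmod z)\<^sup>2" using sum_squares_bound[of 1 "cmod z"] by simp
  then have "cmod z \<le> 1 + (cmod z)\<^sup>2" using norm_ge_zero[of z] by linarith
  then show ?thesis by simp
qed

lemma cgauss_mean:
  assumes v: "v > 0"
  shows "integrable (cgauss v) (\<lambda>z. z)" "(\<integral>z. z \<partial>cgauss v) = 0"
proof -
  interpret prob_space "cgauss v" by (rule prob_space_cgauss[OF v])
  show "integrable (cgauss v) (\<lambda>z. z)"
  proof (rule Bochner_Integration.integrable_bound)
    show "integrable (cgauss v) (\<lambda>z. 1 + (cmod z)\<^sup>2)" using cgauss_second_moment[OF v] by simp
    have "norm z \<le> norm (1 + (cmod z)\<^sup>2)" for z :: complex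
      by (rule norm_le_one_plus_square)
    then show "AE z in cgauss v. norm z \<le> norm (1 + (cmod z)\<^sup>2)" by simp
  qed simp
  have "(\<integral>z. z \<partial>cgauss v) = (\<integral>z. z \<partial>distr (cgauss v) borel uminus)" by (simp add: distr_cgauss_uminus)
  also have "\<dots> = - (\<integral>z. z \<partial>cgauss v)" by (subst integral_distr) auto
  finally show "(\<integral>z. z \<partial>cgauss v) = 0" by simp
qed

lemma (in prob_space) square_integrable_imp_integrable_complex:
  fixes f :: "'a \<Rightarrow> complex"
  assumes [measurable]: "f \<in> borel_measurable M" and "integrable M (\<lambda>x. (cmod (f x))\<^sup>2)"
  shows "integrable M f"
proof (rule Bochner_Integration.integrable_bound)
  show "integrable M (\<lambda>x. 1 + (cmod (f x))\<^sup>2)" using assms by simp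
  have "norm z \<le> norm (1 + (cmod z)\<^sup>2)" for z :: complex
    by (rule norm_le_one_plus_square)
  then show "AE x in M. norm (f x) \<le> norm (1 + (cmod (f x))\<^sup>2)" by simp
qed simp

lemma (in prob_space) integrable_mult_complex:
  fixes f g :: "'a \<Rightarrow> complex"
  assumes [measurable]: "f \<in> borel_measurable M" "g \<in> borel_measurable M"
    and "integrable M (\<lambda>x. (cmod (f x))\<^sup>2)" "integrable M (\<lambda>x. (cmod (g x))\<^sup>2)"
  shows "integrable M (\<lambda>x. f x * g x)"
proof (rule Bochner_Integration.integrable_bound)
  show "integrable M (\<lambda>x. (cmod (f x))\<^sup>2 + (cmod (g x))\<^sup>2)" using assms by simp
  have "norm (z * w) \<le> norm ((cmod z)\<^sup>2 + (cmod w)\<^sup>2)" for z w :: complex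
  proof -
    have "2 * (cmod z * cmod w) \<le> (cmod z)\<^sup>2 + (cmod w)\<^sup>2"
      using sum_squares_bound[of "cmod z" "cmod w"] by simp
    then have "cmod z * cmod w \<le> (cmod z)\<^sup>2 + (cmod w)\<^sup>2"
      using mult_nonneg_nonneg[OF norm_ge_zero[of z] norm_ge_zero[of w]] by linarith
    then show ?thesis by (simp add: norm_mult)
  qed
  then show "AE x in M. norm (f x * g x) \<le> norm ((cmod (f x))\<^sup>2 + (cmod (g x))\<^sup>2)" by simp
qed simp

section \<open>Independence and expectations on product spaces\<close>

lemma (in prob_space) indep_var_nn_integral:
  assumes ind: "indep_var A X B Y" and [measurable]: "f \<in> borel_measurable A" "g \<in> borel_measurable B"
  shows "(\<integral>\<^sup>+\<omega>. f (X \<omega>) * g (Y \<omega>) \<partial>M) = (\<integral>\<^sup>+\<omega>. f (X \<omega>) \<partial>M) * (\<integral>\<^sup>+\<omega>. g (Y \<omega>) \<partial>M)"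
proof -
  have [measurable]: "X \<in> measurable M A" "Y \<in> measurable M B"
    using indep_var_rv1[OF ind] indep_var_rv2[OF ind] by auto
  interpret X: prob_space "distr M A X" by (rule prob_space_distr) simp
  interpret Y: prob_space "distr M B Y" by (rule prob_space_distr) simp
  have "(\<integral>\<^sup>+\<omega>. f (X \<omega>) * g (Y \<omega>) \<partial>M) = (\<integral>\<^sup>+z. f (fst z) * g (snd z) \<partial>distr M (A \<Otimes>\<^sub>M B) (\<lambda>\<omega>. (X \<omega>, Y \<omega>)))"
    by (subst nn_integral_distr) auto
  also have "\<dots> = (\<integral>\<^sup>+z. f (fst z) * g (snd z) \<partial>(distr M A X \<Otimes>\<^sub>M distr M B Y))"
    using ind by (simp add: indep_var_distribution_eq)
  also have "\<dots> = (\<integral>\<^sup>+x. (\<integral>\<^sup>+y. f x * g y \<partial>distr M B Y) \<partial>distr M A X)"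
    by (subst Y.nn_integral_fst[symmetric]) auto
  also have "\<dots> = (\<integral>\<^sup>+x. f x * (\<integral>\<^sup>+y. g y \<partial>distr M B Y) \<partial>distr M A X)"
    by (intro nn_integral_cong nn_integral_cmult) auto
  also have "\<dots> = (\<integral>\<^sup>+x. f x \<partial>distr M A X) * (\<integral>\<^sup>+y. g y \<partial>distr M B Y)"
    by (intro nn_integral_multc) auto
  finally show ?thesis by (simp add: nn_integral_distr)
qed

context pair_prob_space begin

text \<open>Codewords and channel outcomes live on different factors; this makes a codeword row
  paired with an interval state independent of another such pair. Integrating over the second factor
  first turns an event into a function of the first component, so the two independence assumptions
  can be applied one after the other.\<close>

lemma indep_var_pair:
  assumes X: "M1.indep_var A X A' X'" and Y: "M2.indep_var B Y B' Y'"
  shows "indep_var (A \<Otimes>\<^sub>M B) (\<lambda>z. (X (fst z), Y (snd z))) (A' \<Otimes>\<^sub>M B') (\<lambda>z. (X' (fst z), Y' (snd z)))"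
proof -
  have [measurable]: "X \<in> measurable M1 A" "X' \<in> measurable M1 A'" "Y \<in> measurable M2 B" "Y' \<in> measurable M2 B'"
    using M1.indep_var_rv1[OF X] M1.indep_var_rv2[OF X] M2.indep_var_rv1[OF Y] M2.indep_var_rv2[OF Y] by auto
  let ?M = "M1 \<Otimes>\<^sub>M M2"
  let ?Z = "\<lambda>z. (X (fst z), Y (snd z))" and ?Z' = "\<lambda>z. (X' (fst z), Y' (snd z))"
  let ?D = "distr ?M (A \<Otimes>\<^sub>M B) ?Z" and ?D' = "distr ?M (A' \<Otimes>\<^sub>M B') ?Z'"
  interpret D: prob_space ?D by (rule prob_space_distr) measurable
  interpret D': prob_space ?D' by (rule prob_space_distr) measurable
  interpret DY: prob_space "distr M2 B Y" by (rule M2.prob_space_distr) measurable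
  interpret DY': prob_space "distr M2 B' Y'" by (rule M2.prob_space_distr) measurable
  have "?D \<Otimes>\<^sub>M ?D' = distr ?M ((A \<Otimes>\<^sub>M B) \<Otimes>\<^sub>M (A' \<Otimes>\<^sub>M B')) (\<lambda>z. (?Z z, ?Z' z))"
  proof (rule pair_measure_eqI)
    show "sigma_finite_measure ?D" "sigma_finite_measure ?D'" ..
    show "sets (?D \<Otimes>\<^sub>M ?D') = sets (distr ?M ((A \<Otimes>\<^sub>M B) \<Otimes>\<^sub>M (A' \<Otimes>\<^sub>M B')) (\<lambda>z. (?Z z, ?Z' z)))"
      by (simp cong: sets_pair_measure_cong)
    fix E E' assume "E \<in> sets ?D" "E' \<in> sets ?D'"
    then have [measurable]: "E \<in> sets (A \<Otimes>\<^sub>M B)" "E' \<in> sets (A' \<Otimes>\<^sub>M B')" by auto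
    define \<alpha> where "\<alpha> x = (\<integral>\<^sup>+\<omega>. indicator E (x, Y \<omega>) \<partial>M2)" for x
    define \<alpha>' where "\<alpha>' x = (\<integral>\<^sup>+\<omega>. indicator E' (x, Y' \<omega>) \<partial>M2)" for x
    have [measurable]: "\<alpha> \<in> borel_measurable A" "\<alpha>' \<in> borel_measurable A'"
      unfolding \<alpha>_def \<alpha>'_def by measurable
    have e1: "emeasure ?D E = (\<integral>\<^sup>+x. \<alpha> (X x) \<partial>M1)"
    proof -
      have "emeasure ?D E = (\<integral>\<^sup>+z. indicator E z \<partial>?D)"
        by (rule nn_integral_indicator[symmetric]) simp
      also have "\<dots> = (\<integral>\<^sup>+z. indicator E (?Z z) \<partial>?M)"
        by (rule nn_integral_distr) measurable
      also have "\<dots> = (\<integral>\<^sup>+x. (\<integral>\<^sup>+\<omega>. indicator E (?Z (x, \<omega>)) \<partial>M2) \<partial>M1)"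
        by (rule M2.nn_integral_fst[symmetric]) measurable
      finally show ?thesis unfolding \<alpha>_def by simp
    qed
    have e2: "emeasure ?D' E' = (\<integral>\<^sup>+x. \<alpha>' (X' x) \<partial>M1)"
    proof -
      have "emeasure ?D' E' = (\<integral>\<^sup>+z. indicator E' z \<partial>?D')"
        by (rule nn_integral_indicator[symmetric]) simp
      also have "\<dots> = (\<integral>\<^sup>+z. indicator E' (?Z' z) \<partial>?M)"
        by (rule nn_integral_distr) measurable
      also have "\<dots> = (\<integral>\<^sup>+x. (\<integral>\<^sup>+\<omega>. indicator E' (?Z' (x, \<omega>)) \<partial>M2) \<partial>M1)"
        by (rule M2.nn_integral_fst[symmetric]) measurable
      finally show ?thesis unfolding \<alpha>'_def by simp
    qed
    have "emeasure (distr ?M ((A \<Otimes>\<^sub>M B) \<Otimes>\<^sub>M (A' \<Otimes>\<^sub>M B')) (\<lambda>z. (?Z z, ?Z' z))) (E \<times> E')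
        = (\<integral>\<^sup>+z. indicator (E \<times> E') z \<partial>distr ?M ((A \<Otimes>\<^sub>M B) \<Otimes>\<^sub>M (A' \<Otimes>\<^sub>M B')) (\<lambda>z. (?Z z, ?Z' z)))"
      by (rule nn_integral_indicator[symmetric]) simp
    also have "\<dots> = (\<integral>\<^sup>+z. indicator (E \<times> E') (?Z z, ?Z' z) \<partial>?M)"
      by (rule nn_integral_distr) measurable
    also have "\<dots> = (\<integral>\<^sup>+z. indicator E (?Z z) * indicator E' (?Z' z) \<partial>?M)"
      by (intro nn_integral_cong) (auto simp: indicator_def)
    also have "\<dots> = (\<integral>\<^sup>+x. (\<integral>\<^sup>+\<omega>. indicator E (?Z (x, \<omega>)) * indicator E' (?Z' (x, \<omega>)) \<partial>M2) \<partial>M1)"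
      by (rule M2.nn_integral_fst[symmetric]) measurable
    also have "\<dots> = (\<integral>\<^sup>+x. (\<integral>\<^sup>+\<omega>. indicator E (X x, Y \<omega>) * indicator E' (X' x, Y' \<omega>) \<partial>M2) \<partial>M1)"
      by simp
    also have "\<dots> = (\<integral>\<^sup>+x. \<alpha> (X x) * \<alpha>' (X' x) \<partial>M1)"
    proof (rule nn_integral_cong)
      fix x assume x: "x \<in> space M1"
      then have [simp]: "X x \<in> space A" "X' x \<in> space A'" by (auto intro: measurable_space[of _ M1])
      show "(\<integral>\<^sup>+\<omega>. indicator E (X x, Y \<omega>) * indicator E' (X' x, Y' \<omega>) \<partial>M2) = \<alpha> (X x) * \<alpha>' (X' x)"
        unfolding \<alpha>_def \<alpha>'_def by (rule M2.indep_var_nn_integral[OF Y]) measurable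
    qed
    also have "\<dots> = (\<integral>\<^sup>+x. \<alpha> (X x) \<partial>M1) * (\<integral>\<^sup>+x. \<alpha>' (X' x) \<partial>M1)"
      by (rule M1.indep_var_nn_integral[OF X]) measurable
    finally show "emeasure ?D E * emeasure ?D' E' = emeasure (distr ?M ((A \<Otimes>\<^sub>M B) \<Otimes>\<^sub>M (A' \<Otimes>\<^sub>M B')) (\<lambda>z. (?Z z, ?Z' z))) (E \<times> E')"
      unfolding e1 e2 by simp
  qed
  then show ?thesis by (subst indep_var_distribution_eq) measurable
qed

lemma distr_pair_components:
  assumes [measurable]: "X \<in> measurable M1 A" "Y \<in> measurable M2 B"
  shows "distr (M1 \<Otimes>\<^sub>M M2) (A \<Otimes>\<^sub>M B) (\<lambda>z. (X (fst z), Y (snd z))) = distr M1 A X \<Otimes>\<^sub>M distr M2 B Y"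
proof -
  interpret DY: prob_space "distr M2 B Y" by (rule M2.prob_space_distr) measurable
  show ?thesis by (subst pair_measure_distr) (auto simp: split_beta' DY.sigma_finite_measure)
qed

lemma integral_fst_times_snd:
  fixes f :: "_ \<Rightarrow> complex"
  assumes f: "integrable M1 f" and g: "integrable M2 g"
  shows "integrable (M1 \<Otimes>\<^sub>M M2) (\<lambda>z. f (fst z) * g (snd z))"
    "(\<integral>z. f (fst z) * g (snd z) \<partial>(M1 \<Otimes>\<^sub>M M2)) = (\<integral>x. f x \<partial>M1) * (\<integral>y. g y \<partial>M2)"
proof -
  have [measurable]: "f \<in> borel_measurable M1" "g \<in> borel_measurable M2" using f g by auto
  have i: "integrable (M1 \<Otimes>\<^sub>M M2) (case_prod (\<lambda>x y. f x * g y))"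
    unfolding split_beta'
  proof (rule Fubini_integrable)
    have "(\<lambda>x. \<integral>y. norm (f (fst (x, y)) * g (snd (x, y))) \<partial>M2) = (\<lambda>x. norm (f x) * (\<integral>y. norm (g y) \<partial>M2))"
      by (simp add: norm_mult)
    then show "integrable M1 (\<lambda>x. \<integral>y. norm (f (fst (x, y)) * g (snd (x, y))) \<partial>M2)" using f by simp
    show "AE x in M1. integrable M2 (\<lambda>y. f (fst (x, y)) * g (snd (x, y)))" using g by simp
  qed measurable
  then show "integrable (M1 \<Otimes>\<^sub>M M2) (\<lambda>z. f (fst z) * g (snd z))" by (simp add: split_beta')
  have "(\<integral>z. f (fst z) * g (snd z) \<partial>(M1 \<Otimes>\<^sub>M M2)) = (\<integral>x. (\<integral>y. f x * g y \<partial>M2) \<partial>M1)"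
    using integral_fst[OF i] by (simp add: split_beta')
  then show "(\<integral>z. f (fst z) * g (snd z) \<partial>(M1 \<Otimes>\<^sub>M M2)) = (\<integral>x. f x \<partial>M1) * (\<integral>y. g y \<partial>M2)"
    by simp
qed

end

section \<open>Random coding\<close>

text \<open>The probabilistic method: some outcome is at most the average. It extracts a
  deterministic code from a random one.\<close>

lemma (in prob_space) nn_integral_le_imp_ex:
  assumes [measurable]: "f \<in> borel_measurable M" and le: "(\<integral>\<^sup>+x. f x \<partial>M) \<le> ennreal c"
  shows "\<exists>x\<in>space M. f x \<le> ennreal c"
proof (rule ccontr)
  assume "\<not> ?thesis"
  then have gt: "\<And>x. x \<in> space M \<Longrightarrow> ennreal c < f x" by (auto simp: not_le)
  have "(\<integral>\<^sup>+x. ennreal c \<partial>M) < (\<integral>\<^sup>+x. f x \<partial>M)"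
  proof (rule nn_integral_less)
    show "AE x in M. ennreal c \<le> f x" using gt by (auto intro!: AE_I2 less_imp_le)
    show "\<not> (AE x in M. f x \<le> ennreal c)"
    proof
      assume "AE x in M. f x \<le> ennreal c"
      then have "AE x in M. False" using AE_space by eventually_elim (use gt in \<open>auto simp: not_le[symmetric]\<close>)
      then show False by simp
    qed
  qed (auto simp: emeasure_space_1)
  then show False using le by (simp add: emeasure_space_1 not_le[symmetric])
qed

lemma nn_integral_PiM_component:
  assumes "\<And>i. i \<in> I \<Longrightarrow> prob_space (M i)" and i: "i \<in> I" and [measurable]: "f \<in> borel_measurable (M i)"
  shows "(\<integral>\<^sup>+x. f (x i) \<partial>PiM I M) = (\<integral>\<^sup>+y. f y \<partial>M i)"
proof -
  have "(\<integral>\<^sup>+y. f y \<partial>M i) = (\<integral>\<^sup>+y. f y \<partial>distr (PiM I M) (M i) (\<lambda>\<omega>. \<omega> i))"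
    using distr_PiM_component[of I M i] assms by simp
  also have "\<dots> = (\<integral>\<^sup>+x. f (x i) \<partial>PiM I M)"
    using i by (intro nn_integral_distr) auto
  finally show ?thesis ..
qed

lemma nn_integral_PiM_two_components:
  assumes C: "prob_space C" and ij: "i \<in> I" "j \<in> I" "i \<noteq> j"
    and [measurable]: "case_prod g \<in> borel_measurable (C \<Otimes>\<^sub>M C)"
  shows "(\<integral>\<^sup>+x. g (x i) (x j) \<partial>PiM I (\<lambda>_. C)) = (\<integral>\<^sup>+x. \<integral>\<^sup>+y. g x y \<partial>C \<partial>C)"
proof -
  interpret C: prob_space C by fact
  interpret product_prob_space "\<lambda>_. C" I ..
  have "(\<integral>\<^sup>+x. g (x i) (x j) \<partial>PiM I (\<lambda>_. C)) = (\<integral>\<^sup>+x. g (restrict x {i, j} i) (restrict x {i, j} j) \<partial>PiM I (\<lambda>_. C))"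
    by simp
  also have "\<dots> = (\<integral>\<^sup>+x. g (x i) (x j) \<partial>distr (PiM I (\<lambda>_. C)) (PiM {i, j} (\<lambda>_. C)) (\<lambda>x. restrict x {i, j}))"
  proof (rule nn_integral_distr[symmetric, of "\<lambda>x. restrict x {i, j}" _ _ "\<lambda>x. g (x i) (x j)"])
    show "(\<lambda>x. restrict x {i, j}) \<in> measurable (PiM I (\<lambda>_. C)) (PiM {i, j} (\<lambda>_. C))"
      by (rule measurable_restrict_subset) (use ij in auto)
    have "(\<lambda>x. case_prod g (x i, x j)) \<in> borel_measurable (PiM {i, j} (\<lambda>_. C))" by measurable
    then show "(\<lambda>x. g (x i) (x j)) \<in> borel_measurable (distr (PiM I (\<lambda>_. C)) (PiM {i, j} (\<lambda>_. C)) (\<lambda>x. restrict x {i, j}))" by simp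
  qed
  also have "distr (PiM I (\<lambda>_. C)) (PiM {i, j} (\<lambda>_. C)) (\<lambda>x. restrict x {i, j}) = PiM {i, j} (\<lambda>_. C)"
    using ij by (intro distr_PiM_restrict_finite) auto
  also have "(\<integral>\<^sup>+x. g (x i) (x j) \<partial>PiM {i, j} (\<lambda>_. C)) = (\<integral>\<^sup>+z. g (fst z) (snd z) \<partial>(C \<Otimes>\<^sub>M C))"
    by (rule product_nn_integral_pair) (use ij in auto)
  also have "\<dots> = (\<integral>\<^sup>+x. \<integral>\<^sup>+y. g x y \<partial>C \<partial>C)"
    by (subst C.nn_integral_fst[symmetric]) (auto simp: split_beta')
  finally show ?thesis .
qed

text \<open>Markov's inequality for the uniform distribution on \<open>2 * m\<close> indices: more
  than \<open>m\<close> values above twice the mean bound would make the sum too large.\<close>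

lemma card_small_values_ge_half:
  fixes e :: "nat \<Rightarrow> ennreal"
  assumes k: "\<kappa> > 0" and le: "(\<Sum>i<2 * m. e i) \<le> ennreal (real (2 * m) * \<kappa>)"
  shows "m \<le> card {i. i < 2 * m \<and> e i \<le> ennreal (2 * \<kappa>)}"
proof (rule ccontr)
  let ?G = "{i. i < 2 * m \<and> e i \<le> ennreal (2 * \<kappa>)}" and ?B = "{i. i < 2 * m \<and> ennreal (2 * \<kappa>) < e i}"
  assume "\<not> m \<le> card ?G"
  moreover have "card ?G + card ?B = 2 * m"
  proof -
    have "card ?G + card ?B = card (?G \<union> ?B)"
      by (rule card_Un_disjoint[symmetric]) auto
    also have "?G \<union> ?B = {..<2 * m}" by auto
    finally show ?thesis by simp
  qed
  ultimately have B: "m < card ?B" by simp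
  have "ennreal (real (card ?B) * (2 * \<kappa>)) = (\<Sum>i\<in>?B. ennreal (2 * \<kappa>))"
    using k by (simp add: ennreal_mult ennreal_of_nat_eq_real_of_nat)
  also have "\<dots> \<le> (\<Sum>i\<in>?B. e i)" by (intro sum_mono) auto
  also have "\<dots> \<le> (\<Sum>i<2 * m. e i)" by (intro sum_mono2) auto
  also have "\<dots> \<le> ennreal (real (2 * m) * \<kappa>)" by (rule le)
  finally have "real (card ?B) * (2 * \<kappa>) \<le> real (2 * m) * \<kappa>"
    using k by (subst (asm) ennreal_le_iff) auto
  then have "real (card ?B) \<le> real m" using k by simp
  with B show False by simp
qed

text \<open>\<open>f x\<close> stands for the probability that \<open>x\<close> is rejected when
  sent, \<open>g x y\<close> for the probability that \<open>y\<close> is accepted when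
  \<open>x\<close> is sent. Random coding controls the average over the messages, while reliability
  is required for each of them. So \<open>2 * m\<close> codewords are drawn and \<open>m\<close>
  with at most twice the mean error are kept. Discarding the others removes terms from the remaining
  sums, so no error grows.\<close>

lemma expurgated_random_code:
  fixes f :: "'c \<Rightarrow> ennreal" and g :: "'c \<Rightarrow> 'c \<Rightarrow> ennreal"
  assumes C: "prob_space C"
    and [measurable]: "f \<in> borel_measurable C" "case_prod g \<in> borel_measurable (C \<Otimes>\<^sub>M C)"
    and f: "(\<integral>\<^sup>+x. f x \<partial>C) \<le> ennreal \<delta>" and g: "(\<integral>\<^sup>+x. \<integral>\<^sup>+y. g x y \<partial>C \<partial>C) \<le> ennreal q"
    and \<delta>: "0 \<le> \<delta>" and q: "0 < q" and m: "0 < m"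
  shows "\<exists>X. (\<forall>i<m. X i \<in> space C \<and>
     f (X i) + (\<Sum>j\<in>{..<m} - {i}. g (X i) (X j)) \<le> ennreal (2 * (\<delta> + real (2 * m) * q)))"
proof -
  interpret C: prob_space C by fact
  let ?W = "PiM {..<2 * m} (\<lambda>_. C)"
  interpret W: prob_space ?W by (rule prob_space_PiM) (rule C)
  define \<kappa> where "\<kappa> = \<delta> + real (2 * m) * q"
  have k: "\<kappa> > 0" unfolding \<kappa>_def using \<delta> q m by (intro add_nonneg_pos) auto
  define e where "e X i = f (X i) + (\<Sum>j\<in>{..<2 * m} - {i}. g (X i) (X j))" for X i
  have [measurable]: "(\<lambda>X. f (X i)) \<in> borel_measurable ?W" if "i \<in> {..<2 * m}" for i
    using that by measurable
  have [measurable]: "(\<lambda>X. g (X i) (X j)) \<in> borel_measurable ?W" if "i \<in> {..<2 * m}" "j \<in> {..<2 * m}" for i j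
  proof -
    have "(\<lambda>X. case_prod g (X i, X j)) \<in> borel_measurable ?W" using that by measurable
    then show ?thesis by simp
  qed
  have meas: "(\<lambda>X. \<Sum>i<2 * m. e X i) \<in> borel_measurable ?W"
    unfolding e_def by measurable
  have "(\<integral>\<^sup>+X. (\<Sum>i<2 * m. e X i) \<partial>?W)
     = (\<Sum>i<2 * m. (\<integral>\<^sup>+X. f (X i) \<partial>?W) + (\<Sum>j\<in>{..<2 * m} - {i}. \<integral>\<^sup>+X. g (X i) (X j) \<partial>?W))"
  proof -
    have "(\<integral>\<^sup>+X. (\<Sum>i<2 * m. e X i) \<partial>?W) = (\<Sum>i<2 * m. \<integral>\<^sup>+X. e X i \<partial>?W)"
      unfolding e_def by (rule nn_integral_sum) measurable
    also have "\<dots> = (\<Sum>i<2 * m. (\<integral>\<^sup>+X. f (X i) \<partial>?W) + (\<Sum>j\<in>{..<2 * m} - {i}. \<integral>\<^sup>+X. g (X i) (X j) \<partial>?W))"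
    proof (rule sum.cong[OF refl])
      fix i assume i: "i \<in> {..<2 * m}"
      have "(\<integral>\<^sup>+X. e X i \<partial>?W) = (\<integral>\<^sup>+X. f (X i) \<partial>?W) + (\<integral>\<^sup>+X. (\<Sum>j\<in>{..<2 * m} - {i}. g (X i) (X j)) \<partial>?W)"
        unfolding e_def using i by (intro nn_integral_add) measurable
      also have "(\<integral>\<^sup>+X. (\<Sum>j\<in>{..<2 * m} - {i}. g (X i) (X j)) \<partial>?W) = (\<Sum>j\<in>{..<2 * m} - {i}. \<integral>\<^sup>+X. g (X i) (X j) \<partial>?W)"
        using i by (intro nn_integral_sum) measurable
      finally show "(\<integral>\<^sup>+X. e X i \<partial>?W) = (\<integral>\<^sup>+X. f (X i) \<partial>?W) + (\<Sum>j\<in>{..<2 * m} - {i}. \<integral>\<^sup>+X. g (X i) (X j) \<partial>?W)" .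
    qed
    finally show ?thesis .
  qed
  also have "\<dots> \<le> (\<Sum>i<2 * m. ennreal \<delta> + (\<Sum>j\<in>{..<2 * m} - {i}. ennreal q))"
  proof (intro sum_mono add_mono)
    fix i assume i: "i \<in> {..<2 * m}"
    show "(\<integral>\<^sup>+X. f (X i) \<partial>?W) \<le> ennreal \<delta>"
      using f i by (subst nn_integral_PiM_component[where M="\<lambda>_. C"]) (auto intro: C)
    fix j assume j: "j \<in> {..<2 * m} - {i}"
    show "(\<integral>\<^sup>+X. g (X i) (X j) \<partial>?W) \<le> ennreal q"
      using g i j by (subst nn_integral_PiM_two_components[OF C]) auto
  qed
  also have "\<dots> \<le> (\<Sum>i<2 * m. ennreal \<kappa>)"
  proof (rule sum_mono)
    fix i assume i: "i \<in> {..<2 * m}"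
    have "(\<Sum>j\<in>{..<2 * m} - {i}. ennreal q) \<le> (\<Sum>j<2 * m. ennreal q)"
      by (intro sum_mono2) auto
    also have "\<dots> = ennreal (real (2 * m) * q)"
      using q by (simp add: ennreal_mult ennreal_of_nat_eq_real_of_nat flip: ennreal_numeral)
    finally have "ennreal \<delta> + (\<Sum>j\<in>{..<2 * m} - {i}. ennreal q) \<le> ennreal \<delta> + ennreal (real (2 * m) * q)"
      by (rule add_left_mono)
    also have "\<dots> = ennreal \<kappa>" unfolding \<kappa>_def using \<delta> q by (intro ennreal_plus[symmetric]) auto
    finally show "ennreal \<delta> + (\<Sum>j\<in>{..<2 * m} - {i}. ennreal q) \<le> ennreal \<kappa>" .
  qed
  also have "\<dots> = ennreal (real (2 * m) * \<kappa>)"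
    using k by (simp add: ennreal_mult ennreal_of_nat_eq_real_of_nat flip: ennreal_numeral)
  finally have "(\<integral>\<^sup>+X. (\<Sum>i<2 * m. e X i) \<partial>?W) \<le> ennreal (real (2 * m) * \<kappa>)" .
  from W.nn_integral_le_imp_ex[OF meas this] obtain X
    where X: "X \<in> space ?W" and sumX: "(\<Sum>i<2 * m. e X i) \<le> ennreal (real (2 * m) * \<kappa>)" by auto
  define A where "A = {i. i < 2 * m \<and> e X i \<le> ennreal (2 * \<kappa>)}"
  have A: "m \<le> card A" "finite A"
    unfolding A_def by (rule card_small_values_ge_half[OF k sumX]) simp
  obtain \<sigma> where \<sigma>: "bij_betw \<sigma> {0..<card A} A" using ex_bij_betw_nat_finite[OF A(2)] by auto
  have \<sigma>A: "\<sigma> i \<in> A" if "i < m" for i using \<sigma> that A(1) by (auto simp: bij_betw_def)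
  have inj: "inj_on \<sigma> {..<m}" using \<sigma> A(1) by (auto simp: bij_betw_def intro: inj_on_subset)
  show ?thesis
  proof (intro exI[of _ "\<lambda>i. X (\<sigma> i)"] allI impI conjI)
    fix i assume i: "i < m"
    show "X (\<sigma> i) \<in> space C" using X \<sigma>A[OF i] by (auto simp: space_PiM A_def PiE_def Pi_def)
    have "(\<Sum>j\<in>{..<m} - {i}. g (X (\<sigma> i)) (X (\<sigma> j))) = (\<Sum>j\<in>\<sigma> ` ({..<m} - {i}). g (X (\<sigma> i)) (X j))"
      by (subst sum.reindex) (auto intro: inj_on_subset[OF inj])
    also have "\<dots> \<le> (\<Sum>j\<in>{..<2 * m} - {\<sigma> i}. g (X (\<sigma> i)) (X j))"
    proof (rule sum_mono2)
      show "\<sigma> ` ({..<m} - {i}) \<subseteq> {..<2 * m} - {\<sigma> i}"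
        using \<sigma>A inj i by (auto simp: A_def inj_on_def)
    qed auto
    finally have "f (X (\<sigma> i)) + (\<Sum>j\<in>{..<m} - {i}. g (X (\<sigma> i)) (X (\<sigma> j))) \<le> e X (\<sigma> i)"
      unfolding e_def by (rule add_left_mono)
    also have "\<dots> \<le> ennreal (2 * \<kappa>)" using \<sigma>A[OF i] by (simp add: A_def)
    finally show "f (X (\<sigma> i)) + (\<Sum>j\<in>{..<m} - {i}. g (X (\<sigma> i)) (X (\<sigma> j))) \<le> ennreal (2 * (\<delta> + real (2 * m) * q))"
      unfolding \<kappa>_def .
  qed
qed

section \<open>Block fading channels\<close>

lemma measurable_cgauss [simp]:
  "measurable (cgauss v) N = measurable borel N" "measurable N (cgauss v) = measurable N borel"
  by (simp_all cong: measurable_cong_sets)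

text \<open>The law of one random codeword. Indexed by all pairs of interval and symbol, it serves
  every block length at once, and its intervals form a single sequence to which the weak law
  applies.\<close>

abbreviation gauss_codebook :: "(nat \<times> nat \<Rightarrow> complex) measure" where
  "gauss_codebook \<equiv> \<Pi>\<^sub>M p\<in>UNIV. cgauss 1"

lemma prob_space_gauss_codebook: "prob_space gauss_codebook"
  by (rule prob_space_PiM) (simp add: prob_space_cgauss)

lemma measurable_codebook_component [measurable]: "(\<lambda>x. x p) \<in> borel_measurable gauss_codebook"
proof -
  have "(\<lambda>x. x p) \<in> measurable gauss_codebook (cgauss 1)" by (rule measurable_component_singleton) simp
  then show ?thesis by (subst (asm) measurable_cong_sets[OF refl sets_cgauss])
qed

lemma gauss_codebook_component_moments:
  shows "integrable gauss_codebook (\<lambda>x. x p)" "(\<integral>x. x p \<partial>gauss_codebook) = 0"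
    "integrable gauss_codebook (\<lambda>x. cnj (x p))" "(\<integral>x. cnj (x p) \<partial>gauss_codebook) = 0"
    "integrable gauss_codebook (\<lambda>x. x p * cnj (x p))" "(\<integral>x. x p * cnj (x p) \<partial>gauss_codebook) = 1"
proof -
  have d: "distr gauss_codebook (cgauss 1) (\<lambda>x. x p) = cgauss 1"
    by (rule distr_PiM_component) (auto simp: prob_space_cgauss)
  have m: "(\<lambda>x. x p) \<in> measurable gauss_codebook (cgauss 1)" by (rule measurable_component_singleton) simp
  have tr: "integrable gauss_codebook (\<lambda>x. \<phi> (x p)) = integrable (cgauss 1) \<phi>"
    "(\<integral>x. \<phi> (x p) \<partial>gauss_codebook) = (\<integral>z. \<phi> z \<partial>cgauss 1)"
    if "\<phi> \<in> borel_measurable borel" for \<phi> :: "complex \<Rightarrow> complex"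
  proof -
    have [measurable]: "\<phi> \<in> borel_measurable (cgauss 1)"
      using that by simp
    show "integrable gauss_codebook (\<lambda>x. \<phi> (x p)) = integrable (cgauss 1) \<phi>"
      using integrable_distr_eq[OF m, of \<phi>] by (simp add: d)
    show "(\<integral>x. \<phi> (x p) \<partial>gauss_codebook) = (\<integral>z. \<phi> z \<partial>cgauss 1)"
      using integral_distr[OF m, of \<phi>] by (simp add: d)
  qed
  have eq: "(\<lambda>z. z * cnj z) = (\<lambda>z. complex_of_real ((cmod z)\<^sup>2))"
    by (rule ext) (rule complex_norm_square[symmetric])
  have one: "0 < (1::real)" by simp
  have i1: "integrable (cgauss 1) (\<lambda>z. z)" and e1: "(\<integral>z. z \<partial>cgauss 1) = 0"
    by (rule cgauss_mean[OF one])+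
  have i2: "integrable (cgauss 1) cnj" by (rule integrable_cnj[OF i1])
  have e2: "(\<integral>z. cnj z \<partial>cgauss 1) = 0"
    unfolding Bochner_Integration.integral_cnj[of "cgauss 1" "\<lambda>z. z"] e1 by (rule complex_cnj_zero)
  show "integrable gauss_codebook (\<lambda>x. x p)" by (rule tr(1)[of "\<lambda>z. z", THEN iffD2, OF _ i1]) measurable
  show "(\<integral>x. x p \<partial>gauss_codebook) = 0" by (rule trans[OF tr(2)[of "\<lambda>z. z"] e1]) measurable
  show "integrable gauss_codebook (\<lambda>x. cnj (x p))" by (rule tr(1)[of cnj, THEN iffD2, OF _ i2]) measurable
  show "(\<integral>x. cnj (x p) \<partial>gauss_codebook) = 0" by (rule trans[OF tr(2)[of cnj] e2]) measurable
  have i3: "integrable (cgauss 1) (\<lambda>z. z * cnj z)"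
    unfolding eq by (rule integrable_of_real[OF cgauss_second_moment(1)[OF one]])
  have e3: "(\<integral>z. z * cnj z \<partial>cgauss 1) = 1"
    unfolding eq integral_complex_of_real cgauss_second_moment(2)[OF one] by (rule of_real_1)
  show "integrable gauss_codebook (\<lambda>x. x p * cnj (x p))"
    by (rule tr(1)[of "\<lambda>z. z * cnj z", THEN iffD2, OF _ i3]) measurable
  show "(\<integral>x. x p * cnj (x p) \<partial>gauss_codebook) = 1"
    by (rule trans[OF tr(2)[of "\<lambda>z. z * cnj z"] e3]) measurable
qed

definition codebook_row :: "nat \<Rightarrow> nat \<Rightarrow> (nat \<times> nat \<Rightarrow> complex) \<Rightarrow> nat \<Rightarrow> complex" where
  "codebook_row L b x = (\<lambda>t\<in>{..<L}. x (b, t))"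

lemma measurable_codebook_row [measurable]:
  "codebook_row L b \<in> measurable gauss_codebook (\<Pi>\<^sub>M t\<in>{..<L}. cgauss 1)"
  unfolding codebook_row_def by (intro measurable_restrict measurable_component_singleton) simp

lemma distr_codebook_row:
  "distr gauss_codebook (\<Pi>\<^sub>M t\<in>{..<L}. cgauss 1) (codebook_row L b) = (\<Pi>\<^sub>M t\<in>{..<L}. cgauss 1)"
  unfolding codebook_row_def
  using distr_PiM_reindex[of UNIV "\<lambda>_. cgauss 1" "\<lambda>t. (b, t)" "{..<L}"]
  by (simp add: prob_space_cgauss inj_on_def)

lemma indep_codebook_rows:
  assumes "b \<noteq> b'"
  shows "prob_space.indep_var gauss_codebook (\<Pi>\<^sub>M t\<in>{..<L}. cgauss 1) (codebook_row L b)
           (\<Pi>\<^sub>M t\<in>{..<L}. cgauss 1) (codebook_row L b')"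
proof -
  interpret prob_space gauss_codebook by (rule prob_space_gauss_codebook)
  have "indep_vars (\<lambda>_. cgauss 1) (\<lambda>p x. x p) UNIV"
  proof (subst indep_vars_iff_distr_eq_PiM)
    have "distr gauss_codebook gauss_codebook (\<lambda>x. \<lambda>p\<in>UNIV. x p) = gauss_codebook"
      by (simp add: restrict_UNIV distr_id)
    also have "\<dots> = (\<Pi>\<^sub>M p\<in>UNIV. distr gauss_codebook (cgauss 1) (\<lambda>x. x p))"
      by (intro PiM_cong refl distr_PiM_component[symmetric]) (auto simp: prob_space_cgauss)
    finally show "distr gauss_codebook gauss_codebook (\<lambda>x. \<lambda>p\<in>UNIV. x p) = (\<Pi>\<^sub>M p\<in>UNIV. distr gauss_codebook (cgauss 1) (\<lambda>x. x p))" .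
  qed auto
  from indep_var_restrict[OF this, of "{b} \<times> {..<L}" "{b'} \<times> {..<L}"] assms
  have "indep_var (PiM ({b} \<times> {..<L}) (\<lambda>_. cgauss 1)) (\<lambda>x. restrict (\<lambda>p. x p) ({b} \<times> {..<L}))
      (PiM ({b'} \<times> {..<L}) (\<lambda>_. cgauss 1)) (\<lambda>x. restrict (\<lambda>p. x p) ({b'} \<times> {..<L}))"
    by auto
  from indep_var_compose[OF this, of "\<lambda>x. \<lambda>t\<in>{..<L}. x (b, t)" "\<Pi>\<^sub>M t\<in>{..<L}. cgauss 1"
      "\<lambda>x. \<lambda>t\<in>{..<L}. x (b', t)" "\<Pi>\<^sub>M t\<in>{..<L}. cgauss 1"]
  have "indep_var (\<Pi>\<^sub>M t\<in>{..<L}. cgauss 1) ((\<lambda>x. \<lambda>t\<in>{..<L}. x (b, t)) \<circ> (\<lambda>x. restrict (\<lambda>p. x p) ({b} \<times> {..<L})))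
     (\<Pi>\<^sub>M t\<in>{..<L}. cgauss 1) ((\<lambda>x. \<lambda>t\<in>{..<L}. x (b', t)) \<circ> (\<lambda>x. restrict (\<lambda>p. x p) ({b'} \<times> {..<L})))"
    by (auto intro!: measurable_restrict measurable_component_singleton)
  moreover have "(\<lambda>x. \<lambda>t\<in>{..<L}. x (c, t)) \<circ> (\<lambda>x. restrict (\<lambda>p. x p) ({c} \<times> {..<L})) = codebook_row L c" for c
    by (auto simp: codebook_row_def fun_eq_iff)
  ultimately show ?thesis by simp
qed

text \<open>\<open>S b\<close> is everything random in interval \<open>b\<close>, \<open>h\<close>
  the gain common to its \<open>L\<close> symbols and \<open>u t\<close> the remaining disturbance
  at symbol \<open>t\<close>. Independence is assumed between intervals only: inside one, the gain
  and all disturbances may depend on each other. Second moments must suffice, no shape of the laws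
  being given.\<close>

locale block_fading_channel = prob_space P
  for P :: "'w measure" and Q :: "'s measure" and S :: "nat \<Rightarrow> 'w \<Rightarrow> 's"
    and h :: "'s \<Rightarrow> complex" and u :: "nat \<Rightarrow> 's \<Rightarrow> complex" and L :: nat +
  assumes L_pos: "L > 0"
    and indep_blocks: "indep_vars (\<lambda>_. Q) S UNIV"
    and ident_blocks: "\<And>b. distr P Q (S b) = distr P Q (S 0)"
    and h_measurable [measurable]: "h \<in> borel_measurable Q"
    and u_measurable [measurable]: "\<And>t. u t \<in> borel_measurable Q"
    and h_square: "integrable P (\<lambda>\<omega>. (cmod (h (S 0 \<omega>)))\<^sup>2)"
    and u_square: "\<And>t. integrable P (\<lambda>\<omega>. (cmod (u t (S 0 \<omega>)))\<^sup>2)"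
begin

abbreviation "joint \<equiv> gauss_codebook \<Otimes>\<^sub>M P"

sublocale CP: pair_prob_space gauss_codebook P
  by (intro pair_prob_space.intro pair_sigma_finite.intro prob_space_imp_sigma_finite
      prob_space_gauss_codebook prob_space_axioms)

lemma S_measurable [measurable]: "S b \<in> measurable P Q"
  using indep_blocks by (auto simp: indep_vars_def)

definition stat :: "((nat \<Rightarrow> complex) \<Rightarrow> 's \<Rightarrow> real) \<Rightarrow> nat \<Rightarrow> (nat \<times> nat \<Rightarrow> complex) \<times> 'w \<Rightarrow> real" where
  "stat F b z = F (codebook_row L b (fst z)) (S b (snd z))"

text \<open>Row \<open>b\<close> of the codeword together with state \<open>b\<close> has a law that
  is the same for all \<open>b\<close>, and distinct \<open>b\<close> give independent pairs; so any
  integrable function of such a pair obeys the weak law on the joint space.\<close>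

lemma stat_weak_law:
  assumes F: "case_prod F \<in> borel_measurable ((\<Pi>\<^sub>M t\<in>{..<L}. cgauss 1) \<Otimes>\<^sub>M Q)"
    and int: "integrable joint (stat F 0)" and e: "\<epsilon> > 0"
  shows "(\<lambda>n. measure joint {z \<in> space joint. \<epsilon> * real n < \<bar>(\<Sum>b<n. stat F b z) - real n * (\<integral>z. stat F 0 z \<partial>joint)\<bar>}) \<longlonglongrightarrow> 0"
proof (rule CP.weak_law_pairwise_indep[where Z="stat F", OF int _ _ e])
  let ?R = "\<Pi>\<^sub>M t\<in>{..<L}. cgauss 1"
  let ?Z = "\<lambda>b z. (codebook_row L b (fst z), S b (snd z))"
  have stat_eq: "stat F b = case_prod F \<circ> ?Z b" for b by (auto simp: stat_def fun_eq_iff)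
  have Zm: "?Z b \<in> measurable joint (?R \<Otimes>\<^sub>M Q)" for b by measurable
  show "distr joint borel (stat F b) = distr joint borel (stat F 0)" for b
  proof -
    have "distr joint borel (stat F b) = distr (distr joint (?R \<Otimes>\<^sub>M Q) (?Z b)) borel (case_prod F)" for b
      unfolding stat_eq by (rule distr_distr[symmetric, OF F Zm])
    moreover have "distr joint (?R \<Otimes>\<^sub>M Q) (?Z b) = distr joint (?R \<Otimes>\<^sub>M Q) (?Z 0)"
      by (simp add: CP.distr_pair_components distr_codebook_row ident_blocks[of b])
    ultimately show ?thesis by simp
  qed
  fix b b' :: nat assume bb: "b \<noteq> b'"
  have "indep_var Q ((\<lambda>f. f b) \<circ> (\<lambda>\<omega>. \<lambda>i\<in>{b}. S i \<omega>)) Q ((\<lambda>f. f b') \<circ> (\<lambda>\<omega>. \<lambda>i\<in>{b'}. S i \<omega>))"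
    by (rule indep_var_compose[OF indep_var_restrict[OF indep_blocks, of "{b}" "{b'}"]])
       (use bb in \<open>auto intro!: measurable_component_singleton\<close>)
  then have "indep_var Q (S b) Q (S b')" by (simp add: comp_def)
  from CP.indep_var_pair[OF indep_codebook_rows[OF bb] this]
  have "indep_var_joint": "CP.indep_var (?R \<Otimes>\<^sub>M Q) (?Z b) (?R \<Otimes>\<^sub>M Q) (?Z b')" .
  from CP.indep_var_compose[OF this F F]
  show "CP.indep_var borel (stat F b) borel (stat F b')" by (simp only: stat_eq)
qed

text \<open>The real part is what bounds the modulus of a correlation from below.
  \<open>noise_power\<close> is a sum over the \<open>L\<close> symbols of an interval and is
  divided by \<open>L\<close> wherever a power per symbol is meant.\<close>

definition "mean_gain = Re (expectation (\<lambda>\<omega>. h (S 0 \<omega>)))"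
definition "gain_power = expectation (\<lambda>\<omega>. (cmod (h (S 0 \<omega>)))\<^sup>2)"
definition "noise_power = (\<Sum>t<L. expectation (\<lambda>\<omega>. (cmod (u t (S 0 \<omega>)))\<^sup>2))"

text \<open>These statistics refer to the Gaussian codeword before normalisation, since
  normalisation would couple all intervals and destroy their independence. The last one, the energy
  of \<open>h x\<close>, measures how far normalisation perturbs the output.\<close>

definition corr_stat :: "(nat \<Rightarrow> complex) \<Rightarrow> 's \<Rightarrow> real" where
  "corr_stat r s = Re (\<Sum>t<L. cnj (h s * r t + u t s) * r t)"
definition output_stat :: "(nat \<Rightarrow> complex) \<Rightarrow> 's \<Rightarrow> real" where
  "output_stat r s = (\<Sum>t<L. (cmod (h s * r t + u t s))\<^sup>2)"
definition input_stat :: "(nat \<Rightarrow> complex) \<Rightarrow> 's \<Rightarrow> real" where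
  "input_stat r s = (\<Sum>t<L. (cmod (r t))\<^sup>2)"
definition signal_stat :: "(nat \<Rightarrow> complex) \<Rightarrow> 's \<Rightarrow> real" where
  "signal_stat r s = (\<Sum>t<L. (cmod (h s * r t))\<^sup>2)"

lemma stats_measurable:
  "case_prod corr_stat \<in> borel_measurable ((\<Pi>\<^sub>M t\<in>{..<L}. cgauss 1) \<Otimes>\<^sub>M Q)"
  "case_prod output_stat \<in> borel_measurable ((\<Pi>\<^sub>M t\<in>{..<L}. cgauss 1) \<Otimes>\<^sub>M Q)"
  "case_prod input_stat \<in> borel_measurable ((\<Pi>\<^sub>M t\<in>{..<L}. cgauss 1) \<Otimes>\<^sub>M Q)"
  "case_prod signal_stat \<in> borel_measurable ((\<Pi>\<^sub>M t\<in>{..<L}. cgauss 1) \<Otimes>\<^sub>M Q)"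
  unfolding corr_stat_def output_stat_def input_stat_def signal_stat_def split_beta' by measurable

lemma input_moments:
  shows "integrable P (\<lambda>\<omega>. h (S 0 \<omega>))" "integrable P (\<lambda>\<omega>. u t (S 0 \<omega>))"
    "integrable P (\<lambda>\<omega>. h (S 0 \<omega>) * cnj (h (S 0 \<omega>)))" "integrable P (\<lambda>\<omega>. u t (S 0 \<omega>) * cnj (u t (S 0 \<omega>)))"
    "integrable P (\<lambda>\<omega>. h (S 0 \<omega>) * cnj (u t (S 0 \<omega>)))" "integrable P (\<lambda>\<omega>. cnj (h (S 0 \<omega>)) * u t (S 0 \<omega>))"
proof -
  have hc: "integrable P (\<lambda>\<omega>. (cmod (cnj (h (S 0 \<omega>))))\<^sup>2)" and uc: "integrable P (\<lambda>\<omega>. (cmod (cnj (u t (S 0 \<omega>))))\<^sup>2)"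
    using h_square u_square[of t] by simp_all
  show "integrable P (\<lambda>\<omega>. h (S 0 \<omega>))" "integrable P (\<lambda>\<omega>. u t (S 0 \<omega>))"
    by (rule square_integrable_imp_integrable_complex, measurable, rule h_square u_square)+
  show "integrable P (\<lambda>\<omega>. h (S 0 \<omega>) * cnj (h (S 0 \<omega>)))" by (rule integrable_mult_complex[OF _ _ h_square hc]) measurable
  show "integrable P (\<lambda>\<omega>. u t (S 0 \<omega>) * cnj (u t (S 0 \<omega>)))" by (rule integrable_mult_complex[OF _ _ u_square uc]) measurable
  show "integrable P (\<lambda>\<omega>. h (S 0 \<omega>) * cnj (u t (S 0 \<omega>)))" by (rule integrable_mult_complex[OF _ _ h_square uc]) measurable
  show "integrable P (\<lambda>\<omega>. cnj (h (S 0 \<omega>)) * u t (S 0 \<omega>))" by (rule integrable_mult_complex[OF _ _ hc u_square]) measurable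
qed

lemma expectation_mult_cnj: "expectation (\<lambda>\<omega>. f \<omega> * cnj (f \<omega>)) = complex_of_real (expectation (\<lambda>\<omega>. (cmod (f \<omega>))\<^sup>2))"
  unfolding complex_norm_square[symmetric] by (rule integral_complex_of_real)

lemma cmod_square_eq_Re: "(cmod w)\<^sup>2 = Re (w * cnj w)"
  unfolding complex_norm_square[symmetric] by (rule Re_complex_of_real[symmetric])

text \<open>The expectation factors because codeword and channel lie on different factors of
  \<open>joint\<close>. A term linear in the centred codeword vanishes, and this disposes of the
  dependence between \<open>h\<close> and \<open>u\<close> here and in the output energy
  below.\<close>

lemma corr_stat_mean:
  "integrable joint (stat corr_stat 0)" "(\<integral>z. stat corr_stat 0 z \<partial>joint) = real L * mean_gain"
proof -
  let ?f = "\<lambda>t z. (fst z (0, t) * cnj (fst z (0, t))) * cnj (h (S 0 (snd z))) + fst z (0, t) * cnj (u t (S 0 (snd z)))"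
  have eq: "stat corr_stat 0 = (\<lambda>z. Re (\<Sum>t<L. ?f t z))"
    unfolding stat_def corr_stat_def codebook_row_def by (rule ext, rule arg_cong[of _ _ Re], rule sum.cong) (auto simp: algebra_simps)
  note cm = gauss_codebook_component_moments
  note A = CP.integral_fst_times_snd[OF cm(5) integrable_cnj[OF input_moments(1)]]
  note B = CP.integral_fst_times_snd[OF cm(1) integrable_cnj[OF input_moments(2)]]
  have i: "integrable joint (?f t)" for t by (intro Bochner_Integration.integrable_add A(1) B(1))
  have e: "(\<integral>z. ?f t z \<partial>joint) = cnj (expectation (\<lambda>\<omega>. h (S 0 \<omega>)))" for t
    unfolding Bochner_Integration.integral_add[OF A(1) B(1)] A(2) B(2) cm by simp
  have I: "integrable joint (\<lambda>z. \<Sum>t<L. ?f t z)" by (rule Bochner_Integration.integrable_sum[OF i])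
  show "integrable joint (stat corr_stat 0)" unfolding eq by (rule integrable_Re[OF I])
  have "(\<integral>z. stat corr_stat 0 z \<partial>joint) = Re (\<Sum>t<L. \<integral>z. ?f t z \<partial>joint)"
    unfolding eq integral_Re[OF I] Bochner_Integration.integral_sum[OF i] ..
  then show "(\<integral>z. stat corr_stat 0 z \<partial>joint) = real L * mean_gain" by (simp add: e mean_gain_def)
qed

lemma output_stat_mean:
  "integrable joint (stat output_stat 0)" "(\<integral>z. stat output_stat 0 z \<partial>joint) = real L * gain_power + noise_power"
proof -
  let ?f = "\<lambda>t z. ((fst z (0, t) * cnj (fst z (0, t))) * (h (S 0 (snd z)) * cnj (h (S 0 (snd z))))
      + fst z (0, t) * (h (S 0 (snd z)) * cnj (u t (S 0 (snd z)))))
      + (cnj (fst z (0, t)) * (cnj (h (S 0 (snd z))) * u t (S 0 (snd z))) + 1 * (u t (S 0 (snd z)) * cnj (u t (S 0 (snd z)))))"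
  have eq: "stat output_stat 0 = (\<lambda>z. Re (\<Sum>t<L. ?f t z))"
    unfolding stat_def output_stat_def codebook_row_def cmod_square_eq_Re Re_sum[symmetric]
    by (rule ext, rule arg_cong[of _ _ Re], rule sum.cong) (auto simp: algebra_simps)
  note cm = gauss_codebook_component_moments
  have one: "integrable gauss_codebook (\<lambda>x. 1 :: complex)" "(\<integral>x. 1 \<partial>gauss_codebook) = (1 :: complex)"
    using CP.M1.prob_space by auto
  note A = CP.integral_fst_times_snd[OF cm(5) input_moments(3)]
  note B = CP.integral_fst_times_snd[OF cm(1) input_moments(5)]
  note C = CP.integral_fst_times_snd[OF cm(3) input_moments(6)]
  note D = CP.integral_fst_times_snd[OF one(1) input_moments(4)]
  have i: "integrable joint (?f t)" for t by (intro Bochner_Integration.integrable_add A(1) B(1) C(1) D(1))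
  have e: "(\<integral>z. ?f t z \<partial>joint) = complex_of_real (gain_power + expectation (\<lambda>\<omega>. (cmod (u t (S 0 \<omega>)))\<^sup>2))" for t
    unfolding Bochner_Integration.integral_add[OF Bochner_Integration.integrable_add[OF A(1) B(1)] Bochner_Integration.integrable_add[OF C(1) D(1)]]
      Bochner_Integration.integral_add[OF A(1) B(1)]
      Bochner_Integration.integral_add[OF C(1) D(1)] A(2) B(2) C(2) D(2) cm one expectation_mult_cnj gain_power_def by simp
  have I: "integrable joint (\<lambda>z. \<Sum>t<L. ?f t z)" by (rule Bochner_Integration.integrable_sum[OF i])
  show "integrable joint (stat output_stat 0)" unfolding eq by (rule integrable_Re[OF I])
  have "(\<integral>z. stat output_stat 0 z \<partial>joint) = Re (\<Sum>t<L. \<integral>z. ?f t z \<partial>joint)"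
    unfolding eq integral_Re[OF I] Bochner_Integration.integral_sum[OF i] ..
  then show "(\<integral>z. stat output_stat 0 z \<partial>joint) = real L * gain_power + noise_power"
    unfolding e by (simp add: noise_power_def sum.distrib)
qed

lemma input_stat_mean:
  "integrable joint (stat input_stat 0)" "(\<integral>z. stat input_stat 0 z \<partial>joint) = real L"
proof -
  let ?f = "\<lambda>t z. (fst z (0, t) * cnj (fst z (0, t))) * 1"
  have eq: "stat input_stat 0 = (\<lambda>z. Re (\<Sum>t<L. ?f t z))"
    unfolding stat_def input_stat_def codebook_row_def cmod_square_eq_Re Re_sum[symmetric]
    by (rule ext, rule arg_cong[of _ _ Re], rule sum.cong) auto
  note cm = gauss_codebook_component_moments
  have one: "integrable P (\<lambda>x. 1 :: complex)" "(\<integral>x. 1 \<partial>P) = (1 :: complex)"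
    using prob_space by auto
  note A = CP.integral_fst_times_snd[OF cm(5) one(1)]
  have I: "integrable joint (\<lambda>z. \<Sum>t<L. ?f t z)" by (intro Bochner_Integration.integrable_sum A(1))
  show "integrable joint (stat input_stat 0)" unfolding eq by (rule integrable_Re[OF I])
  have "(\<integral>z. stat input_stat 0 z \<partial>joint) = Re (\<Sum>t<L. \<integral>z. ?f t z \<partial>joint)"
    unfolding eq integral_Re[OF I] by (subst Bochner_Integration.integral_sum) (auto intro: A(1) simp only:)
  then show "(\<integral>z. stat input_stat 0 z \<partial>joint) = real L"
    unfolding A(2) cm one by simp
qed

lemma signal_stat_mean:
  "integrable joint (stat signal_stat 0)" "(\<integral>z. stat signal_stat 0 z \<partial>joint) = real L * gain_power"
proof -
  let ?f = "\<lambda>t z. (fst z (0, t) * cnj (fst z (0, t))) * (h (S 0 (snd z)) * cnj (h (S 0 (snd z))))"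
  have eq: "stat signal_stat 0 = (\<lambda>z. Re (\<Sum>t<L. ?f t z))"
    unfolding stat_def signal_stat_def codebook_row_def cmod_square_eq_Re Re_sum[symmetric]
    by (rule ext, rule arg_cong[of _ _ Re], rule sum.cong) (auto simp: algebra_simps)
  note cm = gauss_codebook_component_moments
  note A = CP.integral_fst_times_snd[OF cm(5) input_moments(3)]
  have I: "integrable joint (\<lambda>z. \<Sum>t<L. ?f t z)" by (intro Bochner_Integration.integrable_sum A(1))
  show "integrable joint (stat signal_stat 0)" unfolding eq by (rule integrable_Re[OF I])
  have "(\<integral>z. stat signal_stat 0 z \<partial>joint) = Re (\<Sum>t<L. \<integral>z. ?f t z \<partial>joint)"
    unfolding eq integral_Re[OF I] by (subst Bochner_Integration.integral_sum) (auto intro: A(1) simp only:)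
  then show "(\<integral>z. stat signal_stat 0 z \<partial>joint) = real L * gain_power"
    unfolding A(2) cm expectation_mult_cnj gain_power_def by simp
qed

end

section \<open>The acceptance test for the transmitted codeword\<close>

text \<open>\<open>y\<close> is the output for the raw Gaussian codeword \<open>x\<close>,
  \<open>w\<close> is \<open>h x\<close>, and \<open>y + \<rho> * w\<close> is the output once the
  codeword is scaled by \<open>1 + \<rho>\<close>. Cauchy-Schwarz and the triangle inequality reduce
  the test to four averages whose limits are known.\<close>

lemma correlation_dominates:
  fixes x y w :: "'i \<Rightarrow> complex" and \<rho> t n :: real and I :: "'i set"
  assumes n: "n > 0" and t: "t \<ge> 0"
  defines "s1 \<equiv> (\<Sum>p\<in>I. (cmod (x p))\<^sup>2) / n" and "s2 \<equiv> Re (\<Sum>p\<in>I. cnj (y p) * x p) / n"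
    and "s3 \<equiv> (\<Sum>p\<in>I. (cmod (y p))\<^sup>2) / n" and "s4 \<equiv> (\<Sum>p\<in>I. (cmod (w p))\<^sup>2) / n"
  assumes less: "t * (sqrt s3 + \<bar>\<rho>\<bar> * sqrt s4) * sqrt s1 < s2 - \<bar>\<rho>\<bar> * (sqrt s4 * sqrt s1)"
  shows "t\<^sup>2 * (\<Sum>p\<in>I. (cmod (y p + \<rho> * w p))\<^sup>2) * (\<Sum>p\<in>I. (cmod (x p))\<^sup>2)
      < (cmod (\<Sum>p\<in>I. cnj (y p + \<rho> * w p) * x p))\<^sup>2"
proof -
  define nx ny nw nz where "nx = L2_set (\<lambda>p. cmod (x p)) I" and "ny = L2_set (\<lambda>p. cmod (y p)) I"
    and "nw = L2_set (\<lambda>p. cmod (w p)) I" and "nz = L2_set (\<lambda>p. cmod (y p + \<rho> * w p)) I"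
  have nn: "0 \<le> nx" "0 \<le> ny" "0 \<le> nw" "0 \<le> nz" by (simp_all add: nx_def ny_def nw_def nz_def)
  have s: "sqrt s1 = nx / sqrt n" "sqrt s3 = ny / sqrt n" "sqrt s4 = nw / sqrt n"
    by (simp_all add: s1_def s3_def s4_def nx_def ny_def nw_def L2_set_def real_sqrt_divide)
  have nz: "nz \<le> ny + \<bar>\<rho>\<bar> * nw"
  proof -
    have "nz \<le> L2_set (\<lambda>p. cmod (y p) + \<bar>\<rho>\<bar> * cmod (w p)) I"
      unfolding nz_def by (intro L2_set_mono) (auto intro: order.trans[OF norm_triangle_ineq] simp: norm_mult)
    also have "\<dots> \<le> L2_set (\<lambda>p. cmod (y p)) I + L2_set (\<lambda>p. \<bar>\<rho>\<bar> * cmod (w p)) I"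
      by (rule L2_set_triangle_ineq)
    also have "L2_set (\<lambda>p. \<bar>\<rho>\<bar> * cmod (w p)) I = \<bar>\<rho>\<bar> * nw"
      unfolding nw_def by (rule L2_set_right_distrib[symmetric]) simp
    finally show ?thesis by (simp add: ny_def)
  qed
  have wx: "cmod (\<Sum>p\<in>I. cnj (w p) * x p) \<le> nw * nx"
  proof -
    have "cmod (\<Sum>p\<in>I. cnj (w p) * x p) \<le> (\<Sum>p\<in>I. \<bar>cmod (w p)\<bar> * \<bar>cmod (x p)\<bar>)"
      by (rule order.trans[OF norm_sum]) (simp add: norm_mult)
    also have "\<dots> \<le> nw * nx" unfolding nw_def nx_def by (rule L2_set_mult_ineq)
    finally show ?thesis .
  qed
  have "n * s2 - \<bar>\<rho>\<bar> * (nw * nx) \<le> Re (\<Sum>p\<in>I. cnj (y p + \<rho> * w p) * x p)"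
  proof -
    have "Re (\<Sum>p\<in>I. cnj (y p + \<rho> * w p) * x p) = n * s2 + \<rho> * Re (\<Sum>p\<in>I. cnj (w p) * x p)"
    proof -
      have "(\<Sum>p\<in>I. cnj (y p + \<rho> * w p) * x p) = (\<Sum>p\<in>I. cnj (y p) * x p) + complex_of_real \<rho> * (\<Sum>p\<in>I. cnj (w p) * x p)"
        unfolding sum_distrib_left sum.distrib[symmetric] by (simp add: algebra_simps)
      moreover have "n * s2 = Re (\<Sum>p\<in>I. cnj (y p) * x p)" using n by (simp add: s2_def)
      ultimately show ?thesis by simp
    qed
    moreover have "\<bar>\<rho> * Re (\<Sum>p\<in>I. cnj (w p) * x p)\<bar> \<le> \<bar>\<rho>\<bar> * (nw * nx)"
      unfolding abs_mult by (intro mult_left_mono order.trans[OF abs_Re_le_cmod wx]) simp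
    ultimately show ?thesis by linarith
  qed
  also have "\<dots> \<le> cmod (\<Sum>p\<in>I. cnj (y p + \<rho> * w p) * x p)" by (rule complex_Re_le_cmod)
  finally have 1: "n * s2 - \<bar>\<rho>\<bar> * (nw * nx) \<le> cmod (\<Sum>p\<in>I. cnj (y p + \<rho> * w p) * x p)" .
  have nn': "sqrt n * sqrt n = n" using n by simp
  have "t * (ny + \<bar>\<rho>\<bar> * nw) * nx = n * (t * (sqrt s3 + \<bar>\<rho>\<bar> * sqrt s4) * sqrt s1)"
    unfolding s using n by (simp add: field_simps)
  also have "\<dots> < n * (s2 - \<bar>\<rho>\<bar> * (sqrt s4 * sqrt s1))" using less n by simp
  also have "\<dots> = n * s2 - \<bar>\<rho>\<bar> * (nw * nx)"
    unfolding s using n by (simp add: field_simps)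
  finally have "t * (ny + \<bar>\<rho>\<bar> * nw) * nx < cmod (\<Sum>p\<in>I. cnj (y p + \<rho> * w p) * x p)" using 1 by linarith
  moreover have "t * nz * nx \<le> t * (ny + \<bar>\<rho>\<bar> * nw) * nx"
    using nz t nn by (intro mult_right_mono mult_left_mono) auto
  ultimately have "t * nz * nx < cmod (\<Sum>p\<in>I. cnj (y p + \<rho> * w p) * x p)" by linarith
  then have "(t * nz * nx)\<^sup>2 < (cmod (\<Sum>p\<in>I. cnj (y p + \<rho> * w p) * x p))\<^sup>2"
    using nn t by (intro power_strict_mono) auto
  moreover have "(t * nz * nx)\<^sup>2 = t\<^sup>2 * (\<Sum>p\<in>I. (cmod (y p + \<rho> * w p))\<^sup>2) * (\<Sum>p\<in>I. (cmod (x p))\<^sup>2)"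
    unfolding nz_def nx_def L2_set_def power_mult_distrib by (simp add: sum_nonneg)
  ultimately show ?thesis by simp
qed

text \<open>At the limit point the scaling error \<open>sqrt (L / s1) - 1\<close> is 0 and the claim
  reduces to \<open>t * sqrt H < a\<close>; continuity carries it to a neighbourhood.\<close>

lemma typical_tolerance:
  fixes a H E L t :: real
  assumes L: "L > 0" and t: "t \<ge> 0" and less: "t * sqrt H < a"
  shows "\<exists>r>0. \<forall>s1 s2 s3 s4. \<bar>s1 - L\<bar> \<le> r \<and> \<bar>s2 - L * a\<bar> \<le> r \<and> \<bar>s3 - L * H\<bar> \<le> r \<and> \<bar>s4 - L * E\<bar> \<le> r \<longrightarrow>
     0 < s1 \<and> t * (sqrt s3 + \<bar>sqrt (L / s1) - 1\<bar> * sqrt s4) * sqrt s1 < s2 - \<bar>sqrt (L / s1) - 1\<bar> * (sqrt s4 * sqrt s1)"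
proof -
  define F where "F = (\<lambda>(s1, s2, s3, s4). s2 - \<bar>sqrt (L / s1) - 1\<bar> * (sqrt s4 * sqrt s1)
      - t * (sqrt s3 + \<bar>sqrt (L / s1) - 1\<bar> * sqrt s4) * sqrt s1)"
  define p where "p = (L, L * a, L * H, L * E)"
  have "isCont F p"
    unfolding F_def p_def split_beta' using L by (auto intro!: continuous_intros)
  moreover have "F p > 0"
  proof -
    have "t * sqrt (L * H) * sqrt L = L * (t * sqrt H)" using L by (simp add: real_sqrt_mult)
    also have "\<dots> < L * a" using less L by simp
    finally show ?thesis using L by (simp add: F_def p_def)
  qed
  ultimately have "\<forall>\<^sub>F q in at p. 0 < F q" unfolding isCont_def by (rule order_tendstoD(1))
  then obtain d where d: "d > 0" "\<And>q. q \<noteq> p \<Longrightarrow> dist q p < d \<Longrightarrow> 0 < F q"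
    unfolding eventually_at by auto
  have d': "dist q p < d \<Longrightarrow> 0 < F q" for q using d(2)[of q] \<open>F p > 0\<close> by (cases "q = p") auto
  \<comment> \<open>Four deviations of at most \<open>d / 5\<close> add up to less than
    \<open>d\<close>; the bound \<open>L / 2\<close> keeps \<open>s1\<close> positive.\<close>
  define r where "r = min (L / 2) (d / 5)"
  have r: "r > 0" using L d by (simp add: r_def)
  show ?thesis
  proof (intro exI[of _ r] conjI r allI impI)
    fix s1 s2 s3 s4 assume *: "\<bar>s1 - L\<bar> \<le> r \<and> \<bar>s2 - L * a\<bar> \<le> r \<and> \<bar>s3 - L * H\<bar> \<le> r \<and> \<bar>s4 - L * E\<bar> \<le> r"
    have rL: "r \<le> L / 2" "r \<le> d / 5" by (simp_all add: r_def)
    show "0 < s1" using * rL L by linarith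
    have pr: "dist (x :: real, y :: 'b :: metric_space) (x', y') \<le> \<bar>x - x'\<bar> + dist y y'" for x x' y y'
      using sqrt_sum_squares_le_sum_abs[of "dist x x'" "dist y y'"] by (simp add: dist_Pair_Pair dist_real_def)
    have "dist (s1, s2, s3, s4) p \<le> \<bar>s1 - L\<bar> + dist (s2, s3, s4) (L * a, L * H, L * E)" unfolding p_def by (rule pr)
    also have "dist (s2, s3, s4) (L * a, L * H, L * E) \<le> \<bar>s2 - L * a\<bar> + dist (s3, s4) (L * H, L * E)" by (rule pr)
    also have "dist (s3, s4) (L * H, L * E) \<le> \<bar>s3 - L * H\<bar> + dist s4 (L * E)" by (rule pr)
    finally have "dist (s1, s2, s3, s4) p < d" using * rL d(1) by (simp add: dist_real_def)
    from d'[OF this] show "t * (sqrt s3 + \<bar>sqrt (L / s1) - 1\<bar> * sqrt s4) * sqrt s1 < s2 - \<bar>sqrt (L / s1) - 1\<bar> * (sqrt s4 * sqrt s1)"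
      by (simp add: F_def)
  qed
qed

context block_fading_channel begin

definition channel :: "nat \<Rightarrow> nat \<Rightarrow> complex \<Rightarrow> 'w \<Rightarrow> complex" where
  "channel b t x \<omega> = h (S b \<omega>) * x + u t (S b \<omega>)"

abbreviation cells :: "nat \<Rightarrow> (nat \<times> nat) set" where
  "cells n \<equiv> {..<n} \<times> {..<L}"

definition energy :: "nat \<Rightarrow> (nat \<times> nat \<Rightarrow> complex) \<Rightarrow> real" where
  "energy n x = (\<Sum>p\<in>cells n. (cmod (x p))\<^sup>2)"

text \<open>The energy constraint binds every codeword, so the null event of a draw with energy 0
  needs a value too: all ones, of energy \<open>n * L\<close>.\<close>

definition codeword :: "nat \<Rightarrow> (nat \<times> nat \<Rightarrow> complex) \<Rightarrow> nat \<Rightarrow> nat \<Rightarrow> complex" where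
  "codeword n x b t = (if energy n x = 0 then 1 else complex_of_real (sqrt (real (n * L) / energy n x)) * x (b, t))"

definition received :: "nat \<Rightarrow> (nat \<times> nat \<Rightarrow> complex) \<Rightarrow> 'w \<Rightarrow> nat \<times> nat \<Rightarrow> complex" where
  "received n x \<omega> = (\<lambda>(b, t) \<in> cells n. channel b t (codeword n x b t) \<omega>)"

text \<open>Squared cosine of the angle above \<open>t\<^sup>2\<close>, multiplied out. Scaling
  \<open>x\<close> does not change the test, so the raw vector can stand for the normalised
  codeword; strictness means that a zero vector is never accepted.\<close>

definition accepts :: "nat \<Rightarrow> real \<Rightarrow> (nat \<times> nat \<Rightarrow> complex) \<Rightarrow> (nat \<times> nat \<Rightarrow> complex) \<Rightarrow> bool" where
  "accepts n t x y \<longleftrightarrow> t\<^sup>2 * (\<Sum>p\<in>cells n. (cmod (y p))\<^sup>2) * energy n x < (cmod (\<Sum>p\<in>cells n. cnj (y p) * x p))\<^sup>2"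

lemma energy_nonneg: "0 \<le> energy n x"
  unfolding energy_def by (intro sum_nonneg) simp

lemma energy_measurable [measurable]: "energy n \<in> borel_measurable gauss_codebook"
  unfolding energy_def by measurable

lemma codeword_measurable [measurable]: "(\<lambda>x. codeword n x b t) \<in> borel_measurable gauss_codebook"
  unfolding codeword_def by measurable

lemma received_component: "p \<in> cells n \<Longrightarrow> received n x \<omega> p = channel (fst p) (snd p) (codeword n x (fst p) (snd p)) \<omega>"
  by (auto simp: received_def split_beta')

lemma received_component_measurable [measurable]:
  "p \<in> cells n \<Longrightarrow> (\<lambda>z. received n (fst z) (snd z) p) \<in> borel_measurable joint"
  by (subst measurable_cong[OF received_component]) (simp_all add: channel_def)

lemma received_measurable [measurable]:
  "received n x \<in> measurable P (\<Pi>\<^sub>M p\<in>cells n. borel)"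
  unfolding received_def channel_def split_beta' by measurable

lemma codeword_energy: "(\<Sum>b<n. \<Sum>t<L. (cmod (codeword n x b t))\<^sup>2) = real (n * L)"
proof (cases "energy n x = 0")
  case True
  then show ?thesis by (simp add: codeword_def)
next
  case False
  have "(\<Sum>b<n. \<Sum>t<L. (cmod (codeword n x b t))\<^sup>2) = (\<Sum>p\<in>cells n. real (n * L) / energy n x * (cmod (x p))\<^sup>2)"
    using False energy_nonneg[of n x]
    by (simp add: sum.cartesian_product codeword_def norm_mult power_mult_distrib split_beta')
  also have "\<dots> = real (n * L) / energy n x * energy n x"
    unfolding energy_def by (rule sum_distrib_left[symmetric])
  finally show ?thesis using False by simp
qed

text \<open>Outside four events of vanishing probability, one for each statistic, all averages are
  within \<open>r\<close> of their limits, and there the deterministic estimate decides the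
  test.\<close>

lemma codeword_accepted_in_probability:
  assumes t: "0 \<le> t" "t * sqrt (gain_power + noise_power / real L) < mean_gain"
  shows "(\<lambda>n. measure joint {z \<in> space joint. \<not> accepts n t (fst z) (received n (fst z) (snd z))}) \<longlonglongrightarrow> 0"
proof -
  define H where "H = gain_power + noise_power / real L"
  have L: "real L > 0" using L_pos by simp
  obtain r where r: "r > 0" and tol: "\<And>s1 s2 s3 s4. \<bar>s1 - real L\<bar> \<le> r \<and> \<bar>s2 - real L * mean_gain\<bar> \<le> r \<and>
      \<bar>s3 - real L * H\<bar> \<le> r \<and> \<bar>s4 - real L * gain_power\<bar> \<le> r \<Longrightarrow>
     0 < s1 \<and> t * (sqrt s3 + \<bar>sqrt (real L / s1) - 1\<bar> * sqrt s4) * sqrt s1 < s2 - \<bar>sqrt (real L / s1) - 1\<bar> * (sqrt s4 * sqrt s1)"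
    using typical_tolerance[OF L t(1) t(2)[folded H_def], of gain_power] by blast
  have LH: "real L * H = real L * gain_power + noise_power" using L by (simp add: H_def algebra_simps)
  let ?bad = "\<lambda>F m n. {z \<in> space joint. r * real n < \<bar>(\<Sum>b<n. stat F b z) - real n * m\<bar>}"
  note wl = stat_weak_law[OF _ _ r]
  have lim: "(\<lambda>n. measure joint (?bad input_stat (real L) n) + measure joint (?bad corr_stat (real L * mean_gain) n)
      + (measure joint (?bad output_stat (real L * H) n) + measure joint (?bad signal_stat (real L * gain_power) n))) \<longlonglongrightarrow> 0 + 0 + (0 + 0)"
    by (intro tendsto_add)
      (use wl[OF stats_measurable(3) input_stat_mean(1)] wl[OF stats_measurable(1) corr_stat_mean(1)]
        wl[OF stats_measurable(2) output_stat_mean(1)] wl[OF stats_measurable(4) signal_stat_mean(1)]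
       in \<open>simp_all only: input_stat_mean(2) corr_stat_mean(2) output_stat_mean(2) signal_stat_mean(2) LH\<close>)
  have stat_meas: "stat F b \<in> borel_measurable joint"
    if "case_prod F \<in> borel_measurable ((\<Pi>\<^sub>M t\<in>{..<L}. cgauss 1) \<Otimes>\<^sub>M Q)" for F b
  proof -
    have "(\<lambda>z. (codebook_row L b (fst z), S b (snd z))) \<in> measurable joint ((\<Pi>\<^sub>M t\<in>{..<L}. cgauss 1) \<Otimes>\<^sub>M Q)"
      by measurable
    from measurable_compose[OF this that] show ?thesis by (simp add: stat_def[abs_def])
  qed
  have bad_sets: "?bad F c n \<in> sets joint"
    if F: "case_prod F \<in> borel_measurable ((\<Pi>\<^sub>M t\<in>{..<L}. cgauss 1) \<Otimes>\<^sub>M Q)" for F c n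
  proof -
    note stat_meas[OF F, measurable]
    show ?thesis by measurable
  qed
  have bound: "measure joint {z \<in> space joint. \<not> accepts n t (fst z) (received n (fst z) (snd z))}
     \<le> measure joint (?bad input_stat (real L) n) + measure joint (?bad corr_stat (real L * mean_gain) n)
      + (measure joint (?bad output_stat (real L * H) n) + measure joint (?bad signal_stat (real L * gain_power) n))"
    (is "measure joint ?A \<le> _") if n: "n > 0" for n
  proof -
    have "?A \<subseteq> (?bad input_stat (real L) n \<union> ?bad corr_stat (real L * mean_gain) n)
      \<union> (?bad output_stat (real L * H) n \<union> ?bad signal_stat (real L * gain_power) n)"
    proof (rule subsetI, rule ccontr)
      fix z assume zA: "z \<in> ?A" and nz: "z \<notin> (?bad input_stat (real L) n \<union> ?bad corr_stat (real L * mean_gain) n)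
        \<union> (?bad output_stat (real L * H) n \<union> ?bad signal_stat (real L * gain_power) n)"
      define x where "x = fst z"
      define \<omega> where "\<omega> = snd z"
      define y where "y p = h (S (fst p) \<omega>) * x p + u (snd p) (S (fst p) \<omega>)" for p
      define w where "w p = h (S (fst p) \<omega>) * x p" for p
      have cell_sum: "(\<Sum>b<n. \<Sum>t<L. f (b, t)) = (\<Sum>p\<in>cells n. f p)" for f :: "nat \<times> nat \<Rightarrow> real"
        by (simp add: sum.cartesian_product)
      define s1 s2 s3 s4 where "s1 = (\<Sum>p\<in>cells n. (cmod (x p))\<^sup>2) / real n"
        and "s2 = Re (\<Sum>p\<in>cells n. cnj (y p) * x p) / real n"
        and "s3 = (\<Sum>p\<in>cells n. (cmod (y p))\<^sup>2) / real n"
        and "s4 = (\<Sum>p\<in>cells n. (cmod (w p))\<^sup>2) / real n"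
      have st: "(\<Sum>b<n. stat input_stat b z) = real n * s1" "(\<Sum>b<n. stat corr_stat b z) = real n * s2"
        "(\<Sum>b<n. stat output_stat b z) = real n * s3" "(\<Sum>b<n. stat signal_stat b z) = real n * s4"
        unfolding s1_def s2_def s3_def s4_def Re_sum cell_sum[symmetric] stat_def input_stat_def corr_stat_def
          output_stat_def signal_stat_def codebook_row_def y_def w_def x_def \<omega>_def
        using n by simp_all
      have dev: "\<bar>s - m\<bar> \<le> r" if "\<not> r * real n < \<bar>real n * s - real n * m\<bar>" for s m
      proof -
        have "\<bar>real n * s - real n * m\<bar> = real n * \<bar>s - m\<bar>"
          by (simp add: abs_mult flip: right_diff_distrib)
        then show ?thesis using that n by (simp add: not_less mult.commute)
      qed
      have z: "z \<in> space joint" using zA by simp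
      have devs: "\<bar>s1 - real L\<bar> \<le> r \<and> \<bar>s2 - real L * mean_gain\<bar> \<le> r \<and> \<bar>s3 - real L * H\<bar> \<le> r \<and> \<bar>s4 - real L * gain_power\<bar> \<le> r"
        using nz z unfolding Un_iff mem_Collect_eq st by (blast intro: dev)
      note t12 = tol[OF devs]
      have en: "energy n x = real n * s1" using n by (simp add: energy_def s1_def)
      have enpos: "energy n x > 0" unfolding en using t12 n by simp
      \<comment> \<open>The normalisation multiplies the codeword by \<open>1 + \<rho>\<close>,
        where \<rho> is small because \<open>s1\<close> is close to \<open>L\<close>.\<close>
      define \<rho> where "\<rho> = sqrt (real L / s1) - 1"
      have rho: "sqrt (real (n * L) / energy n x) = 1 + \<rho>"
        unfolding en \<rho>_def using n by simp
      have out: "received n x \<omega> p = y p + \<rho> * w p" if "p \<in> cells n" for p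
        unfolding received_component[OF that] channel_def codeword_def rho y_def w_def
        using enpos by (simp add: algebra_simps)
      have "t\<^sup>2 * (\<Sum>p\<in>cells n. (cmod (y p + \<rho> * w p))\<^sup>2) * (\<Sum>p\<in>cells n. (cmod (x p))\<^sup>2)
        < (cmod (\<Sum>p\<in>cells n. cnj (y p + \<rho> * w p) * x p))\<^sup>2"
        by (rule correlation_dominates[of "real n"])
           (use n t(1) t12 in \<open>simp_all add: \<rho>_def s1_def s2_def s3_def s4_def\<close>)
      then have "accepts n t x (received n x \<omega>)"
        unfolding accepts_def energy_def by (simp only: out cong: sum.cong)
      then show False using zA by (simp add: x_def \<omega>_def)
    qed
    then have "measure joint ?A \<le> measure joint ((?bad input_stat (real L) n \<union> ?bad corr_stat (real L * mean_gain) n)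
      \<union> (?bad output_stat (real L * H) n \<union> ?bad signal_stat (real L * gain_power) n))"
      by (intro CP.finite_measure_mono sets.Un bad_sets stats_measurable)
    also have "\<dots> \<le> measure joint (?bad input_stat (real L) n \<union> ?bad corr_stat (real L * mean_gain) n)
      + measure joint (?bad output_stat (real L * H) n \<union> ?bad signal_stat (real L * gain_power) n)"
      by (intro measure_Un_le sets.Un bad_sets stats_measurable)
    also have "\<dots> \<le> measure joint (?bad input_stat (real L) n) + measure joint (?bad corr_stat (real L * mean_gain) n)
      + (measure joint (?bad output_stat (real L * H) n) + measure joint (?bad signal_stat (real L * gain_power) n))"
      by (intro add_mono measure_Un_le bad_sets stats_measurable)
    finally show ?thesis .
  qed
  show ?thesis
  proof (rule tendsto_sandwich[OF _ _ tendsto_const])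
    show "\<forall>\<^sub>F n in sequentially. measure joint {z \<in> space joint. \<not> accepts n t (fst z) (received n (fst z) (snd z))}
     \<le> measure joint (?bad input_stat (real L) n) + measure joint (?bad corr_stat (real L * mean_gain) n)
      + (measure joint (?bad output_stat (real L * H) n) + measure joint (?bad signal_stat (real L * gain_power) n))"
      using eventually_gt_at_top[of "0::nat"] by eventually_elim (rule bound)
  qed (use lim in auto)
qed

text \<open>This is the probability of accepting a wrong codeword: it is drawn independently of the
  received vector, which may therefore be held fixed. The channel enters only through the dimension
  \<open>n * L\<close>.\<close>

lemma emeasure_accepts_le:
  assumes theta: "0 \<le> \<theta>" "\<theta> * (1 - t\<^sup>2) < 1"
  shows "emeasure gauss_codebook {x \<in> space gauss_codebook. accepts n t x y}
    \<le> ennreal ((1 / (1 + \<theta> * t\<^sup>2)) ^ (n * L) * ((1 + \<theta> * t\<^sup>2) / (1 - \<theta> * (1 - t\<^sup>2))))"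
proof -
  interpret pp: product_prob_space "\<lambda>_ :: nat \<times> nat. cgauss 1" UNIV
    by (intro product_prob_space.intro product_sigma_finite.intro product_prob_space_axioms.intro
        prob_space_imp_sigma_finite prob_space_cgauss) simp_all
  let ?R = "\<Pi>\<^sub>M p\<in>cells n. cgauss 1"
  let ?A = "{x \<in> space ?R. t\<^sup>2 * (\<Sum>p\<in>cells n. (cmod (y p))\<^sup>2) * (\<Sum>p\<in>cells n. (cmod (x p))\<^sup>2) < (cmod (\<Sum>p\<in>cells n. cnj (y p) * x p))\<^sup>2}"
  have [measurable]: "(\<lambda>x. x p) \<in> borel_measurable ?R" if "p \<in> cells n" for p
    using measurable_component_singleton[of p "cells n" "\<lambda>_. cgauss 1"] that by simp
  have A: "?A \<in> sets ?R" by measurable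
  have rm: "(\<lambda>x. restrict x (cells n)) \<in> measurable gauss_codebook ?R"
    by (rule measurable_restrict_subset) simp
  have "{x \<in> space gauss_codebook. accepts n t x y} = (\<lambda>x. restrict x (cells n)) -` ?A \<inter> space gauss_codebook"
    by (auto simp: accepts_def energy_def space_PiM)
  then have "emeasure gauss_codebook {x \<in> space gauss_codebook. accepts n t x y} = emeasure (distr gauss_codebook ?R (\<lambda>x. restrict x (cells n))) ?A"
    by (simp add: emeasure_distr[OF rm A])
  also have "distr gauss_codebook ?R (\<lambda>x. restrict x (cells n)) = ?R"
    by (rule pp.distr_PiM_restrict_finite) auto
  also have "emeasure ?R ?A \<le> ennreal ((1 / (1 + \<theta> * t\<^sup>2)) ^ card (cells n) * ((1 + \<theta> * t\<^sup>2) / (1 - \<theta> * (1 - t\<^sup>2))))"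
    by (rule emeasure_gauss_cap_le[OF _ theta]) simp
  finally show ?thesis by (simp add: card_cartesian_product)
qed

lemma exists_reliable_code:
  fixes n m :: nat and t \<theta> :: real
  assumes theta: "0 \<le> \<theta>" "\<theta> * (1 - t\<^sup>2) < 1" and m: "0 < m"
  defines "\<delta> \<equiv> measure joint {z \<in> space joint. \<not> accepts n t (fst z) (received n (fst z) (snd z))}"
    and "q \<equiv> (1 / (1 + \<theta> * t\<^sup>2)) ^ (n * L) * ((1 + \<theta> * t\<^sup>2) / (1 - \<theta> * (1 - t\<^sup>2)))"
  shows "\<exists>c d. reliable_code P channel L n m c d (2 * (\<delta> + real (2 * m) * q))"
proof -
  let ?C = gauss_codebook
  interpret PC: pair_prob_space P gauss_codebook ..
  have q: "q > 0"
  proof -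
    have "1 + \<theta> * t\<^sup>2 > 0" using theta(1) by (simp add: add_pos_nonneg)
    then show ?thesis unfolding q_def using theta by simp
  qed
  have acc_meas: "Measurable.pred joint (\<lambda>z. accepts n t (fst z) (received n (fst z) (snd z)))"
    unfolding accepts_def by measurable
  have acc2_meas: "Measurable.pred (?C \<Otimes>\<^sub>M (?C \<Otimes>\<^sub>M P)) (\<lambda>z. accepts n t (fst (snd z)) (received n (fst z) (snd (snd z))))"
  proof -
    have [measurable]: "(\<lambda>z. received n (fst z) (snd (snd z)) p) \<in> borel_measurable (?C \<Otimes>\<^sub>M (?C \<Otimes>\<^sub>M P))" if "p \<in> cells n" for p
    proof -
      have "(\<lambda>z. (fst z, snd (snd z))) \<in> measurable (?C \<Otimes>\<^sub>M (?C \<Otimes>\<^sub>M P)) joint" by measurable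
      from measurable_compose[OF this received_component_measurable[OF that]] show ?thesis by simp
    qed
    show ?thesis unfolding accepts_def by measurable
  qed
  define f where "f x = (\<integral>\<^sup>+\<omega>. (if accepts n t x (received n x \<omega>) then 0 else 1) \<partial>P)" for x
  define g where "g x x' = (\<integral>\<^sup>+\<omega>. (if accepts n t x' (received n x \<omega>) then 1 else 0) \<partial>P)" for x x'
  have f_int_meas: "(\<lambda>(x, \<omega>). if accepts n t x (received n x \<omega>) then 0 else 1 :: ennreal) \<in> borel_measurable joint"
    unfolding split_beta' by (intro measurable_If predE[OF acc_meas]) simp_all
  have f_meas: "f \<in> borel_measurable ?C"
    unfolding f_def using f_int_meas by measurable
  have g_int_meas: "(\<lambda>((x, x'), \<omega>). if accepts n t x' (received n x \<omega>) then 1 else 0 :: ennreal) \<in> borel_measurable ((?C \<Otimes>\<^sub>M ?C) \<Otimes>\<^sub>M P)"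
  proof -
    have "(\<lambda>z. (fst (fst z), (snd (fst z), snd z))) \<in> measurable ((?C \<Otimes>\<^sub>M ?C) \<Otimes>\<^sub>M P) (?C \<Otimes>\<^sub>M (?C \<Otimes>\<^sub>M P))" by measurable
    from measurable_compose[OF this acc2_meas] have "Measurable.pred ((?C \<Otimes>\<^sub>M ?C) \<Otimes>\<^sub>M P) (\<lambda>z. accepts n t (snd (fst z)) (received n (fst (fst z)) (snd z)))"
      by simp
    then show ?thesis unfolding split_beta' by measurable
  qed
  have g_meas: "case_prod g \<in> borel_measurable (?C \<Otimes>\<^sub>M ?C)"
    using borel_measurable_nn_integral[of "\<lambda>(x, x') \<omega>. if accepts n t x' (received n x \<omega>) then 1 else 0 :: ennreal" "?C \<Otimes>\<^sub>M ?C"] g_int_meas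
    by (simp add: g_def split_beta')
  have f_le: "(\<integral>\<^sup>+x. f x \<partial>?C) \<le> ennreal \<delta>"
  proof -
    have "(\<integral>\<^sup>+x. f x \<partial>?C) = (\<integral>\<^sup>+z. (if accepts n t (fst z) (received n (fst z) (snd z)) then 0 else 1) \<partial>joint)"
      using nn_integral_fst[OF f_int_meas] by (simp add: f_def split_beta')
    also have "\<dots> = (\<integral>\<^sup>+z. indicator {z \<in> space joint. \<not> accepts n t (fst z) (received n (fst z) (snd z))} z \<partial>joint)"
      by (intro nn_integral_cong) auto
    also have "\<dots> = emeasure joint {z \<in> space joint. \<not> accepts n t (fst z) (received n (fst z) (snd z))}"
      by (intro nn_integral_indicator sets.sets_Collect_neg predE[OF acc_meas])
    also have "\<dots> = ennreal \<delta>" unfolding \<delta>_def by (rule CP.emeasure_eq_measure)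
    finally show ?thesis by simp
  qed
  \<comment> \<open>Fubini: once the sent codeword and the channel outcome are fixed, so is the
    received vector, and \<open>x'\<close> is a fresh Gaussian vector to which the cap bound
    applies.\<close>
  have g_le: "(\<integral>\<^sup>+x. \<integral>\<^sup>+x'. g x x' \<partial>?C \<partial>?C) \<le> ennreal q"
  proof -
    have "(\<integral>\<^sup>+x'. g x x' \<partial>?C) \<le> ennreal q" if x: "x \<in> space ?C" for x
    proof -
      have "(\<lambda>z. (x, (snd z, fst z))) \<in> measurable (P \<Otimes>\<^sub>M ?C) (?C \<Otimes>\<^sub>M (?C \<Otimes>\<^sub>M P))" using x by measurable
      from measurable_compose[OF this acc2_meas] have [measurable]: "Measurable.pred (P \<Otimes>\<^sub>M ?C) (\<lambda>z. accepts n t (snd z) (received n x (fst z)))"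
        by simp
      have "(\<integral>\<^sup>+x'. g x x' \<partial>?C) = (\<integral>\<^sup>+\<omega>. \<integral>\<^sup>+x'. (if accepts n t x' (received n x \<omega>) then 1 else 0) \<partial>?C \<partial>P)"
        unfolding g_def by (rule PC.Fubini') (simp add: split_beta')
      also have "\<dots> \<le> (\<integral>\<^sup>+\<omega>. ennreal q \<partial>P)"
      proof (rule nn_integral_mono)
        fix \<omega> assume w: "\<omega> \<in> space P"
        have [measurable]: "Measurable.pred ?C (\<lambda>x'. accepts n t x' (received n x \<omega>))"
          unfolding accepts_def by measurable
        have "(\<integral>\<^sup>+x'. (if accepts n t x' (received n x \<omega>) then 1 else 0) \<partial>?C)
           = (\<integral>\<^sup>+x'. indicator {x' \<in> space ?C. accepts n t x' (received n x \<omega>)} x' \<partial>?C)"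
          by (intro nn_integral_cong) auto
        also have "\<dots> = emeasure ?C {x' \<in> space ?C. accepts n t x' (received n x \<omega>)}"
          by (intro nn_integral_indicator) measurable
        also have "\<dots> \<le> ennreal q" unfolding q_def by (rule emeasure_accepts_le[OF theta])
        finally show "(\<integral>\<^sup>+x'. (if accepts n t x' (received n x \<omega>) then 1 else 0) \<partial>?C) \<le> ennreal q" .
      qed
      also have "\<dots> = ennreal q" by (simp add: emeasure_space_1)
      finally show ?thesis .
    qed
    then have "(\<integral>\<^sup>+x. \<integral>\<^sup>+x'. g x x' \<partial>?C \<partial>?C) \<le> (\<integral>\<^sup>+x. ennreal q \<partial>?C)" by (rule nn_integral_mono)
    also have "\<dots> = ennreal q" by (simp add: CP.M1.emeasure_space_1)
    finally show ?thesis .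
  qed
  have "\<delta> \<ge> 0" by (simp add: \<delta>_def)
  from expurgated_random_code[OF prob_space_gauss_codebook f_meas g_meas f_le g_le this q m]
  obtain X where X: "\<And>i. i < m \<Longrightarrow> f (X i) + (\<Sum>j\<in>{..<m} - {i}. g (X i) (X j)) \<le> ennreal (2 * (\<delta> + real (2 * m) * q))"
    by blast
  \<comment> \<open>If no codeword is accepted, \<open>LEAST\<close> denotes some fixed number;
    \<open>d\<close> remains measurable, and such outcomes are charged to the rejection of the sent
    codeword.\<close>
  define d where "d y = (LEAST \<mu>. \<mu> < m \<and> accepts n t (X \<mu>) y)" for y
  have d_meas [measurable]: "d \<in> measurable (\<Pi>\<^sub>M p\<in>cells n. borel) (count_space UNIV)"
    unfolding d_def accepts_def by measurable
  have "reliable_code P channel L n m (\<lambda>\<mu>. codeword n (X \<mu>)) d (2 * (\<delta> + real (2 * m) * q))"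
    unfolding reliable_code_def
  proof (intro conjI allI impI codeword_energy d_meas)
    fix \<mu> assume mu: "\<mu> < m"
    let ?G = "{\<omega> \<in> space P. d (received n (X \<mu>) \<omega>) = \<mu>}"
    have G [measurable]: "?G \<in> sets P" by measurable
    have [measurable]: "Measurable.pred P (\<lambda>\<omega>. accepts n t (X j) (received n (X \<mu>) \<omega>))" for j
    proof -
      have "Measurable.pred (\<Pi>\<^sub>M p\<in>cells n. borel) (accepts n t (X j))" unfolding accepts_def by measurable
      from measurable_compose[OF received_measurable this] show ?thesis .
    qed
    \<comment> \<open>Union bound: a wrong decision requires that the sent codeword is rejected or
      that another one is accepted.\<close>
    have "emeasure P (space P - ?G) = (\<integral>\<^sup>+\<omega>. indicator (space P - ?G) \<omega> \<partial>P)"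
      by (rule nn_integral_indicator[symmetric]) measurable
    also have "\<dots> \<le> (\<integral>\<^sup>+\<omega>. (if accepts n t (X \<mu>) (received n (X \<mu>) \<omega>) then 0 else 1)
        + (\<Sum>j\<in>{..<m} - {\<mu>}. if accepts n t (X j) (received n (X \<mu>) \<omega>) then 1 else 0) \<partial>P)"
    proof (rule nn_integral_mono)
      fix \<omega> assume w: "\<omega> \<in> space P"
      let ?y = "received n (X \<mu>) \<omega>"
      have "d ?y = \<mu>" if a: "accepts n t (X \<mu>) ?y" and na: "\<And>j. j < m \<Longrightarrow> j \<noteq> \<mu> \<Longrightarrow> \<not> accepts n t (X j) ?y"
        unfolding d_def by (rule Least_equality) (use a na mu in auto)
      moreover have "(1::ennreal) \<le> (\<Sum>j\<in>{..<m} - {\<mu>}. if accepts n t (X j) ?y then 1 else 0)"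
        if "j < m" "j \<noteq> \<mu>" "accepts n t (X j) ?y" for j
      proof -
        have "(\<Sum>j\<in>{j}. if accepts n t (X j) ?y then 1 else 0) \<le> (\<Sum>j\<in>{..<m} - {\<mu>}. if accepts n t (X j) ?y then 1 else (0::ennreal))"
          using that by (intro sum_mono2) auto
        then show ?thesis using that by simp
      qed
      ultimately show "indicator (space P - ?G) \<omega> \<le> (if accepts n t (X \<mu>) ?y then 0 else 1)
        + (\<Sum>j\<in>{..<m} - {\<mu>}. if accepts n t (X j) ?y then 1 else (0::ennreal))"
        using w by (cases "d ?y = \<mu>"; cases "accepts n t (X \<mu>) ?y") (auto simp: indicator_def)
    qed
    also have "\<dots> = f (X \<mu>) + (\<Sum>j\<in>{..<m} - {\<mu>}. g (X \<mu>) (X j))"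
      unfolding f_def g_def by (subst nn_integral_add, measurable, subst nn_integral_sum, measurable)
    also have "\<dots> \<le> ennreal (2 * (\<delta> + real (2 * m) * q))" by (rule X[OF mu])
    finally have "prob (space P - ?G) \<le> 2 * (\<delta> + real (2 * m) * q)"
      unfolding emeasure_eq_measure using q \<open>\<delta> \<ge> 0\<close> by (subst (asm) ennreal_le_iff) auto
    then have "prob ?G \<ge> 1 - 2 * (\<delta> + real (2 * m) * q)"
      using prob_compl[OF G] by simp
    moreover have "{\<omega> \<in> space P. d (\<lambda>(b, t)\<in>cells n. channel b t (codeword n (X \<mu>) b t) \<omega>) = \<mu>} = ?G"
      by (simp add: received_def)
    ultimately show "1 - 2 * (\<delta> + real (2 * m) * q) \<le> prob {\<omega> \<in> space P. d (\<lambda>(b, t)\<in>cells n. channel b t (codeword n (X \<mu>) b t) \<omega>) = \<mu>}"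
      by simp
  qed
  then show ?thesis by blast
qed

text \<open>The threshold \<open>t\<^sup>2\<close> is kept a factor \<xi> below \<open>p\<close>,
  the limiting squared cosine of the right codeword. The Chernoff parameter is chosen so that
  \<open>\<theta> * (1 - t\<^sup>2)\<close> equals \<xi>, which keeps the cap bound finite. As \<xi>
  tends to 1 the base of the cap bound tends to \<open>1 - p\<close>, the inverse of
  \<open>H / (H - mean_gain\<^sup>2)\<close>.\<close>

lemma achievable_below_capacity:
  fixes T :: nat and R :: real
  defines "H \<equiv> gain_power + noise_power / real L"
  assumes a: "0 < mean_gain" and H: "mean_gain\<^sup>2 < H"
    and R: "2 powr (real T * R) < (H / (H - mean_gain\<^sup>2)) ^ L"
  shows "achievable_rate P channel T L R"
proof -
  define p where "p = mean_gain\<^sup>2 / H"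
  have Hpos: "H > 0" using H a by (meson zero_le_power2 order_le_less_trans)
  have p: "0 < p" "p < 1" unfolding p_def using a H Hpos by simp_all
  \<comment> \<open>At \<xi> = 1 the base is exactly the one in the assumption on \<open>R\<close>;
    since that inequality is strict, it persists for some \<xi> below 1.\<close>
  have lim: "((\<lambda>\<xi>. (1 + \<xi>\<^sup>2 * p / (1 - \<xi> * p)) ^ L) \<longlongrightarrow> (1 + 1\<^sup>2 * p / (1 - 1 * p)) ^ L) (at_left 1)"
    using p by (intro tendsto_intros) auto
  have "1 + 1\<^sup>2 * p / (1 - 1 * p) = H / (H - mean_gain\<^sup>2)"
    using Hpos H by (simp add: p_def field_simps)
  with R have "2 powr (real T * R) < (1 + 1\<^sup>2 * p / (1 - 1 * p)) ^ L" by simp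
  from order_tendstoD(1)[OF lim this]
  have "\<forall>\<^sub>F \<xi> in at_left 1. 2 powr (real T * R) < (1 + \<xi>\<^sup>2 * p / (1 - \<xi> * p)) ^ L" .
  moreover have "\<forall>\<^sub>F \<xi> in at_left (1::real). \<xi> \<in> {0<..<1}"
    by (rule eventually_at_left_real) simp
  ultimately have "\<forall>\<^sub>F \<xi> in at_left 1. 2 powr (real T * R) < (1 + \<xi>\<^sup>2 * p / (1 - \<xi> * p)) ^ L \<and> \<xi> \<in> {0<..<1}"
    by (rule eventually_conj)
  then obtain \<xi> where \<xi>: "2 powr (real T * R) < (1 + \<xi>\<^sup>2 * p / (1 - \<xi> * p)) ^ L" "0 < \<xi>" "\<xi> < 1"
    using eventually_happens'[OF trivial_limit_at_left_real] by fastforce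
  define t where "t = sqrt (\<xi> * p)"
  define \<theta> where "\<theta> = \<xi> / (1 - \<xi> * p)"
  have xp: "\<xi> * p < 1" using \<xi> p by (smt (verit) mult_less_cancel_right2)
  have t2: "t\<^sup>2 = \<xi> * p" using \<xi> p by (simp add: t_def)
  have t0: "0 \<le> t" using \<xi> p by (simp add: t_def)
  have tH: "t * sqrt H < mean_gain"
  proof -
    have "t * sqrt H = sqrt (\<xi> * mean_gain\<^sup>2)"
      unfolding t_def p_def using Hpos by (simp add: real_sqrt_mult[symmetric])
    also have "\<dots> < sqrt (mean_gain\<^sup>2)"
    proof -
      have "\<xi> * mean_gain\<^sup>2 < 1 * mean_gain\<^sup>2" using \<xi> a by (intro mult_strict_right_mono) auto
      then show ?thesis by (simp only: real_sqrt_less_iff mult_1)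
    qed
    finally show ?thesis using a by simp
  qed
  have theta: "0 \<le> \<theta>" "\<theta> * (1 - t\<^sup>2) < 1"
    using \<xi> xp by (simp_all add: \<theta>_def t2)
  define \<rho> where "\<rho> = 1 / (1 + \<theta> * t\<^sup>2)"
  have tt: "1 + \<theta> * t\<^sup>2 = 1 + \<xi>\<^sup>2 * p / (1 - \<xi> * p)" unfolding \<theta>_def t2 by (simp add: power2_eq_square)
  have "\<theta> * t\<^sup>2 > 0" using \<xi> p xp by (simp add: \<theta>_def t2)
  then have \<rho>: "0 < \<rho>" "\<rho> < 1" by (simp_all add: \<rho>_def add_pos_pos)
  \<comment> \<open>Growth per interval of the expected number of wrong acceptances:
    \<open>2 powr (real T * R)\<close> times as many codewords against a cap smaller by
    \<open>\<rho> ^ L\<close>.\<close>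
  define \<kappa> where "\<kappa> = 2 powr (real T * R) * \<rho> ^ L"
  have \<kappa>: "0 < \<kappa>" "\<kappa> < 1"
  proof -
    show "0 < \<kappa>" using \<rho> by (simp add: \<kappa>_def)
    have "2 powr (real T * R) * \<rho> ^ L < (1 + \<theta> * t\<^sup>2) ^ L * \<rho> ^ L"
      using \<xi>(1) \<rho> unfolding tt by (intro mult_strict_right_mono) auto
    also have "\<dots> = 1" using \<open>\<theta> * t\<^sup>2 > 0\<close> by (simp add: \<rho>_def power_mult_distrib[symmetric])
    finally show "\<kappa> < 1" by (simp add: \<kappa>_def)
  qed
  have \<rho>L: "0 \<le> \<rho> ^ L" "\<rho> ^ L < 1" using \<rho> L_pos by (simp_all add: power_Suc_less_one power_less_one_iff)
  define c where "c = (1 + \<theta> * t\<^sup>2) / (1 - \<theta> * (1 - t\<^sup>2))"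
  have c: "c > 0" using theta \<open>\<theta> * t\<^sup>2 > 0\<close> by (simp add: c_def add_pos_pos)
  \<comment> \<open>Rounding up adds at most one codeword, which produces the separate term
    \<open>(\<rho> ^ L) ^ n\<close> below and keeps the estimate valid for negative
    \<open>R\<close>.\<close>
  define m where "m n = nat \<lceil>2 powr (real n * real T * R)\<rceil>" for n
  have m_ge: "2 powr (real n * real T * R) \<le> real (m n)" for n
    unfolding m_def by (rule real_nat_ceiling_ge)
  have m_le: "real (m n) \<le> 2 powr (real n * real T * R) + 1" for n
    unfolding m_def by (simp add: of_nat_nat ceiling_correct less_imp_le)
  have m_pos: "0 < m n" for n
    using m_ge[of n] by (metis gr0I less_le_trans not_le of_nat_0 powr_gt_zero zero_neq_numeral)
  define \<delta> where "\<delta> n = measure joint {z \<in> space joint. \<not> accepts n t (fst z) (received n (fst z) (snd z))}" for n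
  define e where "e n = 2 * (\<delta> n + real (2 * m n) * (\<rho> ^ (n * L) * c))" for n
  have \<delta>: "\<delta> \<longlonglongrightarrow> 0"
    unfolding \<delta>_def by (rule codeword_accepted_in_probability[OF t0 tH[unfolded H_def]])
  have mq: "real (m n) * \<rho> ^ (n * L) \<le> \<kappa> ^ n + (\<rho> ^ L) ^ n" for n
  proof -
    have "real (m n) * \<rho> ^ (n * L) \<le> (2 powr (real n * real T * R) + 1) * \<rho> ^ (n * L)"
      using m_le \<rho> by (intro mult_right_mono) auto
    also have "2 powr (real n * real T * R) = (2 powr (real T * R)) ^ n"
      by (simp add: powr_power mult.assoc)
    finally have "real (m n) * \<rho> ^ (n * L) \<le> ((2 powr (real T * R)) ^ n + 1) * \<rho> ^ (n * L)" .
    moreover have "\<rho> ^ (n * L) = (\<rho> ^ L) ^ n" by (simp add: power_mult mult.commute[of n])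
    ultimately show ?thesis by (simp add: \<kappa>_def power_mult_distrib distrib_right)
  qed
  have "(\<lambda>n. 2 * (\<delta> n + 2 * (\<kappa> ^ n + (\<rho> ^ L) ^ n) * c)) \<longlonglongrightarrow> 2 * (0 + 2 * (0 + 0) * c)"
    by (intro tendsto_intros \<delta> LIMSEQ_power_zero) (use \<kappa> \<rho>L in auto)
  then have bound0: "(\<lambda>n. 2 * (\<delta> n + 2 * (\<kappa> ^ n + (\<rho> ^ L) ^ n) * c)) \<longlonglongrightarrow> 0" by simp
  have e_le: "e n \<le> 2 * (\<delta> n + 2 * (\<kappa> ^ n + (\<rho> ^ L) ^ n) * c)" for n
    using mult_right_mono[OF mq[of n], of c] c by (simp add: e_def algebra_simps)
  show ?thesis
    unfolding achievable_rate_def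
  proof (intro allI impI)
    fix \<epsilon> :: real assume "0 < \<epsilon>"
    from order_tendstoD(2)[OF bound0 this]
    show "\<forall>\<^sub>F n in sequentially. \<exists>m c d. 1 \<le> m \<and> real n * real T * R \<le> log 2 (real m) \<and> reliable_code P channel L n m c d \<epsilon>"
    proof eventually_elim
      case (elim n)
      obtain cd d where cd: "reliable_code P channel L n (m n) cd d (e n)"
        using exists_reliable_code[OF theta m_pos, of n n] unfolding e_def \<delta>_def \<rho>_def c_def by blast
      have "e n \<le> \<epsilon>" using e_le[of n] elim by linarith
      then have "reliable_code P channel L n (m n) cd d \<epsilon>"
        using cd unfolding reliable_code_def by (auto intro: order.trans[rotated])
      moreover have "real n * real T * R \<le> log 2 (real (m n))"
        using m_ge[of n] m_pos[of n] by (subst le_log_iff) auto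
      ultimately show ?case using m_pos[of n] by (intro exI[of _ "m n"]) auto
    qed
  qed
qed

end

section \<open>Estimate and error as independent Gaussians\<close>

declare measurable_codebook_component [measurable del]

lemma nn_integral_lborel_complex_affine:
  fixes t :: complex and c :: real
  assumes c: "c \<noteq> 0" and [measurable]: "f \<in> borel_measurable borel"
  shows "(\<integral>\<^sup>+z. f z \<partial>lborel) = ennreal (c\<^sup>2) * (\<integral>\<^sup>+z. f (t + c *\<^sub>R z) \<partial>lborel)"
proof -
  have "(\<integral>\<^sup>+z. f z \<partial>lborel) = (\<integral>\<^sup>+z. f z \<partial>density (distr lborel borel (\<lambda>x. t + c *\<^sub>R x)) (\<lambda>_. \<bar>c\<bar> ^ DIM(complex)))"
    by (rule arg_cong[OF lborel_affine[OF c, of t]])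
  also have "\<dots> = ennreal (c\<^sup>2) * (\<integral>\<^sup>+z. f (t + c *\<^sub>R z) \<partial>lborel)"
    by (subst nn_integral_density, simp, simp, subst nn_integral_distr, simp, simp, subst nn_integral_cmult) (simp_all add: power2_eq_square)
  finally show ?thesis .
qed

lemma nn_integral_cgauss:
  assumes [measurable]: "f \<in> borel_measurable borel"
  shows "(\<integral>\<^sup>+z. f z \<partial>cgauss v) = (\<integral>\<^sup>+z. ennreal (exp (- (cmod z)\<^sup>2 / v) / (pi * v)) * f z \<partial>lborel)"
  unfolding cgauss_def by (subst nn_integral_density) simp_all

text \<open>Completing the square in the joint density of the channel and the pilot noise: the estimate
  and the estimation error are again independent circular Gaussians.\<close>

lemma distr_estimate_error:
  fixes \<beta> \<rho> :: real
  assumes \<beta>: "\<beta> > 0" and \<rho>: "\<rho> > 0"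
  defines "c \<equiv> sqrt \<rho> * \<beta> / (1 + \<rho> * \<beta>)" and "\<gamma> \<equiv> \<rho> * \<beta>\<^sup>2 / (1 + \<rho> * \<beta>)"
  shows "distr (cgauss \<beta> \<Otimes>\<^sub>M cgauss 1) (borel \<Otimes>\<^sub>M borel) (\<lambda>(x, n). (c * (sqrt \<rho> * x + n), c * (sqrt \<rho> * x + n) - x))
      = cgauss \<gamma> \<Otimes>\<^sub>M cgauss (\<beta> - \<gamma>)" (is "distr ?M ?B ?\<Psi> = ?R")
proof (rule measure_eqI)
  have \<rho>\<beta>: "1 + \<rho> * \<beta> > 0" using \<beta> \<rho> by (simp add: add_pos_pos)
  have c: "c > 0" using \<beta> \<rho> \<rho>\<beta> by (simp add: c_def)
  have \<gamma>: "\<gamma> > 0" using \<beta> \<rho> \<rho>\<beta> by (simp add: \<gamma>_def)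
  have \<beta>\<gamma>: "\<beta> - \<gamma> = \<beta> / (1 + \<rho> * \<beta>)"
    using \<rho>\<beta> by (simp add: \<gamma>_def field_simps power2_eq_square)
  have \<beta>\<gamma>0: "\<beta> - \<gamma> > 0" unfolding \<beta>\<gamma> using \<beta> \<rho>\<beta> by simp
  let ?d = "\<lambda>v z. exp (- (cmod z)\<^sup>2 / v) / (pi * v)"
  interpret G1: prob_space "cgauss \<beta>" by (rule prob_space_cgauss[OF \<beta>])
  interpret G2: prob_space "cgauss 1" by (rule prob_space_cgauss) simp
  interpret G3: prob_space "cgauss \<gamma>" by (rule prob_space_cgauss[OF \<gamma>])
  interpret G4: prob_space "cgauss (\<beta> - \<gamma>)" by (rule prob_space_cgauss[OF \<beta>\<gamma>0])
  have sr: "sqrt \<rho> * sqrt \<rho> = \<rho>" using \<rho> by simp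
  have ci: "1 / c - sqrt \<rho> = 1 / (sqrt \<rho> * \<beta>)"
    using \<rho> \<beta> \<rho>\<beta> sr by (simp add: c_def field_simps)
  have ac: "ennreal a * (ennreal k * (ennreal b * z)) = ennreal (a * b * k) * z" if "0 \<le> a" "0 \<le> b" "0 \<le> k" for a b k z
    using that by (simp add: ennreal_mult mult_ac)
  \<comment> \<open>\<open>(1 / c)\<^sup>2\<close> is the Jacobian of replacing the noise by the
    estimate \<open>y\<close>. The other substitution, \<open>x = y - e\<close>, is a reflection and
    a shift, with Jacobian 1.\<close>
  have dens: "?d \<beta> (y - e) * ?d 1 (- (sqrt \<rho> * (y - e)) + (1 / c) *\<^sub>R y) * (1 / c)\<^sup>2 = ?d \<gamma> y * ?d (\<beta> - \<gamma>) e" for y e :: complex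
  proof -
    have arg: "- (sqrt \<rho> * (y - e)) + (1 / c) *\<^sub>R y = (1 / (sqrt \<rho> * \<beta>)) *\<^sub>R y + sqrt \<rho> *\<^sub>R e"
      unfolding ci[symmetric] by (simp add: scaleR_conv_of_real algebra_simps)
    have sq1: "(cmod (y - e))\<^sup>2 = (cmod y)\<^sup>2 - 2 * inner y e + (cmod e)\<^sup>2"
      by (simp add: power2_norm_eq_inner inner_diff_left inner_diff_right inner_commute)
    have sq2: "(cmod ((1 / (sqrt \<rho> * \<beta>)) *\<^sub>R y + sqrt \<rho> *\<^sub>R e))\<^sup>2 = (cmod y)\<^sup>2 / (\<rho> * \<beta>\<^sup>2) + 2 * inner y e / \<beta> + \<rho> * (cmod e)\<^sup>2"
    proof -
      have "(cmod ((1 / (sqrt \<rho> * \<beta>)) *\<^sub>R y + sqrt \<rho> *\<^sub>R e))\<^sup>2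
        = (1 / (sqrt \<rho> * \<beta>)) * (1 / (sqrt \<rho> * \<beta>)) * (cmod y)\<^sup>2 + 2 * ((1 / (sqrt \<rho> * \<beta>)) * sqrt \<rho>) * inner y e + (sqrt \<rho> * sqrt \<rho>) * (cmod e)\<^sup>2"
        by (simp only: power2_norm_eq_inner inner_add_left inner_add_right inner_scaleR_left inner_scaleR_right inner_commute[of e y]) (simp add: algebra_simps)
      also have "(1 / (sqrt \<rho> * \<beta>)) * (1 / (sqrt \<rho> * \<beta>)) = 1 / (\<rho> * \<beta>\<^sup>2)"
        using sr by (simp add: power2_eq_square mult_ac)
      also have "(1 / (sqrt \<rho> * \<beta>)) * sqrt \<rho> = 1 / \<beta>" using \<rho> by simp
      finally show ?thesis unfolding sr by simp
    qed
    have ex: "- (cmod (y - e))\<^sup>2 / \<beta> + - (cmod ((1 / (sqrt \<rho> * \<beta>)) *\<^sub>R y + sqrt \<rho> *\<^sub>R e))\<^sup>2 / 1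
       = - (cmod y)\<^sup>2 / \<gamma> + - (cmod e)\<^sup>2 / (\<beta> - \<gamma>)"
      unfolding sq1 sq2 \<beta>\<gamma> unfolding \<gamma>_def using \<beta> \<rho> \<rho>\<beta> by (simp add: field_simps power2_eq_square)
    have norm: "1 / (pi * \<beta>) * (1 / (pi * 1)) * (1 / c)\<^sup>2 = 1 / (pi * \<gamma>) * (1 / (pi * (\<beta> - \<gamma>)))"
      unfolding \<beta>\<gamma> unfolding \<gamma>_def c_def using \<beta> \<rho> \<rho>\<beta> sr by (simp add: field_simps power2_eq_square)
    have "?d \<beta> (y - e) * ?d 1 (- (sqrt \<rho> * (y - e)) + (1 / c) *\<^sub>R y) * (1 / c)\<^sup>2
      = exp (- (cmod (y - e))\<^sup>2 / \<beta> + - (cmod ((1 / (sqrt \<rho> * \<beta>)) *\<^sub>R y + sqrt \<rho> *\<^sub>R e))\<^sup>2 / 1) * (1 / (pi * \<beta>) * (1 / (pi * 1)) * (1 / c)\<^sup>2)"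
      unfolding arg exp_add by simp
    also have "\<dots> = ?d \<gamma> y * ?d (\<beta> - \<gamma>) e"
      unfolding ex norm exp_add by simp
    finally show ?thesis .
  qed
  show "sets (distr ?M ?B ?\<Psi>) = sets ?R" by (simp cong: sets_pair_measure_cong)
  fix A assume "A \<in> sets (distr ?M ?B ?\<Psi>)"
  then have A [measurable]: "A \<in> sets (borel \<Otimes>\<^sub>M borel)" by simp
  let ?I = "\<lambda>y e. indicator A (y, e) :: ennreal"
  have Im [measurable]: "(\<lambda>z. ?I (f z) (g z)) \<in> borel_measurable M"
    if [measurable]: "f \<in> borel_measurable M" "g \<in> borel_measurable M" for f g and M :: "'z measure"
    by measurable
  have \<Psi>m: "?\<Psi> \<in> measurable ?M ?B"
  proof -
    have "?\<Psi> \<in> measurable (borel \<Otimes>\<^sub>M borel) ?B" unfolding split_beta' by measurable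
    then show ?thesis by (subst measurable_cong_sets[OF sets_pair_measure_cong[OF sets_cgauss sets_cgauss] refl])
  qed
  have "emeasure (distr ?M ?B ?\<Psi>) A = (\<integral>\<^sup>+z. indicator A z \<partial>distr ?M ?B ?\<Psi>)"
    by (rule nn_integral_indicator[symmetric]) simp
  also have "\<dots> = (\<integral>\<^sup>+z. indicator A (?\<Psi> z) \<partial>?M)"
    by (rule nn_integral_distr[OF \<Psi>m]) simp
  also have "\<dots> = (\<integral>\<^sup>+(x::complex). \<integral>\<^sup>+(n::complex). ?I (c * (sqrt \<rho> * x + n)) (c * (sqrt \<rho> * x + n) - x) \<partial>cgauss 1 \<partial>cgauss \<beta>)"
  proof -
    have "(\<lambda>z. indicator A (?\<Psi> z) :: ennreal) \<in> borel_measurable ?M"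
      by (rule measurable_compose[OF \<Psi>m]) measurable
    from G2.nn_integral_fst[OF this] show ?thesis by simp
  qed
  also have "\<dots> = (\<integral>\<^sup>+(x::complex). ?d \<beta> x * (\<integral>\<^sup>+(n::complex). ?d 1 n * ?I (c * (sqrt \<rho> * x + n)) (c * (sqrt \<rho> * x + n) - x) \<partial>lborel) \<partial>lborel)"
  proof -
    have inner: "(\<integral>\<^sup>+n. ?I (c * (sqrt \<rho> * x + n)) (c * (sqrt \<rho> * x + n) - x) \<partial>cgauss 1)
      = (\<integral>\<^sup>+n. ?d 1 n * ?I (c * (sqrt \<rho> * x + n)) (c * (sqrt \<rho> * x + n) - x) \<partial>lborel)" for x :: complex
      by (rule nn_integral_cgauss) measurable
    show ?thesis unfolding inner by (rule nn_integral_cgauss) measurable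
  qed
  also have "\<dots> = (\<integral>\<^sup>+(x::complex). ?d \<beta> x * (ennreal ((1 / c)\<^sup>2) * (\<integral>\<^sup>+(y::complex). ?d 1 (- (sqrt \<rho> * x) + (1 / c) *\<^sub>R y) * ?I y (y - x) \<partial>lborel)) \<partial>lborel)"
  proof (rule nn_integral_cong)
    fix x :: complex
    have "c * (sqrt \<rho> * x + (- (sqrt \<rho> * x) + (1 / c) *\<^sub>R y)) = y" for y :: complex
      using c by (simp add: scaleR_conv_of_real)
    then show "?d \<beta> x * (\<integral>\<^sup>+(n::complex). ?d 1 n * ?I (c * (sqrt \<rho> * x + n)) (c * (sqrt \<rho> * x + n) - x) \<partial>lborel)
      = ?d \<beta> x * (ennreal ((1 / c)\<^sup>2) * (\<integral>\<^sup>+(y::complex). ?d 1 (- (sqrt \<rho> * x) + (1 / c) *\<^sub>R y) * ?I y (y - x) \<partial>lborel))"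
      using c by (subst nn_integral_lborel_complex_affine[of "1 / c" _ "- (sqrt \<rho> * x)"]) simp_all
  qed
  also have "\<dots> = (\<integral>\<^sup>+(x::complex). \<integral>\<^sup>+(y::complex). ?d \<beta> x * (ennreal ((1 / c)\<^sup>2) * (?d 1 (- (sqrt \<rho> * x) + (1 / c) *\<^sub>R y) * ?I y (y - x))) \<partial>lborel \<partial>lborel)"
  proof (rule nn_integral_cong)
    fix x :: complex
    have F: "(\<lambda>y. ennreal (?d 1 (- (sqrt \<rho> * x) + (1 / c) *\<^sub>R y)) * ?I y (y - x)) \<in> borel_measurable lborel"
      by measurable
    then have F': "(\<lambda>y. ennreal ((1 / c)\<^sup>2) * (ennreal (?d 1 (- (sqrt \<rho> * x) + (1 / c) *\<^sub>R y)) * ?I y (y - x))) \<in> borel_measurable lborel"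
      by (rule borel_measurable_times_ennreal[OF borel_measurable_const])
    show "ennreal (?d \<beta> x) * (ennreal ((1 / c)\<^sup>2) * (\<integral>\<^sup>+(y::complex). ?d 1 (- (sqrt \<rho> * x) + (1 / c) *\<^sub>R y) * ?I y (y - x) \<partial>lborel))
      = (\<integral>\<^sup>+(y::complex). ?d \<beta> x * (ennreal ((1 / c)\<^sup>2) * (?d 1 (- (sqrt \<rho> * x) + (1 / c) *\<^sub>R y) * ?I y (y - x))) \<partial>lborel)"
      unfolding nn_integral_cmult[OF F'] nn_integral_cmult[OF F] ..
  qed
  also have "\<dots> = (\<integral>\<^sup>+(y::complex). \<integral>\<^sup>+(x::complex). ?d \<beta> x * (ennreal ((1 / c)\<^sup>2) * (?d 1 (- (sqrt \<rho> * x) + (1 / c) *\<^sub>R y) * ?I y (y - x))) \<partial>lborel \<partial>lborel)"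
    by (rule lborel_pair.Fubini'[symmetric]) measurable
  also have "\<dots> = (\<integral>\<^sup>+(y::complex). \<integral>\<^sup>+(e::complex). ?d \<gamma> y * ?d (\<beta> - \<gamma>) e * ?I y e \<partial>lborel \<partial>lborel)"
  proof (rule nn_integral_cong)
    fix y :: complex
    have "(\<integral>\<^sup>+(x::complex). ?d \<beta> x * (ennreal ((1 / c)\<^sup>2) * (?d 1 (- (sqrt \<rho> * x) + (1 / c) *\<^sub>R y) * ?I y (y - x))) \<partial>lborel)
      = (\<integral>\<^sup>+(e::complex). ?d \<beta> (y - e) * (ennreal ((1 / c)\<^sup>2) * (?d 1 (- (sqrt \<rho> * (y - e)) + (1 / c) *\<^sub>R y) * ?I y e)) \<partial>lborel)"
      by (subst nn_integral_lborel_complex_affine[of "-1" _ y]) simp_all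
    also have "\<dots> = (\<integral>\<^sup>+(e::complex). ?d \<gamma> y * ?d (\<beta> - \<gamma>) e * ?I y e \<partial>lborel)"
    proof (rule nn_integral_cong)
      fix e :: complex
      have "ennreal (?d \<beta> (y - e)) * (ennreal ((1 / c)\<^sup>2) * (ennreal (?d 1 (- (sqrt \<rho> * (y - e)) + (1 / c) *\<^sub>R y)) * ?I y e))
        = ennreal (?d \<beta> (y - e) * ?d 1 (- (sqrt \<rho> * (y - e)) + (1 / c) *\<^sub>R y) * (1 / c)\<^sup>2) * ?I y e"
      proof (rule ac)
        show "0 \<le> ?d \<beta> (y - e)" using \<beta> by simp
      qed simp_all
      then show "ennreal (?d \<beta> (y - e)) * (ennreal ((1 / c)\<^sup>2) * (ennreal (?d 1 (- (sqrt \<rho> * (y - e)) + (1 / c) *\<^sub>R y)) * ?I y e))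
        = ennreal (?d \<gamma> y * ?d (\<beta> - \<gamma>) e) * ?I y e"
        unfolding dens .
    qed
    finally show "(\<integral>\<^sup>+(x::complex). ?d \<beta> x * (ennreal ((1 / c)\<^sup>2) * (?d 1 (- (sqrt \<rho> * x) + (1 / c) *\<^sub>R y) * ?I y (y - x))) \<partial>lborel)
      = (\<integral>\<^sup>+(e::complex). ?d \<gamma> y * ?d (\<beta> - \<gamma>) e * ?I y e \<partial>lborel)" .
  qed
  also have "\<dots> = (\<integral>\<^sup>+(y::complex). ?d \<gamma> y * (\<integral>\<^sup>+(e::complex). ?d (\<beta> - \<gamma>) e * ?I y e \<partial>lborel) \<partial>lborel)"
  proof (rule nn_integral_cong)
    fix y :: complex
    have "(\<integral>\<^sup>+(e::complex). ?d \<gamma> y * ?d (\<beta> - \<gamma>) e * ?I y e \<partial>lborel)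
       = (\<integral>\<^sup>+(e::complex). ?d \<gamma> y * (?d (\<beta> - \<gamma>) e * ?I y e) \<partial>lborel)"
      using \<gamma> \<beta>\<gamma>0 by (intro nn_integral_cong) (simp only: ennreal_mult' divide_nonneg_pos exp_ge_zero mult_pos_pos pi_gt_zero mult.assoc)
    also have "\<dots> = ?d \<gamma> y * (\<integral>\<^sup>+(e::complex). ?d (\<beta> - \<gamma>) e * ?I y e \<partial>lborel)"
      by (rule nn_integral_cmult) measurable
    finally show "(\<integral>\<^sup>+(e::complex). ?d \<gamma> y * ?d (\<beta> - \<gamma>) e * ?I y e \<partial>lborel)
       = ?d \<gamma> y * (\<integral>\<^sup>+(e::complex). ?d (\<beta> - \<gamma>) e * ?I y e \<partial>lborel)" .
  qed
  also have "\<dots> = (\<integral>\<^sup>+(y::complex). \<integral>\<^sup>+(e::complex). ?I y e \<partial>cgauss (\<beta> - \<gamma>) \<partial>cgauss \<gamma>)"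
  proof -
    have inner: "(\<integral>\<^sup>+e. ?I y e \<partial>cgauss (\<beta> - \<gamma>)) = (\<integral>\<^sup>+e. ?d (\<beta> - \<gamma>) e * ?I y e \<partial>lborel)" for y :: complex
      by (rule nn_integral_cgauss) measurable
    show ?thesis unfolding inner by (rule nn_integral_cgauss[symmetric]) measurable
  qed
  also have "\<dots> = (\<integral>\<^sup>+z. indicator A z \<partial>?R)"
  proof -
    have "(\<lambda>z. indicator A z :: ennreal) \<in> borel_measurable ?R"
      by (subst measurable_cong_sets[OF sets_pair_measure_cong[OF sets_cgauss sets_cgauss] refl]) measurable
    from G4.nn_integral_fst[OF this] show ?thesis by simp
  qed
  also have "\<dots> = emeasure ?R A"
    by (rule nn_integral_indicator) (simp cong: sets_pair_measure_cong)
  finally show "emeasure (distr ?M ?B ?\<Psi>) A = emeasure ?R A" .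
qed

section \<open>Independence of regrouped and transformed families\<close>

text \<open>Inside a group, finitely many events of its members form one event of the group's tuple;
  the product formula across the groups and then the one inside each group apply. It serves families
  in which a channel entry and its pilot noise are transformed together.\<close>

lemma (in prob_space) indep_vars_refine:
  assumes outer: "indep_vars (\<lambda>j. PiM (K j) M') (\<lambda>j \<omega>. restrict (\<lambda>i. X i \<omega>) (K j)) J"
    and inner: "\<And>j. j \<in> J \<Longrightarrow> indep_vars M' X (K j)"
    and disj: "disjoint_family_on K J"
  shows "indep_vars M' X (\<Union>j\<in>J. K j)"
  unfolding indep_vars_def2
proof (intro conjI ballI)
  show "random_variable (M' i) (X i)" if "i \<in> (\<Union>j\<in>J. K j)" for i
    using that inner by (auto simp: indep_vars_def2)
  then have rv: "random_variable (M' i) (X i)" if "i \<in> K j" "j \<in> J" for i j using that by blast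
  show "indep_sets (\<lambda>i. {X i -` A \<inter> space M |A. A \<in> sets (M' i)}) (\<Union>j\<in>J. K j)"
  proof (rule indep_setsI)
    show "{X i -` A \<inter> space M |A. A \<in> sets (M' i)} \<subseteq> events" if "i \<in> (\<Union>j\<in>J. K j)" for i
      using that rv by (auto intro: measurable_sets)
    fix A I assume I: "I \<noteq> {}" "I \<subseteq> (\<Union>j\<in>J. K j)" "finite I"
      and A: "\<forall>i\<in>I. A i \<in> {X i -` B \<inter> space M |B. B \<in> sets (M' i)}"
    then have "\<forall>i. \<exists>B. i \<in> I \<longrightarrow> A i = X i -` B \<inter> space M \<and> B \<in> sets (M' i)" by blast
    then obtain B where B: "\<And>i. i \<in> I \<Longrightarrow> A i = X i -` B i \<inter> space M" "\<And>i. i \<in> I \<Longrightarrow> B i \<in> sets (M' i)"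
      by metis
    \<comment> \<open>The groups that meet \<open>I\<close>; finitely many, as a member lies in one
      group only.\<close>
    define J1 where "J1 = {j\<in>J. K j \<inter> I \<noteq> {}}"
    have uniq: "j = j'" if "i \<in> K j" "i \<in> K j'" "j \<in> J" "j' \<in> J" for i j j'
      using disj that by (auto simp: disjoint_family_on_def)
    have "J1 = (\<Union>i\<in>I. {j\<in>J. i \<in> K j})" by (auto simp: J1_def)
    moreover have "finite {j\<in>J. i \<in> K j}" for i
    proof (cases "\<exists>j\<in>J. i \<in> K j")
      case True
      then obtain j where "j \<in> J" "i \<in> K j" by blast
      then have "{j\<in>J. i \<in> K j} = {j}" using uniq by blast
      then show ?thesis by simp
    next
      case False
      then have "{j\<in>J. i \<in> K j} = {}" by blast
      then show ?thesis by (simp only: finite.emptyI)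
    qed
    ultimately have J1: "finite J1" using I by simp
    have J1ne: "J1 \<noteq> {}" using I by (auto simp: J1_def)
    have IJ: "I = (\<Union>j\<in>J1. K j \<inter> I)"
    proof (rule equalityI)
      show "I \<subseteq> (\<Union>j\<in>J1. K j \<inter> I)"
      proof
        fix i assume i: "i \<in> I"
        then obtain j where "j \<in> J" "i \<in> K j" using I(2) by blast
        then show "i \<in> (\<Union>j\<in>J1. K j \<inter> I)" using i by (auto simp: J1_def)
      qed
    qed auto
    define C where "C j = {f \<in> space (PiM (K j) M'). \<forall>i\<in>K j \<inter> I. f i \<in> B i}" for j
    have C: "C j \<in> sets (PiM (K j) M')" for j
      unfolding C_def using I(3) B(2)
      by (intro sets.sets_Collect_finite_All) (auto intro: predE[unfolded pred_def] sets_Collect_single)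
    have E: "(\<lambda>\<omega>. restrict (\<lambda>i. X i \<omega>) (K j)) -` C j \<inter> space M = (\<Inter>i\<in>K j \<inter> I. A i)" if "j \<in> J1" for j
    proof -
      have "X i \<omega> \<in> space (M' i)" if "i \<in> K j" "\<omega> \<in> space M" for i \<omega>
        using rv[OF that(1)] \<open>j \<in> J1\<close> that(2) by (auto simp: J1_def intro: measurable_space)
      moreover have "K j \<inter> I \<noteq> {}" using that by (simp add: J1_def)
      ultimately show ?thesis by (auto simp: C_def B(1) space_PiM)
    qed
    have "prob (\<Inter>i\<in>I. A i) = prob (\<Inter>j\<in>J1. \<Inter>i\<in>K j \<inter> I. A i)"
      using IJ by (intro arg_cong[of _ _ prob]) blast
    also have "\<dots> = prob (\<Inter>j\<in>J1. (\<lambda>\<omega>. restrict (\<lambda>i. X i \<omega>) (K j)) -` C j \<inter> space M)"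
      by (intro arg_cong[of _ _ prob]) (simp add: E)
    also have "\<dots> = (\<Prod>j\<in>J1. prob ((\<lambda>\<omega>. restrict (\<lambda>i. X i \<omega>) (K j)) -` C j \<inter> space M))"
      by (rule indep_varsD[OF outer J1ne J1]) (auto simp: J1_def C)
    also have "\<dots> = (\<Prod>j\<in>J1. \<Prod>i\<in>K j \<inter> I. prob (A i))"
    proof (rule prod.cong[OF refl])
      fix j assume j: "j \<in> J1"
      have "prob (\<Inter>i\<in>K j \<inter> I. A i) = prob (\<Inter>i\<in>K j \<inter> I. X i -` B i \<inter> space M)"
        using B(1) by (intro arg_cong[of _ _ prob]) auto
      also have "\<dots> = (\<Prod>i\<in>K j \<inter> I. prob (X i -` B i \<inter> space M))"
        using j I(3) B(2) by (intro indep_varsD[OF inner[of j]]) (auto simp: J1_def)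
      also have "\<dots> = (\<Prod>i\<in>K j \<inter> I. prob (A i))" using B(1) by (intro prod.cong) auto
      finally show "prob ((\<lambda>\<omega>. restrict (\<lambda>i. X i \<omega>) (K j)) -` C j \<inter> space M) = (\<Prod>i\<in>K j \<inter> I. prob (A i))"
        unfolding E[OF j] .
    qed
    also have "\<dots> = (\<Prod>i\<in>(\<Union>j\<in>J1. K j \<inter> I). prob (A i))"
      using J1 I(3) uniq by (intro prod.UNION_disjoint[symmetric]) (auto simp: J1_def)
    also have "\<dots> = (\<Prod>i\<in>I. prob (A i))" using IJ by simp
    finally show "prob (\<Inter>i\<in>I. A i) = (\<Prod>i\<in>I. prob (A i))" .
  qed
qed

lemma (in prob_space) indep_vars_reindex:
  assumes ind: "indep_vars M' X (f ` I)" and inj: "inj_on f I"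
  shows "indep_vars (\<lambda>i. M' (f i)) (\<lambda>i. X (f i)) I"
  unfolding indep_vars_def2
proof (intro conjI ballI)
  show "random_variable (M' (f i)) (X (f i))" if "i \<in> I" for i
    using that ind by (auto simp: indep_vars_def2)
  show "indep_sets (\<lambda>i. {X (f i) -` A \<inter> space M |A. A \<in> sets (M' (f i))}) I"
  proof (rule indep_setsI)
    show "{X (f i) -` A \<inter> space M |A. A \<in> sets (M' (f i))} \<subseteq> events" if "i \<in> I" for i
      using that ind by (auto simp: indep_vars_def2 intro: measurable_sets)
    fix A J assume J: "J \<noteq> {}" "J \<subseteq> I" "finite J"
      and A: "\<forall>j\<in>J. A j \<in> {X (f j) -` B \<inter> space M |B. B \<in> sets (M' (f j))}"
    define g where "g = the_inv_into J f"
    have injJ: "inj_on f J" using inj J(2) by (rule inj_on_subset)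
    have g: "g (f j) = j" if "j \<in> J" for j using injJ that by (simp add: g_def the_inv_into_f_f)
    have i: "indep_sets (\<lambda>i. {X i -` A \<inter> space M |A. A \<in> sets (M' i)}) (f ` I)" using ind by (simp add: indep_vars_def2)
    have "prob (\<Inter>i\<in>f ` J. A (g i)) = (\<Prod>i\<in>f ` J. prob (A (g i)))"
      by (rule indep_setsD[OF i]) (use J A g in auto)
    then show "prob (\<Inter>j\<in>J. A j) = (\<Prod>j\<in>J. prob (A j))"
      by (simp add: prod.reindex[OF injJ] g)
  qed
qed

lemma (in prob_space) indep_vars_two:
  assumes ind: "indep_var (M' i) (X i) (M' j) (X j)" and ij: "i \<noteq> j"
  shows "indep_vars M' X {i, j}"
  unfolding indep_vars_def2
proof (intro conjI ballI)
  have rv: "random_variable (M' i) (X i)" "random_variable (M' j) (X j)"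
    using indep_var_rv1[OF ind] indep_var_rv2[OF ind] by auto
  show "random_variable (M' k) (X k)" if "k \<in> {i, j}" for k using that rv by auto
  show "indep_sets (\<lambda>i. {X i -` A \<inter> space M |A. A \<in> sets (M' i)}) {i, j}"
  proof (rule indep_setsI)
    show "{X k -` A \<inter> space M |A. A \<in> sets (M' k)} \<subseteq> events" if "k \<in> {i, j}" for k
      using that rv by (auto intro: measurable_sets)
    fix A J assume J: "J \<noteq> {}" "J \<subseteq> {i, j}" "finite J"
      and A: "\<forall>k\<in>J. A k \<in> {X k -` B \<inter> space M |B. B \<in> sets (M' k)}"
    consider "J = {i}" | "J = {j}" | "J = {i, j}" using J by blast
    then show "prob (\<Inter>j\<in>J. A j) = (\<Prod>j\<in>J. prob (A j))"
    proof cases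
      case 3
      with A obtain B B' where B: "A i = X i -` B \<inter> space M" "B \<in> sets (M' i)" "A j = X j -` B' \<inter> space M" "B' \<in> sets (M' j)"
        by auto
      have "A i \<inter> A j = (\<lambda>x. (X i x, X j x)) -` (B \<times> B') \<inter> space M" using B by auto
      then show ?thesis using indep_varD[OF ind B(2,4)] ij by (simp add: 3 B)
    qed auto
  qed
qed

text \<open>Translates the density with respect to \<open>lborel\<close> into an equality of
  measures on \<open>borel\<close>, the form used for all laws here.\<close>

lemma circular_gaussian_distr:
  assumes "circular_gaussian P v X"
  shows "X \<in> borel_measurable P" "distr P borel X = cgauss v"
proof -
  have d: "distr P lborel X = density lborel (\<lambda>z. ennreal (exp (- (cmod z)\<^sup>2 / v) / (pi * v)))" and m: "X \<in> measurable P lborel"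
    using assms by (auto simp: circular_gaussian_def distributed_def)
  show "X \<in> borel_measurable P" using m by simp
  have "distr P borel X = distr P lborel X" by (rule distr_cong) simp_all
  then show "distr P borel X = cgauss v" unfolding d cgauss_def .
qed

section \<open>Zero-forcing vectors\<close>

definition col_mat :: "nat \<Rightarrow> nat \<Rightarrow> (nat \<Rightarrow> nat \<Rightarrow> complex) \<Rightarrow> complex mat" where
  "col_mat N K x = mat N K (\<lambda>(a, s). x s a)"

definition gram_mat :: "nat \<Rightarrow> nat \<Rightarrow> (nat \<Rightarrow> nat \<Rightarrow> complex) \<Rightarrow> complex mat" where
  "gram_mat N K x = mat_adjoint (col_mat N K x) * col_mat N K x"

text \<open>The column with index \<open>s\<close>, from 0, of the pseudo-inverse's adjoint. It
  keeps \<open>the (mat_inverse ...)\<close> as in \<open>zf_precoder\<close>, so that the two agree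
  for singular Gram matrices as well.\<close>

definition zf_vec :: "nat \<Rightarrow> nat \<Rightarrow> (nat \<Rightarrow> nat \<Rightarrow> complex) \<Rightarrow> nat \<Rightarrow> complex vec" where
  "zf_vec N K x s = (col_mat N K x * the (mat_inverse (gram_mat N K x))) *\<^sub>v unit_vec K s"

lemma col_mat_carrier [simp]: "col_mat N K x \<in> carrier_mat N K"
  by (simp add: col_mat_def)

lemma mat_adjoint_carrier: "A \<in> carrier_mat n m \<Longrightarrow> mat_adjoint A \<in> carrier_mat m n"
  unfolding mat_adjoint_def by (intro carrier_matI) auto

lemma mat_adjoint_index:
  assumes "A \<in> carrier_mat n m" "i < m" "j < n"
  shows "mat_adjoint A $$ (i, j) = conjugate (A $$ (j, i))"
  using assms unfolding mat_adjoint_def by (subst mat_of_rows_index) auto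

lemma gram_mat_carrier [simp]: "gram_mat N K x \<in> carrier_mat K K"
  unfolding gram_mat_def by (rule mult_carrier_mat[OF mat_adjoint_carrier]) (rule col_mat_carrier)+

lemma adjoint_mult_vec_index:
  assumes s: "s < K" and v: "v \<in> carrier_vec N"
  shows "(mat_adjoint (col_mat N K x) *\<^sub>v v) $ s = (\<Sum>a<N. cnj (x s a) * v $ a)"
proof -
  let ?A = "mat_adjoint (col_mat N K x)"
  have A: "?A \<in> carrier_mat K N" by (rule mat_adjoint_carrier) simp
  have "(?A *\<^sub>v v) $ s = row ?A s \<bullet> v" using A s by (intro index_mult_mat_vec) auto
  also have "\<dots> = (\<Sum>a\<in>{0..<N}. row ?A s $ a * v $ a)" using v by (simp add: scalar_prod_def)
  also have "\<dots> = (\<Sum>a\<in>{0..<N}. cnj (x s a) * v $ a)"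
  proof (rule sum.cong[OF refl])
    fix a assume "a \<in> {0..<N}"
    then have "row ?A s $ a = cnj (x s a)"
      using A s by (simp add: mat_adjoint_index[OF col_mat_carrier]) (simp add: col_mat_def)
    then show "row ?A s $ a * v $ a = cnj (x s a) * v $ a" by simp
  qed
  finally show ?thesis by (simp add: atLeast0LessThan)
qed

lemma gram_mat_index:
  assumes "s < K" "s' < K"
  shows "gram_mat N K x $$ (s, s') = (\<Sum>a<N. cnj (x s a) * x s' a)"
proof -
  have "gram_mat N K x $$ (s, s') = col (gram_mat N K x) s' $ s"
    using assms carrier_matD[OF gram_mat_carrier, of N K x] by (intro index_col[symmetric]) auto
  also have "col (gram_mat N K x) s' = mat_adjoint (col_mat N K x) *\<^sub>v col (col_mat N K x) s'"
    unfolding gram_mat_def by (rule col_mult2[OF mat_adjoint_carrier[OF col_mat_carrier] col_mat_carrier assms(2)])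
  also have "\<dots> $ s = (\<Sum>a<N. cnj (x s a) * col (col_mat N K x) s' $ a)"
    by (rule adjoint_mult_vec_index[OF assms(1)], rule carrier_vecI, simp add: col_mat_def)
  also have "\<dots> = (\<Sum>a<N. cnj (x s a) * x s' a)"
    using assms by (intro sum.cong) (auto simp: col_mat_def)
  finally show ?thesis .
qed

lemma mat_inverse_eq_None_iff:
  fixes A :: "complex mat"
  assumes A: "A \<in> carrier_mat n n"
  shows "mat_inverse A = None \<longleftrightarrow> det A = 0"
proof
  assume "mat_inverse A = None"
  then show "det A = 0" using mat_inverse(1)[OF A, where b="()"] det_non_zero_imp_unit[OF A, where b="()"] by auto
next
  assume d: "det A = 0"
  show "mat_inverse A = None"
  proof (rule ccontr)
    assume "mat_inverse A \<noteq> None"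
    then obtain B where "mat_inverse A = Some B" by auto
    from mat_inverse(2)[OF A this] have B: "A * B = 1\<^sub>m n" "B \<in> carrier_mat n n" by auto
    then have "det A * det B = 1" by (metis A det_mult det_one)
    with d show False by simp
  qed
qed

lemma zf_vec_dim [simp]: "dim_vec (zf_vec N K x s) = N"
  by (simp add: zf_vec_def col_mat_def)

text \<open>Duality to the columns and membership in their span determine the vector. The arguments
  for nonsingular Gram matrices below rest on these two facts instead of the matrix formula.\<close>

lemma zf_vec_nonsingular:
  assumes d: "det (gram_mat N K x) \<noteq> 0" and s: "s < K"
  shows "\<And>s'. s' < K \<Longrightarrow> (\<Sum>a<N. cnj (x s' a) * zf_vec N K x s $ a) = (if s' = s then 1 else 0)"
    and "\<exists>c. \<forall>a<N. zf_vec N K x s $ a = (\<Sum>s'<K. x s' a * c s')"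
proof -
  let ?H = "col_mat N K x" and ?G = "gram_mat N K x"
  obtain B where "mat_inverse ?G = Some B"
    using d mat_inverse_eq_None_iff[OF gram_mat_carrier, of N K x] by auto
  then have B: "?G * B = 1\<^sub>m K" "B \<in> carrier_mat K K" "the (mat_inverse ?G) = B"
    using mat_inverse(2)[OF gram_mat_carrier] by auto
  have HA: "mat_adjoint ?H \<in> carrier_mat K N" by (rule mat_adjoint_carrier) simp
  have e: "unit_vec K s \<in> carrier_vec K" by simp
  have HB: "?H * B \<in> carrier_mat N K" by (rule mult_carrier_mat[OF col_mat_carrier B(2)])
  have z: "zf_vec N K x s \<in> carrier_vec N" by (rule carrier_vecI) simp
  have "mat_adjoint ?H *\<^sub>v zf_vec N K x s = (mat_adjoint ?H * (?H * B)) *\<^sub>v unit_vec K s"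
    unfolding zf_vec_def B(3) by (rule assoc_mult_mat_vec[symmetric, OF HA HB e])
  also have "mat_adjoint ?H * (?H * B) = ?G * B"
    unfolding gram_mat_def by (rule assoc_mult_mat[symmetric, OF HA col_mat_carrier B(2)])
  also have "\<dots> *\<^sub>v unit_vec K s = unit_vec K s" unfolding B(1) using e by (rule one_mult_mat_vec)
  finally have "mat_adjoint ?H *\<^sub>v zf_vec N K x s = unit_vec K s" .
  then show "(\<Sum>a<N. cnj (x s' a) * zf_vec N K x s $ a) = (if s' = s then 1 else 0)" if "s' < K" for s'
    using adjoint_mult_vec_index[OF that z, of x] that s by (auto simp: unit_vec_def)
  let ?c = "B *\<^sub>v unit_vec K s"
  have c: "?c \<in> carrier_vec K" by (rule mult_mat_vec_carrier[OF B(2) e])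
  have "zf_vec N K x s = ?H *\<^sub>v ?c"
    unfolding zf_vec_def B(3) by (rule assoc_mult_mat_vec[OF col_mat_carrier B(2) e])
  moreover have "(?H *\<^sub>v ?c) $ a = (\<Sum>s'<K. x s' a * ?c $ s')" if "a < N" for a
  proof -
    have "(?H *\<^sub>v ?c) $ a = row ?H a \<bullet> ?c" using that by (intro index_mult_mat_vec) (simp add: col_mat_def)
    also have "\<dots> = (\<Sum>s'\<in>{0..<K}. row ?H a $ s' * ?c $ s')" by (simp only: scalar_prod_def carrier_vecD[OF c])
    also have "\<dots> = (\<Sum>s'\<in>{0..<K}. x s' a * ?c $ s')"
      using that by (intro sum.cong) (auto simp: col_mat_def)
    finally show ?thesis by (simp add: atLeast0LessThan)
  qed
  ultimately show "\<exists>c. \<forall>a<N. zf_vec N K x s $ a = (\<Sum>s'<K. x s' a * c s')"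
    by (intro exI[of _ "\<lambda>s'. ?c $ s'"]) simp
qed

text \<open>\<open>y\<close> is orthogonal to itself. This is the uniqueness principle applied to
  the difference of two candidates for a zero-forcing vector, and to the image of a kernel vector of
  the Gram matrix.\<close>

lemma range_zero_iff:
  fixes x :: "nat \<Rightarrow> nat \<Rightarrow> complex"
  assumes y: "\<And>a. a < N \<Longrightarrow> y a = (\<Sum>s<K. x s a * c s)" and o: "\<And>s. s < K \<Longrightarrow> (\<Sum>a<N. cnj (x s a) * y a) = 0"
  shows "\<forall>a<N. y a = 0"
proof -
  have "(\<Sum>a<N. cnj (y a) * y a) = (\<Sum>a<N. \<Sum>s<K. cnj (c s) * (cnj (x s a) * y a))"
  proof (rule sum.cong[OF refl])
    fix a assume "a \<in> {..<N}"
    then have c: "cnj (y a) = (\<Sum>s<K. cnj (x s a) * cnj (c s))" by (simp add: y)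
    show "cnj (y a) * y a = (\<Sum>s<K. cnj (c s) * (cnj (x s a) * y a))"
      unfolding c sum_distrib_right by (simp add: mult_ac)
  qed
  also have "\<dots> = (\<Sum>s<K. cnj (c s) * (\<Sum>a<N. cnj (x s a) * y a))"
    unfolding sum_distrib_left by (rule sum.swap)
  also have "\<dots> = 0" using o by simp
  finally have "(\<Sum>a<N. cnj (y a) * y a) = 0" .
  moreover have "(\<Sum>a<N. cnj (y a) * y a) = complex_of_real (\<Sum>a<N. (cmod (y a))\<^sup>2)"
    by (simp add: complex_norm_square mult.commute del: of_real_power)
  ultimately have "(\<Sum>a<N. (cmod (y a))\<^sup>2) = 0" by (simp only: of_real_eq_0_iff)
  then show ?thesis by (simp add: sum_nonneg_eq_0_iff)
qed

lemma singular_gram_kernel: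
  assumes d: "det (gram_mat N K x) = 0"
  shows "\<exists>c. (\<exists>s<K. c s \<noteq> 0) \<and> (\<forall>a<N. (\<Sum>s<K. x s a * c s) = 0)"
proof -
  obtain v where v: "v \<in> carrier_vec K" "v \<noteq> 0\<^sub>v K" "gram_mat N K x *\<^sub>v v = 0\<^sub>v K"
    using d det_0_iff_vec_prod_zero[OF gram_mat_carrier, of N K x] by auto
  have ne: "\<exists>s<K. v $ s \<noteq> 0"
  proof (rule ccontr)
    assume "\<not> ?thesis"
    then have "v = 0\<^sub>v K" using v(1) by (intro eq_vecI) auto
    then show False using v(2) by simp
  qed
  let ?y = "\<lambda>a. \<Sum>s<K. x s a * v $ s"
  have "(\<Sum>s'<K. gram_mat N K x $$ (s, s') * v $ s') = 0" if "s < K" for s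
  proof -
    have "(gram_mat N K x *\<^sub>v v) $ s = row (gram_mat N K x) s \<bullet> v"
      using that by (intro index_mult_mat_vec) (simp add: carrier_matD[OF gram_mat_carrier])
    also have "\<dots> = (\<Sum>s'\<in>{0..<K}. row (gram_mat N K x) s $ s' * v $ s')" using v(1) by (simp add: scalar_prod_def)
    also have "\<dots> = (\<Sum>s'\<in>{0..<K}. gram_mat N K x $$ (s, s') * v $ s')"
      using that by (intro sum.cong) (auto simp: carrier_matD[OF gram_mat_carrier])
    finally show ?thesis using that v(3) by (simp add: atLeast0LessThan)
  qed
  then have orth: "(\<Sum>a<N. cnj (x s a) * ?y a) = 0" if "s < K" for s
  proof -
    have "(\<Sum>a<N. cnj (x s a) * ?y a) = (\<Sum>s'<K. (\<Sum>a<N. cnj (x s a) * x s' a) * v $ s')"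
      unfolding sum_distrib_left sum_distrib_right by (subst sum.swap) (simp add: mult.assoc)
    also have "\<dots> = (\<Sum>s'<K. gram_mat N K x $$ (s, s') * v $ s')"
      using that by (intro sum.cong) (auto simp: gram_mat_index)
    finally show ?thesis using \<open>\<And>s. s < K \<Longrightarrow> _ s = 0\<close>[OF that] by simp
  qed
  have "\<forall>a<N. ?y a = 0" by (rule range_zero_iff[OF refl orth])
  then show ?thesis using ne by (intro exI[of _ "\<lambda>s. v $ s"]) auto
qed

text \<open>Signs leave the span of the columns unchanged and alter the dual conditions by signs
  only, so both sides satisfy the same characterisation.\<close>

lemma zf_vec_sign_flip:
  assumes d: "det (gram_mat N K x) \<noteq> 0" and d': "det (gram_mat N K x') \<noteq> 0" and s: "s < K"
    and \<sigma>: "\<And>s. \<sigma> s \<in> {1, -1}" and x': "\<And>s a. s < K \<Longrightarrow> a < N \<Longrightarrow> x' s a = \<sigma> s * x s a" and a: "a < N"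
  shows "zf_vec N K x' s $ a = \<sigma> s * zf_vec N K x s $ a"
proof -
  note z = zf_vec_nonsingular[OF d s] and z' = zf_vec_nonsingular[OF d' s]
  obtain c where c: "\<And>a. a < N \<Longrightarrow> zf_vec N K x s $ a = (\<Sum>s'<K. x s' a * c s')" using z(2) by blast
  obtain c' where c': "\<And>a. a < N \<Longrightarrow> zf_vec N K x' s $ a = (\<Sum>s'<K. x' s' a * c' s')" using z'(2) by blast
  have \<sigma>2: "\<sigma> s * \<sigma> s = 1" "cnj (\<sigma> s) = \<sigma> s" for s using \<sigma>[of s] by auto
  define y where "y a = zf_vec N K x' s $ a - \<sigma> s * zf_vec N K x s $ a" for a
  have "\<forall>a<N. y a = 0"
  proof (rule range_zero_iff)
    show "y a = (\<Sum>s'<K. x s' a * (\<sigma> s' * c' s' - \<sigma> s * c s'))" if "a < N" for a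
      unfolding y_def c[OF that] c'[OF that] using x' that
      by (simp add: sum_distrib_left sum_subtractf[symmetric] algebra_simps)
    fix s' assume s': "s' < K"
    have "(\<Sum>a<N. cnj (x s' a) * zf_vec N K x' s $ a) = (\<Sum>a<N. \<sigma> s' * (cnj (x' s' a) * zf_vec N K x' s $ a))"
      using x'[OF s'] \<sigma>2[of s'] by (intro sum.cong) (auto simp: mult.assoc[symmetric])
    also have "\<dots> = \<sigma> s' * (if s' = s then 1 else 0)"
      unfolding sum_distrib_left[symmetric] z'(1)[OF s'] ..
    finally have 1: "(\<Sum>a<N. cnj (x s' a) * zf_vec N K x' s $ a) = \<sigma> s' * (if s' = s then 1 else 0)" .
    have "(\<Sum>a<N. cnj (x s' a) * y a) = (\<Sum>a<N. cnj (x s' a) * zf_vec N K x' s $ a) - \<sigma> s * (\<Sum>a<N. cnj (x s' a) * zf_vec N K x s $ a)"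
      by (simp add: y_def sum_distrib_left sum_subtractf[symmetric] algebra_simps)
    also have "\<dots> = 0" unfolding 1 z(1)[OF s'] by simp
    finally show "(\<Sum>a<N. cnj (x s' a) * y a) = 0" .
  qed
  then show ?thesis using a by (simp add: y_def)
qed

text \<open>Gram-Schmidt for functions on \<open>I\<close>. The number \<open>r\<close> can fall
  short of \<open>card F\<close>, because a vector without residual contributes no new
  direction.\<close>

lemma exists_orthonormal_span:
  fixes F :: "('i \<Rightarrow> complex) set"
  assumes "finite F" and I: "finite I"
  shows "\<exists>(q :: nat \<Rightarrow> 'i \<Rightarrow> complex) r. r \<le> card F \<and>
     (\<forall>l<r. \<forall>l'<r. (\<Sum>a\<in>I. cnj (q l a) * q l' a) = (if l = l' then 1 else 0)) \<and>
     (\<forall>f\<in>F. \<exists>\<alpha>. \<forall>a\<in>I. f a = (\<Sum>l<r. \<alpha> l * q l a))"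
  using assms(1)
proof (induction F rule: finite_induct)
  case empty
  show ?case by (intro exI[of _ "\<lambda>_ _. 0"] exI[of _ 0]) simp
next
  case (insert f F)
  then obtain q :: "nat \<Rightarrow> 'i \<Rightarrow> complex" and r where r: "r \<le> card F"
    and orth: "\<And>l l'. l < r \<Longrightarrow> l' < r \<Longrightarrow> (\<Sum>a\<in>I. cnj (q l a) * q l' a) = (if l = l' then 1 else 0)"
    and span: "\<And>g. g \<in> F \<Longrightarrow> \<exists>\<alpha>. \<forall>a\<in>I. g a = (\<Sum>l<r. \<alpha> l * q l a)" by blast
  define \<alpha> where "\<alpha> l = (\<Sum>a\<in>I. cnj (q l a) * f a)" for l
  define w where "w a = f a - (\<Sum>l<r. \<alpha> l * q l a)" for a
  have worth: "(\<Sum>a\<in>I. cnj (q l a) * w a) = 0" if "l < r" for l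
  proof -
    have "(\<Sum>a\<in>I. cnj (q l a) * w a) = \<alpha> l - (\<Sum>a\<in>I. \<Sum>l'<r. \<alpha> l' * (cnj (q l a) * q l' a))"
      by (simp add: w_def \<alpha>_def right_diff_distrib sum_subtractf sum_distrib_left mult_ac)
    also have "(\<Sum>a\<in>I. \<Sum>l'<r. \<alpha> l' * (cnj (q l a) * q l' a)) = (\<Sum>l'<r. \<alpha> l' * (if l = l' then 1 else 0))"
      by (subst sum.swap) (simp add: sum_distrib_left[symmetric] orth that)
    also have "\<dots> = (\<Sum>l'<r. if l = l' then \<alpha> l' else 0)" by (intro sum.cong) auto
    also have "\<dots> = \<alpha> l" using that by simp
    finally show ?thesis by simp
  qed
  show ?case
  proof (cases "\<forall>a\<in>I. w a = 0")
    case True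
    then have "\<forall>a\<in>I. f a = (\<Sum>l<r. \<alpha> l * q l a)" by (simp add: w_def)
    then show ?thesis using r orth span insert.hyps by (intro exI[of _ q] exI[of _ r]) auto
  next
    case False
    define n where "n = (\<Sum>a\<in>I. (cmod (w a))\<^sup>2)"
    have n: "n > 0" using False I by (auto simp: n_def order_less_le sum_nonneg sum_nonneg_eq_0_iff intro!: sum_nonneg)
    define q' where "q' l = (if l = r then (\<lambda>a. w a / sqrt n) else q l)" for l
    have nn: "sqrt n * sqrt n = n" using n by simp
    have nn': "complex_of_real (sqrt n) * complex_of_real (sqrt n) = complex_of_real n"
      using nn by (simp flip: of_real_mult)
    have ww: "(\<Sum>a\<in>I. cnj (w a) * w a) = complex_of_real n"
      by (simp add: n_def complex_norm_square mult.commute del: of_real_power)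
    have orth': "(\<Sum>a\<in>I. cnj (q' l a) * q' l' a) = (if l = l' then 1 else 0)" if l: "l < Suc r" "l' < Suc r" for l l'
    proof -
      consider "l = r" "l' = r" | "l = r" "l' < r" | "l < r" "l' = r" | "l < r" "l' < r" using l by linarith
      then show ?thesis
      proof cases
        case 1
        have "(\<Sum>a\<in>I. cnj (q' l a) * q' l' a) = (\<Sum>a\<in>I. cnj (w a) * w a) / (complex_of_real (sqrt n) * complex_of_real (sqrt n))"
          using 1 by (simp add: q'_def sum_divide_distrib)
        then show ?thesis using 1 n unfolding ww nn' by simp
      next
        case 2
        have "(\<Sum>a\<in>I. cnj (q' l a) * q' l' a) = cnj (\<Sum>a\<in>I. cnj (q l' a) * w a) / sqrt n"
          using 2 by (simp add: q'_def sum_divide_distrib mult.commute)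
        then show ?thesis using 2 worth by simp
      next
        case 3
        have "(\<Sum>a\<in>I. cnj (q' l a) * q' l' a) = (\<Sum>a\<in>I. cnj (q l a) * w a) / sqrt n"
          using 3 by (simp add: q'_def sum_divide_distrib)
        then show ?thesis using 3 worth by simp
      next
        case 4
        then show ?thesis using orth by (simp add: q'_def)
      qed
    qed
    have f': "f a = (\<Sum>l<Suc r. (if l = r then complex_of_real (sqrt n) else \<alpha> l) * q' l a)" for a
      using n by (simp add: q'_def w_def)
    have span': "\<exists>\<alpha>. \<forall>a\<in>I. g a = (\<Sum>l<Suc r. \<alpha> l * q' l a)" if g: "g \<in> insert f F" for g
    proof (cases "g = f")
      case True
      then show ?thesis using f' by (intro exI[of _ "\<lambda>l. if l = r then complex_of_real (sqrt n) else \<alpha> l"]) simp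
    next
      case False
      then obtain \<alpha>' where "\<forall>a\<in>I. g a = (\<Sum>l<r. \<alpha>' l * q l a)" using span g by blast
      then show ?thesis by (intro exI[of _ "\<lambda>l. if l = r then 0 else \<alpha>' l"]) (simp add: q'_def)
    qed
    show ?thesis
      using r insert.hyps orth' span' by (intro exI[of _ q'] exI[of _ "Suc r"]) auto
  qed
qed

text \<open>\<open>w\<close> is the component of \<open>f\<close> orthogonal to all
  \<open>q l\<close>, and \<open>D\<close> is its squared norm in the form in which the Gaussian
  integral delivers it.\<close>

lemma residual_decomposition:
  fixes q :: "'l \<Rightarrow> 'i \<Rightarrow> complex" and f :: "'i \<Rightarrow> complex" and I :: "'i set" and J :: "'l set"
  assumes fin: "finite J"
    and orth: "\<And>l l'. l \<in> J \<Longrightarrow> l' \<in> J \<Longrightarrow> (\<Sum>a\<in>I. cnj (q l a) * q l' a) = (if l = l' then 1 else 0)"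
  defines "D \<equiv> (\<Sum>a\<in>I. (cmod (f a))\<^sup>2) - (\<Sum>l\<in>J. (cmod (\<Sum>a\<in>I. cnj (q l a) * f a))\<^sup>2)"
  obtains w where "\<And>g \<alpha>. (\<And>a. a \<in> I \<Longrightarrow> g a = (\<Sum>l\<in>J. \<alpha> l * q l a)) \<Longrightarrow> (\<Sum>a\<in>I. cnj (w a) * g a) = 0"
    and "(\<Sum>a\<in>I. cnj (w a) * f a) = complex_of_real D" and "(\<Sum>a\<in>I. (cmod (w a))\<^sup>2) = D"
proof -
  define \<alpha> where "\<alpha> l = (\<Sum>a\<in>I. cnj (q l a) * f a)" for l
  define w where "w a = f a - (\<Sum>l\<in>J. \<alpha> l * q l a)" for a
  have worth: "(\<Sum>a\<in>I. cnj (q l a) * w a) = 0" if "l \<in> J" for l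
  proof -
    have "(\<Sum>a\<in>I. cnj (q l a) * w a) = \<alpha> l - (\<Sum>a\<in>I. \<Sum>l'\<in>J. \<alpha> l' * (cnj (q l a) * q l' a))"
      by (simp add: w_def \<alpha>_def right_diff_distrib sum_subtractf sum_distrib_left mult_ac)
    also have "(\<Sum>a\<in>I. \<Sum>l'\<in>J. \<alpha> l' * (cnj (q l a) * q l' a)) = (\<Sum>l'\<in>J. \<alpha> l' * (if l = l' then 1 else 0))"
      by (subst sum.swap) (simp add: sum_distrib_left[symmetric] orth that)
    also have "\<dots> = (\<Sum>l'\<in>J. if l = l' then \<alpha> l' else 0)" by (intro sum.cong) auto
    also have "\<dots> = \<alpha> l" using that fin by simp
    finally show ?thesis by simp
  qed
  have 1: "(\<Sum>a\<in>I. cnj (w a) * g a) = 0" if g: "\<And>a. a \<in> I \<Longrightarrow> g a = (\<Sum>l\<in>J. \<alpha>' l * q l a)" for g \<alpha>'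
  proof -
    have "(\<Sum>a\<in>I. cnj (w a) * g a) = (\<Sum>a\<in>I. \<Sum>l\<in>J. \<alpha>' l * (cnj (w a) * q l a))"
      using g by (intro sum.cong) (auto simp: sum_distrib_left mult_ac)
    also have "\<dots> = (\<Sum>l\<in>J. \<alpha>' l * (\<Sum>a\<in>I. cnj (w a) * q l a))"
      by (subst sum.swap) (simp add: sum_distrib_left)
    also have "\<dots> = (\<Sum>l\<in>J. \<alpha>' l * cnj (\<Sum>a\<in>I. cnj (q l a) * w a))"
      by (simp add: mult.commute)
    also have "\<dots> = 0" using worth by simp
    finally show ?thesis .
  qed
  have f: "f a = w a + (\<Sum>l\<in>J. \<alpha> l * q l a)" for a by (simp add: w_def)
  have proj0: "(\<Sum>a\<in>I. cnj (w a) * (\<Sum>l\<in>J. \<alpha> l * q l a)) = 0" by (rule 1) simp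
  have "(\<Sum>a\<in>I. cnj (w a) * f a) = (\<Sum>a\<in>I. cnj (w a) * w a) + (\<Sum>a\<in>I. cnj (w a) * (\<Sum>l\<in>J. \<alpha> l * q l a))"
    by (subst f) (simp add: distrib_left sum.distrib)
  then have wf: "(\<Sum>a\<in>I. cnj (w a) * f a) = (\<Sum>a\<in>I. cnj (w a) * w a)" using proj0 by simp
  have ww: "(\<Sum>a\<in>I. cnj (w a) * w a) = complex_of_real (\<Sum>a\<in>I. (cmod (w a))\<^sup>2)"
    by (simp add: complex_norm_square mult.commute del: of_real_power)
  have "(\<Sum>a\<in>I. cnj (w a) * f a) = (\<Sum>a\<in>I. cnj (f a) * f a) - (\<Sum>a\<in>I. \<Sum>l\<in>J. cnj (\<alpha> l) * (cnj (q l a) * f a))"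
    by (simp add: w_def left_diff_distrib sum_subtractf sum_distrib_right mult.assoc)
  also have "(\<Sum>a\<in>I. \<Sum>l\<in>J. cnj (\<alpha> l) * (cnj (q l a) * f a)) = (\<Sum>l\<in>J. cnj (\<alpha> l) * \<alpha> l)"
    unfolding \<alpha>_def by (subst sum.swap) (simp add: sum_distrib_left)
  also have "(\<Sum>a\<in>I. cnj (f a) * f a) - (\<Sum>l\<in>J. cnj (\<alpha> l) * \<alpha> l) = complex_of_real D"
    unfolding D_def \<alpha>_def of_real_diff of_real_sum complex_norm_square by (simp add: mult.commute)
  finally have wD: "(\<Sum>a\<in>I. cnj (w a) * f a) = complex_of_real D" .
  have "(\<Sum>a\<in>I. (cmod (w a))\<^sup>2) = D" using wD wf ww by (simp only: of_real_eq_iff)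
  with 1 wD show ?thesis by (rule that)
qed

text \<open>Let \<open>V\<close> be the squared norm of the zero-forcing vector. By duality,
  \<open>V\<close> is also its coefficient on column \<open>s\<close>; the residual \<open>w\<close>
  of that column is orthogonal to all other columns, so pairing the vector with \<open>w\<close>
  gives \<open>V * D\<close>. Cauchy-Schwarz bounds this by \<open>sqrt (V * D)\<close>. The product
  form does not presuppose \<open>D > 0\<close>.\<close>

lemma zf_vec_norm_le:
  fixes q x :: "nat \<Rightarrow> nat \<Rightarrow> complex" and N K r s :: nat
  assumes d: "det (gram_mat N K x) \<noteq> 0" and s: "s < K"
    and orth: "\<And>l l'. l < r \<Longrightarrow> l' < r \<Longrightarrow> (\<Sum>a<N. cnj (q l a) * q l' a) = (if l = l' then 1 else 0)"
    and span: "\<And>s'. s' < K \<Longrightarrow> s' \<noteq> s \<Longrightarrow> \<exists>\<alpha>. \<forall>a<N. x s' a = (\<Sum>l<r. \<alpha> l * q l a)"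
  defines "D \<equiv> (\<Sum>a<N. (cmod (x s a))\<^sup>2) - (\<Sum>l<r. (cmod (\<Sum>a<N. cnj (q l a) * x s a))\<^sup>2)"
  shows "D * (\<Sum>a<N. (cmod (zf_vec N K x s $ a))\<^sup>2) \<le> 1"
proof -
  let ?v = "\<lambda>a. zf_vec N K x s $ a"
  note z = zf_vec_nonsingular[OF d s]
  obtain c where c: "\<And>a. a < N \<Longrightarrow> ?v a = (\<Sum>s'<K. x s' a * c s')" using z(2) by blast
  obtain w where w: "\<And>g \<alpha>. (\<And>a. a \<in> {..<N} \<Longrightarrow> g a = (\<Sum>l\<in>{..<r}. \<alpha> l * q l a)) \<Longrightarrow> (\<Sum>a<N. cnj (w a) * g a) = 0"
    and wx: "(\<Sum>a<N. cnj (w a) * x s a) = complex_of_real D" and ww: "(\<Sum>a<N. (cmod (w a))\<^sup>2) = D"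
    unfolding D_def
  proof (rule residual_decomposition[where J="{..<r}" and I="{..<N}" and q=q and f="x s"])
    show "(\<Sum>a<N. cnj (q l a) * q l' a) = (if l = l' then 1 else 0)" if "l \<in> {..<r}" "l' \<in> {..<r}" for l l'
      using that by (intro orth) auto
    fix w assume 1: "\<And>g \<alpha>. (\<And>a. a \<in> {..<N} \<Longrightarrow> g a = (\<Sum>l<r. \<alpha> l * q l a)) \<Longrightarrow> (\<Sum>a<N. cnj (w a) * g a) = 0"
      and 2: "(\<Sum>a<N. cnj (w a) * x s a) = complex_of_real ((\<Sum>a<N. (cmod (x s a))\<^sup>2) - (\<Sum>l<r. (cmod (\<Sum>a<N. cnj (q l a) * x s a))\<^sup>2))" and 3: "(\<Sum>a<N. (cmod (w a))\<^sup>2) = (\<Sum>a<N. (cmod (x s a))\<^sup>2) - (\<Sum>l<r. (cmod (\<Sum>a<N. cnj (q l a) * x s a))\<^sup>2)"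
    show thesis by (rule that[unfolded D_def, OF 1 2 3])
  qed simp
  define V where "V = (\<Sum>a<N. (cmod (?v a))\<^sup>2)"
  have D0: "D \<ge> 0" unfolding ww[symmetric] by (intro sum_nonneg) simp
  have V0: "V \<ge> 0" unfolding V_def by (intro sum_nonneg) simp
  have "complex_of_real V = (\<Sum>a<N. cnj (?v a) * ?v a)"
    by (simp add: V_def complex_norm_square mult.commute del: of_real_power)
  also have "\<dots> = (\<Sum>a<N. \<Sum>s'<K. cnj (c s') * (cnj (x s' a) * ?v a))"
  proof (rule sum.cong[OF refl])
    fix a assume "a \<in> {..<N}"
    then have "cnj (?v a) = (\<Sum>s'<K. cnj (x s' a) * cnj (c s'))" by (simp add: c)
    then show "cnj (?v a) * ?v a = (\<Sum>s'<K. cnj (c s') * (cnj (x s' a) * ?v a))"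
      by (simp only: sum_distrib_right) (simp add: mult_ac)
  qed
  also have "\<dots> = (\<Sum>s'<K. cnj (c s') * (\<Sum>a<N. cnj (x s' a) * ?v a))"
    unfolding sum_distrib_left by (rule sum.swap)
  also have "\<dots> = (\<Sum>s'<K. if s' = s then cnj (c s') else 0)" using z(1) by (intro sum.cong) auto
  also have "\<dots> = cnj (c s)" using s by simp
  finally have "complex_of_real V = cnj (c s)" .
  then have cV: "c s = complex_of_real V" by (metis complex_cnj_cnj complex_cnj_complex_of_real)
  have "(\<Sum>a<N. cnj (w a) * ?v a) = (\<Sum>a<N. \<Sum>s'<K. c s' * (cnj (w a) * x s' a))"
    using c by (intro sum.cong) (auto simp: sum_distrib_left mult_ac)
  also have "\<dots> = (\<Sum>s'<K. c s' * (\<Sum>a<N. cnj (w a) * x s' a))"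
    unfolding sum_distrib_left by (rule sum.swap)
  also have "\<dots> = (\<Sum>s'<K. if s' = s then c s * complex_of_real D else 0)"
  proof (rule sum.cong[OF refl])
    fix s' assume s': "s' \<in> {..<K}"
    show "c s' * (\<Sum>a<N. cnj (w a) * x s' a) = (if s' = s then c s * complex_of_real D else 0)"
    proof (cases "s' = s")
      case False
      then obtain \<alpha> where "\<forall>a<N. x s' a = (\<Sum>l<r. \<alpha> l * q l a)" using span s' by blast
      then have "(\<Sum>a<N. cnj (w a) * x s' a) = 0" by (intro w[of _ \<alpha>]) auto
      then show ?thesis using False by simp
    qed (simp add: wx)
  qed
  also have "\<dots> = complex_of_real (V * D)" using s by (simp add: cV)
  finally have wv: "(\<Sum>a<N. cnj (w a) * ?v a) = complex_of_real (V * D)" .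
  have "V * D \<le> (\<Sum>a<N. \<bar>cmod (w a)\<bar> * \<bar>cmod (?v a)\<bar>)"
  proof -
    have "V * D = cmod (\<Sum>a<N. cnj (w a) * ?v a)" unfolding wv norm_of_real using V0 D0 by simp
    also have "\<dots> \<le> (\<Sum>a<N. \<bar>cmod (w a)\<bar> * \<bar>cmod (?v a)\<bar>)"
      by (rule order.trans[OF norm_sum]) (simp add: norm_mult)
    finally show ?thesis .
  qed
  also have "\<dots> \<le> L2_set (\<lambda>a. cmod (w a)) {..<N} * L2_set (\<lambda>a. cmod (?v a)) {..<N}"
    by (rule L2_set_mult_ineq)
  also have "\<dots> = sqrt D * sqrt V" by (simp add: L2_set_def ww V_def)
  also have "\<dots> = sqrt (V * D)" by (simp add: real_sqrt_mult)
  finally have le: "V * D \<le> sqrt (V * D)" .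
  have "V * D \<le> 1"
  proof (rule ccontr)
    assume "\<not> V * D \<le> 1"
    then have g: "V * D > 1" by simp
    then have "V * D < (V * D)\<^sup>2" using mult_strict_right_mono[of 1 "V * D" "V * D"] g by (simp add: power2_eq_square)
    then have "sqrt (V * D) < sqrt ((V * D)\<^sup>2)" by (rule real_sqrt_less_mono)
    then have "sqrt (V * D) < V * D" using g by simp
    then show False using le by simp
  qed
  then show ?thesis by (simp add: V_def mult.commute)
qed

text \<open>The first \<open>k\<close> columns are independent, so a vanishing combination of all
  columns involves column \<open>k\<close>. That column then lies in the span of the others and has
  no residual.\<close>

lemma residual_zero_if_singular:
  fixes q :: "nat \<Rightarrow> nat \<Rightarrow> complex"
  assumes d: "det (gram_mat N k x) \<noteq> 0" and d': "det (gram_mat N (Suc k) x) = 0"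
    and orth: "\<And>l l'. l < r \<Longrightarrow> l' < r \<Longrightarrow> (\<Sum>a<N. cnj (q l a) * q l' a) = (if l = l' then 1 else 0)"
    and span: "\<And>s. s < k \<Longrightarrow> \<exists>\<alpha>. \<forall>a<N. x s a = (\<Sum>l<r. \<alpha> l * q l a)"
  shows "(\<Sum>a<N. (cmod (x k a))\<^sup>2) - (\<Sum>l<r. (cmod (\<Sum>a<N. cnj (q l a) * x k a))\<^sup>2) = 0" (is "?D = 0")
proof -
  obtain c s where c: "s < Suc k" "c s \<noteq> 0" "\<And>a. a < N \<Longrightarrow> (\<Sum>s<Suc k. x s a * c s) = 0"
    using singular_gram_kernel[OF d'] by blast
  have ck: "c k \<noteq> 0"
  proof
    assume ck: "c k = 0"
    then have s: "s < k" using c by (cases "s = k") auto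
    \<comment> \<open>Pairing the vanishing combination with the dual vector of column
      \<open>s\<close> returns the coefficient \<open>c s\<close>, which is nonzero.\<close>
    note z = zf_vec_nonsingular(1)[OF d s]
    have "0 = (\<Sum>a<N. cnj (zf_vec N k x s $ a) * (\<Sum>s'<k. x s' a * c s'))"
      using c(3) ck by simp
    also have "\<dots> = (\<Sum>a<N. \<Sum>s'<k. c s' * cnj (cnj (x s' a) * zf_vec N k x s $ a))"
      by (simp add: sum_distrib_left mult_ac)
    also have "\<dots> = (\<Sum>s'<k. c s' * cnj (\<Sum>a<N. cnj (x s' a) * zf_vec N k x s $ a))"
      unfolding cnj_sum sum_distrib_left by (rule sum.swap)
    also have "\<dots> = (\<Sum>s'<k. if s' = s then c s' else 0)" using z by (intro sum.cong) auto
    also have "\<dots> = c s" using s by simp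
    finally show False using c(2) by simp
  qed
  obtain w where w: "\<And>g \<alpha>. (\<And>a. a \<in> {..<N} \<Longrightarrow> g a = (\<Sum>l\<in>{..<r}. \<alpha> l * q l a)) \<Longrightarrow> (\<Sum>a<N. cnj (w a) * g a) = 0"
    and wx: "(\<Sum>a<N. cnj (w a) * x k a) = complex_of_real ?D"
  proof (rule residual_decomposition[where J="{..<r}" and I="{..<N}" and q=q and f="x k"])
    show "(\<Sum>a<N. cnj (q l a) * q l' a) = (if l = l' then 1 else 0)" if "l \<in> {..<r}" "l' \<in> {..<r}" for l l'
      using that by (intro orth) auto
    fix w assume 1: "\<And>g \<alpha>. (\<And>a. a \<in> {..<N} \<Longrightarrow> g a = (\<Sum>l<r. \<alpha> l * q l a)) \<Longrightarrow> (\<Sum>a<N. cnj (w a) * g a) = 0"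
      and 2: "(\<Sum>a<N. cnj (w a) * x k a) = complex_of_real ((\<Sum>a<N. (cmod (x k a))\<^sup>2) - (\<Sum>l<r. (cmod (\<Sum>a<N. cnj (q l a) * x k a))\<^sup>2))" and 3: "(\<Sum>a<N. (cmod (w a))\<^sup>2) = (\<Sum>a<N. (cmod (x k a))\<^sup>2) - (\<Sum>l<r. (cmod (\<Sum>a<N. cnj (q l a) * x k a))\<^sup>2)"
    show thesis by (rule that[OF 1 2])
  qed simp
  have ws: "(\<Sum>a<N. cnj (w a) * x s a) = 0" if s: "s < k" for s
  proof -
    obtain \<alpha> where "\<forall>a<N. x s a = (\<Sum>l<r. \<alpha> l * q l a)" using span s by blast
    then show ?thesis by (intro w[of _ \<alpha>]) auto
  qed
  have "0 = (\<Sum>a<N. cnj (w a) * (\<Sum>s<Suc k. x s a * c s))" using c(3) by simp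
  also have "\<dots> = (\<Sum>a<N. \<Sum>s<Suc k. c s * (cnj (w a) * x s a))"
    by (simp only: sum_distrib_left) (simp add: mult_ac)
  also have "\<dots> = (\<Sum>s<Suc k. c s * (\<Sum>a<N. cnj (w a) * x s a))"
    unfolding sum_distrib_left by (rule sum.swap)
  also have "\<dots> = c k * complex_of_real ?D" using ws wx by simp
  finally have cD: "0 = c k * complex_of_real ?D" .
  have "complex_of_real ?D = 0" using mult_eq_0_iff[THEN iffD1, OF cD[symmetric]] ck by blast
  then show ?thesis by (simp only: of_real_eq_0_iff)
qed

section \<open>Measurability of the zero-forcing vectors\<close>

lemma det_measurable:
  fixes f :: "nat \<Rightarrow> nat \<Rightarrow> 'w \<Rightarrow> complex"
  assumes f: "\<And>i j. i < n \<Longrightarrow> j < n \<Longrightarrow> f i j \<in> borel_measurable M"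
  shows "(\<lambda>\<omega>. det (mat n n (\<lambda>(i, j). f i j \<omega>))) \<in> borel_measurable M"
proof -
  have eq: "det (mat n n (\<lambda>(i, j). f i j \<omega>)) = (\<Sum>p\<in>{p. p permutes {0..<n}}. signof p * (\<Prod>i = 0..<n. f i (p i) \<omega>))" for \<omega>
  proof -
    have "(\<Prod>i = 0..<n. mat n n (\<lambda>(i, j). f i j \<omega>) $$ (i, p i)) = (\<Prod>i = 0..<n. f i (p i) \<omega>)" if "p permutes {0..<n}" for p
    proof (rule prod.cong[OF refl])
      fix i assume i: "i \<in> {0..<n}"
      then have "p i \<in> {0..<n}" using that by (simp only: permutes_in_image)
      then show "mat n n (\<lambda>(i, j). f i j \<omega>) $$ (i, p i) = f i (p i) \<omega>" using i by simp
    qed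
    then show ?thesis by (subst det_def'[of _ n]) (auto intro!: sum.cong)
  qed
  show ?thesis unfolding eq
  proof (intro borel_measurable_sum borel_measurable_times borel_measurable_const borel_measurable_prod)
    fix p i assume "p \<in> {p. p permutes {0..<n}}" "i \<in> {0..<n}"
    then have "p i \<in> {0..<n}" "i < n" using permutes_in_image[of p "{0..<n}" i] by auto
    then show "(\<lambda>\<omega>. f i (p i) \<omega>) \<in> borel_measurable M" using f[of i "p i"] by simp
  qed
qed

lemma gram_mat_eq: "gram_mat N K x = mat K K (\<lambda>(s, s'). \<Sum>a<N. cnj (x s a) * x s' a)"
  by (rule eq_matI) (auto simp: gram_mat_index carrier_matD[OF gram_mat_carrier])

text \<open>Cramer's rule writes the entries as rational functions of the columns and their
  conjugates, from which measurability can be read off; \<open>mat_inverse\<close> itself is an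
  elimination procedure.\<close>

lemma zf_vec_adj:
  assumes d: "det (gram_mat N K x) \<noteq> 0" and s: "s < K" and a: "a < N"
  shows "zf_vec N K x s $ a = (\<Sum>s'<K. x s' a * (adj_mat (gram_mat N K x) $$ (s', s) / det (gram_mat N K x)))"
proof -
  let ?G = "gram_mat N K x"
  note z = zf_vec_nonsingular[OF d s] and adj = adj_mat[OF gram_mat_carrier, of N K x]
  obtain c where c: "\<And>a. a < N \<Longrightarrow> zf_vec N K x s $ a = (\<Sum>s'<K. x s' a * c s')" using z(2) by blast
  define y where "y a = zf_vec N K x s $ a - (\<Sum>s'<K. x s' a * (adj_mat ?G $$ (s', s) / det ?G))" for a
  have "\<forall>a<N. y a = 0"
  proof (rule range_zero_iff)
    show "y a = (\<Sum>s'<K. x s' a * (c s' - adj_mat ?G $$ (s', s) / det ?G))" if "a < N" for a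
      unfolding y_def c[OF that] by (simp add: right_diff_distrib sum_subtractf)
    fix t assume t: "t < K"
    have "(\<Sum>a<N. cnj (x t a) * (\<Sum>s'<K. x s' a * (adj_mat ?G $$ (s', s) / det ?G)))
      = (\<Sum>s'<K. (\<Sum>a<N. cnj (x t a) * x s' a) * (adj_mat ?G $$ (s', s) / det ?G))"
      unfolding sum_distrib_left sum_distrib_right by (subst sum.swap) (simp add: mult.assoc)
    also have "\<dots> = (\<Sum>s'\<in>{0..<K}. ?G $$ (t, s') * adj_mat ?G $$ (s', s)) / det ?G"
      using t by (simp add: gram_mat_index sum_divide_distrib atLeast0LessThan)
    also have "(\<Sum>s'\<in>{0..<K}. ?G $$ (t, s') * adj_mat ?G $$ (s', s)) = (?G * adj_mat ?G) $$ (t, s)"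
      using t s adj(1) carrier_matD[OF gram_mat_carrier, of N K x]
      by (subst index_mult_mat) (auto simp: scalar_prod_def intro!: sum.cong)
    also have "(?G * adj_mat ?G) $$ (t, s) = det ?G * (if t = s then 1 else 0)"
      unfolding adj(2) using t s by simp
    finally have "(\<Sum>a<N. cnj (x t a) * (\<Sum>s'<K. x s' a * (adj_mat ?G $$ (s', s) / det ?G))) = (if t = s then 1 else 0)"
      using d by simp
    then show "(\<Sum>a<N. cnj (x t a) * y a) = 0"
      using z(1)[OF t] by (simp add: y_def right_diff_distrib sum_subtractf)
  qed
  then show ?thesis using a by (simp add: y_def)
qed

text \<open>Beyond the dimension an entry is a value of \<open>undef_vec\<close> that does not
  depend on \<omega>. Such entries cannot be excluded for the matrix \<open>the None\<close>, whose
  dimensions are unknown.\<close>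

lemma vec_index_measurable:
  fixes f :: "'w \<Rightarrow> nat \<Rightarrow> complex"
  assumes f: "\<And>j. j < n \<Longrightarrow> (\<lambda>\<omega>. f \<omega> j) \<in> borel_measurable M"
  shows "(\<lambda>\<omega>. vec n (f \<omega>) $ i) \<in> borel_measurable M"
proof (cases "i < n")
  case True
  then show ?thesis using f by simp
next
  case False
  have "vec n (f \<omega>) $ i = undef_vec (i - n)" for \<omega>
    using False by transfer (simp add: mk_vec_def)
  then show ?thesis by simp
qed

text \<open>On the null event of a singular Gram matrix the precoder is a fixed matrix of unknown
  dimensions applied to the estimates; it is still a measurable function of them.\<close>

lemma zf_vec_measurable:
  fixes f :: "nat \<Rightarrow> nat \<Rightarrow> 'w \<Rightarrow> complex"
  assumes f [measurable]: "\<And>s a. s < K \<Longrightarrow> a < N \<Longrightarrow> f s a \<in> borel_measurable M" and s: "s < K" and a: "a < N"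
  shows "(\<lambda>\<omega>. zf_vec N K (\<lambda>s a. f s a \<omega>) s $ a) \<in> borel_measurable M"
    and "(\<lambda>\<omega>. det (gram_mat N K (\<lambda>s a. f s a \<omega>))) \<in> borel_measurable M"
proof -
  let ?G = "\<lambda>\<omega>. gram_mat N K (\<lambda>s a. f s a \<omega>)"
  define e where "e i j \<omega> = (\<Sum>a<N. cnj (f i a \<omega>) * f j a \<omega>)" for i j \<omega>
  have cnj_m [measurable]: "cnj \<in> borel_measurable borel"
    by (intro borel_measurable_continuous_onI continuous_intros)
  have e: "e i j \<in> borel_measurable M" if "i < K" "j < K" for i j
    unfolding e_def using that by measurable
  have G: "?G \<omega> = mat K K (\<lambda>(i, j). e i j \<omega>)" for \<omega> by (simp add: gram_mat_eq e_def)
  show det: "(\<lambda>\<omega>. det (?G \<omega>)) \<in> borel_measurable M"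
    unfolding G by (rule det_measurable[OF e])
  have adj: "(\<lambda>\<omega>. adj_mat (?G \<omega>) $$ (i, j)) \<in> borel_measurable M" if ij: "i < K" "j < K" for i j
  proof -
    let ?k = "\<lambda>m i. if i < m then i else Suc i"
    have eq: "adj_mat (?G \<omega>) $$ (i, j) = (-1) ^ (j + i) * det (mat (K - 1) (K - 1) (\<lambda>(i', j'). e (?k j i') (?k i j') \<omega>))" for \<omega>
    proof -
      have "mat_delete (?G \<omega>) j i = mat (K - 1) (K - 1) (\<lambda>(i', j'). e (?k j i') (?k i j') \<omega>)"
        unfolding G mat_delete_def by (rule eq_matI) auto
      then show ?thesis
        using ij by (simp add: adj_mat_def cofactor_def carrier_matD[OF gram_mat_carrier])
    qed
    show ?thesis unfolding eq
      by (intro borel_measurable_times borel_measurable_const det_measurable e) auto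
  qed
  let ?X = "the None :: complex mat"
  have junk: "(\<lambda>\<omega>. ((col_mat N K (\<lambda>s a. f s a \<omega>) * ?X) *\<^sub>v unit_vec K s) $ a) \<in> borel_measurable M"
  proof -
    let ?H = "\<lambda>\<omega>. col_mat N K (\<lambda>s a. f s a \<omega>)"
    have rH: "row (?H \<omega>) a = vec K (\<lambda>s. f s a \<omega>)" for \<omega>
      using a by (intro eq_vecI) (auto simp: col_mat_def)
    have rHX: "row (?H \<omega> * ?X) a = vec (dim_col ?X) (\<lambda>j. \<Sum>i\<in>{0..<dim_row ?X}. vec K (\<lambda>s. f s a \<omega>) $ i * col ?X j $ i)" for \<omega>
      using a by (intro eq_vecI) (auto simp: col_mat_def scalar_prod_def rH[unfolded col_mat_def])
    have eq: "((?H \<omega> * ?X) *\<^sub>v unit_vec K s) $ a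
      = (\<Sum>l\<in>{0..<K}. vec (dim_col ?X) (\<lambda>j. \<Sum>i\<in>{0..<dim_row ?X}. vec K (\<lambda>s. f s a \<omega>) $ i * col ?X j $ i) $ l * unit_vec K s $ l)" for \<omega>
    proof -
      have "((?H \<omega> * ?X) *\<^sub>v unit_vec K s) $ a = row (?H \<omega> * ?X) a \<bullet> unit_vec K s"
        using a by (intro index_mult_mat_vec) (simp add: col_mat_def)
      then show ?thesis unfolding rHX by (simp only: scalar_prod_def index_unit_vec(3))
    qed
    show ?thesis unfolding eq
      by (intro borel_measurable_sum borel_measurable_times borel_measurable_const vec_index_measurable f a)
  qed
  have "zf_vec N K (\<lambda>s a. f s a \<omega>) s $ a = (if det (?G \<omega>) = 0 then ((col_mat N K (\<lambda>s a. f s a \<omega>) * ?X) *\<^sub>v unit_vec K s) $ a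
      else (\<Sum>s'<K. f s' a \<omega> * (adj_mat (?G \<omega>) $$ (s', s) / det (?G \<omega>))))" for \<omega>
  proof (cases "det (?G \<omega>) = 0")
    case True
    then have "mat_inverse (?G \<omega>) = None" by (rule mat_inverse_eq_None_iff[OF gram_mat_carrier, THEN iffD2])
    then show ?thesis using True by (simp add: zf_vec_def)
  next
    case False
    then show ?thesis using zf_vec_adj[OF False s a] by simp
  qed
  moreover have "(\<lambda>\<omega>. if det (?G \<omega>) = 0 then ((col_mat N K (\<lambda>s a. f s a \<omega>) * ?X) *\<^sub>v unit_vec K s) $ a
      else (\<Sum>s'<K. f s' a \<omega> * (adj_mat (?G \<omega>) $$ (s', s) / det (?G \<omega>)))) \<in> borel_measurable M"
  proof (rule measurable_If[OF junk])
    show "(\<lambda>\<omega>. \<Sum>s'<K. f s' a \<omega> * (adj_mat (?G \<omega>) $$ (s', s) / det (?G \<omega>))) \<in> borel_measurable M"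
      by (intro borel_measurable_sum borel_measurable_times borel_measurable_divide f a adj s det) auto
    show "{\<omega> \<in> space M. det (?G \<omega>) = 0} \<in> sets M"
      using det by measurable
  qed
  ultimately show "(\<lambda>\<omega>. zf_vec N K (\<lambda>s a. f s a \<omega>) s $ a) \<in> borel_measurable M" by simp
qed

lemma zf_vec_cong:
  assumes "\<And>s a. s < K \<Longrightarrow> a < N \<Longrightarrow> x s a = x' s a"
  shows "gram_mat N K x = gram_mat N K x'" "zf_vec N K x = zf_vec N K x'"
proof -
  have c: "col_mat N K x = col_mat N K x'"
    unfolding col_mat_def by (rule eq_matI) (auto simp: assms)
  show g: "gram_mat N K x = gram_mat N K x'" unfolding gram_mat_def c ..
  show "zf_vec N K x = zf_vec N K x'" unfolding zf_vec_def g c ..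
qed

section \<open>Zero forcing for Gaussian columns\<close>

abbreviation gauss_vec :: "nat \<Rightarrow> real \<Rightarrow> (nat \<Rightarrow> complex) measure" where
  "gauss_vec N v \<equiv> \<Pi>\<^sub>M a\<in>{..<N}. cgauss v"

lemma prob_space_gauss_vec: "v > 0 \<Longrightarrow> prob_space (gauss_vec N v)"
  by (intro prob_space_PiM prob_space_cgauss)

lemma gauss_vec_component:
  "a < N \<Longrightarrow> (\<lambda>y. y a) \<in> borel_measurable (gauss_vec N v)"
  using measurable_component_singleton[of a "{..<N}" "\<lambda>_. cgauss v"] by simp

lemma gauss_cols_component:
  assumes "s \<in> S" "a < N"
  shows "(\<lambda>x. x s a) \<in> borel_measurable (\<Pi>\<^sub>M s\<in>S. gauss_vec N (\<gamma> s))"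
  by (rule measurable_compose[OF measurable_component_singleton[OF assms(1)] gauss_vec_component[OF assms(2)]])

text \<open>The basis depends on the fixed columns alone, so it is constant while the new column
  \<open>y\<close> is integrated. Dependent columns span less and leave a larger residual, which
  only lowers the value: hence an inequality.\<close>

lemma exists_orthonormal_for_columns:
  fixes x :: "nat \<Rightarrow> nat \<Rightarrow> complex"
  assumes S: "finite S" "card S + 2 \<le> N" and v: "v > 0"
  shows "\<exists>(q :: nat \<Rightarrow> nat \<Rightarrow> complex) r.
    (\<forall>l<r. \<forall>l'<r. (\<Sum>a<N. cnj (q l a) * q l' a) = (if l = l' then 1 else 0)) \<and>
    (\<forall>s\<in>S. \<exists>\<alpha>. \<forall>a<N. x s a = (\<Sum>l<r. \<alpha> l * q l a)) \<and>
    (\<integral>\<^sup>+y. inverse (ennreal ((\<Sum>a<N. (cmod (y a))\<^sup>2) - (\<Sum>l<r. (cmod (\<Sum>a<N. cnj (q l a) * y a))\<^sup>2))) \<partial>gauss_vec N v)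
      \<le> ennreal (1 / (v * (real N - real (card S) - 1)))"
proof -
  obtain q :: "nat \<Rightarrow> nat \<Rightarrow> complex" and r where r: "r \<le> card (x ` S)"
    and orth: "\<forall>l<r. \<forall>l'<r. (\<Sum>a\<in>{..<N}. cnj (q l a) * q l' a) = (if l = l' then 1 else 0)"
    and span: "\<forall>f\<in>x ` S. \<exists>\<alpha>. \<forall>a\<in>{..<N}. f a = (\<Sum>l<r. \<alpha> l * q l a)"
    using exists_orthonormal_span[of "x ` S" "{..<N}"] S by auto
  have rS: "r \<le> card S" using r card_image_le[OF S(1), of x] by linarith
  have "(\<integral>\<^sup>+y. inverse (ennreal ((\<Sum>a<N. (cmod (y a))\<^sup>2) - (\<Sum>l<r. (cmod (\<Sum>a<N. cnj (q l a) * y a))\<^sup>2))) \<partial>gauss_vec N v)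
      = ennreal (1 / (v * (real (card {..<N}) - real (card {..<r}) - 1)))"
    by (rule nn_integral_inverse_gauss_residual) (use v rS S orth in auto)
  also have "\<dots> \<le> ennreal (1 / (v * (real N - real (card S) - 1)))"
  proof (intro ennreal_leI divide_left_mono mult_left_mono mult_pos_pos)
    have "real (card S) + 2 \<le> real N" using S(2) by (simp flip: of_nat_add)
    then show "0 < real N - real (card S) - 1" by linarith
    then show "0 < real (card {..<N}) - real (card {..<r}) - 1" using rS by simp
  qed (use rS v in auto)
  finally have int: "(\<integral>\<^sup>+y. inverse (ennreal ((\<Sum>a<N. (cmod (y a))\<^sup>2) - (\<Sum>l<r. (cmod (\<Sum>a<N. cnj (q l a) * y a))\<^sup>2))) \<partial>gauss_vec N v)
      \<le> ennreal (1 / (v * (real N - real (card S) - 1)))" .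
  show ?thesis
  proof (intro exI[of _ q] exI[of _ r] conjI int ballI)
    show "\<forall>l<r. \<forall>l'<r. (\<Sum>a<N. cnj (q l a) * q l' a) = (if l = l' then 1 else 0)" by (rule orth)
    show "\<exists>\<alpha>. \<forall>a<N. x s a = (\<Sum>l<r. \<alpha> l * q l a)" if "s \<in> S" for s
      using span[rule_format, of "x s"] that by (auto simp: Ball_def)
  qed
qed

lemma zf_law_measurable:
  assumes "s < K" "a < N"
  shows "(\<lambda>x. zf_vec N K x s $ a) \<in> borel_measurable (\<Pi>\<^sub>M s\<in>{..<K}. gauss_vec N (\<gamma> s))"
    and "(\<lambda>x. det (gram_mat N K x)) \<in> borel_measurable (\<Pi>\<^sub>M s\<in>{..<K}. gauss_vec N (\<gamma> s))"
  by (rule zf_vec_measurable[where f="\<lambda>s a x. x s a", OF _ assms], rule gauss_cols_component, simp, simp)+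

text \<open>Columns are added one at a time. A finite mean of the inverse squared distance forces
  this distance to be positive almost surely, while a singular extension would make it 0. The mean
  is finite as long as two dimensions are left, and this is why \<open>k < N\<close> is
  strict.\<close>

lemma AE_gram_nonsingular:
  assumes \<gamma>: "\<And>s. \<gamma> s > 0" and k: "k < N"
  shows "AE x in (\<Pi>\<^sub>M s\<in>{..<k}. gauss_vec N (\<gamma> s)). det (gram_mat N k x) \<noteq> 0"
  using k
proof (induction k)
  case 0
  show ?case by (auto simp: gram_mat_eq det_def intro!: AE_I2)
next
  case (Suc k)
  interpret product_sigma_finite "\<lambda>s. gauss_vec N (\<gamma> s)"
    by (intro product_sigma_finite.intro prob_space_imp_sigma_finite prob_space_gauss_vec \<gamma>)
  let ?M = "\<lambda>S. \<Pi>\<^sub>M s\<in>S. gauss_vec N (\<gamma> s)"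
  have IH: "AE x in ?M {..<k}. det (gram_mat N k x) \<noteq> 0" using Suc by simp
  have ins: "{..<Suc k} = insert k {..<k}" by auto
  let ?A = "{x \<in> space (?M {..<Suc k}). det (gram_mat N (Suc k) x) = 0}"
  have detm: "(\<lambda>x. det (gram_mat N (Suc k) x)) \<in> borel_measurable (?M {..<Suc k})"
    by (rule zf_law_measurable(2)[of 0 _ 0]) (use Suc.prems in auto)
  have A: "?A \<in> sets (?M {..<Suc k})" using detm by measurable
  have "emeasure (?M {..<Suc k}) ?A = (\<integral>\<^sup>+x. indicator ?A x \<partial>?M (insert k {..<k}))"
    using nn_integral_indicator[OF A] by (simp add: ins)
  also have "\<dots> = (\<integral>\<^sup>+x. (\<integral>\<^sup>+y. indicator ?A (x(k := y)) \<partial>gauss_vec N (\<gamma> k)) \<partial>?M {..<k})"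
    by (rule product_nn_integral_insert) (use A in \<open>auto simp: ins\<close>)
  also have "\<dots> = (\<integral>\<^sup>+x. 0 \<partial>?M {..<k})"
  proof (rule nn_integral_cong_AE, use IH AE_space in eventually_elim)
    fix x assume d: "det (gram_mat N k x) \<noteq> 0" and x: "x \<in> space (?M {..<k})"
    have "\<exists>(q :: nat \<Rightarrow> nat \<Rightarrow> complex) r.
      (\<forall>l<r. \<forall>l'<r. (\<Sum>a<N. cnj (q l a) * q l' a) = (if l = l' then 1 else 0)) \<and>
      (\<forall>s\<in>{..<k}. \<exists>\<alpha>. \<forall>a<N. x s a = (\<Sum>l<r. \<alpha> l * q l a)) \<and>
      (\<integral>\<^sup>+y. inverse (ennreal ((\<Sum>a<N. (cmod (y a))\<^sup>2) - (\<Sum>l<r. (cmod (\<Sum>a<N. cnj (q l a) * y a))\<^sup>2))) \<partial>gauss_vec N (\<gamma> k))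
        \<le> ennreal (1 / (\<gamma> k * (real N - real (card ({..<k})) - 1)))"
      by (rule exists_orthonormal_for_columns) (use \<gamma> Suc.prems in auto)
    then obtain q :: "nat \<Rightarrow> nat \<Rightarrow> complex" and r
      where orth': "\<forall>l<r. \<forall>l'<r. (\<Sum>a<N. cnj (q l a) * q l' a) = (if l = l' then 1 else 0)"
        and span: "\<forall>s\<in>{..<k}. \<exists>\<alpha>. \<forall>a<N. x s a = (\<Sum>l<r. \<alpha> l * q l a)"
        and int: "(\<integral>\<^sup>+y. inverse (ennreal ((\<Sum>a<N. (cmod (y a))\<^sup>2) - (\<Sum>l<r. (cmod (\<Sum>a<N. cnj (q l a) * y a))\<^sup>2))) \<partial>gauss_vec N (\<gamma> k))
          \<le> ennreal (1 / (\<gamma> k * (real N - real (card ({..<k})) - 1)))"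
      by (elim exE conjE)
    have orth: "(\<Sum>a<N. cnj (q l a) * q l' a) = (if l = l' then 1 else 0)" if "l < r" "l' < r" for l l'
      using orth' that by blast
    let ?D = "\<lambda>y. (\<Sum>a<N. (cmod (y a))\<^sup>2) - (\<Sum>l<r. (cmod (\<Sum>a<N. cnj (q l a) * y a))\<^sup>2)"
    note gauss_vec_component[measurable]
    have "AE y in gauss_vec N (\<gamma> k). inverse (ennreal (?D y)) \<noteq> \<infinity>"
    proof (rule nn_integral_PInf_AE)
      show "(\<integral>\<^sup>+y. inverse (ennreal (?D y)) \<partial>gauss_vec N (\<gamma> k)) \<noteq> \<infinity>"
        using int by (auto simp: top_unique)
    qed measurable
    then have "AE y in gauss_vec N (\<gamma> k). indicator ?A (x(k := y)) = (0 :: ennreal)"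
    proof eventually_elim
      fix y assume fin: "inverse (ennreal (?D y)) \<noteq> \<infinity>"
      have "det (gram_mat N (Suc k) (x(k := y))) \<noteq> 0"
      proof
        assume d': "det (gram_mat N (Suc k) (x(k := y))) = 0"
        have dk: "det (gram_mat N k (x(k := y))) \<noteq> 0"
          using d zf_vec_cong(1)[of k N "x(k := y)" x] by simp
        have "(\<Sum>a<N. (cmod ((x(k := y)) k a))\<^sup>2) - (\<Sum>l<r. (cmod (\<Sum>a<N. cnj (q l a) * (x(k := y)) k a))\<^sup>2) = 0"
          by (rule residual_zero_if_singular[OF dk d' orth]) (use span in auto)
        then show False using fin by simp
      qed
      then show "indicator ?A (x(k := y)) = (0 :: ennreal)" by (auto simp: indicator_def)
    qed
    then show "(\<integral>\<^sup>+y. indicator ?A (x(k := y)) \<partial>gauss_vec N (\<gamma> k)) = 0"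
      by (subst nn_integral_cong_AE[where v="\<lambda>_. 0"]) simp_all
  qed
  finally have "emeasure (?M {..<Suc k}) ?A = 0" by simp
  then show ?case using A by (intro AE_I[of _ _ ?A]) auto
qed

text \<open>With the other columns fixed, the squared norm is at most the inverse squared distance
  of column \<open>s\<close> from a space of dimension at most \<open>K - 1\<close>. On singular
  Gram matrices the integrand is set to 0, because the default value of the precoder there is not
  under control.\<close>

lemma nn_integral_zf_norm_le:
  assumes \<gamma>: "\<And>s. \<gamma> s > 0" and K: "K < N" and s: "s < K"
  shows "(\<integral>\<^sup>+x. (if det (gram_mat N K x) = 0 then 0 else ennreal (\<Sum>a<N. (cmod (zf_vec N K x s $ a))\<^sup>2)) \<partial>(\<Pi>\<^sub>M s\<in>{..<K}. gauss_vec N (\<gamma> s)))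
     \<le> ennreal (1 / (\<gamma> s * (real N - real K)))"
proof -
  interpret product_sigma_finite "\<lambda>s. gauss_vec N (\<gamma> s)"
    by (intro product_sigma_finite.intro prob_space_imp_sigma_finite prob_space_gauss_vec \<gamma>)
  let ?M = "\<lambda>S. \<Pi>\<^sub>M s\<in>S. gauss_vec N (\<gamma> s)"
  let ?S = "{..<K} - {s}"
  let ?\<psi> = "\<lambda>x. if det (gram_mat N K x) = 0 then 0 else ennreal (\<Sum>a<N. (cmod (zf_vec N K x s $ a))\<^sup>2)"
  have ins: "{..<K} = insert s ?S" using s by auto
  have N: "0 < N" using K by simp
  have \<psi>m: "?\<psi> \<in> borel_measurable (?M {..<K})"
  proof -
    note [measurable] = zf_law_measurable(1)[OF s, of _ N \<gamma>] zf_law_measurable(2)[OF s N, of \<gamma>]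
    show ?thesis by measurable
  qed
  have "(\<integral>\<^sup>+x. ?\<psi> x \<partial>?M {..<K}) = (\<integral>\<^sup>+x. ?\<psi> x \<partial>?M (insert s ?S))" using ins by simp
  also have "\<dots> = (\<integral>\<^sup>+x. (\<integral>\<^sup>+y. ?\<psi> (x(s := y)) \<partial>gauss_vec N (\<gamma> s)) \<partial>?M ?S)"
    by (rule product_nn_integral_insert) (use \<psi>m ins in auto)
  also have "\<dots> \<le> (\<integral>\<^sup>+x. ennreal (1 / (\<gamma> s * (real N - real K))) \<partial>?M ?S)"
  proof (rule nn_integral_mono)
    fix x assume "x \<in> space (?M ?S)"
    have cS: "card ?S = K - 1" using s by simp
    have "\<exists>(q :: nat \<Rightarrow> nat \<Rightarrow> complex) r.
      (\<forall>l<r. \<forall>l'<r. (\<Sum>a<N. cnj (q l a) * q l' a) = (if l = l' then 1 else 0)) \<and>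
      (\<forall>t\<in>?S. \<exists>\<alpha>. \<forall>a<N. x t a = (\<Sum>l<r. \<alpha> l * q l a)) \<and>
      (\<integral>\<^sup>+y. inverse (ennreal ((\<Sum>a<N. (cmod (y a))\<^sup>2) - (\<Sum>l<r. (cmod (\<Sum>a<N. cnj (q l a) * y a))\<^sup>2))) \<partial>gauss_vec N (\<gamma> s))
        \<le> ennreal (1 / (\<gamma> s * (real N - real (card (?S)) - 1)))"
      by (rule exists_orthonormal_for_columns) (use \<gamma> K s cS in auto)
    then obtain q :: "nat \<Rightarrow> nat \<Rightarrow> complex" and r
      where orth': "\<forall>l<r. \<forall>l'<r. (\<Sum>a<N. cnj (q l a) * q l' a) = (if l = l' then 1 else 0)"
        and span: "\<forall>t\<in>?S. \<exists>\<alpha>. \<forall>a<N. x t a = (\<Sum>l<r. \<alpha> l * q l a)"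
        and int: "(\<integral>\<^sup>+y. inverse (ennreal ((\<Sum>a<N. (cmod (y a))\<^sup>2) - (\<Sum>l<r. (cmod (\<Sum>a<N. cnj (q l a) * y a))\<^sup>2))) \<partial>gauss_vec N (\<gamma> s))
          \<le> ennreal (1 / (\<gamma> s * (real N - real (card (?S)) - 1)))"
      by (elim exE conjE)
    have orth: "(\<Sum>a<N. cnj (q l a) * q l' a) = (if l = l' then 1 else 0)" if "l < r" "l' < r" for l l'
      using orth' that by blast
    let ?D = "\<lambda>y. (\<Sum>a<N. (cmod (y a))\<^sup>2) - (\<Sum>l<r. (cmod (\<Sum>a<N. cnj (q l a) * y a))\<^sup>2)"
    have "?\<psi> (x(s := y)) \<le> inverse (ennreal (?D y))" for y
    proof (cases "det (gram_mat N K (x(s := y))) = 0")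
      case False
      let ?V = "\<Sum>a<N. (cmod (zf_vec N K (x(s := y)) s $ a))\<^sup>2"
      have le: "?D y * ?V \<le> 1"
        using zf_vec_norm_le[OF False s orth, of r] span by auto
      show ?thesis
      proof (cases "?D y > 0")
        case True
        then have "?V \<le> 1 / ?D y" using le by (simp add: field_simps)
        then have "ennreal ?V \<le> ennreal (1 / ?D y)" by (rule ennreal_leI)
        then show ?thesis using True False by (simp add: inverse_ennreal divide_inverse)
      next
        case f: False
        then show ?thesis by (simp add: ennreal_neg)
      qed
    qed simp
    then have "(\<integral>\<^sup>+y. ?\<psi> (x(s := y)) \<partial>gauss_vec N (\<gamma> s)) \<le> (\<integral>\<^sup>+y. inverse (ennreal (?D y)) \<partial>gauss_vec N (\<gamma> s))"
      by (intro nn_integral_mono)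
    also have "\<dots> \<le> ennreal (1 / (\<gamma> s * (real N - real (card ?S) - 1)))" by (rule int)
    also have "real N - real (card ?S) - 1 = real N - real K" using s by (simp add: cS of_nat_diff)
    finally show "(\<integral>\<^sup>+y. ?\<psi> (x(s := y)) \<partial>gauss_vec N (\<gamma> s)) \<le> ennreal (1 / (\<gamma> s * (real N - real K)))" .
  qed
  also have "\<dots> = ennreal (1 / (\<gamma> s * (real N - real K)))"
  proof -
    interpret p: prob_space "?M ?S" by (rule prob_space_PiM) (rule prob_space_gauss_vec[OF \<gamma>])
    show ?thesis by (simp add: p.emeasure_space_1)
  qed
  finally show ?thesis .
qed

locale gaussian_columns = prob_space P for P :: "'w measure" +
  fixes N K :: nat and \<gamma> :: "nat \<Rightarrow> real" and f :: "nat \<Rightarrow> nat \<Rightarrow> 'w \<Rightarrow> complex"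
  assumes K_pos: "0 < K" and K_less: "K < N" and \<gamma>_pos: "\<And>s. \<gamma> s > 0"
    and f_indep: "indep_vars (\<lambda>_. borel) (\<lambda>(s, a). f s a) ({..<K} \<times> {..<N})"
    and f_distr: "\<And>s a. s < K \<Longrightarrow> a < N \<Longrightarrow> distr P borel (f s a) = cgauss (\<gamma> s)"
begin

definition cols :: "'w \<Rightarrow> nat \<Rightarrow> nat \<Rightarrow> complex" where
  "cols \<omega> = (\<lambda>s\<in>{..<K}. \<lambda>a\<in>{..<N}. f s a \<omega>)"

abbreviation "col_law \<equiv> \<Pi>\<^sub>M s\<in>{..<K}. gauss_vec N (\<gamma> s)"

lemma f_measurable: "s < K \<Longrightarrow> a < N \<Longrightarrow> f s a \<in> borel_measurable P"
  using f_indep by (auto simp: indep_vars_def)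

lemma cols_measurable [measurable]: "cols \<in> measurable P col_law"
  unfolding cols_def by (intro measurable_restrict) (simp add: f_measurable)

lemma distr_cols: "distr P col_law cols = col_law"
proof -
  have N0: "0 < N" using K_less by simp
  have col_indep: "indep_vars (\<lambda>s. gauss_vec N (\<gamma> s)) (\<lambda>s \<omega>. \<lambda>a\<in>{..<N}. f s a \<omega>) {..<K}"
  proof -
    have "indep_vars (\<lambda>s. PiM ({s} \<times> {..<N}) (\<lambda>_. borel)) (\<lambda>s \<omega>. restrict (\<lambda>i. (\<lambda>(s, a). f s a) i \<omega>) ({s} \<times> {..<N})) {..<K}"
      by (rule indep_vars_restrict[OF f_indep]) (auto simp: disjoint_family_on_def)
    from indep_vars_compose2[OF this, of "\<lambda>s x. \<lambda>a\<in>{..<N}. x (s, a)" "\<lambda>s. gauss_vec N (\<gamma> s)"]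
    have "indep_vars (\<lambda>s. gauss_vec N (\<gamma> s)) (\<lambda>s \<omega>. \<lambda>a\<in>{..<N}. restrict (\<lambda>i. (\<lambda>(s, a). f s a) i \<omega>) ({s} \<times> {..<N}) (s, a)) {..<K}"
      by (auto intro!: measurable_restrict measurable_component_singleton)
    then show ?thesis by (simp cong: restrict_cong)
  qed
  have col_distr: "distr P (gauss_vec N (\<gamma> s)) (\<lambda>\<omega>. \<lambda>a\<in>{..<N}. f s a \<omega>) = gauss_vec N (\<gamma> s)" if s: "s < K" for s
  proof -
    have "indep_vars (\<lambda>a. borel) (\<lambda>a. (\<lambda>(s, a). f s a) (s, a)) {..<N}"
      by (rule indep_vars_reindex[where M'="\<lambda>_. borel" and f="\<lambda>a. (s, a)"])
         (use s in \<open>auto intro: indep_vars_subset[OF f_indep] simp: inj_on_def\<close>)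
    then have i: "indep_vars (\<lambda>a. borel) (f s) {..<N}" by simp
    have "distr P (\<Pi>\<^sub>M a\<in>{..<N}. borel) (\<lambda>\<omega>. \<lambda>a\<in>{..<N}. f s a \<omega>) = (\<Pi>\<^sub>M a\<in>{..<N}. distr P borel (f s a))"
      by (rule indep_vars_iff_distr_eq_PiM'[THEN iffD1, OF _ _ i]) (use N0 s f_measurable in auto)
    also have "\<dots> = gauss_vec N (\<gamma> s)" by (intro PiM_cong) (use s f_distr in auto)
    finally have "distr P (\<Pi>\<^sub>M a\<in>{..<N}. borel) (\<lambda>\<omega>. \<lambda>a\<in>{..<N}. f s a \<omega>) = gauss_vec N (\<gamma> s)" .
    moreover have "distr P (gauss_vec N (\<gamma> s)) (\<lambda>\<omega>. \<lambda>a\<in>{..<N}. f s a \<omega>) = distr P (\<Pi>\<^sub>M a\<in>{..<N}. borel) (\<lambda>\<omega>. \<lambda>a\<in>{..<N}. f s a \<omega>)"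
      by (intro distr_cong sets_PiM_cong) auto
    ultimately show ?thesis by simp
  qed
  have "distr P col_law cols = (\<Pi>\<^sub>M s\<in>{..<K}. distr P (gauss_vec N (\<gamma> s)) (\<lambda>\<omega>. \<lambda>a\<in>{..<N}. f s a \<omega>))"
    unfolding cols_def
  proof (rule indep_vars_iff_distr_eq_PiM'[THEN iffD1, OF _ _ col_indep])
    show "random_variable (gauss_vec N (\<gamma> s)) (\<lambda>\<omega>. \<lambda>a\<in>{..<N}. f s a \<omega>)" if "s \<in> {..<K}" for s
      using that by (intro measurable_restrict) (simp add: f_measurable)
  qed (use K_pos in auto)
  also have "\<dots> = col_law" by (intro PiM_cong) (use col_distr in auto)
  finally show ?thesis .
qed

abbreviation "zf \<omega> s a \<equiv> zf_vec N K (\<lambda>s a. f s a \<omega>) s $ a"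

lemma zf_cols: "zf_vec N K (\<lambda>s a. f s a \<omega>) = zf_vec N K (cols \<omega>)" "gram_mat N K (\<lambda>s a. f s a \<omega>) = gram_mat N K (cols \<omega>)"
  by (rule zf_vec_cong; simp add: cols_def)+

lemma zf_measurable: "s < K \<Longrightarrow> a < N \<Longrightarrow> (\<lambda>\<omega>. zf \<omega> s a) \<in> borel_measurable P"
  by (rule zf_vec_measurable(1)) (auto simp: f_measurable)

lemma AE_nonsingular: "AE \<omega> in P. det (gram_mat N K (\<lambda>s a. f s a \<omega>)) \<noteq> 0"
proof -
  have "AE x in distr P col_law cols. det (gram_mat N K x) \<noteq> 0"
    unfolding distr_cols by (rule AE_gram_nonsingular[OF \<gamma>_pos K_less])
  from AE_distrD[OF cols_measurable this] show ?thesis by (simp add: zf_cols)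
qed

lemma zf_norm:
  assumes s: "s < K"
  shows "integrable P (\<lambda>\<omega>. \<Sum>a<N. (cmod (zf \<omega> s a))\<^sup>2)"
    and "expectation (\<lambda>\<omega>. \<Sum>a<N. (cmod (zf \<omega> s a))\<^sup>2) \<le> 1 / (\<gamma> s * (real N - real K))"
proof -
  let ?\<psi> = "\<lambda>x. if det (gram_mat N K x) = 0 then 0 else ennreal (\<Sum>a<N. (cmod (zf_vec N K x s $ a))\<^sup>2)"
  have zm [measurable]: "(\<lambda>\<omega>. zf \<omega> s a) \<in> borel_measurable P" if "a < N" for a using zf_measurable s that by simp
  have lm [measurable]: "(\<lambda>x. zf_vec N K x s $ a) \<in> borel_measurable col_law" if "a < N" for a
    by (rule zf_law_measurable(1)[OF s that])
  have [measurable]: "(\<lambda>x. det (gram_mat N K x)) \<in> borel_measurable col_law"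
    by (rule zf_law_measurable(2)[OF s, of 0]) (use K_less in simp)
  have "(\<integral>\<^sup>+\<omega>. ennreal (\<Sum>a<N. (cmod (zf \<omega> s a))\<^sup>2) \<partial>P) = (\<integral>\<^sup>+\<omega>. ?\<psi> (cols \<omega>) \<partial>P)"
    by (rule nn_integral_cong_AE) (use AE_nonsingular in eventually_elim, simp add: zf_cols)
  also have "\<dots> = (\<integral>\<^sup>+x. ?\<psi> x \<partial>distr P col_law cols)"
    by (rule nn_integral_distr[symmetric]) measurable
  also have "\<dots> \<le> ennreal (1 / (\<gamma> s * (real N - real K)))"
    unfolding distr_cols by (rule nn_integral_zf_norm_le[OF \<gamma>_pos K_less s])
  finally have le: "(\<integral>\<^sup>+\<omega>. ennreal (\<Sum>a<N. (cmod (zf \<omega> s a))\<^sup>2) \<partial>P) \<le> ennreal (1 / (\<gamma> s * (real N - real K)))" .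
  show i: "integrable P (\<lambda>\<omega>. \<Sum>a<N. (cmod (zf \<omega> s a))\<^sup>2)"
  proof (rule integrableI_bounded)
    have "(\<integral>\<^sup>+\<omega>. ennreal (norm (\<Sum>a<N. (cmod (zf \<omega> s a))\<^sup>2)) \<partial>P) = (\<integral>\<^sup>+\<omega>. ennreal (\<Sum>a<N. (cmod (zf \<omega> s a))\<^sup>2) \<partial>P)"
      by (simp add: sum_nonneg)
    then show "(\<integral>\<^sup>+\<omega>. ennreal (norm (\<Sum>a<N. (cmod (zf \<omega> s a))\<^sup>2)) \<partial>P) < \<infinity>"
      using le by (auto intro: le_less_trans)
  qed measurable
  have "0 \<le> 1 / (\<gamma> s * (real N - real K))" using \<gamma>_pos[of s] K_less by simp
  moreover have "ennreal (expectation (\<lambda>\<omega>. \<Sum>a<N. (cmod (zf \<omega> s a))\<^sup>2)) \<le> ennreal (1 / (\<gamma> s * (real N - real K)))"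
    using le nn_integral_eq_integral[OF i] by (simp add: sum_nonneg)
  ultimately show "expectation (\<lambda>\<omega>. \<Sum>a<N. (cmod (zf \<omega> s a))\<^sup>2) \<le> 1 / (\<gamma> s * (real N - real K))"
    by (simp add: ennreal_le_iff)
qed

lemma zf_entry_square_integrable:
  assumes "s < K" "a < N"
  shows "integrable P (\<lambda>\<omega>. (cmod (zf \<omega> s a))\<^sup>2)"
proof (rule Bochner_Integration.integrable_bound[OF zf_norm(1)[OF assms(1)]])
  show "(\<lambda>\<omega>. (cmod (zf \<omega> s a))\<^sup>2) \<in> borel_measurable P"
    using zf_measurable[OF assms] by measurable
  have "(cmod (zf \<omega> s a))\<^sup>2 \<le> (\<Sum>a<N. (cmod (zf \<omega> s a))\<^sup>2)" for \<omega>
    using assms by (intro member_le_sum) auto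
  then show "AE \<omega> in P. norm ((cmod (zf \<omega> s a))\<^sup>2) \<le> norm (\<Sum>a<N. (cmod (zf \<omega> s a))\<^sup>2)"
    by (simp add: sum_nonneg)
qed

end

text \<open>Flipping the sign of one column preserves the law of the estimates, leaves the other
  zero-forcing vectors unchanged and flips the one belonging to that column.\<close>

lemma (in gaussian_columns) zf_orthogonal:
  assumes s: "s < K" "s' < K" "s \<noteq> s'"
  shows "expectation (\<lambda>\<omega>. \<Sum>a<N. cnj (zf \<omega> s a) * zf \<omega> s' a) = 0"
proof -
  define \<sigma> :: "nat \<Rightarrow> complex" where "\<sigma> t = (if t = s then -1 else 1)" for t
  define f' where "f' t a \<omega> = \<sigma> t * f t a \<omega>" for t a \<omega>
  interpret F: gaussian_columns P N K \<gamma> f'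
  proof
    have "indep_vars (\<lambda>_. borel) (\<lambda>i \<omega>. (\<lambda>z. \<sigma> (fst i) * z) ((\<lambda>(s, a). f s a) i \<omega>)) ({..<K} \<times> {..<N})"
      by (rule indep_vars_compose2[OF f_indep]) measurable
    then show "indep_vars (\<lambda>_. borel) (\<lambda>(s, a). f' s a) ({..<K} \<times> {..<N})"
      by (simp add: f'_def[abs_def] split_beta')
    fix t a assume t: "t < K" "a < N"
    show "distr P borel (f' t a) = cgauss (\<gamma> t)"
    proof (cases "t = s")
      case True
      have "f' t a = uminus \<circ> f t a" by (simp add: f'_def[abs_def] \<sigma>_def True comp_def)
      then have "distr P borel (f' t a) = distr (distr P borel (f t a)) borel uminus"
        using f_measurable[OF t] by (simp add: distr_distr)
      then show ?thesis by (simp add: f_distr[OF t] distr_cgauss_uminus)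
    next
      case False
      then have "f' t a = f t a" by (simp add: f'_def[abs_def] \<sigma>_def)
      then show ?thesis by (simp add: f_distr[OF t])
    qed
  qed (use K_pos K_less \<gamma>_pos in auto)
  let ?\<phi> = "\<lambda>x. \<Sum>a<N. cnj (zf_vec N K x s $ a) * zf_vec N K x s' $ a"
  have \<phi>m: "?\<phi> \<in> borel_measurable col_law"
    by (intro borel_measurable_sum borel_measurable_times measurable_compose[OF zf_law_measurable(1) borel_measurable_cnj] zf_law_measurable(1)) (use s in auto)
  have "expectation (\<lambda>\<omega>. ?\<phi> (cols \<omega>)) = (\<integral>x. ?\<phi> x \<partial>distr P col_law cols)"
    by (rule integral_distr[symmetric]) (use \<phi>m in auto)
  also have "\<dots> = (\<integral>x. ?\<phi> x \<partial>distr P col_law F.cols)"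
    unfolding distr_cols F.distr_cols ..
  also have "\<dots> = expectation (\<lambda>\<omega>. ?\<phi> (F.cols \<omega>))"
    by (rule integral_distr) (use \<phi>m in auto)
  also have "\<dots> = expectation (\<lambda>\<omega>. - ?\<phi> (cols \<omega>))"
  proof (rule integral_cong_AE)
    show "AE \<omega> in P. ?\<phi> (F.cols \<omega>) = - ?\<phi> (cols \<omega>)"
      using AE_nonsingular F.AE_nonsingular
    proof eventually_elim
      fix \<omega> assume d: "det (gram_mat N K (\<lambda>s a. f s a \<omega>)) \<noteq> 0" and d': "det (gram_mat N K (\<lambda>s a. f' s a \<omega>)) \<noteq> 0"
      have flip: "F.zf \<omega> t a = \<sigma> t * zf \<omega> t a" if "t < K" "a < N" for t a
        by (rule zf_vec_sign_flip[OF d d' that(1) _ _ that(2)]) (auto simp: \<sigma>_def f'_def)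
      have "?\<phi> (F.cols \<omega>) = (\<Sum>a<N. cnj (F.zf \<omega> s a) * F.zf \<omega> s' a)" by (simp add: F.zf_cols)
      also have "\<dots> = (\<Sum>a<N. - (cnj (zf \<omega> s a) * zf \<omega> s' a))"
        using flip s by (intro sum.cong) (auto simp: \<sigma>_def)
      also have "\<dots> = - ?\<phi> (cols \<omega>)" by (simp add: zf_cols sum_negf)
      finally show "?\<phi> (F.cols \<omega>) = - ?\<phi> (cols \<omega>)" .
    qed
    show "(\<lambda>\<omega>. ?\<phi> (F.cols \<omega>)) \<in> borel_measurable P" by (rule measurable_compose[OF F.cols_measurable \<phi>m])
    show "(\<lambda>\<omega>. - ?\<phi> (cols \<omega>)) \<in> borel_measurable P"
      by (intro borel_measurable_uminus measurable_compose[OF cols_measurable \<phi>m])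
  qed
  finally have "expectation (\<lambda>\<omega>. ?\<phi> (cols \<omega>)) = - expectation (\<lambda>\<omega>. ?\<phi> (cols \<omega>))" by simp
  then show ?thesis by (simp add: zf_cols)
qed

section \<open>Sources and users\<close>

text \<open>Meant for estimate and error, whose joint law is computed directly from a density:
  independence and both marginals are read off from it.\<close>

lemma (in prob_space) indep_var_of_product_law:
  assumes [measurable]: "Y \<in> borel_measurable M" "Z \<in> borel_measurable M"
    and A: "prob_space A" and B: "prob_space B" and sets: "sets A = sets borel" "sets B = sets borel"
    and law: "distr M (borel \<Otimes>\<^sub>M borel) (\<lambda>\<omega>. (Y \<omega>, Z \<omega>)) = A \<Otimes>\<^sub>M B"
  shows "indep_var borel Y borel Z" "distr M borel Y = A" "distr M borel Z = B"
proof -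
  interpret A: prob_space A by fact
  interpret B: prob_space B by fact
  have sp: "space A = space borel" "space B = space borel" using sets by (auto dest: sets_eq_imp_space_eq)
  have joint: "emeasure (distr M (borel \<Otimes>\<^sub>M borel) (\<lambda>\<omega>. (Y \<omega>, Z \<omega>))) (E \<times> F) = emeasure M (Y -` E \<inter> Z -` F \<inter> space M)"
    if "E \<in> sets borel" "F \<in> sets borel" for E F
    using that by (subst emeasure_distr) (auto intro!: arg_cong[of _ _ "emeasure M"])
  show Y: "distr M borel Y = A"
  proof (rule measure_eqI)
    fix E assume "E \<in> sets (distr M borel Y)"
    then have E: "E \<in> sets borel" by simp
    have "emeasure (distr M borel Y) E = emeasure M (Y -` E \<inter> Z -` UNIV \<inter> space M)" using E by (simp add: emeasure_distr)
    also have "\<dots> = emeasure (A \<Otimes>\<^sub>M B) (E \<times> UNIV)" using joint[OF E, of UNIV] law by simp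
    also have "\<dots> = emeasure A E" using E sets B.emeasure_space_1 sp by (subst B.emeasure_pair_measure_Times) auto
    finally show "emeasure (distr M borel Y) E = emeasure A E" .
  qed (simp add: sets)
  show Z: "distr M borel Z = B"
  proof (rule measure_eqI)
    fix F assume "F \<in> sets (distr M borel Z)"
    then have F: "F \<in> sets borel" by simp
    have "emeasure (distr M borel Z) F = emeasure M (Y -` UNIV \<inter> Z -` F \<inter> space M)" using F by (simp add: emeasure_distr)
    also have "\<dots> = emeasure (A \<Otimes>\<^sub>M B) (UNIV \<times> F)" using joint[OF _ F, of UNIV] law by simp
    also have "\<dots> = emeasure B F" using F sets A.emeasure_space_1 sp by (subst B.emeasure_pair_measure_Times) auto
    finally show "emeasure (distr M borel Z) F = emeasure B F" .
  qed (simp add: sets)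
  show "indep_var borel Y borel Z"
    by (subst indep_var_distribution_eq) (simp add: Y Z law)
qed

lemma (in prob_space) indep_vars_imp_indep_var:
  assumes ind: "indep_vars (\<lambda>_. borel) X I" and xy: "x \<in> I" "y \<in> I" "x \<noteq> y"
  shows "indep_var borel (X x) borel (X y)"
proof -
  have "indep_var borel ((\<lambda>f. f x) \<circ> (\<lambda>\<omega>. \<lambda>i\<in>{x}. X i \<omega>)) borel ((\<lambda>f. f y) \<circ> (\<lambda>\<omega>. \<lambda>i\<in>{y}. X i \<omega>))"
    by (rule indep_var_compose[OF indep_var_restrict[OF ind, of "{x}" "{y}"]])
       (use xy in \<open>auto intro!: measurable_component_singleton\<close>)
  then show ?thesis by (simp add: comp_def)
qed

text \<open>Only the \<open>p a\<close> need be centred and uncorrelated: being independent of the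
  \<open>q a\<close>, they remove all cross terms however the latter are correlated. It is applied
  to error times beam and to data symbols times leakage.\<close>

lemma (in prob_space) indep_linear_combination:
  fixes p :: "'i \<Rightarrow> 'x \<Rightarrow> complex" and q :: "'i \<Rightarrow> 'x \<Rightarrow> complex"
    and A :: "'x measure" and B :: "'x measure" and \<xi> :: "'a \<Rightarrow> 'x" and \<eta> :: "'a \<Rightarrow> 'x" and I :: "'i set" and v :: real
  assumes fin: "finite I" and ind: "indep_var A \<xi> B \<eta>"
    and pm: "\<And>a. a \<in> I \<Longrightarrow> p a \<in> borel_measurable A" and qm: "\<And>a. a \<in> I \<Longrightarrow> q a \<in> borel_measurable B"
    and p2: "\<And>a. a \<in> I \<Longrightarrow> integrable M (\<lambda>\<omega>. (cmod (p a (\<xi> \<omega>)))\<^sup>2)"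
    and q2: "\<And>a. a \<in> I \<Longrightarrow> integrable M (\<lambda>\<omega>. (cmod (q a (\<eta> \<omega>)))\<^sup>2)"
    and mean: "\<And>a. a \<in> I \<Longrightarrow> expectation (\<lambda>\<omega>. p a (\<xi> \<omega>)) = 0"
    and cov: "\<And>a b. a \<in> I \<Longrightarrow> b \<in> I \<Longrightarrow> expectation (\<lambda>\<omega>. p a (\<xi> \<omega>) * cnj (p b (\<xi> \<omega>))) = (if a = b then complex_of_real v else 0)"
  defines "W \<equiv> \<lambda>\<omega>. \<Sum>a\<in>I. p a (\<xi> \<omega>) * q a (\<eta> \<omega>)"
  shows "integrable M (\<lambda>\<omega>. (cmod (W \<omega>))\<^sup>2)" "expectation W = 0" "integrable M W"
    "expectation (\<lambda>\<omega>. (cmod (W \<omega>))\<^sup>2) = v * (\<Sum>a\<in>I. expectation (\<lambda>\<omega>. (cmod (q a (\<eta> \<omega>)))\<^sup>2))"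
proof -
  have [measurable]: "\<xi> \<in> measurable M A" "\<eta> \<in> measurable M B"
    using indep_var_rv1[OF ind] indep_var_rv2[OF ind] by auto
  have prod: "integrable M (\<lambda>\<omega>. \<phi> (\<xi> \<omega>) * \<psi> (\<eta> \<omega>))"
    "expectation (\<lambda>\<omega>. \<phi> (\<xi> \<omega>) * \<psi> (\<eta> \<omega>)) = expectation (\<lambda>\<omega>. \<phi> (\<xi> \<omega>)) * expectation (\<lambda>\<omega>. \<psi> (\<eta> \<omega>))"
    if "\<phi> \<in> borel_measurable A" "\<psi> \<in> borel_measurable B" "integrable M (\<lambda>\<omega>. \<phi> (\<xi> \<omega>))" "integrable M (\<lambda>\<omega>. \<psi> (\<eta> \<omega>))"
    for \<phi> :: "'x \<Rightarrow> complex" and \<psi> :: "'x \<Rightarrow> complex"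
  proof -
    have i: "indep_var borel (\<lambda>\<omega>. \<phi> (\<xi> \<omega>)) borel (\<lambda>\<omega>. \<psi> (\<eta> \<omega>))"
      using indep_var_compose[OF ind that(1,2)] by (simp add: comp_def)
    show "integrable M (\<lambda>\<omega>. \<phi> (\<xi> \<omega>) * \<psi> (\<eta> \<omega>))" by (rule indep_var_integrable[OF i that(3,4)])
    show "expectation (\<lambda>\<omega>. \<phi> (\<xi> \<omega>) * \<psi> (\<eta> \<omega>)) = expectation (\<lambda>\<omega>. \<phi> (\<xi> \<omega>)) * expectation (\<lambda>\<omega>. \<psi> (\<eta> \<omega>))"
      by (rule indep_var_lebesgue_integral[OF i that(3,4)])
  qed
  have pm': "(\<lambda>\<omega>. p a (\<xi> \<omega>)) \<in> borel_measurable M" if "a \<in> I" for a using pm[OF that] by measurable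
  have qm': "(\<lambda>\<omega>. q a (\<eta> \<omega>)) \<in> borel_measurable M" if "a \<in> I" for a using qm[OF that] by measurable
  have pi: "integrable M (\<lambda>\<omega>. p a (\<xi> \<omega>))" if "a \<in> I" for a
    by (rule square_integrable_imp_integrable_complex[OF pm'[OF that] p2[OF that]])
  have qi: "integrable M (\<lambda>\<omega>. q a (\<eta> \<omega>))" if "a \<in> I" for a
    by (rule square_integrable_imp_integrable_complex[OF qm'[OF that] q2[OF that]])
  have cm: "(\<lambda>x. cnj (f x)) \<in> borel_measurable D" if "f \<in> borel_measurable D" for f and D :: "'d measure"
    by (rule measurable_compose[OF that borel_measurable_cnj])
  have ppi: "integrable M (\<lambda>\<omega>. p a (\<xi> \<omega>) * cnj (p b (\<xi> \<omega>)))" if "a \<in> I" "b \<in> I" for a b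
    by (rule integrable_mult_complex[OF pm' cm[OF pm']]) (use that p2 in auto)
  have qqi: "integrable M (\<lambda>\<omega>. q a (\<eta> \<omega>) * cnj (q b (\<eta> \<omega>)))" if "a \<in> I" "b \<in> I" for a b
    by (rule integrable_mult_complex[OF qm' cm[OF qm']]) (use that q2 in auto)
  have ppm: "(\<lambda>x. p a x * cnj (p b x)) \<in> borel_measurable A" if "a \<in> I" "b \<in> I" for a b
    by (intro borel_measurable_times cm pm that)
  have qqm: "(\<lambda>x. q a x * cnj (q b x)) \<in> borel_measurable B" if "a \<in> I" "b \<in> I" for a b
    by (intro borel_measurable_times cm qm that)
  show "integrable M W" unfolding W_def
    by (intro Bochner_Integration.integrable_sum prod(1) pm qm pi qi)
  have "expectation W = (\<Sum>a\<in>I. expectation (\<lambda>\<omega>. p a (\<xi> \<omega>) * q a (\<eta> \<omega>)))"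
    unfolding W_def by (rule Bochner_Integration.integral_sum) (intro prod(1) pm qm pi qi)
  also have "\<dots> = 0" using prod(2)[OF pm qm pi qi] mean by simp
  finally show "expectation W = 0" .
  let ?t = "\<lambda>a b \<omega>. (p a (\<xi> \<omega>) * cnj (p b (\<xi> \<omega>))) * (q a (\<eta> \<omega>) * cnj (q b (\<eta> \<omega>)))"
  have WW: "W \<omega> * cnj (W \<omega>) = (\<Sum>a\<in>I. \<Sum>b\<in>I. ?t a b \<omega>)" for \<omega>
    unfolding W_def cnj_sum sum_product by (simp add: mult_ac)
  have ti: "integrable M (?t a b)" if "a \<in> I" "b \<in> I" for a b
    by (rule prod(1)[OF ppm[OF that] qqm[OF that] ppi[OF that] qqi[OF that]])
  have te: "expectation (?t a b) = (if a = b then complex_of_real (v * expectation (\<lambda>\<omega>. (cmod (q a (\<eta> \<omega>)))\<^sup>2)) else 0)" if "a \<in> I" "b \<in> I" for a b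
  proof -
    have "expectation (\<lambda>\<omega>. q a (\<eta> \<omega>) * cnj (q a (\<eta> \<omega>))) = complex_of_real (expectation (\<lambda>\<omega>. (cmod (q a (\<eta> \<omega>)))\<^sup>2))"
      unfolding complex_norm_square[symmetric] by (rule integral_complex_of_real)
    then show ?thesis unfolding prod(2)[OF ppm[OF that] qqm[OF that] ppi[OF that] qqi[OF that]] cov[OF that] by (cases "a = b") simp_all
  qed
  have WWi: "integrable M (\<lambda>\<omega>. W \<omega> * cnj (W \<omega>))"
    unfolding WW by (intro Bochner_Integration.integrable_sum ti)
  have sq: "(\<lambda>\<omega>. (cmod (W \<omega>))\<^sup>2) = (\<lambda>\<omega>. Re (W \<omega> * cnj (W \<omega>)))"
    by (rule ext) (simp only: complex_norm_square[symmetric] Re_complex_of_real)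
  show "integrable M (\<lambda>\<omega>. (cmod (W \<omega>))\<^sup>2)" unfolding sq by (rule integrable_Re[OF WWi])
  have "expectation (\<lambda>\<omega>. W \<omega> * cnj (W \<omega>)) = (\<Sum>a\<in>I. \<Sum>b\<in>I. expectation (?t a b))"
    unfolding WW using ti by (simp add: Bochner_Integration.integral_sum Bochner_Integration.integrable_sum)
  also have "\<dots> = (\<Sum>a\<in>I. \<Sum>b\<in>I. if a = b then complex_of_real (v * expectation (\<lambda>\<omega>. (cmod (q a (\<eta> \<omega>)))\<^sup>2)) else 0)"
    by (intro sum.cong refl te)
  also have "\<dots> = complex_of_real (v * (\<Sum>a\<in>I. expectation (\<lambda>\<omega>. (cmod (q a (\<eta> \<omega>)))\<^sup>2)))"
    using fin by (simp add: sum_distrib_left)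
  finally have "expectation (\<lambda>\<omega>. W \<omega> * cnj (W \<omega>)) = complex_of_real (v * (\<Sum>a\<in>I. expectation (\<lambda>\<omega>. (cmod (q a (\<eta> \<omega>)))\<^sup>2)))" .
  then show "expectation (\<lambda>\<omega>. (cmod (W \<omega>))\<^sup>2) = v * (\<Sum>a\<in>I. expectation (\<lambda>\<omega>. (cmod (q a (\<eta> \<omega>)))\<^sup>2))"
    unfolding sq integral_Re[OF WWi] by simp
qed

lemma (in prob_space) cgauss_variable_moments:
  assumes [measurable]: "X \<in> borel_measurable M" and d: "distr M borel X = cgauss v" and v: "v > 0"
  shows "integrable M (\<lambda>\<omega>. (cmod (X \<omega>))\<^sup>2)" "expectation (\<lambda>\<omega>. (cmod (X \<omega>))\<^sup>2) = v" "integrable M X" "expectation X = 0"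
proof -
  have i: "integrable M (\<lambda>\<omega>. \<phi> (X \<omega>)) \<longleftrightarrow> integrable (cgauss v) \<phi>"
    and e: "expectation (\<lambda>\<omega>. \<phi> (X \<omega>)) = (\<integral>z. \<phi> z \<partial>cgauss v)"
    if "\<phi> \<in> borel_measurable borel" for \<phi> :: "complex \<Rightarrow> 'b :: {banach, second_countable_topology}"
    using integrable_distr_eq[of X M borel \<phi>] integral_distr[of X M borel \<phi>] that by (simp_all add: d)
  show "integrable M (\<lambda>\<omega>. (cmod (X \<omega>))\<^sup>2)"
    by (rule i[of "\<lambda>z. (cmod z)\<^sup>2", THEN iffD2, OF _ cgauss_second_moment(1)[OF v]]) measurable
  show "expectation (\<lambda>\<omega>. (cmod (X \<omega>))\<^sup>2) = v"
    by (rule trans[OF e[of "\<lambda>z. (cmod z)\<^sup>2"] cgauss_second_moment(2)[OF v]]) measurable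
  show "integrable M X"
    by (rule i[of "\<lambda>z. z", THEN iffD2, OF _ cgauss_mean(1)[OF v]]) measurable
  show "expectation X = 0"
    by (rule trans[OF e[of "\<lambda>z. z"] cgauss_mean(2)[OF v]]) measurable
qed

lemma (in prob_space) cgauss_family_covariance:
  assumes ind: "indep_vars (\<lambda>_. borel) X I" and xy: "x \<in> I" "y \<in> I" and v: "v > 0"
    and d: "distr M borel (X x) = cgauss v" "distr M borel (X y) = cgauss v'" "v' > 0"
  shows "expectation (\<lambda>\<omega>. X x \<omega> * cnj (X y \<omega>)) = (if x = y then complex_of_real v else 0)"
proof -
  have m: "X x \<in> borel_measurable M" "X y \<in> borel_measurable M" using ind xy by (auto simp: indep_vars_def)
  show ?thesis
  proof (cases "x = y")
    case True
    have "expectation (\<lambda>\<omega>. X x \<omega> * cnj (X x \<omega>)) = complex_of_real (expectation (\<lambda>\<omega>. (cmod (X x \<omega>))\<^sup>2))"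
      unfolding complex_norm_square[symmetric] by (rule integral_complex_of_real)
    also have "\<dots> = complex_of_real v" unfolding cgauss_variable_moments(2)[OF m(1) d(1) v] ..
    finally show ?thesis using True by simp
  next
    case False
    have "indep_var borel (id \<circ> X x) borel (cnj \<circ> X y)"
      by (rule indep_var_compose[OF indep_vars_imp_indep_var[OF ind xy False]]) auto
    then have i: "indep_var borel (X x) borel (\<lambda>\<omega>. cnj (X y \<omega>))" by (simp add: comp_def)
    have "expectation (\<lambda>\<omega>. X x \<omega> * cnj (X y \<omega>)) = expectation (X x) * expectation (\<lambda>\<omega>. cnj (X y \<omega>))"
      by (rule indep_var_lebesgue_integral[OF i])
        (intro cgauss_variable_moments(3)[OF m(1) d(1) v] integrable_cnj cgauss_variable_moments(3)[OF m(2) d(2,3)])+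
    also have "\<dots> = 0" unfolding cgauss_variable_moments(4)[OF m(1) d(1) v] by simp
    finally show ?thesis using False by simp
  qed
qed

text \<open>Interval 0 is the model: \<open>set_block b\<close> carries each of its sources to the
  counterpart in interval \<open>b\<close>, so that the states of all intervals become tuples over
  one index set.\<close>

fun set_block :: "nat \<Rightarrow> source \<Rightarrow> source" where
  "set_block b (Channel _ j k a) = Channel b j k a"
| "set_block b (Pilot_Noise _ j k a) = Pilot_Noise b j k a"
| "set_block b (Data _ t j) = Data b t j"
| "set_block b (Receiver_Noise _ t) = Receiver_Noise b t"

fun source_block :: "source \<Rightarrow> nat" where
  "source_block (Channel b j k a) = b"
| "source_block (Pilot_Noise b j k a) = b"
| "source_block (Data b t j) = b"
| "source_block (Receiver_Noise b t) = b"

definition block_sources :: "nat \<Rightarrow> nat \<Rightarrow> (nat \<Rightarrow> nat) \<Rightarrow> nat \<Rightarrow> source set" where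
  "block_sources N G K L = {x \<in> sources N G K L. source_block x = 0}"

lemma set_block_sources: "x \<in> sources N G K L \<Longrightarrow> set_block b x \<in> sources N G K L"
  by (cases x) (auto simp: sources_def)

lemma source_block_set_block [simp]: "source_block (set_block b x) = b"
  by (cases x) auto

lemma set_block_zero: "source_block x = 0 \<Longrightarrow> set_block 0 x = x"
  by (cases x) auto

lemma set_block_set_block [simp]: "set_block b (set_block c x) = set_block b x"
  by (cases x) auto

lemma source_variance_set_block [simp]: "source_variance \<beta> (set_block b x) = source_variance \<beta> x"
  by (cases x) auto

lemma inj_on_set_block: "inj_on (set_block b) (block_sources N G K L)"
  by (rule inj_on_inverseI[of _ "set_block 0"]) (auto simp: block_sources_def set_block_zero)

section \<open>The order of the users among the columns\<close>

definition user_list :: "nat \<Rightarrow> (nat \<Rightarrow> nat) \<Rightarrow> (nat \<times> nat) list" where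
  "user_list G K = concat (map (\<lambda>j. map (Pair j) [1..<K j + 1]) [1..<G + 1])"

lemma user_list_Suc: "user_list (Suc G) K = user_list G K @ map (Pair (Suc G)) [1..<K (Suc G) + 1]"
  by (simp add: user_list_def)

lemma length_user_list: "length (user_list G K) = K_tot G K"
  by (induction G) (simp_all add: user_list_Suc K_tot_def, simp add: user_list_def)

lemma set_user_list: "set (user_list G K) = Sigma {1..G} (\<lambda>j. {1..K j})"
  by (force simp: user_list_def simp del: upt_Suc)

lemma distinct_user_list: "distinct (user_list G K)"
proof (induction G)
  case 0
  show ?case by (simp add: user_list_def)
next
  case (Suc G)
  then show ?case by (auto simp: user_list_Suc distinct_map inj_on_def set_user_list)
qed

text \<open>The induction on the number of groups works because the users of a new group are
  appended. Positions count from 1 and list indices from 0.\<close>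

lemma user_list_nth_position:
  assumes "j \<in> {1..G}" "k \<in> {1..K j}"
  shows "user_position K j k - 1 < K_tot G K \<and> user_list G K ! (user_position K j k - 1) = (j, k)"
  using assms(1)
proof (induction G)
  case (Suc G)
  show ?case
  proof (cases "j = Suc G")
    case True
    have "user_position K j k - 1 = length (user_list G K) + (k - 1)"
      using True assms(2) by (simp add: user_position_def length_user_list K_tot_def atLeastLessThanSuc_atLeastAtMost)
    moreover have "k - 1 < length (map (Pair (Suc G)) [1..<K (Suc G) + 1])" using True assms(2) by auto
    moreover have "map (Pair (Suc G)) [1..<K (Suc G) + 1] ! (k - 1) = (j, k)"
      using True assms(2) by (subst nth_map) (auto simp del: upt_Suc)
    moreover have "K_tot (Suc G) K = length (user_list G K) + K (Suc G)" by (simp add: length_user_list K_tot_def)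
    ultimately show ?thesis unfolding user_list_Suc using True assms(2) by (auto simp: nth_append simp del: upt_Suc)
  next
    case False
    then have IH: "user_position K j k - 1 < K_tot G K" "user_list G K ! (user_position K j k - 1) = (j, k)"
      using Suc by auto
    then show ?thesis unfolding user_list_Suc by (simp add: nth_append length_user_list K_tot_def)
  qed
qed simp

lemma user_list_nth_in: "s < K_tot G K \<Longrightarrow> user_list G K ! s \<in> Sigma {1..G} (\<lambda>j. {1..K j})"
  using nth_mem[of s "user_list G K"] by (simp add: length_user_list set_user_list)

lemma estimate_matrix_eq_col_mat:
  assumes dim: "\<And>j k. j \<in> {1..G} \<Longrightarrow> k \<in> {1..K j} \<Longrightarrow> dim_vec (h j k) = N"
  shows "estimate_matrix N G K h = col_mat N (K_tot G K) (\<lambda>s a. case_prod h (user_list G K ! s) $ a)"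
proof -
  have l: "concat (map (\<lambda>j. map (h j) [1..<K j + 1]) [1..<G + 1]) = map (case_prod h) (user_list G K)"
    by (simp add: user_list_def map_concat comp_def)
  show ?thesis
    unfolding estimate_matrix_def l col_mat_def
    by (rule eq_matI) (auto simp: mat_of_cols_index length_user_list)
qed

lemma zf_precoder_eq:
  assumes dim: "\<And>j k. j \<in> {1..G} \<Longrightarrow> k \<in> {1..K j} \<Longrightarrow> dim_vec (h j k) = N" and a: "a < N"
  shows "zf_precoder N G K p \<gamma> h j k $ a = complex_of_real (sqrt (p j k * \<gamma> j k * (real N - real (K_tot G K)))) *
     zf_vec N (K_tot G K) (\<lambda>s a. case_prod h (user_list G K ! s) $ a) (user_position K j k - 1) $ a"
proof -
  have e: "estimate_matrix N G K h = col_mat N (K_tot G K) (\<lambda>s a. case_prod h (user_list G K ! s) $ a)"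
    by (rule estimate_matrix_eq_col_mat[OF dim])
  show ?thesis
    unfolding zf_precoder_def Let_def e gram_mat_def[symmetric] zf_vec_def[symmetric]
    by (rule index_smult_vec(1)) (simp add: a)
qed

text \<open>The powers of the vectors of one group add although they carry the same symbol, because
  distinct zero-forcing vectors are orthogonal in expectation. Orthogonality is available for sums
  over the antennas, so the double sum over the users is moved outside first.\<close>

lemma (in gaussian_columns) zf_combination:
  fixes \<alpha> :: "'l \<Rightarrow> real" and \<iota> :: "'l \<Rightarrow> nat"
  assumes A: "finite A" and inj: "inj_on \<iota> A" and \<iota>: "\<And>l. l \<in> A \<Longrightarrow> \<iota> l < K"
  defines "V \<equiv> \<lambda>\<omega> a. \<Sum>l\<in>A. complex_of_real (\<alpha> l) * zf \<omega> (\<iota> l) a"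
  shows "\<And>a. a < N \<Longrightarrow> integrable P (\<lambda>\<omega>. (cmod (V \<omega> a))\<^sup>2)"
    and "(\<Sum>a<N. expectation (\<lambda>\<omega>. (cmod (V \<omega> a))\<^sup>2)) \<le> (\<Sum>l\<in>A. (\<alpha> l)\<^sup>2 / (\<gamma> (\<iota> l) * (real N - real K)))"
proof -
  let ?t = "\<lambda>a l l' \<omega>. complex_of_real (\<alpha> l * \<alpha> l') * (cnj (zf \<omega> (\<iota> l') a) * zf \<omega> (\<iota> l) a)"
  have VV: "V \<omega> a * cnj (V \<omega> a) = (\<Sum>l\<in>A. \<Sum>l'\<in>A. ?t a l l' \<omega>)" for \<omega> a
    unfolding V_def cnj_sum sum_product by (simp add: mult_ac)
  have zi: "integrable P (\<lambda>\<omega>. cnj (zf \<omega> (\<iota> l') a) * zf \<omega> (\<iota> l) a)" if "l \<in> A" "l' \<in> A" "a < N" for l l' a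
    by (rule integrable_mult_complex)
      (use that \<iota> zf_measurable zf_entry_square_integrable in \<open>auto intro: measurable_compose[OF _ borel_measurable_cnj]\<close>)
  have VVi: "integrable P (\<lambda>\<omega>. V \<omega> a * cnj (V \<omega> a))" if "a < N" for a
    unfolding VV by (intro Bochner_Integration.integrable_sum integrable_mult_right zi that)
  have sq: "(\<lambda>\<omega>. (cmod (V \<omega> a))\<^sup>2) = (\<lambda>\<omega>. Re (V \<omega> a * cnj (V \<omega> a)))" for a
    by (rule ext) (simp only: complex_norm_square[symmetric] Re_complex_of_real)
  show "integrable P (\<lambda>\<omega>. (cmod (V \<omega> a))\<^sup>2)" if "a < N" for a
    unfolding sq by (rule integrable_Re[OF VVi[OF that]])
  let ?E = "\<lambda>l l'. \<Sum>a<N. expectation (\<lambda>\<omega>. cnj (zf \<omega> (\<iota> l') a) * zf \<omega> (\<iota> l) a)"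
  have E: "?E l l' = (if l = l' then complex_of_real (expectation (\<lambda>\<omega>. \<Sum>a<N. (cmod (zf \<omega> (\<iota> l) a))\<^sup>2)) else 0)"
    if l: "l \<in> A" "l' \<in> A" for l l'
  proof -
    have e: "?E l l' = expectation (\<lambda>\<omega>. \<Sum>a<N. cnj (zf \<omega> (\<iota> l') a) * zf \<omega> (\<iota> l) a)"
      by (rule Bochner_Integration.integral_sum[symmetric]) (use zi l in auto)
    show ?thesis
    proof (cases "l = l'")
      case True
      have "cnj z * z = complex_of_real ((cmod z)\<^sup>2)" for z
        unfolding complex_norm_square by (rule mult.commute)
      then have "expectation (\<lambda>\<omega>. \<Sum>a<N. cnj (zf \<omega> (\<iota> l) a) * zf \<omega> (\<iota> l) a) = expectation (\<lambda>\<omega>. complex_of_real (\<Sum>a<N. (cmod (zf \<omega> (\<iota> l) a))\<^sup>2))"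
        by (simp only: of_real_sum)
      then show ?thesis using True unfolding e integral_complex_of_real by simp
    next
      case False
      then have "\<iota> l' \<noteq> \<iota> l" using inj l by (auto simp: inj_on_def)
      then show ?thesis using False zf_orthogonal[OF \<iota>[OF l(2)] \<iota>[OF l(1)]] unfolding e by simp
    qed
  qed
  have "complex_of_real (\<Sum>a<N. expectation (\<lambda>\<omega>. (cmod (V \<omega> a))\<^sup>2)) = (\<Sum>a<N. expectation (\<lambda>\<omega>. V \<omega> a * cnj (V \<omega> a)))"
    unfolding of_real_sum integral_complex_of_real[symmetric] complex_norm_square ..
  also have "\<dots> = (\<Sum>a<N. \<Sum>l\<in>A. \<Sum>l'\<in>A. complex_of_real (\<alpha> l * \<alpha> l') * expectation (\<lambda>\<omega>. cnj (zf \<omega> (\<iota> l') a) * zf \<omega> (\<iota> l) a))"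
  proof (rule sum.cong[OF refl])
    fix a assume "a \<in> {..<N}"
    then have a: "a < N" by simp
    have "expectation (\<lambda>\<omega>. V \<omega> a * cnj (V \<omega> a)) = (\<Sum>l\<in>A. \<Sum>l'\<in>A. expectation (?t a l l'))"
      unfolding VV using zi a by (simp add: Bochner_Integration.integral_sum Bochner_Integration.integrable_sum)
    then show "expectation (\<lambda>\<omega>. V \<omega> a * cnj (V \<omega> a)) = (\<Sum>l\<in>A. \<Sum>l'\<in>A. complex_of_real (\<alpha> l * \<alpha> l') * expectation (\<lambda>\<omega>. cnj (zf \<omega> (\<iota> l') a) * zf \<omega> (\<iota> l) a))"
      by (simp only: integral_mult_right_zero)
  qed
  also have "\<dots> = (\<Sum>l\<in>A. \<Sum>l'\<in>A. complex_of_real (\<alpha> l * \<alpha> l') * ?E l l')"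
    unfolding sum_distrib_left by (subst sum.swap, rule sum.cong[OF refl], rule sum.swap)
  also have "\<dots> = (\<Sum>l\<in>A. \<Sum>l'\<in>A. if l = l' then complex_of_real ((\<alpha> l)\<^sup>2 * expectation (\<lambda>\<omega>. \<Sum>a<N. (cmod (zf \<omega> (\<iota> l) a))\<^sup>2)) else 0)"
    by (intro sum.cong refl) (simp add: E power2_eq_square)
  also have "\<dots> = complex_of_real (\<Sum>l\<in>A. (\<alpha> l)\<^sup>2 * expectation (\<lambda>\<omega>. \<Sum>a<N. (cmod (zf \<omega> (\<iota> l) a))\<^sup>2))"
    using A by (simp add: of_real_sum)
  finally have "(\<Sum>a<N. expectation (\<lambda>\<omega>. (cmod (V \<omega> a))\<^sup>2)) = (\<Sum>l\<in>A. (\<alpha> l)\<^sup>2 * expectation (\<lambda>\<omega>. \<Sum>a<N. (cmod (zf \<omega> (\<iota> l) a))\<^sup>2))"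
    by (simp only: of_real_eq_iff)
  also have "\<dots> \<le> (\<Sum>l\<in>A. (\<alpha> l)\<^sup>2 * (1 / (\<gamma> (\<iota> l) * (real N - real K))))"
    by (intro sum_mono mult_left_mono zf_norm(2) \<iota>) auto
  finally show "(\<Sum>a<N. expectation (\<lambda>\<omega>. (cmod (V \<omega> a))\<^sup>2)) \<le> (\<Sum>l\<in>A. (\<alpha> l)\<^sup>2 / (\<gamma> (\<iota> l) * (real N - real K)))"
    by simp
qed

section \<open>The zero-forcing downlink\<close>

definition estimate_coeff :: "nat \<Rightarrow> real \<Rightarrow> real \<Rightarrow> real" where
  "estimate_coeff \<tau> p \<beta> = sqrt (real \<tau> * p) * \<beta> / (1 + real \<tau> * p * \<beta>)"

lemma mmse_estimate_index:
  assumes "a < N"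
  shows "mmse_estimate \<tau> p \<beta> (vec N x) (vec N y) $ a
    = complex_of_real (estimate_coeff \<tau> p \<beta>) * (complex_of_real (sqrt (real \<tau> * p)) * x a + y a)"
  using assms by (simp add: mmse_estimate_def estimate_coeff_def)

lemma dim_mmse_estimate [simp]: "dim_vec (mmse_estimate \<tau> p \<beta> x y) = dim_vec y"
  by (simp add: mmse_estimate_def)

text \<open>One user \<open>(i, k)\<close> is fixed. \<open>X\<close> comprises all sources, with
  the receiver noise of this user, and \<open>L\<close> is the number of data symbols in an
  interval.\<close>

locale zf_downlink = prob_space P for P :: "'w measure" +
  fixes N G :: nat and K :: "nat \<Rightarrow> nat" and \<tau> L :: nat and \<beta> pu pdl :: "nat \<Rightarrow> nat \<Rightarrow> real"
    and X :: "source \<Rightarrow> 'w \<Rightarrow> complex" and i k :: nat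
  assumes antennas: "K_tot G K < N" and pilots: "K_tot G K \<le> \<tau>"
    and \<beta>_pos: "\<And>j l. j \<in> {1..G} \<Longrightarrow> l \<in> {1..K j} \<Longrightarrow> \<beta> j l > 0"
    and pu_pos: "\<And>j l. j \<in> {1..G} \<Longrightarrow> l \<in> {1..K j} \<Longrightarrow> pu j l > 0"
    and pdl_nonneg: "\<And>j l. j \<in> {1..G} \<Longrightarrow> l \<in> {1..K j} \<Longrightarrow> pdl j l \<ge> 0"
    and X_indep: "indep_vars (\<lambda>_. borel) X (sources N G K L)"
    and X_gauss: "\<And>x. x \<in> sources N G K L \<Longrightarrow> circular_gaussian P (source_variance \<beta> x) (X x)"
    and user: "i \<in> {1..G}" "k \<in> {1..K i}" and L_pos: "0 < L"
begin

abbreviation "S0 \<equiv> block_sources N G K L"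
abbreviation "Kt \<equiv> K_tot G K"
abbreviation "law0 \<equiv> \<Pi>\<^sub>M x\<in>S0. (borel :: complex measure)"

definition "gam j l = mmse_gamma \<tau> (pu j l) (\<beta> j l)"
definition "usr s = user_list G K ! s"
definition "pos j l = user_position K j l - 1"
definition "amp j l = sqrt (pdl j l * gam j l * (real N - real Kt))"

text \<open>\<open>transform c\<close> replaces the pilot noise by the channel estimate and the channel by the
  estimation error.\<close>

definition transform :: "(source \<Rightarrow> complex) \<Rightarrow> source \<Rightarrow> complex" where
  "transform c x = (case x of
     Channel b j l a \<Rightarrow> complex_of_real (estimate_coeff \<tau> (pu j l) (\<beta> j l)) *
        (complex_of_real (sqrt (real \<tau> * pu j l)) * c (Channel b j l a) + c (Pilot_Noise b j l a)) - c (Channel b j l a)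
   | Pilot_Noise b j l a \<Rightarrow> complex_of_real (estimate_coeff \<tau> (pu j l) (\<beta> j l)) *
        (complex_of_real (sqrt (real \<tau> * pu j l)) * c (Channel b j l a) + c (Pilot_Noise b j l a))
   | _ \<Rightarrow> c x)"

definition "X' x \<omega> = transform (\<lambda>x. X x \<omega>) x"

definition "est_col c s a = c (Pilot_Noise 0 (fst (usr s)) (snd (usr s)) a)"
definition "beam c j a = (\<Sum>l=1..K j. complex_of_real (amp j l) * zf_vec N Kt (est_col c) (pos j l) $ a)"

lemma users_pos: "0 < Kt"
proof -
  have "K i \<le> Kt" unfolding K_tot_def using user by (intro member_le_sum) auto
  then show ?thesis using user by simp
qed

lemma tau_pos: "0 < \<tau>"
  using users_pos pilots by simp

lemma pos_less: "j \<in> {1..G} \<Longrightarrow> l \<in> {1..K j} \<Longrightarrow> pos j l < Kt"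
  and usr_pos: "j \<in> {1..G} \<Longrightarrow> l \<in> {1..K j} \<Longrightarrow> usr (pos j l) = (j, l)"
  using user_list_nth_position[of j G l K] by (auto simp: pos_def usr_def)

lemma usr_in: "s < Kt \<Longrightarrow> fst (usr s) \<in> {1..G} \<and> snd (usr s) \<in> {1..K (fst (usr s))}"
  using user_list_nth_in[of s G K] by (auto simp: usr_def)

lemma usr_inj: "s < Kt \<Longrightarrow> s' < Kt \<Longrightarrow> usr s = usr s' \<Longrightarrow> s = s'"
  using distinct_user_list[of G K] by (simp add: usr_def nth_eq_iff_index_eq length_user_list)

lemma S0_iff [simp]:
  "Channel b j l a \<in> S0 \<longleftrightarrow> b = 0 \<and> j \<in> {1..G} \<and> l \<in> {1..K j} \<and> a < N"
  "Pilot_Noise b j l a \<in> S0 \<longleftrightarrow> b = 0 \<and> j \<in> {1..G} \<and> l \<in> {1..K j} \<and> a < N"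
  "Data b t j \<in> S0 \<longleftrightarrow> b = 0 \<and> t < L \<and> j \<in> {1..G}"
  "Receiver_Noise b t \<in> S0 \<longleftrightarrow> b = 0 \<and> t < L"
  by (auto simp: block_sources_def sources_def)

lemma S0_sources: "S0 \<subseteq> sources N G K L"
  by (auto simp: block_sources_def)

lemma X_measurable: "x \<in> sources N G K L \<Longrightarrow> X x \<in> borel_measurable P"
  using X_indep by (auto simp: indep_vars_def)

lemma X_distr: "x \<in> sources N G K L \<Longrightarrow> distr P borel (X x) = cgauss (source_variance \<beta> x)"
  using circular_gaussian_distr(2)[OF X_gauss] .

text \<open>Both inequalities are strict, so estimate and error are proper Gaussians with
  densities.\<close>

lemma gam_bounds:
  assumes "j \<in> {1..G}" "l \<in> {1..K j}"
  shows "0 < gam j l" "0 < \<beta> j l - gam j l"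
proof -
  have \<beta>: "\<beta> j l > 0" and \<rho>: "real \<tau> * pu j l > 0" using assms \<beta>_pos pu_pos tau_pos by auto
  have d: "1 + real \<tau> * pu j l * \<beta> j l > 0" using mult_pos_pos[OF \<rho> \<beta>] by simp
  show "0 < gam j l" using \<beta> \<rho> d by (simp add: gam_def mmse_gamma_def)
  have "\<beta> j l - gam j l = \<beta> j l / (1 + real \<tau> * pu j l * \<beta> j l)"
    using d by (simp add: gam_def mmse_gamma_def field_simps power2_eq_square)
  then show "0 < \<beta> j l - gam j l" using \<beta> d by simp
qed

lemma X'_simps:
  "X' (Data b t j) = X (Data b t j)" "X' (Receiver_Noise b t) = X (Receiver_Noise b t)"
  "X' (Channel b j l a) = (\<lambda>\<omega>. X' (Pilot_Noise b j l a) \<omega> - X (Channel b j l a) \<omega>)"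
  by (auto simp: X'_def transform_def fun_eq_iff)

lemma estimate_error_pair:
  assumes "j \<in> {1..G}" "l \<in> {1..K j}" "a < N"
  shows "indep_var borel (X' (Pilot_Noise 0 j l a)) borel (X' (Channel 0 j l a))"
    "distr P borel (X' (Pilot_Noise 0 j l a)) = cgauss (gam j l)"
    "distr P borel (X' (Channel 0 j l a)) = cgauss (\<beta> j l - gam j l)"
proof -
  let ?C = "Channel 0 j l a" and ?Q = "Pilot_Noise 0 j l a"
  have in_sources: "?C \<in> sources N G K L" "?Q \<in> sources N G K L" using assms S0_sources by auto
  note [measurable] = X_measurable[OF in_sources(1)] X_measurable[OF in_sources(2)]
  have \<beta>: "\<beta> j l > 0" and \<rho>: "real \<tau> * pu j l > 0" using assms \<beta>_pos pu_pos tau_pos by auto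
  let ?c = "estimate_coeff \<tau> (pu j l) (\<beta> j l)" and ?s = "sqrt (real \<tau> * pu j l)"
  let ?\<Psi> = "\<lambda>(x, n). (complex_of_real ?c * (complex_of_real ?s * x + n), complex_of_real ?c * (complex_of_real ?s * x + n) - x)"
  have "indep_var borel (X ?C) borel (X ?Q)"
    by (rule indep_vars_imp_indep_var[OF X_indep in_sources]) simp
  then have joint: "distr P (borel \<Otimes>\<^sub>M borel) (\<lambda>\<omega>. (X ?C \<omega>, X ?Q \<omega>)) = cgauss (\<beta> j l) \<Otimes>\<^sub>M cgauss 1"
    by (simp add: indep_var_distribution_eq X_distr[OF in_sources(1)] X_distr[OF in_sources(2)])
  have \<Psi>: "?\<Psi> \<in> measurable (borel \<Otimes>\<^sub>M borel) (borel \<Otimes>\<^sub>M borel)"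
    unfolding split_beta' by measurable
  have m: "X' ?Q \<in> borel_measurable P" "X' ?C \<in> borel_measurable P"
    unfolding X'_def[abs_def] transform_def by (simp_all, measurable)
  have "distr P (borel \<Otimes>\<^sub>M borel) (\<lambda>\<omega>. (X' ?Q \<omega>, X' ?C \<omega>))
      = distr (distr P (borel \<Otimes>\<^sub>M borel) (\<lambda>\<omega>. (X ?C \<omega>, X ?Q \<omega>))) (borel \<Otimes>\<^sub>M borel) ?\<Psi>"
    by (subst distr_distr[OF \<Psi>]) (auto simp: comp_def X'_def transform_def)
  also have "\<dots> = cgauss (gam j l) \<Otimes>\<^sub>M cgauss (\<beta> j l - gam j l)"
    unfolding joint using distr_estimate_error[OF \<beta> \<rho>]
    by (simp add: estimate_coeff_def gam_def mmse_gamma_def)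
  finally have law: "distr P (borel \<Otimes>\<^sub>M borel) (\<lambda>\<omega>. (X' ?Q \<omega>, X' ?C \<omega>)) = cgauss (gam j l) \<Otimes>\<^sub>M cgauss (\<beta> j l - gam j l)" .
  note res = indep_var_of_product_law[OF m prob_space_cgauss prob_space_cgauss sets_cgauss sets_cgauss law]
  show "indep_var borel (X' ?Q) borel (X' ?C)" "distr P borel (X' ?Q) = cgauss (gam j l)"
    "distr P borel (X' ?C) = cgauss (\<beta> j l - gam j l)"
    using res gam_bounds[OF assms(1,2)] by auto
qed

text \<open>\<open>transform\<close> mixes a channel entry only with its own pilot noise. These
  pairs and the remaining single sources are independent groups, inside a pair estimate and error
  are independent, and so independence refines to all members.\<close>

lemma X'_indep: "indep_vars (\<lambda>_. borel) X' S0"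
proof -
  \<comment> \<open>A pilot noise represents the pair formed with its channel entry, so the channel
    entries are left out of the index set.\<close>
  define J where "J = {x \<in> S0. \<forall>b j l a. x \<noteq> Channel b j l a}"
  define F where "F x = (case x of Pilot_Noise b j l a \<Rightarrow> {Channel b j l a, Pilot_Noise b j l a} | _ \<Rightarrow> {x})" for x
  have F_simps: "F (Pilot_Noise b j l a) = {Channel b j l a, Pilot_Noise b j l a}" "F (Data b t j) = {Data b t j}"
    "F (Receiver_Noise b t) = {Receiver_Noise b t}" for b j l a t by (auto simp: F_def)
  have noC: "Channel b j l a \<notin> J" for b j l a by (auto simp: J_def)
  have FJ: "F x \<subseteq> S0" if "x \<in> J" for x
    using that noC by (cases x) (auto simp: F_simps J_def)
  have S0_eq: "S0 = (\<Union>x\<in>J. F x)"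
  proof (rule equalityI)
    show "S0 \<subseteq> (\<Union>x\<in>J. F x)"
    proof
      fix x assume x: "x \<in> S0"
      show "x \<in> (\<Union>x\<in>J. F x)"
      proof (cases x)
        case (Channel b j l a)
        then have "Pilot_Noise b j l a \<in> J" using x by (auto simp: J_def)
        moreover have "x \<in> F (Pilot_Noise b j l a)" using Channel by (simp add: F_simps)
        ultimately show ?thesis by blast
      next
        case (Pilot_Noise b j l a)
        then have "x \<in> J" "x \<in> F x" using x by (auto simp: J_def F_simps)
        then show ?thesis by blast
      next
        case (Data b t j)
        then have "x \<in> J" "x \<in> F x" using x by (auto simp: J_def F_simps)
        then show ?thesis by blast
      next
        case (Receiver_Noise b t)
        then have "x \<in> J" "x \<in> F x" using x by (auto simp: J_def F_simps)
        then show ?thesis by blast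
      qed
    qed
  qed (use FJ in blast)
  have disj: "disjoint_family_on F J"
    unfolding disjoint_family_on_def
  proof (intro ballI impI)
    fix x y assume "x \<in> J" "y \<in> J" "x \<noteq> y"
    then show "F x \<inter> F y = {}" using noC by (cases x; cases y) (auto simp: F_simps)
  qed
  have X0: "indep_vars (\<lambda>_. borel) X S0" by (rule indep_vars_subset[OF X_indep S0_sources])
  have base: "indep_vars (\<lambda>x. PiM (F x) (\<lambda>_. borel)) (\<lambda>x \<omega>. restrict (\<lambda>y. X y \<omega>) (F x)) J"
    by (rule indep_vars_restrict[OF X0 FJ disj])
  have outer: "indep_vars (\<lambda>x. PiM (F x) (\<lambda>_. borel)) (\<lambda>x \<omega>. restrict (\<lambda>y. X' y \<omega>) (F x)) J"
  proof -
    have tm: "(\<lambda>c. \<lambda>y\<in>F x. transform c y) \<in> measurable (PiM (F x) (\<lambda>_. borel)) (PiM (F x) (\<lambda>_. borel))" if "x \<in> J" for x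
    proof (rule measurable_restrict)
      have comp: "(\<lambda>c. c y) \<in> borel_measurable (PiM (F x) (\<lambda>_. borel :: complex measure))" if "y \<in> F x" for y
        using that by (rule measurable_component_singleton)
      fix y assume "y \<in> F x"
      then show "(\<lambda>c. transform c y) \<in> borel_measurable (PiM (F x) (\<lambda>_. borel :: complex measure))"
        using that noC
        by (cases x) (auto simp: F_simps transform_def intro!: borel_measurable_times borel_measurable_diff borel_measurable_add comp)
    qed
    have tr: "(\<lambda>y\<in>F x. transform (restrict (\<lambda>y. X y \<omega>) (F x)) y) = restrict (\<lambda>y. X' y \<omega>) (F x)" if "x \<in> J" for x \<omega>
    proof (rule restrict_ext)
      fix y assume "y \<in> F x"
      then show "transform (restrict (\<lambda>y. X y \<omega>) (F x)) y = X' y \<omega>"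
        using that noC by (cases x) (auto simp: F_simps transform_def X'_def)
    qed
    have "indep_vars (\<lambda>x. PiM (F x) (\<lambda>_. borel)) (\<lambda>x \<omega>. (\<lambda>y\<in>F x. transform (restrict (\<lambda>y. X y \<omega>) (F x)) y)) J"
      by (rule indep_vars_compose2[OF base tm])
    then show ?thesis by (subst indep_vars_cong[OF refl _ refl]) (auto simp: fun_eq_iff tr[symmetric])
  qed
  have inner: "indep_vars (\<lambda>_. borel) X' (F x)" if x: "x \<in> J" for x
  proof (cases x)
    case (Channel b j l a)
    then show ?thesis using x noC by simp
  next
    case (Pilot_Noise b j l a)
    then have "indep_vars (\<lambda>_. borel) X' {Pilot_Noise b j l a, Channel b j l a}"
      using x by (intro indep_vars_two) (auto simp: J_def intro: estimate_error_pair(1))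
    then show ?thesis by (simp add: Pilot_Noise F_simps insert_commute)
  next
    case (Data b t j)
    then have "indep_vars (\<lambda>_. borel) X {x}" using x by (intro indep_vars_subset[OF X0]) (auto simp: J_def)
    then show ?thesis using Data by (subst indep_vars_cong[of _ "{x}" _ X]) (auto simp: F_simps X'_simps)
  next
    case (Receiver_Noise b t)
    then have "indep_vars (\<lambda>_. borel) X {x}" using x by (intro indep_vars_subset[OF X0]) (auto simp: J_def)
    then show ?thesis using Receiver_Noise by (subst indep_vars_cong[of _ "{x}" _ X]) (auto simp: F_simps X'_simps)
  qed
  show ?thesis unfolding S0_eq by (rule indep_vars_refine[OF outer inner disj])
qed

lemma X'_measurable: "x \<in> S0 \<Longrightarrow> X' x \<in> borel_measurable P"
  using X'_indep by (auto simp: indep_vars_def)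

text \<open>The value 1 beyond the last user is a default that keeps every variance
  positive.\<close>

definition "col_gam s = (if s < Kt then gam (fst (usr s)) (snd (usr s)) else 1)"

sublocale cols: gaussian_columns P N Kt col_gam "\<lambda>s a. X' (Pilot_Noise 0 (fst (usr s)) (snd (usr s)) a)"
proof
  show "0 < Kt" by (rule users_pos)
  show "Kt < N" by (rule antennas)
  show "0 < col_gam s" for s using usr_in[of s] gam_bounds(1) by (auto simp: col_gam_def)
  let ?f = "\<lambda>(s, a). Pilot_Noise 0 (fst (usr s)) (snd (usr s)) a"
  have "indep_vars (\<lambda>p. borel) (\<lambda>p. X' (?f p)) ({..<Kt} \<times> {..<N})"
  proof (rule indep_vars_reindex[where M'="\<lambda>_. borel" and f="?f"])
    show "indep_vars (\<lambda>_. borel) X' (?f ` ({..<Kt} \<times> {..<N}))"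
      by (rule indep_vars_subset[OF X'_indep]) (use usr_in in auto)
    show "inj_on ?f ({..<Kt} \<times> {..<N})"
      by (auto simp: inj_on_def intro: usr_inj prod_eqI)
  qed
  then show "indep_vars (\<lambda>_. borel) (\<lambda>(s, a). X' (Pilot_Noise 0 (fst (usr s)) (snd (usr s)) a)) ({..<Kt} \<times> {..<N})"
    by (simp add: split_beta')
  show "distr P borel (X' (Pilot_Noise 0 (fst (usr s)) (snd (usr s)) a)) = cgauss (col_gam s)" if "s < Kt" "a < N" for s a
    using estimate_error_pair(2)[of "fst (usr s)" "snd (usr s)" a] usr_in[OF that(1)] that by (simp add: col_gam_def)
qed

abbreviation "V \<omega> j a \<equiv> beam (\<lambda>x. X' x \<omega>) j a"

lemma V_eq: "V \<omega> j a = (\<Sum>l\<in>{1..K j}. complex_of_real (amp j l) * cols.zf \<omega> (pos j l) a)"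
  by (simp add: beam_def est_col_def[abs_def])

lemma amp_square: "j \<in> {1..G} \<Longrightarrow> l \<in> {1..K j} \<Longrightarrow> (amp j l)\<^sup>2 = pdl j l * gam j l * (real N - real Kt)"
  unfolding amp_def using pdl_nonneg[of j l] gam_bounds(1)[of j l] antennas by (simp add: less_imp_le)

text \<open>The factor \<open>gam j l * (real N - real Kt)\<close> in the squared amplitude cancels
  the bound on the squared norm, so each vector has mean power at most
  \<open>pdl j l\<close>.\<close>

lemma V_moments:
  assumes j: "j \<in> {1..G}"
  shows "\<And>a. a < N \<Longrightarrow> integrable P (\<lambda>\<omega>. (cmod (V \<omega> j a))\<^sup>2)"
    "(\<Sum>a<N. expectation (\<lambda>\<omega>. (cmod (V \<omega> j a))\<^sup>2)) \<le> (\<Sum>l=1..K j. pdl j l)"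
proof -
  have inj: "inj_on (pos j) {1..K j}"
  proof (rule inj_onI)
    fix l l' assume l: "l \<in> {1..K j}" "l' \<in> {1..K j}" "pos j l = pos j l'"
    from l(3) have "usr (pos j l) = usr (pos j l')" by (rule arg_cong)
    then show "l = l'" unfolding usr_pos[OF j l(1)] usr_pos[OF j l(2)] by simp
  qed
  note c = cols.zf_combination[OF finite_atLeastAtMost inj pos_less[OF j], where \<alpha>="amp j", folded V_eq]
  show "integrable P (\<lambda>\<omega>. (cmod (V \<omega> j a))\<^sup>2)" if "a < N" for a using c(1)[OF _ that] by simp
  have "(\<Sum>a<N. expectation (\<lambda>\<omega>. (cmod (V \<omega> j a))\<^sup>2)) \<le> (\<Sum>l=1..K j. (amp j l)\<^sup>2 / (col_gam (pos j l) * (real N - real Kt)))"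
    using c(2) by simp
  also have "\<dots> = (\<Sum>l=1..K j. pdl j l)"
  proof (rule sum.cong[OF refl])
    fix l assume l: "l \<in> {1..K j}"
    have "col_gam (pos j l) = gam j l" using pos_less[OF j l] usr_pos[OF j l] by (simp add: col_gam_def)
    then show "(amp j l)\<^sup>2 / (col_gam (pos j l) * (real N - real Kt)) = pdl j l"
      using amp_square[OF j l] gam_bounds(1)[OF j l] antennas by simp
  qed
  finally show "(\<Sum>a<N. expectation (\<lambda>\<omega>. (cmod (V \<omega> j a))\<^sup>2)) \<le> (\<Sum>l=1..K j. pdl j l)" .
qed

text \<open>The estimation error of the user paired with a beam: in a transformed configuration the
  \<open>Channel\<close> entries are errors.\<close>

definition "leak c j = (\<Sum>a<N. cnj (c (Channel 0 i k a)) * beam c j a)"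

abbreviation "W \<omega> j \<equiv> leak (\<lambda>x. X' x \<omega>) j"

lemma beam_measurable:
  assumes j: "j \<in> {1..G}" and a: "a < N"
    and c: "\<And>j l a. j \<in> {1..G} \<Longrightarrow> l \<in> {1..K j} \<Longrightarrow> a < N \<Longrightarrow> (\<lambda>\<omega>. c \<omega> (Pilot_Noise 0 j l a)) \<in> borel_measurable M"
  shows "(\<lambda>\<omega>. beam (c \<omega>) j a) \<in> borel_measurable M"
  unfolding beam_def
proof (intro borel_measurable_sum borel_measurable_times borel_measurable_const)
  fix l assume l: "l \<in> {1..K j}"
  show "(\<lambda>\<omega>. zf_vec N Kt (est_col (c \<omega>)) (pos j l) $ a) \<in> borel_measurable M"
    unfolding est_col_def[abs_def]
    by (rule zf_vec_measurable(1)[where f="\<lambda>s a \<omega>. c \<omega> (Pilot_Noise 0 (fst (usr s)) (snd (usr s)) a)"])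
       (use c usr_in pos_less[OF j l] a in auto)
qed

lemma beam_cong:
  assumes j: "j \<in> {1..G}"
    and c: "\<And>j l a. j \<in> {1..G} \<Longrightarrow> l \<in> {1..K j} \<Longrightarrow> a < N \<Longrightarrow> c (Pilot_Noise 0 j l a) = c' (Pilot_Noise 0 j l a)"
  shows "beam c j = beam c' j"
proof -
  have "zf_vec N Kt (est_col c) = zf_vec N Kt (est_col c')"
    by (rule zf_vec_cong(2)) (use c usr_in in \<open>auto simp: est_col_def\<close>)
  then show ?thesis by (simp add: beam_def fun_eq_iff)
qed

lemma leak_measurable:
  assumes j: "j \<in> {1..G}"
    and c: "\<And>j l a. j \<in> {1..G} \<Longrightarrow> l \<in> {1..K j} \<Longrightarrow> a < N \<Longrightarrow> (\<lambda>\<omega>. c \<omega> (Pilot_Noise 0 j l a)) \<in> borel_measurable M"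
      "\<And>a. a < N \<Longrightarrow> (\<lambda>\<omega>. c \<omega> (Channel 0 i k a)) \<in> borel_measurable M"
  shows "(\<lambda>\<omega>. leak (c \<omega>) j) \<in> borel_measurable M"
  unfolding leak_def
  by (intro borel_measurable_sum borel_measurable_times beam_measurable j c measurable_compose[OF c(2) borel_measurable_cnj]) auto

text \<open>The error of the user is independent of all estimates, hence of the beams, and white
  over the antennas. Every antenna thus contributes the power of the beam there times
  \<open>\<beta> i k - gam i k\<close>.\<close>

lemma W_moments:
  assumes j: "j \<in> {1..G}"
  shows "integrable P (\<lambda>\<omega>. (cmod (W \<omega> j))\<^sup>2)" "expectation (\<lambda>\<omega>. W \<omega> j) = 0" "integrable P (\<lambda>\<omega>. W \<omega> j)"
    "expectation (\<lambda>\<omega>. (cmod (W \<omega> j))\<^sup>2) \<le> (\<beta> i k - gam i k) * (\<Sum>l=1..K j. pdl j l)"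
proof -
  \<comment> \<open>Disjoint sets of sources: \<open>A\<close> carries the errors of the fixed user,
    \<open>B\<close> the estimates of all users.\<close>
  define A where "A = {Channel 0 i k a | a. a < N}"
  define B where "B = {Pilot_Noise 0 j l a | j l a. j \<in> {1..G} \<and> l \<in> {1..K j} \<and> a < N}"
  have AB: "A \<inter> B = {}" "A \<subseteq> S0" "B \<subseteq> S0" using user by (auto simp: A_def B_def)
  let ?v = "\<beta> i k - gam i k"
  have v: "?v > 0" by (rule gam_bounds(2)[OF user])
  let ?\<xi> = "\<lambda>\<omega>. restrict (\<lambda>x. X' x \<omega>) A" and ?\<eta> = "\<lambda>\<omega>. restrict (\<lambda>x. X' x \<omega>) B"
  let ?p = "\<lambda>a c. cnj (c (Channel 0 i k a)) :: complex" and ?q = "\<lambda>a c. beam c j a"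
  have ind: "indep_var (PiM A (\<lambda>_. borel)) ?\<xi> (PiM B (\<lambda>_. borel)) ?\<eta>"
    by (rule indep_var_restrict[OF X'_indep AB])
  have p_eq: "?p a (?\<xi> \<omega>) = cnj (X' (Channel 0 i k a) \<omega>)" if "a < N" for a \<omega> using that by (auto simp: A_def)
  have q_eq: "?q a (?\<eta> \<omega>) = V \<omega> j a" for a \<omega>
    by (subst beam_cong[OF j, of _ "\<lambda>x. X' x \<omega>"]) (auto simp: B_def)
  have m: "X' (Channel 0 i k a) \<in> borel_measurable P" if "a < N" for a using that user by (intro X'_measurable) simp
  note mom = cgauss_variable_moments[OF m estimate_error_pair(3)[OF user] v]
  have cov: "expectation (\<lambda>\<omega>. cnj (X' (Channel 0 i k a) \<omega>) * cnj (cnj (X' (Channel 0 i k b) \<omega>))) = (if a = b then complex_of_real ?v else 0)"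
    if "a < N" "b < N" for a b
    using cgauss_family_covariance[OF X'_indep, of "Channel 0 i k b" "Channel 0 i k a" ?v ?v] that user v estimate_error_pair(3)[OF user]
    by (auto simp: mult.commute)
  have W_eq: "(\<Sum>a\<in>{..<N}. ?p a (?\<xi> \<omega>) * ?q a (?\<eta> \<omega>)) = W \<omega> j" for \<omega>
    unfolding leak_def q_eq by (intro sum.cong refl) (simp only: p_eq lessThan_iff)
  have mean: "expectation (\<lambda>\<omega>. cnj (X' (Channel 0 i k a) \<omega>)) = 0" if "a < N" for a
    unfolding Bochner_Integration.integral_cnj using mom(4)[OF that that] by simp
  have pm: "?p a \<in> borel_measurable (PiM A (\<lambda>_. borel))" if "a \<in> {..<N}" for a
    using that by (intro measurable_compose[OF _ borel_measurable_cnj] measurable_component_singleton) (auto simp: A_def)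
  have qm: "?q a \<in> borel_measurable (PiM B (\<lambda>_. borel))" if "a \<in> {..<N}" for a
    using that by (intro beam_measurable j measurable_component_singleton) (auto simp: B_def)
  have p2: "integrable P (\<lambda>\<omega>. (cmod (?p a (?\<xi> \<omega>)))\<^sup>2)" if "a \<in> {..<N}" for a
    using that mom(1)[of a] by (simp add: p_eq del: restrict_apply)
  have q2: "integrable P (\<lambda>\<omega>. (cmod (?q a (?\<eta> \<omega>)))\<^sup>2)" if "a \<in> {..<N}" for a
    using that V_moments(1)[OF j, of a] by (simp only: q_eq lessThan_iff)
  have me: "expectation (\<lambda>\<omega>. ?p a (?\<xi> \<omega>)) = 0" if "a \<in> {..<N}" for a
    using that mean[of a] by (simp only: p_eq lessThan_iff)
  have co: "expectation (\<lambda>\<omega>. ?p a (?\<xi> \<omega>) * cnj (?p b (?\<xi> \<omega>))) = (if a = b then complex_of_real ?v else 0)" if "a \<in> {..<N}" "b \<in> {..<N}" for a b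
    using that cov[of a b] by (simp only: p_eq lessThan_iff)
  note res = indep_linear_combination[where p="?p" and q="?q" and v="?v", OF finite_lessThan[of N] ind pm qm p2 q2 me co, unfolded W_eq]
  show "integrable P (\<lambda>\<omega>. (cmod (W \<omega> j))\<^sup>2)" by (rule res(1))
  show "expectation (\<lambda>\<omega>. W \<omega> j) = 0" by (rule res(2))
  show "integrable P (\<lambda>\<omega>. W \<omega> j)" by (rule res(3))
  have "expectation (\<lambda>\<omega>. (cmod (W \<omega> j))\<^sup>2) = ?v * (\<Sum>a<N. expectation (\<lambda>\<omega>. (cmod (V \<omega> j a))\<^sup>2))"
    using res(4) unfolding q_eq .
  also have "\<dots> \<le> ?v * (\<Sum>l=1..K j. pdl j l)"
    using V_moments(2)[OF j] v by (intro mult_left_mono) auto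
  finally show "expectation (\<lambda>\<omega>. (cmod (W \<omega> j))\<^sup>2) \<le> ?v * (\<Sum>l=1..K j. pdl j l)" .
qed

text \<open>The channel is the estimate minus the error. Against the estimate, duality leaves
  nothing but the vector meant for the user; the error gives \<open>- W\<close>. The exceptional set
  is that of singular Gram matrices.\<close>

lemma AE_zero_forcing:
  "AE \<omega> in P. \<forall>j\<in>{1..G}. (\<Sum>a<N. V \<omega> j a * cnj (X (Channel 0 i k a) \<omega>)) = (if j = i then complex_of_real (amp i k) else 0) - W \<omega> j"
  using cols.AE_nonsingular
proof eventually_elim
  fix \<omega> assume d: "det (gram_mat N Kt (\<lambda>s a. X' (Pilot_Noise 0 (fst (usr s)) (snd (usr s)) a) \<omega>)) \<noteq> 0"
  show "\<forall>j\<in>{1..G}. (\<Sum>a<N. V \<omega> j a * cnj (X (Channel 0 i k a) \<omega>)) = (if j = i then complex_of_real (amp i k) else 0) - W \<omega> j"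
  proof
    fix j assume j: "j \<in> {1..G}"
    have zf: "(\<Sum>a<N. cnj (X' (Pilot_Noise 0 i k a) \<omega>) * cols.zf \<omega> (pos j l) a) = (if j = i \<and> l = k then 1 else 0)" if l: "l \<in> {1..K j}" for l
    proof -
      have "(\<Sum>a<N. cnj (X' (Pilot_Noise 0 i k a) \<omega>) * cols.zf \<omega> (pos j l) a) = (if pos i k = pos j l then 1 else 0)"
        using zf_vec_nonsingular(1)[OF d pos_less[OF j l] pos_less[OF user]] by (simp add: usr_pos[OF user])
      moreover have "pos i k = pos j l \<longleftrightarrow> j = i \<and> l = k"
      proof
        assume "pos i k = pos j l"
        then have "usr (pos i k) = usr (pos j l)" by (rule arg_cong)
        then show "j = i \<and> l = k" unfolding usr_pos[OF user] usr_pos[OF j l] by simp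
      qed simp
      ultimately show ?thesis by simp
    qed
    have "(\<Sum>a<N. V \<omega> j a * cnj (X (Channel 0 i k a) \<omega>)) = (\<Sum>a<N. V \<omega> j a * cnj (X' (Pilot_Noise 0 i k a) \<omega>)) - W \<omega> j"
      unfolding X'_simps(3)[of 0 i k] leak_def by (simp add: sum_subtractf[symmetric] algebra_simps X'_simps(3))
    also have "(\<Sum>a<N. V \<omega> j a * cnj (X' (Pilot_Noise 0 i k a) \<omega>))
      = (\<Sum>a<N. \<Sum>l\<in>{1..K j}. complex_of_real (amp j l) * (cnj (X' (Pilot_Noise 0 i k a) \<omega>) * cols.zf \<omega> (pos j l) a))"
      unfolding V_eq sum_distrib_right by (simp add: mult_ac)
    also have "\<dots> = (\<Sum>l\<in>{1..K j}. complex_of_real (amp j l) * (\<Sum>a<N. cnj (X' (Pilot_Noise 0 i k a) \<omega>) * cols.zf \<omega> (pos j l) a))"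
      unfolding sum_distrib_left by (rule sum.swap)
    also have "\<dots> = (\<Sum>l\<in>{1..K j}. if l = k then (if j = i then complex_of_real (amp j l) else 0) else 0)"
      by (rule sum.cong[OF refl]) (simp add: zf)
    also have "\<dots> = (if j = i then complex_of_real (amp i k) else 0)" using user by (auto simp: sum.delta)
    finally show "(\<Sum>a<N. V \<omega> j a * cnj (X (Channel 0 i k a) \<omega>)) = (if j = i then complex_of_real (amp i k) else 0) - W \<omega> j" .
  qed
qed

section \<open>Gain and interference in one coherence interval\<close>

definition config :: "nat \<Rightarrow> 'w \<Rightarrow> source \<Rightarrow> complex" where
  "config b \<omega> = (\<lambda>x\<in>S0. X (set_block b x) \<omega>)"

text \<open>The coefficient with which the symbol of group \<open>j\<close> reaches the user. Here
  \<open>c\<close> is the raw configuration; it is transformed for the beam only, while the channel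
  itself is taken as it is.\<close>

definition channel_sum :: "(source \<Rightarrow> complex) \<Rightarrow> nat \<Rightarrow> complex" where
  "channel_sum c j = (\<Sum>a<N. beam (transform c) j a * cnj (c (Channel 0 i k a)))"

abbreviation "gain c \<equiv> channel_sum c i"

text \<open>The value 0 for \<open>t \<ge> L\<close> is a default: the locale
  \<open>block_fading_channel\<close> asks for square integrability at every
  \<open>t\<close>.\<close>

definition interference :: "nat \<Rightarrow> (source \<Rightarrow> complex) \<Rightarrow> complex" where
  "interference t c = (if t < L then (\<Sum>j\<in>{1..G} - {i}. channel_sum c j * c (Data 0 t j)) + c (Receiver_Noise 0 t) else 0)"

lemma transform_measurable:
  assumes "j \<in> {1..G}" "l \<in> {1..K j}" "a < N"
  shows "(\<lambda>c. transform c (Pilot_Noise 0 j l a)) \<in> borel_measurable law0"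
  unfolding transform_def source.case
  by (intro borel_measurable_times borel_measurable_add borel_measurable_const measurable_component_singleton) (use assms in auto)

lemma channel_sum_measurable: "j \<in> {1..G} \<Longrightarrow> (\<lambda>c. channel_sum c j) \<in> borel_measurable law0"
  unfolding channel_sum_def
  by (intro borel_measurable_sum borel_measurable_times beam_measurable transform_measurable
      measurable_compose[OF _ borel_measurable_cnj] measurable_component_singleton) (use user in auto)

lemma interference_measurable: "interference t \<in> borel_measurable law0"
proof (cases "t < L")
  case True
  have "(\<lambda>c. (\<Sum>j\<in>{1..G} - {i}. channel_sum c j * c (Data 0 t j)) + c (Receiver_Noise 0 t)) \<in> borel_measurable law0"
    by (intro borel_measurable_sum borel_measurable_times borel_measurable_add channel_sum_measurable measurable_component_singleton)
       (use True in auto)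
  then show ?thesis using True by (simp add: interference_def[abs_def])
qed (simp add: interference_def[abs_def])

lemma config_measurable: "config b \<in> measurable P law0"
  unfolding config_def
  by (intro measurable_restrict X_measurable set_block_sources) (use S0_sources in auto)

lemma config_indep: "indep_vars (\<lambda>_. law0) config UNIV"
proof -
  have sub: "set_block b ` S0 \<subseteq> sources N G K L" for b
    using S0_sources set_block_sources by auto
  have disj: "disjoint_family_on (\<lambda>b. set_block b ` S0) UNIV"
    unfolding disjoint_family_on_def
  proof (intro ballI impI)
    fix b b' :: nat assume "b \<noteq> b'"
    then show "set_block b ` S0 \<inter> set_block b' ` S0 = {}" by (metis (no_types, lifting) disjoint_iff imageE source_block_set_block)
  qed
  have "indep_vars (\<lambda>b. PiM (set_block b ` S0) (\<lambda>_. borel)) (\<lambda>b \<omega>. restrict (\<lambda>x. X x \<omega>) (set_block b ` S0)) UNIV"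
    by (rule indep_vars_restrict[OF X_indep sub disj])
  then have "indep_vars (\<lambda>b. law0) (\<lambda>b \<omega>. (\<lambda>c. \<lambda>x\<in>S0. c (set_block b x)) (restrict (\<lambda>x. X x \<omega>) (set_block b ` S0))) UNIV"
    by (rule indep_vars_compose2) (intro measurable_restrict measurable_component_singleton imageI)
  moreover have "(\<lambda>c. \<lambda>x\<in>S0. c (set_block b x)) (restrict (\<lambda>x. X x \<omega>) (set_block b ` S0)) = config b \<omega>" for b \<omega>
    by (simp add: config_def cong: restrict_cong)
  ultimately show ?thesis by simp
qed

lemma config_distr: "distr P law0 (config b) = distr P law0 (config 0)"
proof -
  have d: "distr P law0 (config b) = (\<Pi>\<^sub>M x\<in>S0. cgauss (source_variance \<beta> x))" for b
  proof -
    have ind: "indep_vars (\<lambda>_. borel) (\<lambda>x. X (set_block b x)) S0"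
      by (rule indep_vars_reindex[where M'="\<lambda>_. borel"])
         (use S0_sources set_block_sources inj_on_set_block in \<open>auto intro!: indep_vars_subset[OF X_indep]\<close>)
    have ne: "S0 \<noteq> {}"
    proof -
      have "Receiver_Noise 0 0 \<in> S0" using L_pos by simp
      then show ?thesis by blast
    qed
    have "distr P law0 (config b) = (\<Pi>\<^sub>M x\<in>S0. distr P borel (X (set_block b x)))"
      unfolding config_def
      by (rule indep_vars_iff_distr_eq_PiM'[THEN iffD1, OF ne _ ind])
         (use X_measurable set_block_sources S0_sources in auto)
    also have "\<dots> = (\<Pi>\<^sub>M x\<in>S0. cgauss (source_variance \<beta> x))"
    proof (rule PiM_cong[OF refl])
      fix x assume "x \<in> S0"
      then have "set_block b x \<in> sources N G K L" using set_block_sources S0_sources by auto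
      from X_distr[OF this] show "distr P borel (X (set_block b x)) = cgauss (source_variance \<beta> x)" by simp
    qed
    finally show ?thesis .
  qed
  show ?thesis by (simp only: d)
qed

lemma config_zero: "x \<in> S0 \<Longrightarrow> config 0 \<omega> x = X x \<omega>"
  by (simp add: config_def set_block_zero block_sources_def)

lemma channel_sum_config:
  assumes j: "j \<in> {1..G}"
  shows "channel_sum (config 0 \<omega>) j = (\<Sum>a<N. V \<omega> j a * cnj (X (Channel 0 i k a) \<omega>))"
proof -
  have "beam (transform (config 0 \<omega>)) j = beam (\<lambda>x. X' x \<omega>) j"
    by (rule beam_cong[OF j]) (simp add: X'_def transform_def config_zero)
  then show ?thesis using user by (simp add: channel_sum_def config_zero)
qed

lemma AE_channel_sum: "AE \<omega> in P. \<forall>j\<in>{1..G}. channel_sum (config 0 \<omega>) j = (if j = i then complex_of_real (amp i k) else 0) - W \<omega> j"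
  using AE_zero_forcing by eventually_elim (simp add: channel_sum_config)

lemma AE_gain: "AE \<omega> in P. gain (config 0 \<omega>) = complex_of_real (amp i k) - W \<omega> i"
  using AE_channel_sum by eventually_elim (use user in auto)

lemma gain_config_measurable: "(\<lambda>\<omega>. gain (config 0 \<omega>)) \<in> borel_measurable P"
  by (rule measurable_compose[OF config_measurable channel_sum_measurable[OF user(1)]])

lemma W_measurable: "j \<in> {1..G} \<Longrightarrow> (\<lambda>\<omega>. W \<omega> j) \<in> borel_measurable P"
  using W_moments(3) by auto

text \<open>The leakage is centred, so the mean gain is the deterministic amplitude, and the leakage
  of the own group adds to the second moment without a cross term.\<close>

lemma gain_moments:
  shows "integrable P (\<lambda>\<omega>. (cmod (gain (config 0 \<omega>)))\<^sup>2)"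
    "expectation (\<lambda>\<omega>. gain (config 0 \<omega>)) = complex_of_real (amp i k)"
    "expectation (\<lambda>\<omega>. (cmod (gain (config 0 \<omega>)))\<^sup>2) = (amp i k)\<^sup>2 + expectation (\<lambda>\<omega>. (cmod (W \<omega> i))\<^sup>2)"
proof -
  note Wm = W_moments[OF user(1)] and [measurable] = W_measurable[OF user(1)] gain_config_measurable
  have sq: "(cmod (complex_of_real \<alpha> - z))\<^sup>2 = (\<alpha>\<^sup>2 - 2 * \<alpha> * Re z) + (cmod z)\<^sup>2" for \<alpha> z
    by (simp only: cmod_power2) (simp add: power2_eq_square algebra_simps)
  have Re: "integrable P (\<lambda>\<omega>. Re (W \<omega> i))" "expectation (\<lambda>\<omega>. Re (W \<omega> i)) = 0"
    using integrable_Re[OF Wm(3)] integral_Re[OF Wm(3)] Wm(2) by auto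
  have ae: "AE \<omega> in P. (cmod (gain (config 0 \<omega>)))\<^sup>2 = ((amp i k)\<^sup>2 - 2 * amp i k * Re (W \<omega> i)) + (cmod (W \<omega> i))\<^sup>2"
    using AE_gain by eventually_elim (simp only: sq)
  have i1: "integrable P (\<lambda>\<omega>. (amp i k)\<^sup>2 - 2 * amp i k * Re (W \<omega> i))"
    using Re(1) by simp
  have i: "integrable P (\<lambda>\<omega>. ((amp i k)\<^sup>2 - 2 * amp i k * Re (W \<omega> i)) + (cmod (W \<omega> i))\<^sup>2)"
    by (rule Bochner_Integration.integrable_add[OF i1 Wm(1)])
  show "integrable P (\<lambda>\<omega>. (cmod (gain (config 0 \<omega>)))\<^sup>2)"
    by (rule integrable_cong_AE[THEN iffD2, OF _ _ ae i]) measurable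
  have "expectation (\<lambda>\<omega>. (cmod (gain (config 0 \<omega>)))\<^sup>2) = expectation (\<lambda>\<omega>. ((amp i k)\<^sup>2 - 2 * amp i k * Re (W \<omega> i)) + (cmod (W \<omega> i))\<^sup>2)"
    by (rule integral_cong_AE[OF _ _ ae]) measurable
  also have "\<dots> = expectation (\<lambda>\<omega>. (amp i k)\<^sup>2 - 2 * amp i k * Re (W \<omega> i)) + expectation (\<lambda>\<omega>. (cmod (W \<omega> i))\<^sup>2)"
    by (rule Bochner_Integration.integral_add[OF i1 Wm(1)])
  also have "expectation (\<lambda>\<omega>. (amp i k)\<^sup>2 - 2 * amp i k * Re (W \<omega> i)) = (amp i k)\<^sup>2"
    using Re by (simp add: prob_space)
  finally show "expectation (\<lambda>\<omega>. (cmod (gain (config 0 \<omega>)))\<^sup>2) = (amp i k)\<^sup>2 + expectation (\<lambda>\<omega>. (cmod (W \<omega> i))\<^sup>2)" .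
  have "expectation (\<lambda>\<omega>. gain (config 0 \<omega>)) = expectation (\<lambda>\<omega>. complex_of_real (amp i k) - W \<omega> i)"
    by (rule integral_cong_AE[OF _ _ AE_gain]) measurable
  also have "\<dots> = complex_of_real (amp i k)" using Wm(2,3) by (simp add: prob_space)
  finally show "expectation (\<lambda>\<omega>. gain (config 0 \<omega>)) = complex_of_real (amp i k)" .
qed

text \<open>Data symbols and receiver noise are white and independent of the leakages, so powers
  add. Group \<open>i\<close> is absent, as its leakage multiplies the codeword and belongs to the
  gain.\<close>

lemma interference_moments:
  assumes t: "t < L"
  shows "integrable P (\<lambda>\<omega>. (cmod (interference t (config 0 \<omega>)))\<^sup>2)"
    "expectation (\<lambda>\<omega>. (cmod (interference t (config 0 \<omega>)))\<^sup>2) = 1 + (\<Sum>j\<in>{1..G} - {i}. expectation (\<lambda>\<omega>. (cmod (W \<omega> j))\<^sup>2))"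
proof -
  \<comment> \<open>Groups are numbered from 1, which leaves index 0 for the receiver noise, treated
    as one more symbol with coefficient 1.\<close>
  define idx where "idx j = (if j = 0 then Receiver_Noise 0 t else Data 0 t j)" for j
  let ?J = "{1..G} - {i}"
  let ?I = "insert 0 ?J"
  define A where "A = idx ` ?I"
  define B where "B = {Channel 0 i k a | a. a < N} \<union> {Pilot_Noise 0 j l a | j l a. j \<in> {1..G} \<and> l \<in> {1..K j} \<and> a < N}"
  have AB: "A \<inter> B = {}" "A \<subseteq> S0" "B \<subseteq> S0" using user t by (auto simp: A_def B_def idx_def)
  let ?\<xi> = "\<lambda>\<omega>. restrict (\<lambda>x. X' x \<omega>) A" and ?\<eta> = "\<lambda>\<omega>. restrict (\<lambda>x. X' x \<omega>) B"
  let ?p = "\<lambda>j c. c (idx j) :: complex" and ?q = "\<lambda>j c. if j = 0 then 1 else - leak c j"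
  have ind: "indep_var (PiM A (\<lambda>_. borel)) ?\<xi> (PiM B (\<lambda>_. borel)) ?\<eta>"
    by (rule indep_var_restrict[OF X'_indep AB])
  have idx_A: "idx j \<in> A" if "j \<in> ?I" for j unfolding A_def using that by (rule imageI)
  have p_eq: "?p j (?\<xi> \<omega>) = X' (idx j) \<omega>" if "j \<in> ?I" for j \<omega> using idx_A[OF that] by simp
  have leak_eq: "leak (?\<eta> \<omega>) j = W \<omega> j" if "j \<in> ?J" for j \<omega>
  proof -
    have "beam (?\<eta> \<omega>) j = beam (\<lambda>x. X' x \<omega>) j"
      by (rule beam_cong) (use that in \<open>auto simp: B_def\<close>)
    moreover have "?\<eta> \<omega> (Channel 0 i k a) = X' (Channel 0 i k a) \<omega>" if "a < N" for a
      using that by (auto simp: B_def)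
    ultimately show ?thesis unfolding leak_def by (intro sum.cong refl) simp
  qed
  have q_eq: "?q j (?\<eta> \<omega>) = (if j = 0 then 1 else - W \<omega> j)" if "j \<in> ?I" for j \<omega>
    using that leak_eq[of j \<omega>] by (cases "j = 0") auto
  have idx_in: "idx j \<in> S0" if "j \<in> ?I" for j using that t by (auto simp: idx_def)
  have X'_idx: "X' (idx j) = X (idx j)" for j by (simp add: idx_def X'_simps)
  have d: "distr P borel (X' (idx j)) = cgauss 1" if "j \<in> ?I" for j
  proof -
    have "distr P borel (X (idx j)) = cgauss (source_variance \<beta> (idx j))"
      using idx_in[OF that] S0_sources by (intro X_distr) auto
    then show ?thesis unfolding X'_idx by (simp add: idx_def split: if_splits)
  qed
  have m: "X' (idx j) \<in> borel_measurable P" if "j \<in> ?I" for j by (rule X'_measurable[OF idx_in[OF that]])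
  have pm: "?p j \<in> borel_measurable (PiM A (\<lambda>_. borel))" if "j \<in> ?I" for j
    by (rule measurable_component_singleton[OF idx_A[OF that]])
  have qm: "?q j \<in> borel_measurable (PiM B (\<lambda>_. borel))" if j: "j \<in> ?I" for j
  proof (cases "j = 0")
    case False
    then have "j \<in> {1..G}" using j by auto
    then have "(\<lambda>c. leak c j) \<in> borel_measurable (PiM B (\<lambda>_. borel))"
      by (rule leak_measurable) (auto intro!: measurable_component_singleton simp: B_def)
    then show ?thesis using False by simp
  qed simp
  have p2: "integrable P (\<lambda>\<omega>. (cmod (?p j (?\<xi> \<omega>)))\<^sup>2)" if "j \<in> ?I" for j
    unfolding p_eq[OF that] using cgauss_variable_moments(1)[OF m[OF that] d[OF that]] by simp
  have q2: "integrable P (\<lambda>\<omega>. (cmod (?q j (?\<eta> \<omega>)))\<^sup>2)" if "j \<in> ?I" for j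
    unfolding q_eq[OF that] using W_moments(1)[of j] that by (cases "j = 0") auto
  have me: "expectation (\<lambda>\<omega>. ?p j (?\<xi> \<omega>)) = 0" if "j \<in> ?I" for j
    unfolding p_eq[OF that] using cgauss_variable_moments(4)[OF m[OF that] d[OF that]] by simp
  have co: "expectation (\<lambda>\<omega>. ?p a (?\<xi> \<omega>) * cnj (?p b (?\<xi> \<omega>))) = (if a = b then complex_of_real 1 else 0)" if "a \<in> ?I" "b \<in> ?I" for a b
  proof -
    have "expectation (\<lambda>\<omega>. X' (idx a) \<omega> * cnj (X' (idx b) \<omega>)) = (if idx a = idx b then complex_of_real 1 else 0)"
      by (rule cgauss_family_covariance[OF X'_indep idx_in idx_in _ d d]) (use that in auto)
    moreover have "idx a = idx b \<longleftrightarrow> a = b" by (auto simp: idx_def split: if_splits)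
    ultimately show ?thesis unfolding p_eq[OF that(1)] p_eq[OF that(2)] by simp
  qed
  have fin: "finite ?I" by simp
  note res = indep_linear_combination[where p="?p" and q="?q" and v=1, OF fin ind pm qm p2 q2 me co]
  have W_eq: "(\<Sum>j\<in>?I. ?p j (?\<xi> \<omega>) * ?q j (?\<eta> \<omega>)) = (\<Sum>j\<in>?I. X' (idx j) \<omega> * (if j = 0 then 1 else - W \<omega> j))" for \<omega>
    by (intro sum.cong refl) (simp only: p_eq q_eq)
  have ae: "AE \<omega> in P. interference t (config 0 \<omega>) = (\<Sum>j\<in>?I. X' (idx j) \<omega> * (if j = 0 then 1 else - W \<omega> j))"
    using AE_channel_sum
  proof eventually_elim
    fix \<omega> assume cs: "\<forall>j\<in>{1..G}. channel_sum (config 0 \<omega>) j = (if j = i then complex_of_real (amp i k) else 0) - W \<omega> j"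
    have "interference t (config 0 \<omega>) = (\<Sum>j\<in>?J. - W \<omega> j * X (Data 0 t j) \<omega>) + X (Receiver_Noise 0 t) \<omega>"
      unfolding interference_def using t cs by (auto simp: config_zero intro!: sum.cong)
    also have "\<dots> = (\<Sum>j\<in>?I. X' (idx j) \<omega> * (if j = 0 then 1 else - W \<omega> j))"
      by (subst sum.insert) (auto simp: idx_def X'_simps mult.commute intro!: sum.cong)
    finally show "interference t (config 0 \<omega>) = (\<Sum>j\<in>?I. X' (idx j) \<omega> * (if j = 0 then 1 else - W \<omega> j))" .
  qed
  let ?Z = "\<lambda>\<omega>. \<Sum>j\<in>?I. X' (idx j) \<omega> * (if j = 0 then 1 else - W \<omega> j)"
  have Zi: "integrable P (\<lambda>\<omega>. (cmod (?Z \<omega>))\<^sup>2)" using res(1) unfolding W_eq .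
  have Ze: "expectation (\<lambda>\<omega>. (cmod (?Z \<omega>))\<^sup>2) = 1 * (\<Sum>j\<in>?I. expectation (\<lambda>\<omega>. (cmod (?q j (?\<eta> \<omega>)))\<^sup>2))"
    using res(4) unfolding W_eq .
  have sqae: "AE \<omega> in P. (cmod (interference t (config 0 \<omega>)))\<^sup>2 = (cmod (?Z \<omega>))\<^sup>2"
    using ae by eventually_elim simp
  have im: "(\<lambda>\<omega>. (cmod (interference t (config 0 \<omega>)))\<^sup>2) \<in> borel_measurable P"
    using measurable_compose[OF config_measurable interference_measurable] by measurable
  have Zm: "(\<lambda>\<omega>. (cmod (?Z \<omega>))\<^sup>2) \<in> borel_measurable P" using Zi by simp
  show "integrable P (\<lambda>\<omega>. (cmod (interference t (config 0 \<omega>)))\<^sup>2)"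
    by (rule integrable_cong_AE[THEN iffD2, OF im Zm sqae Zi])
  have "expectation (\<lambda>\<omega>. (cmod (interference t (config 0 \<omega>)))\<^sup>2) = expectation (\<lambda>\<omega>. (cmod (?Z \<omega>))\<^sup>2)"
    by (rule integral_cong_AE[OF im Zm sqae])
  also have "\<dots> = (\<Sum>j\<in>?I. expectation (\<lambda>\<omega>. (cmod (if j = 0 then 1 else - W \<omega> j))\<^sup>2))"
    unfolding Ze mult_1 by (intro sum.cong refl) (simp only: q_eq)
  also have "\<dots> = 1 + (\<Sum>j\<in>?J. expectation (\<lambda>\<omega>. (cmod (W \<omega> j))\<^sup>2))"
    by (subst sum.insert) (auto simp: prob_space intro!: sum.cong)
  finally show "expectation (\<lambda>\<omega>. (cmod (interference t (config 0 \<omega>)))\<^sup>2) = 1 + (\<Sum>j\<in>?J. expectation (\<lambda>\<omega>. (cmod (W \<omega> j))\<^sup>2))" .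
qed

sublocale fading: block_fading_channel P law0 config gain interference L
proof
  show "0 < L" by (rule L_pos)
  show "indep_vars (\<lambda>_. law0) config UNIV" by (rule config_indep)
  show "distr P law0 (config b) = distr P law0 (config 0)" for b by (rule config_distr)
  show "gain \<in> borel_measurable law0" by (rule channel_sum_measurable[OF user(1)])
  show "interference t \<in> borel_measurable law0" for t by (rule interference_measurable)
  show "integrable P (\<lambda>\<omega>. (cmod (gain (config 0 \<omega>)))\<^sup>2)" by (rule gain_moments(1))
  show "integrable P (\<lambda>\<omega>. (cmod (interference t (config 0 \<omega>)))\<^sup>2)" for t
  proof (cases "t < L")
    case False
    then show ?thesis by (simp add: interference_def)
  qed (rule interference_moments(1))
qed

text \<open>The leakage of the own group enters as variance of the gain, that of the others as
  interference. Together the received power minus the squared mean gain is 1 plus a sum over all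
  groups, which is at most the denominator of the SINR. So the bound on the rate is at least as good
  as the one claimed.\<close>

lemma achievable_below_SINR:
  assumes p: "pdl i k > 0" and R: "2 powr (real T * R) < (1 + SINR_un N G K \<tau> \<beta> pu pdl i k) ^ L"
  shows "achievable_rate P fading.channel T L R"
proof -
  define w2 where "w2 j = expectation (\<lambda>\<omega>. (cmod (W \<omega> j))\<^sup>2)" for j
  define D where "D = 1 + (\<beta> i k - gam i k) * total_power G K pdl"
  have mg: "fading.mean_gain = amp i k"
    unfolding fading.mean_gain_def gain_moments(2) by simp
  have gp: "fading.gain_power = (amp i k)\<^sup>2 + w2 i"
    unfolding fading.gain_power_def gain_moments(3) w2_def ..
  have np: "fading.noise_power = real L * (1 + (\<Sum>j\<in>{1..G} - {i}. w2 j))"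
    unfolding fading.noise_power_def w2_def using interference_moments(2) by simp
  have split: "(\<Sum>j\<in>{1..G}. w2 j) = w2 i + (\<Sum>j\<in>{1..G} - {i}. w2 j)"
    using user by (intro sum.remove) auto
  have H: "fading.gain_power + fading.noise_power / real L = (amp i k)\<^sup>2 + (1 + (\<Sum>j\<in>{1..G}. w2 j))"
    unfolding gp np split using L_pos by simp
  have w2_nonneg: "0 \<le> (\<Sum>j\<in>{1..G}. w2 j)" unfolding w2_def by (intro sum_nonneg Bochner_Integration.integral_nonneg) simp
  have w2_le: "1 + (\<Sum>j\<in>{1..G}. w2 j) \<le> D"
    unfolding D_def total_power_def w2_def sum_distrib_left[of _ _ "{1..G}"] by (intro add_left_mono sum_mono W_moments(4)) simp
  have amp_pos: "0 < amp i k"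
    unfolding amp_def using p gam_bounds(1)[OF user] antennas by simp
  have SINR: "SINR_un N G K \<tau> \<beta> pu pdl i k = (amp i k)\<^sup>2 / D"
    unfolding SINR_un_def Let_def D_def amp_square[OF user] gam_def by (simp add: mult_ac)
  show ?thesis
  proof (rule fading.achievable_below_capacity)
    show "0 < fading.mean_gain" unfolding mg by (rule amp_pos)
    show "fading.mean_gain\<^sup>2 < fading.gain_power + fading.noise_power / real L"
      unfolding H mg using w2_nonneg by simp
    have "1 + (amp i k)\<^sup>2 / D \<le> 1 + (amp i k)\<^sup>2 / (1 + (\<Sum>j\<in>{1..G}. w2 j))"
      using w2_le w2_nonneg by (intro add_left_mono divide_left_mono) (auto intro!: mult_pos_pos)
    also have "\<dots> = (fading.gain_power + fading.noise_power / real L) / (fading.gain_power + fading.noise_power / real L - fading.mean_gain\<^sup>2)"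
      unfolding H mg using w2_nonneg by (simp add: field_simps)
    finally have "(1 + SINR_un N G K \<tau> \<beta> pu pdl i k) ^ L \<le> ((fading.gain_power + fading.noise_power / real L) / (fading.gain_power + fading.noise_power / real L - fading.mean_gain\<^sup>2)) ^ L"
      unfolding SINR by (intro power_mono) (use w2_le w2_nonneg in auto)
    with R show "2 powr (real T * R) < ((fading.gain_power + fading.noise_power / real L) / (fading.gain_power + fading.noise_power / real L - fading.mean_gain\<^sup>2)) ^ L"
      by linarith
  qed
qed

text \<open>The identity holds for every outcome and not just almost surely, because both sides
  share the default for singular Gram matrices. For \<open>t < L\<close> the default of
  \<open>interference\<close> is not met.\<close>

lemma zf_user_channel_eq:
  assumes X: "X = source_variable g w s z" and t: "t < L"
  shows "zf_user_channel N G K \<tau> \<beta> pu pdl g w s z i k b t x \<omega> = fading.channel b t x \<omega>"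
proof -
  define gv where "gv j l = vec N (\<lambda>a. g b j l a \<omega>)" for j l
  define wv where "wv j l = vec N (\<lambda>a. w b j l a \<omega>)" for j l
  define hv where "hv j l = mmse_estimate \<tau> (pu j l) (\<beta> j l) (gv j l) (wv j l)" for j l
  let ?c = "config b \<omega>"
  let ?s = "\<lambda>j. if j = i then x else s b t j \<omega>"
  define v where "v = zf_precoder N G K pdl gam hv"
  have hv_dim: "dim_vec (hv j l) = N" for j l by (simp add: hv_def wv_def)
  have cC: "?c (Channel 0 j l a) = g b j l a \<omega>" "?c (Pilot_Noise 0 j l a) = w b j l a \<omega>"
    if "j \<in> {1..G}" "l \<in> {1..K j}" "a < N" for j l a
    using that by (simp_all add: config_def) (simp_all add: X)
  have cD: "?c (Data 0 t j) = s b t j \<omega>" if "j \<in> {1..G}" for j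
    using that t by (simp add: config_def) (simp add: X)
  have cR: "?c (Receiver_Noise 0 t) = z b t \<omega>" using t by (simp add: config_def) (simp add: X)
  have cols_eq: "zf_vec N Kt (\<lambda>s a. case_prod hv (user_list G K ! s) $ a) = zf_vec N Kt (est_col (transform ?c))"
  proof (rule zf_vec_cong(2))
    fix s' a assume s': "s' < Kt" and a: "a < N"
    obtain j l where jl: "usr s' = (j, l)" by (cases "usr s'")
    then have r: "j \<in> {1..G}" "l \<in> {1..K j}" using usr_in[OF s'] by auto
    have "case_prod hv (user_list G K ! s') $ a = hv j l $ a" using jl by (simp add: usr_def)
    also have "\<dots> = complex_of_real (estimate_coeff \<tau> (pu j l) (\<beta> j l)) * (complex_of_real (sqrt (real \<tau> * pu j l)) * g b j l a \<omega> + w b j l a \<omega>)"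
      unfolding hv_def gv_def wv_def by (rule mmse_estimate_index[OF a])
    also have "\<dots> = est_col (transform ?c) s' a"
      unfolding est_col_def jl by (simp add: transform_def cC[OF r a])
    finally show "case_prod hv (user_list G K ! s') $ a = est_col (transform ?c) s' a" .
  qed
  have v_eq: "v j l $ a = complex_of_real (amp j l) * zf_vec N Kt (est_col (transform ?c)) (pos j l) $ a" if "a < N" for j l a
    unfolding v_def zf_precoder_eq[OF hv_dim that] cols_eq amp_def pos_def ..
  have tx: "transmit_signal N G K v ?s $ a = (\<Sum>j=1..G. beam (transform ?c) j a * ?s j)" if "a < N" for a
    using that by (simp add: transmit_signal_def beam_def v_eq sum_distrib_right)
  have gam_eq: "(\<lambda>j l. mmse_gamma \<tau> (pu j l) (\<beta> j l)) = gam" by (simp add: gam_def fun_eq_iff)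
  have "zf_user_channel N G K \<tau> \<beta> pu pdl g w s z i k b t x \<omega> = received_signal (gv i k) (transmit_signal N G K v ?s) (z b t \<omega>)"
    unfolding zf_user_channel_def Let_def gam_eq v_def hv_def[abs_def] gv_def[abs_def] wv_def[abs_def] ..
  also have "\<dots> = (\<Sum>a\<in>{0..<N}. transmit_signal N G K v ?s $ a * cnj (g b i k a \<omega>)) + z b t \<omega>"
    unfolding received_signal_def scalar_prod_def by (simp add: gv_def)
  also have "(\<Sum>a\<in>{0..<N}. transmit_signal N G K v ?s $ a * cnj (g b i k a \<omega>)) = (\<Sum>a<N. (\<Sum>j=1..G. beam (transform ?c) j a * ?s j) * cnj (?c (Channel 0 i k a)))"
    by (intro sum.cong) (auto simp: tx cC[OF user])
  also have "\<dots> = (\<Sum>a<N. \<Sum>j=1..G. beam (transform ?c) j a * cnj (?c (Channel 0 i k a)) * ?s j)"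
    by (intro sum.cong refl) (simp add: sum_distrib_left mult_ac)
  also have "\<dots> = (\<Sum>j=1..G. channel_sum ?c j * ?s j)"
    unfolding channel_sum_def sum_distrib_right by (rule sum.swap)
  also have "\<dots> = channel_sum ?c i * ?s i + (\<Sum>j\<in>{1..G} - {i}. channel_sum ?c j * ?s j)"
    using user by (intro sum.remove) auto
  also have "(\<Sum>j\<in>{1..G} - {i}. channel_sum ?c j * ?s j) = (\<Sum>j\<in>{1..G} - {i}. channel_sum ?c j * ?c (Data 0 t j))"
    by (intro sum.cong refl) (simp add: cD)
  finally show ?thesis
    unfolding fading.channel_def interference_def using t by (simp add: cR)
qed

end

section \<open>Achievable rates\<close>

lemma achievable_rate_cong:
  assumes "\<And>b t x \<omega>. t < L \<Longrightarrow> Y b t x \<omega> = Y' b t x \<omega>"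
  shows "achievable_rate P Y T L R \<longleftrightarrow> achievable_rate P Y' T L R"
proof -
  have "(\<lambda>(b, t) \<in> {..<n} \<times> {..<L}. Y b t (c b t) \<omega>) = (\<lambda>(b, t) \<in> {..<n} \<times> {..<L}. Y' b t (c b t) \<omega>)" for n c \<omega>
    using assms by (auto simp: fun_eq_iff restrict_def)
  then show ?thesis unfolding achievable_rate_def reliable_code_def by simp
qed

text \<open>A single message is decoded without looking at the output; the all-ones codeword has the
  prescribed energy \<open>n * L\<close>.\<close>

lemma (in prob_space) achievable_rate_nonpos:
  assumes "R \<le> 0"
  shows "achievable_rate M Y T L R"
  unfolding achievable_rate_def
proof (intro allI impI always_eventually)
  fix \<epsilon> :: real and n :: nat assume "0 < \<epsilon>"
  have "reliable_code M Y L n 1 (\<lambda>_ _ _. 1) (\<lambda>_. 0) \<epsilon>"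
    unfolding reliable_code_def using \<open>0 < \<epsilon>\<close> by (auto simp: prob_space)
  moreover have "real n * real T * R \<le> log 2 (real 1)"
    using assms by (simp add: mult_nonneg_nonpos)
  ultimately show "\<exists>m c d. 1 \<le> m \<and> real n * real T * R \<le> log 2 (real m) \<and> reliable_code M Y L n m c d \<epsilon>"
    by (intro exI[of _ "1::nat"]) auto
qed

text \<open>The capacity is a supremum, so the rates strictly below \<open>R\<close> are enough and
  no code at \<open>R\<close> itself is constructed.\<close>

lemma achievable_spectral_efficiencyI:
  assumes "\<And>r. r < R \<Longrightarrow> achievable_rate P Y T L r"
  shows "achievable_spectral_efficiency P Y T L R"
  unfolding achievable_spectral_efficiency_def ergodic_capacity_def
proof (rule dense_le)
  fix y assume y: "y < ereal R"
  show "y \<le> (SUP R\<in>{R. achievable_rate P Y T L R}. ereal R)"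
  proof (cases y)
    case (real r)
    then have "achievable_rate P Y T L r" using y by (intro assms) simp
    then show ?thesis unfolding real by (intro SUP_upper) simp
  qed (use y in auto)
qed

text \<open>Every user has a receiver noise of its own, so the family of independent sources is
  formed separately for each user.\<close>

theorem proposition1:
  fixes P :: "'w measure"
    and N G T \<tau> :: nat
    and K :: "nat \<Rightarrow> nat"
    and \<beta> pu pdl :: "nat \<Rightarrow> nat \<Rightarrow> real"
    and g w :: "nat \<Rightarrow> nat \<Rightarrow> nat \<Rightarrow> nat \<Rightarrow> 'w \<Rightarrow> complex"
    and s :: "nat \<Rightarrow> nat \<Rightarrow> nat \<Rightarrow> 'w \<Rightarrow> complex"
    and z :: "nat \<Rightarrow> nat \<Rightarrow> nat \<Rightarrow> nat \<Rightarrow> 'w \<Rightarrow> complex"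
  assumes "prob_space P"
    and "N > K_tot G K"
    and "K_tot G K \<le> \<tau>" and "\<tau> \<le> T"
    and "\<And>j k. j \<in> {1..G} \<Longrightarrow> k \<in> {1..K j} \<Longrightarrow> \<beta> j k > 0"
    and "\<And>j k. j \<in> {1..G} \<Longrightarrow> k \<in> {1..K j} \<Longrightarrow> pu j k > 0"
    and "\<And>j k. j \<in> {1..G} \<Longrightarrow> k \<in> {1..K j} \<Longrightarrow> pdl j k \<ge> 0"
    and "\<And>j k. j \<in> {1..G} \<Longrightarrow> k \<in> {1..K j} \<Longrightarrow>
           prob_space.indep_vars P (\<lambda>_. borel) (source_variable g w s (z j k))
             (sources N G K (T - \<tau>))"
    and "\<And>j k x. j \<in> {1..G} \<Longrightarrow> k \<in> {1..K j} \<Longrightarrow> x \<in> sources N G K (T - \<tau>) \<Longrightarrow>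
           circular_gaussian P (source_variance \<beta> x) (source_variable g w s (z j k) x)"
  shows "\<forall>i\<in>{1..G}. \<forall>k\<in>{1..K i}.
           achievable_spectral_efficiency P
             (zf_user_channel N G K \<tau> \<beta> pu pdl g w s (z i k) i k) T (T - \<tau>)
             (SE_un N G K T \<tau> \<beta> pu pdl i k)"
proof (intro ballI achievable_spectral_efficiencyI)
  fix i k R assume i: "i \<in> {1..G}" and k: "k \<in> {1..K i}" and R: "R < SE_un N G K T \<tau> \<beta> pu pdl i k"
  interpret prob_space P by fact
  let ?SINR = "SINR_un N G K \<tau> \<beta> pu pdl i k"
  have "K i \<le> K_tot G K" unfolding K_tot_def using i by (intro member_le_sum) auto
  then have T: "T > 0" using k assms(3,4) by simp
  show "achievable_rate P (zf_user_channel N G K \<tau> \<beta> pu pdl g w s (z i k) i k) T (T - \<tau>) R"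
  proof (cases "T - \<tau> = 0 \<or> pdl i k = 0")
    case True
    \<comment> \<open>Without data symbols or without power for this user the spectral efficiency is
      0. The trivial code then suffices, while the angle test would lack a positive mean gain or any
      symbol to use.\<close>
    then have "SE_un N G K T \<tau> \<beta> pu pdl i k = 0"
      using T assms(4) by (auto simp: SE_un_def SINR_un_def Let_def)
    then show ?thesis using R by (intro achievable_rate_nonpos) simp
  next
    case False
    then have L: "0 < T - \<tau>" and p: "pdl i k > 0" using assms(7)[OF i k] by auto
    interpret zf_downlink P N G K \<tau> "T - \<tau>" \<beta> pu pdl "source_variable g w s (z i k)" i k
      by unfold_locales (use assms(2-7) assms(8)[OF i k] assms(9)[OF i k] i k L in auto)
    have SINR: "?SINR \<ge> 0"
    proof -
      have "0 \<le> total_power G K pdl" unfolding total_power_def by (intro sum_nonneg pdl_nonneg)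
      then have "0 \<le> (\<beta> i k - gam i k) * total_power G K pdl"
        using gam_bounds(2)[OF user] by (intro mult_nonneg_nonneg) auto
      then show ?thesis
        using gam_bounds(1)[OF user] p antennas by (simp add: SINR_un_def Let_def gam_def)
    qed
    have "real T * R < real T * ((1 - real \<tau> / real T) * log 2 (1 + ?SINR))"
      using R T by (simp add: SE_un_def)
    \<comment> \<open>The pre-log factor turns into the number of symbols that a codeword occupies
      per interval, which is the exponent in the coding bound.\<close>
    also have "\<dots> = real (T - \<tau>) * log 2 (1 + ?SINR)"
      using T assms(4) by (simp add: field_simps of_nat_diff)
    also have "\<dots> = log 2 ((1 + ?SINR) ^ (T - \<tau>))"
      using SINR by (simp add: log_nat_power)
    finally have "2 powr (real T * R) < 2 powr (log 2 ((1 + ?SINR) ^ (T - \<tau>)))" by simp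
    also have "\<dots> = (1 + ?SINR) ^ (T - \<tau>)" using SINR by simp
    finally have "achievable_rate P fading.channel T (T - \<tau>) R"
      by (rule achievable_below_SINR[OF p])
    moreover have "achievable_rate P (zf_user_channel N G K \<tau> \<beta> pu pdl g w s (z i k) i k) T (T - \<tau>) R
        \<longleftrightarrow> achievable_rate P fading.channel T (T - \<tau>) R"
      by (rule achievable_rate_cong) (rule zf_user_channel_eq[OF refl])
    ultimately show ?thesis by (rule iffD2[rotated])
  qed
qed

end
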